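(* Let $A$ be a unital associative $\mathbf{k}$-algebra such that $\mathbf{k}\to A$ is a $\mathbf{k}$-split injection, where $\mathbf{k}$ is a unital commutative $\mathbb{Q}$-algebra. (i) For every $n\ge1$ one has canonical maps given by the composition $$\Psi^m_\bullet:\ \overline{\mathrm{HC}}_\bullet(A)\xrightarrow{\ \mathsf{w}_{\bullet-m}\circ\mathsf{E}\ }\overline{\mathrm{EHC}}_\bullet(A,m)\xrightarrow{\ \operatorname{tr}\circ\operatorname{ev}\ }{}^{\mathcal{D}}\overline{H}{}^\bullet_{\mathfrak{gl}_n}(\operatorname{Rep}_nA,\,m),\qquad m\in\mathbb{Z}.$$ (ii) For $m=0$ and every $\ell\ge0$, the composite map $$\Psi'_\ell:\ \ker\bigl(\mathsf{i}:\overline{\mathrm{DR}}^\ell/\mathsf{d}\overline{\mathrm{DR}}^{\ell-1}\to\overline{\Omega}^{\ell-1}/\mathsf{d}\overline{\Omega}^{\ell-2}\bigr)\ \cong\ \overline{\mathrm{HC}}_\ell(A)\xrightarrow{\ \Psi^0_\ell\ }{}^{\mathcal{D}}\overline{H}{}^\ell_{\mathfrak{gl}_n}(\operatorname{Rep}_nA,\,0)$$ is given by the explicit formula $$\Psi'_\ell(f)=\frac{1}{\ell!}\sum_{0\le j\le[\ell/2]}u^{-j}\cdot\operatorname{tr}\circ\operatorname{ev}\circ(\tilde{\mathsf{d}}^{-1}\mathsf{i}_t)^j(f).$$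
   Context: Forms. $\mathbf{k}$ is a unital commutative $\mathbb{Q}$-algebra, $\otimes=\otimes_{\mathbf{k}}$, $\overline{A}=A/\mathbf{k}$. $\Omega=\Omega A$ is the dg algebra generated by $A$ (degree $0$) and symbols $\mathsf{d}a$ (degree $1$), $\mathbf{k}$-linear in $a\in\overline{A}$, with relations: products of elements of $A$ are as in $A$ (same unit), and $\mathsf{d}(ab)=\mathsf{d}a\,b+a\,\mathsf{d}b$; the differential is $a\mapsto \mathsf{d}a\mapsto 0$. One has $A\otimes\overline{A}^{\otimes n}\cong\Omega^nA$ via $a_0\otimes\cdots\otimes a_n\mapsto a_0\,\mathsf{d}a_1\cdots \mathsf{d}a_n$. Commutators are supercommutators. $\overline{\Omega}=\Omega/\mathbf{k}$, $\overline{\mathrm{DR}}=(\Omega/[\Omega,\Omega])/\mathbf{k}$. Operators on $\overline{\Omega}$: $\mathsf{b}(\alpha\,\mathsf{d}a)=(-1)^{n-1}[\alpha,a]$ for $\alpha\in\Omega^{n-1}A$, $\mathsf{b}|_{\Omega^0}=0$; $\kappa(\alpha\,\mathsf{d}a)=(-1)^{|\alpha|}\mathsf{d}a\,\alpha$; $\mathsf{B}|_{\overline{\Omega}^n}=(\mathrm{Id}+\kappa+\cdots+\kappa^n)\mathsf{d}$. With $|u|=-2$ and $R=\mathbf{k}(\!(u)\!)/u\mathbf{k}[\![u]\!]$, $\overline{\mathrm{HC}}_\bullet(A)=H_\bullet(\overline{\Omega}\otimes R,\mathsf{b}-u\mathsf{B})$. The map $a_0\,\mathsf{d}a_1\cdots\mathsf{d}a_n\mapsto\sum_{\ell=1}^n(-1)^{(\ell-1)(n-1)+1}[a_\ell,\mathsf{d}a_{\ell+1}\cdots\mathsf{d}a_n\,a_0\,\mathsf{d}a_1\cdots\mathsf{d}a_{\ell-1}]$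 induces $\mathsf{i}:\overline{\mathrm{DR}}^\bullet\to\overline{\Omega}^{\bullet-1}$, and the identification in (ii) is the isomorphism $\overline{\mathrm{HC}}_\ell(A)\to\ker(\mathsf{i}:\overline{\mathrm{DR}}^\ell/\mathsf{d}\overline{\mathrm{DR}}^{\ell-1}\to\overline{\Omega}^{\ell-1}/\mathsf{d}\overline{\Omega}^{\ell-2})$ induced by $\sum_{k\ge0}f_ku^{-k}\mapsto(f_0)_\natural$. Extended forms. $\Omega_t=\Omega A*_{\mathbf{k}}\mathbf{k}[t]$ (free product), bigraded as $\Omega_t^{p,q}$ ($p$ = de Rham degree, $q$ = degree in $t$; $t$ even). $\mathrm{DR}_t=\Omega_t/[\Omega_t,\Omega_t]$, $f_\natural$ the image of $f$, $\overline{\mathrm{DR}}_t=\mathrm{DR}_t/\mathbf{k}[t]$, $\overline{\mathrm{DR}}_t^+=\bigoplus_{q>0}\overline{\mathrm{DR}}_t^{\bullet,q}$, $\overline{\mathrm{DR}}_t^{\bullet,0}=\overline{\mathrm{DR}}$. The superderivation $\mathsf{d}$ of $\Omega_t$ extending $\mathsf{d}$ with $\mathsf{d}t=0$, and the superderivation with $t\mapsto0$, $a\mapsto0$, $\mathsf{d}a\mapsto[a,t]$, descend to anticommuting differentials $\mathsf{d},\mathsf{i}_t$ on $\overline{\mathrm{DR}}_t$. $\overline{\mathrm{DR}}_t^{p,q}u^{-r}\subset\overline{\mathrm{DR}}_t\otimes R$ has homological degree $p+2r$ and internal degree $p+q+r$; $\overline{\mathrm{EHC}}_\ell(A,m)$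 is the homology in homological degree $\ell$ of the internal degree $\ell-m$ subcomplex of $(\overline{\mathrm{DR}}_t\otimes R,\mathsf{i}_t-u\mathsf{d})$; $\mathsf{w}_k$ is the projection to internal degree $k$. The Tsygan map is $\mathsf{E}(a_0\,\mathsf{d}a_1\cdots\mathsf{d}a_n)=\sum_{k_0,\ldots,k_n\ge0}\frac{1}{(k_0+\cdots+k_n+n)!}(a_0t^{k_0}\mathsf{d}a_1t^{k_1}\cdots\mathsf{d}a_nt^{k_n})_\natural\in\prod_{q\ge0}\overline{\mathrm{DR}}_t^{\bullet,q}$; it satisfies $\mathsf{E}\mathsf{B}=\mathsf{d}\mathsf{E}$, $\mathsf{E}\mathsf{b}=\mathsf{i}_t\mathsf{E}$ and is extended $R$-linearly. $(\overline{\mathrm{DR}}_t^+,\mathsf{d})$ is acyclic and $\tilde{\mathsf{d}}^{-1}$ is any bidegree-homogeneous set-theoretic section of $\mathsf{d}:\overline{\mathrm{DR}}_t^+\to\mathsf{d}\overline{\mathrm{DR}}_t^+$; in (ii) $f$ is represented by an element of $\overline{\mathrm{DR}}^\ell$ (so $\mathsf{i}_tf\in\mathsf{d}\overline{\mathrm{DR}}_t^+$). Equivariant Deligne cohomology. Let a reductive group with Lie algebra $\mathfrak{g}$ act on an affine scheme $X$, with infinitesimal action $\operatorname{act}:\mathfrak{g}\to\operatorname{Vect}(X)$. Let $\Omega_X=\wedge_{\mathbf{k}[X]}\Omega^1_X$ be the algebra of Kähler forms, $\overline{\Omega}_X=\Omega_X/\mathbf{k}$, $\overline{\Omega}_X[\mathfrak{g}]=\overline{\Omega}_X\otimes\mathbf{k}[\mathfrak{g}]$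 with diagonal $\mathfrak{g}$-action ($\mathbf{k}[\mathfrak{g}]$ = polynomials on $\mathfrak{g}$). On $(\overline{\Omega}_X[\mathfrak{g}])^{\mathfrak{g}}\otimes R$ one has the de Rham differential $\mathsf{d}_X$ and the superderivation $i_{\mathfrak{g}}$ given by $i_{\mathfrak{g}}(\mathsf{d}f)(x)=\operatorname{act}(x)(f)$, $i_{\mathfrak{g}}|_{\Omega^0_X}=0=i_{\mathfrak{g}}|_{\mathbf{k}[\mathfrak{g}]}$. The component $(\overline{\Omega}^p_X\otimes\mathbf{k}^q[\mathfrak{g}])^{\mathfrak{g}}u^{-r}$ has homological degree $p+2r$ and internal degree $p+q+r$. The reduced equivariant Deligne cohomology ${}^{\mathcal{D}}\overline{H}{}^\ell_{\mathfrak{g}}(X,m)$ is the homology in homological degree $\ell$ of the internal degree $\ell-m$ subcomplex of $((\overline{\Omega}_X[\mathfrak{g}])^{\mathfrak{g}}\otimes R,\ i_{\mathfrak{g}}-u\mathsf{d}_X)$. Representation functor. $\operatorname{Rep}_nA$ is the affine $\mathbf{k}$-scheme of algebra homomorphisms $\rho:A\to\operatorname{Mat}_n$, with $\mathrm{GL}_n$ acting by conjugation (infinitesimally, $x\in\mathfrak{gl}_n$ acts on the matrix-valued function $\rho\mapsto\rho(a)$ by $\rho\mapsto[\rho(a),x]$). The algebra map $\operatorname{ev}:\Omega_tA\to(\Omega_{\operatorname{Rep}_nA}[\mathfrak{gl}_n]\otimes\operatorname{Mat}_n(\mathbf{k}))^{\mathfrak{gl}_n}$ is determined by $\operatorname{ev}(a)=(\rho\mapsto\rho(a))$,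 $\operatorname{ev}(\mathsf{d}a)=\mathsf{d}\operatorname{ev}(a)$, and $\operatorname{ev}(t)=$ the identity map $\mathfrak{gl}_n\to\operatorname{Mat}_n(\mathbf{k})$. Composing with the matrix trace gives $\operatorname{tr}\circ\operatorname{ev}:\mathrm{DR}_t\to(\Omega_{\operatorname{Rep}_nA}[\mathfrak{gl}_n])^{\mathfrak{gl}_n}$, a map of bicomplexes from $(\mathsf{d},\mathsf{i}_t)$ to $(\mathsf{d}_{\operatorname{Rep}_nA},i_{\mathfrak{gl}_n})$, which passes to reduced versions and is extended $R$-linearly. *)

theory Defs
  imports "HOL-Library.Poly_Mapping" "HOL-Analysis.Determinants"
begin

section \<open>Base ring and algebra\<close>

text \<open>A \<open>\<rat>\<close>-algebra structure on a commutative ring is a ring homomorphism from \<open>\<rat>\<close>.\<close>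

definition rat_algebra :: "(rat \<Rightarrow> 'k::comm_ring_1) \<Rightarrow> bool" where
  "rat_algebra \<rho> \<longleftrightarrow> \<rho> 1 = 1 \<and> (\<forall>x y. \<rho> (x + y) = \<rho> x + \<rho> y) \<and> (\<forall>x y. \<rho> (x * y) = \<rho> x * \<rho> y)"

definition k_algebra :: "('k::comm_ring_1 \<Rightarrow> 'a::ring_1 \<Rightarrow> 'a) \<Rightarrow> bool" where
  "k_algebra sc \<longleftrightarrow> module sc \<and>
     (\<forall>c x y. sc c (x * y) = sc c x * y) \<and> (\<forall>c x y. sc c (x * y) = x * sc c y)"

definition k_split_injection :: "('k::comm_ring_1 \<Rightarrow> 'a::ring_1 \<Rightarrow> 'a) \<Rightarrow> bool" where
  "k_split_injection sc \<longleftrightarrow> inj (\<lambda>c. sc c 1) \<and>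
     (\<exists>p. module_hom sc (*) p \<and> (\<forall>c. p (sc c 1) = c))"

section \<open>Free algebras\<close>

text \<open>Words over an alphabet form a monoid under concatenation (written additively, as required by
  \<open>Poly_Mapping\<close>), so that finitely supported \<open>'k\<close>-valued functions on words with the
  convolution product of \<open>Poly_Mapping\<close> are the free associative \<open>'k\<close>-algebra.\<close>

datatype 'g word = Word (letters: "'g list")

instantiation word :: (type) monoid_add
begin
definition zero_word :: "'a word" where "zero_word = Word []"
definition plus_word :: "'a word \<Rightarrow> 'a word \<Rightarrow> 'a word" where
  "plus_word u v = Word (letters u @ letters v)"
instance by standard (simp_all add: zero_word_def plus_word_def)
end

type_synonym ('g, 'k) falg = "'g word \<Rightarrow>\<^sub>0 'k"

definition smul :: "'k::comm_ring_1 \<Rightarrow> ('x \<Rightarrow>\<^sub>0 'k) \<Rightarrow> ('x \<Rightarrow>\<^sub>0 'k)" where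
  "smul c = Poly_Mapping.map ((*) c)"

definition lin :: "('x \<Rightarrow> 'y \<Rightarrow>\<^sub>0 'k) \<Rightarrow> ('x \<Rightarrow>\<^sub>0 'k::comm_ring_1) \<Rightarrow> ('y \<Rightarrow>\<^sub>0 'k)" where
  "lin \<phi> p = (\<Sum>x\<in>Poly_Mapping.keys p. smul (Poly_Mapping.lookup p x) (\<phi> x))"

definition mon :: "'g list \<Rightarrow> ('g, 'k::comm_ring_1) falg" where
  "mon w = Poly_Mapping.single (Word w) 1"

abbreviation gen :: "'g \<Rightarrow> ('g, 'k::comm_ring_1) falg" where
  "gen g \<equiv> mon [g]"

definition span_k :: "('x \<Rightarrow>\<^sub>0 'k::comm_ring_1) set \<Rightarrow> ('x \<Rightarrow>\<^sub>0 'k) set" where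
  "span_k = module.span smul"

definition ideal_k :: "('g, 'k::comm_ring_1) falg set \<Rightarrow> ('g, 'k) falg set" where
  "ideal_k S = span_k {p * r * q | p r q. r \<in> S}"

definition wdeg :: "('g \<Rightarrow> nat) \<Rightarrow> 'g word \<Rightarrow> nat" where
  "wdeg deg w = sum_list (map deg (letters w))"

text \<open>The homogeneous component of degree \<open>p\<close>; it is zero for negative \<open>p\<close>.\<close>

definition piece :: "('g \<Rightarrow> nat) \<Rightarrow> int \<Rightarrow> ('g, 'k::comm_ring_1) falg set" where
  "piece deg p = {f. \<forall>w\<in>Poly_Mapping.keys f. int (wdeg deg w) = p}"

definition supercommutators :: "('g \<Rightarrow> nat) \<Rightarrow> ('g, 'k::comm_ring_1) falg set" where
  "supercommutators deg =
     {f * g - (-1) ^ (p * q) * (g * f) | f g p q. f \<in> piece deg (int p) \<and> g \<in> piece deg (int q)}"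

text \<open>The derivation with prescribed values \<open>\<delta>\<close> on the letters; \<open>e\<close> is its parity
  (\<open>1\<close> for a superderivation of odd degree, \<open>0\<close> for an ordinary derivation).\<close>

primrec deriv_word :: "nat \<Rightarrow> ('g \<Rightarrow> nat) \<Rightarrow> ('g \<Rightarrow> ('g, 'k::comm_ring_1) falg) \<Rightarrow> 'g list \<Rightarrow> ('g, 'k) falg"
where
  "deriv_word e deg \<delta> [] = 0"
| "deriv_word e deg \<delta> (l # w) =
     \<delta> l * mon w + (-1) ^ (e * deg l) * (gen l * deriv_word e deg \<delta> w)"

definition derivation :: "nat \<Rightarrow> ('g \<Rightarrow> nat) \<Rightarrow> ('g \<Rightarrow> ('g, 'k::comm_ring_1) falg) \<Rightarrow> ('g, 'k) falg \<Rightarrow> ('g, 'k) falg"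
where
  "derivation e deg \<delta> = lin (\<lambda>w. deriv_word e deg \<delta> (letters w))"

section \<open>Subquotients and homology\<close>

text \<open>All modules below are subquotients of free modules. The pair \<open>(Z, B)\<close> stands for \<open>Z/B\<close>,
  whose elements are the cosets of \<open>B\<close>.\<close>

type_synonym 'x subquotient = "'x set \<times> 'x set"

definition coset :: "'x::ab_group_add subquotient \<Rightarrow> 'x \<Rightarrow> 'x set" where
  "coset M x = {x + b | b. b \<in> snd M}"

definition elements :: "'x::ab_group_add subquotient \<Rightarrow> 'x set set" where
  "elements M = coset M ` fst M"

definition coset_add :: "'x::ab_group_add subquotient \<Rightarrow> 'x set \<Rightarrow> 'x set \<Rightarrow> 'x set" where
  "coset_add M X Y = {x + y + b | x y b. x \<in> X \<and> y \<in> Y \<and> b \<in> snd M}"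

definition coset_scale ::
  "('k \<Rightarrow> 'x \<Rightarrow> 'x) \<Rightarrow> 'x::ab_group_add subquotient \<Rightarrow> 'k \<Rightarrow> 'x set \<Rightarrow> 'x set" where
  "coset_scale s M c X = {s c x + b | x b. x \<in> X \<and> b \<in> snd M}"

definition k_linear ::
  "('k \<Rightarrow> 'x \<Rightarrow> 'x) \<Rightarrow> ('k \<Rightarrow> 'y \<Rightarrow> 'y) \<Rightarrow> 'x::ab_group_add subquotient \<Rightarrow> 'y::ab_group_add subquotient
    \<Rightarrow> ('x set \<Rightarrow> 'y set) \<Rightarrow> bool" where
  "k_linear s t M N \<phi> \<longleftrightarrow>
     (\<forall>X\<in>elements M. \<phi> X \<in> elements N) \<and>
     (\<forall>X\<in>elements M. \<forall>Y\<in>elements M. \<phi> (coset_add M X Y) = coset_add N (\<phi> X) (\<phi> Y)) \<and>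
     (\<forall>c. \<forall>X\<in>elements M. \<phi> (coset_scale s M c X) = coset_scale t N c (\<phi> X))"

text \<open>The map between subquotients induced by \<open>f\<close>. The set on the right-hand side is a single
  coset precisely when the coset of \<open>f x\<close> does not depend on the representative \<open>x \<in> X\<close>, so
  \<open>induced N f X \<in> elements N\<close> includes well-definedness.\<close>

definition induced :: "'y::ab_group_add subquotient \<Rightarrow> ('x \<Rightarrow> 'y) \<Rightarrow> 'x set \<Rightarrow> 'y set" where
  "induced N f X = {f x + b | x b. x \<in> X \<and> b \<in> snd N}"

text \<open>Homology in degree \<open>l\<close> of the complex \<open>C/W\<close>, where \<open>C l\<close> is the module of representatives of
  the chains of degree \<open>l\<close>, \<open>W\<close> is the set of representatives of zero, and the differential, of
  degree \<open>-1\<close>, is represented by \<open>D\<close>.\<close>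

definition homology ::
  "(int \<Rightarrow> 'x set) \<Rightarrow> 'x set \<Rightarrow> ('x \<Rightarrow> 'x) \<Rightarrow> int \<Rightarrow> 'x::ab_group_add subquotient" where
  "homology C W D l =
     ({x \<in> C l. D x \<in> W}, {D y + w | y w. y \<in> C (l + 1) \<and> w \<in> W \<inter> C l})"

text \<open>The module \<open>R = k((u))/u k[[u]]\<close> is free over \<open>k\<close> on \<open>u\<^sup>-\<^sup>r\<close>, \<open>r \<ge> 0\<close>, with
  \<open>u \<cdot> u\<^sup>-\<^sup>r = u\<^sup>-\<^sup>(\<^sup>r\<^sup>-\<^sup>1\<^sup>)\<close> and \<open>u \<cdot> 1 = 0\<close>. Thus \<open>M \<otimes> R\<close> consists of the finitely supported families
  \<open>x\<close> in \<open>M\<close>, with \<open>lookup x r\<close> the coefficient of \<open>u\<^sup>-\<^sup>r\<close>.\<close>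

type_synonym 'x tensor_R = "nat \<Rightarrow>\<^sub>0 'x"

definition scale_R :: "'k::comm_ring_1 \<Rightarrow> ('x \<Rightarrow>\<^sub>0 'k) tensor_R \<Rightarrow> ('x \<Rightarrow>\<^sub>0 'k) tensor_R" where
  "scale_R c = Poly_Mapping.map (smul c)"

definition u_act :: "'x::zero tensor_R \<Rightarrow> 'x tensor_R" where
  "u_act x = Poly_Mapping.Abs_poly_mapping (\<lambda>r. Poly_Mapping.lookup x (Suc r))"

definition null_R :: "'x::zero set \<Rightarrow> 'x tensor_R set" where
  "null_R W = {x. \<forall>r. Poly_Mapping.lookup x r \<in> W}"

text \<open>The differential \<open>d\<^sub>1 - u d\<^sub>2\<close>.\<close>

definition mixed_diff :: "('x \<Rightarrow> 'x) \<Rightarrow> ('x \<Rightarrow> 'x) \<Rightarrow> 'x::ab_group_add tensor_R \<Rightarrow> 'x tensor_R" where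
  "mixed_diff d1 d2 x = Poly_Mapping.map d1 x - u_act (Poly_Mapping.map d2 x)"

section \<open>Noncommutative differential forms\<close>

text \<open>\<open>El a\<close> is the element \<open>a\<close> and \<open>Df a\<close> is the symbol \<open>da\<close>.\<close>

datatype 'a form = El 'a | Df 'a

primrec fdeg :: "'a form \<Rightarrow> nat" where
  "fdeg (El a) = 0"
| "fdeg (Df a) = 1"

text \<open>The relations of the algebra of noncommutative forms of the algebra \<open>'a/J\<close>, where \<open>sc\<close> is the
  \<open>k\<close>-module structure of \<open>'a\<close>. They are imposed in the free algebra on an alphabet containing
  the letters \<open>El a\<close>, \<open>Df a\<close> by way of \<open>e\<close>, which makes it possible to adjoin further free
  generators.\<close>

definition form_relations ::
  "('k::comm_ring_1 \<Rightarrow> 'a::ring_1 \<Rightarrow> 'a) \<Rightarrow> 'a set \<Rightarrow> ('a form \<Rightarrow> 'g) \<Rightarrow> ('g, 'k) falg set" where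
  "form_relations sc J e = (let el = (\<lambda>a. gen (e (El a))); df = (\<lambda>a. gen (e (Df a))) in
     {el (a + b) - (el a + el b) | a b. True} \<union>
     {el (sc c a) - smul c (el a) | c a. True} \<union>
     {el (a * b) - el a * el b | a b. True} \<union>
     {el 1 - 1} \<union>
     {el a | a. a \<in> J} \<union>
     {df (a + b) - (df a + df b) | a b. True} \<union>
     {df (sc c a) - smul c (df a) | c a. True} \<union>
     {df (sc c 1) | c. True} \<union>
     {df a | a. a \<in> J} \<union>
     {df (a * b) - (df a * el b + el a * df b) | a b. True})"

type_synonym ('a, 'k) nc_forms = "('a form, 'k) falg"

definition forms_ideal :: "('k::comm_ring_1 \<Rightarrow> 'a::ring_1 \<Rightarrow> 'a) \<Rightarrow> ('a, 'k) nc_forms set" where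
  "forms_ideal sc = ideal_k (form_relations sc {} (\<lambda>l. l))"

text \<open>The zero elements of \<open>\<Omega>/k\<close> and of \<open>(\<Omega>/[\<Omega>,\<Omega>])/k\<close>.\<close>

definition omega_null :: "('k::comm_ring_1 \<Rightarrow> 'a::ring_1 \<Rightarrow> 'a) \<Rightarrow> ('a, 'k) nc_forms set" where
  "omega_null sc = span_k (forms_ideal sc \<union> {1})"

definition dr_null :: "('k::comm_ring_1 \<Rightarrow> 'a::ring_1 \<Rightarrow> 'a) \<Rightarrow> ('a, 'k) nc_forms set" where
  "dr_null sc = span_k (forms_ideal sc \<union> supercommutators fdeg \<union> {1})"

primrec d_letter :: "'a form \<Rightarrow> ('a, 'k::comm_ring_1) nc_forms" where
  "d_letter (El a) = gen (Df a)"
| "d_letter (Df a) = 0"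

definition d_form :: "('a, 'k::comm_ring_1) nc_forms \<Rightarrow> ('a, 'k) nc_forms" where
  "d_form = derivation 1 fdeg d_letter"

text \<open>Normal form of a word: a linear combination of pairs \<open>(a\<^sub>0, [a\<^sub>1, \<dots>, a\<^sub>n])\<close>, each standing for
  \<open>a\<^sub>0 da\<^sub>1 \<dots> da\<^sub>n\<close>. The letters are multiplied in from the right to the left, with
  \<open>da \<cdot> a\<^sub>0 = d(a a\<^sub>0) - a da\<^sub>0\<close>. Operators given by a formula on \<open>a\<^sub>0 da\<^sub>1 \<dots> da\<^sub>n\<close> are represented
  by applying the formula to the normal form.\<close>

primrec normal_word :: "'a::ring_1 form list \<Rightarrow> ('a \<times> 'a list) \<Rightarrow>\<^sub>0 'k::comm_ring_1" where
  "normal_word [] = Poly_Mapping.single (1, []) 1"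
| "normal_word (l # w) = lin (\<lambda>(a0, as). case l of
       El a \<Rightarrow> Poly_Mapping.single (a * a0, as) 1
     | Df a \<Rightarrow> Poly_Mapping.single (1, (a * a0) # as) 1 - Poly_Mapping.single (a, a0 # as) 1)
     (normal_word w)"

definition on_normal ::
  "('a \<Rightarrow> 'a list \<Rightarrow> 'y \<Rightarrow>\<^sub>0 'k) \<Rightarrow> ('a::ring_1, 'k::comm_ring_1) nc_forms \<Rightarrow> ('y \<Rightarrow>\<^sub>0 'k)" where
  "on_normal \<phi> = lin (\<lambda>w. lin (\<lambda>(a0, as). \<phi> a0 as) (normal_word (letters w)))"

definition std_form :: "'a \<Rightarrow> 'a list \<Rightarrow> ('a, 'k::comm_ring_1) nc_forms" where
  "std_form a0 as = mon (El a0 # map Df as)"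

definition b_op :: "('a::ring_1, 'k::comm_ring_1) nc_forms \<Rightarrow> ('a, 'k) nc_forms" where
  "b_op = on_normal (\<lambda>a0 as. if as = [] then 0 else
     (let n = length as; \<alpha> = std_form a0 (butlast as); a = gen (El (last as))
      in (-1) ^ (n - 1) * (\<alpha> * a - a * \<alpha>)))"

text \<open>\<open>\<kappa>\<close> is only used in positive degree; in degree zero it is taken to be the identity.\<close>

definition kappa :: "('a::ring_1, 'k::comm_ring_1) nc_forms \<Rightarrow> ('a, 'k) nc_forms" where
  "kappa = on_normal (\<lambda>a0 as. if as = [] then std_form a0 [] else
     (-1) ^ (length as - 1) * (gen (Df (last as)) * std_form a0 (butlast as)))"

definition B_op :: "('a::ring_1, 'k::comm_ring_1) nc_forms \<Rightarrow> ('a, 'k) nc_forms" where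
  "B_op = on_normal (\<lambda>a0 as. \<Sum>j\<le>length as. (kappa ^^ j) (d_form (std_form a0 as)))"

text \<open>Here \<open>as ! (l - 1)\<close> is \<open>a\<^sub>l\<close>.\<close>

definition i_op :: "('a::ring_1, 'k::comm_ring_1) nc_forms \<Rightarrow> ('a, 'k) nc_forms" where
  "i_op = on_normal (\<lambda>a0 as. let n = length as in
     \<Sum>l = 1..n. (let a = gen (El (as ! (l - 1)));
                       \<omega> = mon (map Df (drop l as) @ El a0 # map Df (take (l - 1) as))
                   in (-1) ^ ((l - 1) * (n - 1) + 1) * (a * \<omega> - \<omega> * a)))"

definition omega_R_chains :: "int \<Rightarrow> ('a, 'k::comm_ring_1) nc_forms tensor_R set" where
  "omega_R_chains l = {x. \<forall>r. Poly_Mapping.lookup x r \<in> piece fdeg (l - 2 * int r)}"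

definition HC :: "('k::comm_ring_1 \<Rightarrow> 'a::ring_1 \<Rightarrow> 'a) \<Rightarrow> int \<Rightarrow> ('a, 'k) nc_forms tensor_R subquotient" where
  "HC sc = homology omega_R_chains (null_R (omega_null sc)) (mixed_diff b_op B_op)"

text \<open>The kernel of \<open>i\<close> from \<open>DR\<^sup>l / d DR\<^sup>l\<^sup>-\<^sup>1\<close> to \<open>\<Omega>\<^sup>l\<^sup>-\<^sup>1 / d \<Omega>\<^sup>l\<^sup>-\<^sup>2\<close> (reduced versions).\<close>

definition ker_i :: "('k::comm_ring_1 \<Rightarrow> 'a::ring_1 \<Rightarrow> 'a) \<Rightarrow> int \<Rightarrow> ('a, 'k) nc_forms subquotient" where
  "ker_i sc l =
     ({f \<in> piece fdeg l. \<exists>h\<in>piece fdeg (l - 2). i_op f - d_form h \<in> omega_null sc},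
      {d_form h + w | h w. h \<in> piece fdeg (l - 1) \<and> w \<in> dr_null sc \<inter> piece fdeg l})"

definition HC_to_ker_i ::
  "('k::comm_ring_1 \<Rightarrow> 'a::ring_1 \<Rightarrow> 'a) \<Rightarrow> int \<Rightarrow> ('a, 'k) nc_forms tensor_R set \<Rightarrow> ('a, 'k) nc_forms set"
where
  "HC_to_ker_i sc l = induced (ker_i sc l) (\<lambda>x. Poly_Mapping.lookup x 0)"

section \<open>Extended forms\<close>

text \<open>The alphabet of forms enlarged by even variables \<open>Var v\<close> of form degree zero.\<close>

datatype ('a, 'v) letter = Form "'a form" | Var 'v

primrec ldeg :: "('a, 'v) letter \<Rightarrow> nat" where
  "ldeg (Form l) = fdeg l"
| "ldeg (Var v) = 0"

primrec vdeg :: "('a, 'v) letter \<Rightarrow> nat" where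
  "vdeg (Form l) = 0"
| "vdeg (Var v) = 1"

definition bipiece :: "int \<Rightarrow> int \<Rightarrow> (('a, 'v) letter, 'k::comm_ring_1) falg set" where
  "bipiece p q = piece ldeg p \<inter> piece vdeg q"

text \<open>Representatives of chains of homological degree \<open>l\<close> in the internal degree \<open>N\<close> subcomplex.\<close>

definition internal_chains :: "int \<Rightarrow> int \<Rightarrow> (('a, 'v) letter, 'k::comm_ring_1) falg tensor_R set" where
  "internal_chains N l = {x. \<forall>r. \<exists>p q. p + 2 * int r = l \<and> p + q + int r = N \<and>
     Poly_Mapping.lookup x r \<in> bipiece p q}"

definition d_ext_letter :: "('a, 'v) letter \<Rightarrow> (('a, 'v) letter, 'k::comm_ring_1) falg" where
  "d_ext_letter l = (case l of Form (El a) \<Rightarrow> gen (Form (Df a)) | _ \<Rightarrow> 0)"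

definition d_ext :: "(('a, 'v) letter, 'k::comm_ring_1) falg \<Rightarrow> (('a, 'v) letter, 'k) falg" where
  "d_ext = derivation 1 ldeg d_ext_letter"

type_synonym ('a, 'k) ext_forms = "(('a, unit) letter, 'k) falg"

abbreviation t_letter :: "('a, unit) letter" where "t_letter \<equiv> Var ()"

text \<open>No relation involves \<open>t\<close>, so the quotient by \<open>ext_ideal\<close> is the free product of \<open>\<Omega>A\<close>
  and \<open>k[t]\<close>.\<close>

definition ext_ideal :: "('k::comm_ring_1 \<Rightarrow> 'a::ring_1 \<Rightarrow> 'a) \<Rightarrow> ('a, 'k) ext_forms set" where
  "ext_ideal sc = ideal_k (form_relations sc {} Form)"

definition drt_null :: "('k::comm_ring_1 \<Rightarrow> 'a::ring_1 \<Rightarrow> 'a) \<Rightarrow> ('a, 'k) ext_forms set" where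
  "drt_null sc = span_k (ext_ideal sc \<union> supercommutators ldeg \<union> {mon (replicate q t_letter) | q. True})"

definition it_letter :: "('a, unit) letter \<Rightarrow> ('a, 'k::comm_ring_1) ext_forms" where
  "it_letter l = (case l of
     Form (Df a) \<Rightarrow> gen (Form (El a)) * gen t_letter - gen t_letter * gen (Form (El a)) | _ \<Rightarrow> 0)"

definition i_t :: "('a, 'k::comm_ring_1) ext_forms \<Rightarrow> ('a, 'k) ext_forms" where
  "i_t = derivation 1 ldeg it_letter"

definition EHC ::
  "('k::comm_ring_1 \<Rightarrow> 'a::ring_1 \<Rightarrow> 'a) \<Rightarrow> int \<Rightarrow> int \<Rightarrow> ('a, 'k) ext_forms tensor_R subquotient" where
  "EHC sc l m = homology (internal_chains (l - m)) (null_R (drt_null sc)) (mixed_diff i_t d_ext) l"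

text \<open>The Tsygan map; \<open>tsygan \<rho> f q\<close> is the component of \<open>E f\<close> of degree \<open>q\<close> in \<open>t\<close>.\<close>

definition tsygan :: "(rat \<Rightarrow> 'k::comm_ring_1) \<Rightarrow> ('a::ring_1, 'k) nc_forms \<Rightarrow> nat \<Rightarrow> ('a, 'k) ext_forms" where
  "tsygan \<rho> f q = on_normal (\<lambda>a0 as.
     \<Sum>ks\<in>{ks :: nat list. length ks = Suc (length as) \<and> sum_list ks = q}.
       smul (\<rho> (1 / fact (sum_list ks + length as)))
         (mon (concat (map2 (\<lambda>l k. Form l # replicate k t_letter) (El a0 # map Df as) ks)))) f"

text \<open>The \<open>R\<close>-linear extension of the Tsygan map: \<open>tsygan_R \<rho> x r q\<close> is the component of degree
  \<open>q\<close> in \<open>t\<close> of the coefficient of \<open>u\<^sup>-\<^sup>r\<close>.\<close>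

definition tsygan_R ::
  "(rat \<Rightarrow> 'k::comm_ring_1) \<Rightarrow> ('a::ring_1, 'k) nc_forms tensor_R \<Rightarrow> nat \<Rightarrow> nat \<Rightarrow> ('a, 'k) ext_forms" where
  "tsygan_R \<rho> x r q = tsygan \<rho> (Poly_Mapping.lookup x r) q"

definition proj_ldeg :: "int \<Rightarrow> (('a, 'v) letter, 'k::comm_ring_1) falg \<Rightarrow> (('a, 'v) letter, 'k) falg" where
  "proj_ldeg p = lin (\<lambda>w. if int (wdeg ldeg w) = p then Poly_Mapping.single w 1 else 0)"

text \<open>The projection of \<open>(\<Prod>\<^sub>q DR\<^sub>t\<^sup>\<bullet>\<^sup>,\<^sup>q) \<otimes> R\<close> to internal degree \<open>k\<close>, where \<open>y r q\<close> is the component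
  of degree \<open>q\<close> in \<open>t\<close> of the coefficient of \<open>u\<^sup>-\<^sup>r\<close>.\<close>

definition internal_proj :: "int \<Rightarrow> (nat \<Rightarrow> nat \<Rightarrow> ('a, 'k::comm_ring_1) ext_forms) \<Rightarrow> ('a, 'k) ext_forms tensor_R"
where
  "internal_proj k y = Poly_Mapping.Abs_poly_mapping (\<lambda>r.
     \<Sum>q\<in>{q. int q + int r \<le> k}. proj_ldeg (k - int q - int r) (y r q))"

definition HC_to_EHC ::
  "(rat \<Rightarrow> 'k::comm_ring_1) \<Rightarrow> ('k \<Rightarrow> 'a::ring_1 \<Rightarrow> 'a) \<Rightarrow> int \<Rightarrow> int
    \<Rightarrow> ('a, 'k) nc_forms tensor_R set \<Rightarrow> ('a, 'k) ext_forms tensor_R set" where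
  "HC_to_EHC \<rho> sc l m = induced (EHC sc l m) (\<lambda>x. internal_proj (l - m) (tsygan_R \<rho> x))"

text \<open>Representatives of the part of positive degree in \<open>t\<close>, of its image under \<open>d\<close>, and
  bidegree-homogeneous set-theoretic sections of \<open>d\<close> onto that image. The section is a map of
  quotients, hence the last condition.\<close>

definition drt_plus :: "('a, 'k::comm_ring_1) ext_forms set" where
  "drt_plus = {f. \<forall>w\<in>Poly_Mapping.keys f. 0 < wdeg vdeg w}"

definition d_drt_plus :: "('k::comm_ring_1 \<Rightarrow> 'a::ring_1 \<Rightarrow> 'a) \<Rightarrow> ('a, 'k) ext_forms set" where
  "d_drt_plus sc = {y \<in> drt_plus. \<exists>h\<in>drt_plus. y - d_ext h \<in> drt_null sc}"

definition homogeneous_section ::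
  "('k::comm_ring_1 \<Rightarrow> 'a::ring_1 \<Rightarrow> 'a) \<Rightarrow> (('a, 'k) ext_forms \<Rightarrow> ('a, 'k) ext_forms) \<Rightarrow> bool" where
  "homogeneous_section sc \<sigma> \<longleftrightarrow>
     (\<forall>y\<in>d_drt_plus sc. \<sigma> y \<in> drt_plus \<and> d_ext (\<sigma> y) - y \<in> drt_null sc) \<and>
     (\<forall>p q. \<forall>y\<in>d_drt_plus sc \<inter> bipiece p q. \<sigma> y \<in> bipiece (p - 1) q) \<and>
     (\<forall>y\<in>d_drt_plus sc. \<forall>y'\<in>d_drt_plus sc. y - y' \<in> drt_null sc \<longrightarrow> \<sigma> y - \<sigma> y' \<in> drt_null sc)"

definition forms_to_ext :: "('a, 'k::comm_ring_1) nc_forms \<Rightarrow> ('a, 'k) ext_forms" where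
  "forms_to_ext = lin (\<lambda>w. mon (map Form (letters w)))"

section \<open>Equivariant Deligne cohomology\<close>

text \<open>Data: an affine scheme with coordinate ring \<open>'p/J\<close>, where \<open>'p\<close> is a \<open>k\<close>-algebra with module
  structure \<open>sc\<close> and the ideal \<open>J\<close> contains all commutators; a Lie algebra with underlying
  module \<open>'v \<Rightarrow> 'k\<close> (free of finite rank) and bracket \<open>br\<close>; and a lift \<open>act\<close> to \<open>'p\<close> of its
  infinitesimal action. The variable \<open>Var v\<close> is the coordinate function \<open>x \<mapsto> x v\<close>.\<close>

type_synonym ('p, 'v, 'k) eq_forms = "(('p, 'v) letter, 'k) falg"

definition basis_vec :: "'v \<Rightarrow> 'v \<Rightarrow> 'k::comm_ring_1" where
  "basis_vec v = (\<lambda>w. if w = v then 1 else 0)"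

text \<open>The zero elements of \<open>\<Omega>\<^sub>X/k \<otimes> k[\<gg>]\<close>: Kaehler forms are the graded-commutative quotient
  of the noncommutative ones, and the variables are even and central.\<close>

definition eq_null ::
  "('k::comm_ring_1 \<Rightarrow> 'p::ring_1 \<Rightarrow> 'p) \<Rightarrow> 'p set \<Rightarrow> ('p, 'v, 'k) eq_forms set" where
  "eq_null sc J = span_k
     (ideal_k (form_relations sc J Form \<union> supercommutators ldeg \<union>
         {gen (Form (Df c)) * gen (Form (Df c)) | c. True})
      \<union> {mon (map Var vs) | vs. True})"

definition lie_letter ::
  "(('v::finite \<Rightarrow> 'k) \<Rightarrow> 'p \<Rightarrow> 'p) \<Rightarrow> (('v \<Rightarrow> 'k) \<Rightarrow> ('v \<Rightarrow> 'k) \<Rightarrow> 'v \<Rightarrow> 'k) \<Rightarrow> ('v \<Rightarrow> 'k)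
    \<Rightarrow> ('p, 'v) letter \<Rightarrow> ('p, 'v, 'k::comm_ring_1) eq_forms" where
  "lie_letter act br x l = (case l of
     Form (El f) \<Rightarrow> gen (Form (El (act x f)))
   | Form (Df f) \<Rightarrow> gen (Form (Df (act x f)))
   | Var v \<Rightarrow> - (\<Sum>w\<in>UNIV. smul (br x (basis_vec w) v) (gen (Var w))))"

text \<open>The diagonal action of \<open>x\<close>: Lie derivative on forms, coadjoint action
  \<open>(x \<cdot> P)(y) = - P [x, y]\<close> on linear functions \<open>P\<close>.\<close>

definition lie_action ::
  "(('v::finite \<Rightarrow> 'k) \<Rightarrow> 'p \<Rightarrow> 'p) \<Rightarrow> (('v \<Rightarrow> 'k) \<Rightarrow> ('v \<Rightarrow> 'k) \<Rightarrow> 'v \<Rightarrow> 'k) \<Rightarrow> ('v \<Rightarrow> 'k)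
    \<Rightarrow> ('p, 'v, 'k::comm_ring_1) eq_forms \<Rightarrow> ('p, 'v, 'k) eq_forms" where
  "lie_action act br x = derivation 0 ldeg (lie_letter act br x)"

text \<open>The function \<open>x \<mapsto> act x f\<close> is \<open>\<Sum>\<^sub>v (x v) act e\<^sub>v f\<close>.\<close>

definition ig_letter ::
  "(('v::finite \<Rightarrow> 'k) \<Rightarrow> 'p \<Rightarrow> 'p) \<Rightarrow> ('p, 'v) letter \<Rightarrow> ('p, 'v, 'k::comm_ring_1) eq_forms" where
  "ig_letter act l = (case l of
     Form (Df f) \<Rightarrow> (\<Sum>v\<in>UNIV. gen (Var v) * gen (Form (El (act (basis_vec v) f)))) | _ \<Rightarrow> 0)"

definition i_g ::
  "(('v::finite \<Rightarrow> 'k) \<Rightarrow> 'p \<Rightarrow> 'p) \<Rightarrow> ('p, 'v, 'k::comm_ring_1) eq_forms \<Rightarrow> ('p, 'v, 'k) eq_forms" where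
  "i_g act = derivation 1 ldeg (ig_letter act)"

definition deligne ::
  "('k::comm_ring_1 \<Rightarrow> 'p::ring_1 \<Rightarrow> 'p) \<Rightarrow> 'p set \<Rightarrow> (('v::finite \<Rightarrow> 'k) \<Rightarrow> 'p \<Rightarrow> 'p)
    \<Rightarrow> (('v \<Rightarrow> 'k) \<Rightarrow> ('v \<Rightarrow> 'k) \<Rightarrow> 'v \<Rightarrow> 'k) \<Rightarrow> int \<Rightarrow> int \<Rightarrow> ('p, 'v, 'k) eq_forms tensor_R subquotient"
where
  "deligne sc J act br l m =
     homology
       (\<lambda>l'. {x \<in> internal_chains (l - m) l'.
                \<forall>r \<xi>. lie_action act br \<xi> (Poly_Mapping.lookup x r) \<in> eq_null sc J})
       (null_R (eq_null sc J)) (mixed_diff (i_g act) d_ext) l"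

section \<open>Representation schemes\<close>

text \<open>The coordinate ring of \<open>Rep\<^sub>n A\<close>, \<open>n = CARD('n)\<close>, is generated by the functions
  \<open>\<rho> \<mapsto> \<rho>(a)\<^sub>i\<^sub>j\<close>; its homomorphisms to a commutative \<open>k\<close>-algebra \<open>C\<close> are the algebra
  homomorphisms \<open>A \<rightarrow> Mat\<^sub>n(C)\<close>.\<close>

type_synonym ('a, 'n, 'k) rep_ring = "('a \<times> 'n \<times> 'n, 'k) falg"

definition coord :: "'a \<Rightarrow> 'n \<Rightarrow> 'n \<Rightarrow> ('a, 'n, 'k::comm_ring_1) rep_ring" where
  "coord a i j = gen (a, i, j)"

definition rep_ideal ::
  "('k::comm_ring_1 \<Rightarrow> 'a::ring_1 \<Rightarrow> 'a) \<Rightarrow> ('a, 'n::finite, 'k) rep_ring set" where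
  "rep_ideal sc = ideal_k (
     {f * g - g * f | f g. True} \<union>
     {coord (a + b) i j - (coord a i j + coord b i j) | a b i j. True} \<union>
     {coord (sc c a) i j - smul c (coord a i j) | c a i j. True} \<union>
     {coord (a * b) i j - (\<Sum>k\<in>UNIV. coord a i k * coord b k j) | a b i j. True} \<union>
     {coord 1 i j - (if i = j then 1 else 0) | i j. True})"

text \<open>The action \<open>\<rho>(a) \<mapsto> [\<rho>(a), x]\<close> and the commutator bracket; elements of \<open>\<gg>\<ll>\<^sub>n\<close> are
  functions of the index pair.\<close>

definition gl_act ::
  "('n::finite \<times> 'n \<Rightarrow> 'k::comm_ring_1) \<Rightarrow> ('a, 'n, 'k) rep_ring \<Rightarrow> ('a, 'n, 'k) rep_ring" where
  "gl_act x = derivation 0 (\<lambda>_. 0)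
     (\<lambda>(a, i, j). \<Sum>k\<in>UNIV. smul (x (k, j)) (coord a i k) - smul (x (i, k)) (coord a k j))"

definition gl_bracket ::
  "('n::finite \<times> 'n \<Rightarrow> 'k::comm_ring_1) \<Rightarrow> ('n \<times> 'n \<Rightarrow> 'k) \<Rightarrow> 'n \<times> 'n \<Rightarrow> 'k" where
  "gl_bracket x y = (\<lambda>(i, j). \<Sum>k\<in>UNIV. x (i, k) * y (k, j) - y (i, k) * x (k, j))"

type_synonym ('a, 'n, 'k) rep_eq_forms = "(('a, 'n, 'k) rep_ring, 'n \<times> 'n, 'k) eq_forms"

definition deligne_rep ::
  "('k::comm_ring_1 \<Rightarrow> 'a::ring_1 \<Rightarrow> 'a) \<Rightarrow> int \<Rightarrow> int \<Rightarrow> ('a, 'n::finite, 'k) rep_eq_forms tensor_R subquotient"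
where
  "deligne_rep sc = deligne smul (rep_ideal sc) gl_act gl_bracket"

definition ev_letter ::
  "('a, unit) letter \<Rightarrow> ('a, 'n::finite, 'k::comm_ring_1) rep_eq_forms ^ 'n ^ 'n" where
  "ev_letter l = (\<chi> i j. case l of
     Form (El a) \<Rightarrow> gen (Form (El (coord a i j)))
   | Form (Df a) \<Rightarrow> gen (Form (Df (coord a i j)))
   | Var _ \<Rightarrow> gen (Var (i, j)))"

definition ev_word ::
  "('a, unit) letter list \<Rightarrow> ('a, 'n::finite, 'k::comm_ring_1) rep_eq_forms ^ 'n ^ 'n" where
  "ev_word ls = foldr (\<lambda>l M. ev_letter l ** M) ls (mat 1)"

definition ev ::
  "('a, 'k::comm_ring_1) ext_forms \<Rightarrow> ('a, 'n::finite, 'k) rep_eq_forms ^ 'n ^ 'n" where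
  "ev f = (\<chi> i j. lin (\<lambda>w. ev_word (letters w) $ i $ j) f)"

definition tr_ev ::
  "('a, 'k::comm_ring_1) ext_forms \<Rightarrow> ('a, 'n::finite, 'k) rep_eq_forms" where
  "tr_ev f = trace (ev f)"

definition EHC_to_deligne ::
  "('k::comm_ring_1 \<Rightarrow> 'a::ring_1 \<Rightarrow> 'a) \<Rightarrow> int \<Rightarrow> int
    \<Rightarrow> ('a, 'k) ext_forms tensor_R set \<Rightarrow> ('a, 'n::finite, 'k) rep_eq_forms tensor_R set" where
  "EHC_to_deligne sc l m = induced (deligne_rep sc l m) (Poly_Mapping.map tr_ev)"

section \<open>The composite maps\<close>

definition Psi ::
  "(rat \<Rightarrow> 'k::comm_ring_1) \<Rightarrow> ('k \<Rightarrow> 'a::ring_1 \<Rightarrow> 'a) \<Rightarrow> int \<Rightarrow> int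
    \<Rightarrow> ('a, 'k) nc_forms tensor_R set \<Rightarrow> ('a, 'n::finite, 'k) rep_eq_forms tensor_R set" where
  "Psi \<rho> sc l m = EHC_to_deligne sc l m \<circ> HC_to_EHC \<rho> sc l m"

definition Psi' ::
  "(rat \<Rightarrow> 'k::comm_ring_1) \<Rightarrow> ('k \<Rightarrow> 'a::ring_1 \<Rightarrow> 'a) \<Rightarrow> int
    \<Rightarrow> ('a, 'k) nc_forms set \<Rightarrow> ('a, 'n::finite, 'k) rep_eq_forms tensor_R set" where
  "Psi' \<rho> sc l = Psi \<rho> sc l 0 \<circ> inv_into (elements (HC sc l)) (HC_to_ker_i sc l)"

end

theory Submission
  imports Defs "HOL-Computational_Algebra.Formal_Power_Series"
begin

text \<open>
  Forms, extended forms and equivariant forms are quotients of free algebras, so a map on a quotient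
  is a linear map on the free algebra that respects the relations modulo the ideal.

  Cyclic homology is compared with \<open>ker i\<close> through Connes' operator \<open>\<kappa>\<close>: it has finite
  order on exact forms of each degree, and over \<open>\<rat>\<close> the operator \<open>1 - \<kappa>\<close> can be
  inverted where it has to be. Together with the exactness of \<open>d\<close> on reduced forms, this lets one
  extend a form \<open>f\<^sub>0\<close> with \<open>i f\<^sub>0 \<in> d\<Omega>\<close> step by step to a cycle \<open>f\<^sub>0 + f\<^sub>1 u\<^sup>-\<^sup>1 + \<dots>\<close>,
  uniquely up to boundaries.

  The Tsygan map is handled through generating functions: with \<open>T = (1 - z t)\<^sup>-\<^sup>1\<close> it sends
  \<open>a\<^sub>0 da\<^sub>1 \<dots> da\<^sub>n\<close>, up to factorials, to \<open>a\<^sub>0 T da\<^sub>1 T \<dots> da\<^sub>n T\<close>. The identity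
  \<open>aT - Ta = z T (at - ta) T\<close> gives \<open>E b = i\<^sub>t E\<close>, and \<open>T\<^sup>2 = (1 + z d/dz) T\<close> gives \<open>E B = d E\<close>.

  For the explicit formula, let \<open>e\<^sub>j\<close> be \<open>l!\<close> times the coefficient of \<open>u\<^sup>-\<^sup>j\<close> in the image of a
  cycle that lifts \<open>f\<close> and \<open>g\<^sub>j\<close> the term \<open>(d\<^sup>-\<^sup>1 i\<^sub>t)\<^sup>j f\<close>. Both satisfy \<open>i\<^sub>t x\<^sub>j = d x\<^sub>j\<^sub>+\<^sub>1\<close>, and
  \<open>e\<^sub>0 - g\<^sub>0\<close> is exact, so the acyclicity of extended forms of positive degree in \<open>t\<close> shows
  inductively that \<open>e - g\<close> is a boundary.
\<close>

section \<open>Linear algebra of finitely supported functions\<close>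

text \<open>The operators b, B, i and the Tsygan map are given by formulas on a_0 da_1 ... da_n,
  whereas forms are classes of words. A formula is evaluated on a normal form, and it descends to
  classes when it is linear in every entry and kills d1. Once \<kappa> = 1 - bd - db is known, the
  cyclic part becomes algebra in b, d and \<kappa>: in degree n, B is a sum of n + 1 powers of
  \<kappa> after d, and i is b after a sum of n powers. Division by integers occurs in the averages
  over \<kappa>, in the factorials of the Tsygan map, and in the acyclicity argument, where one
  divides by the number of letters t. The splitting of the scalars gives the contraction of d.
  Modulo commutators a contraction has no first factor to act on. The cyclic derivative with respect
  to t cuts a cyclic word open at each t, and multiplication by t closes it again; in between, the
  word is a product of forms separated by t, and the contraction of \<Omega> can act on a single
  factor. The section is only a map of sets, so its iterates cannot be compared with the Tsygan map
  as linear maps. They are compared term by term for one cycle that lifts f.\<close>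

lemma lookup_smul [simp]: "Poly_Mapping.lookup (smul c p) x = c * Poly_Mapping.lookup p x"
  unfolding smul_def by (transfer) (auto simp: when_def)

interpretation smul: module "smul :: 'k::comm_ring_1 \<Rightarrow> ('x \<Rightarrow>\<^sub>0 'k) \<Rightarrow> ('x \<Rightarrow>\<^sub>0 'k)"
  by standard (rule poly_mapping_eqI; simp add: lookup_add algebra_simps)+

abbreviation klin :: "(('x \<Rightarrow>\<^sub>0 'k::comm_ring_1) \<Rightarrow> ('y \<Rightarrow>\<^sub>0 'k)) \<Rightarrow> bool" where
  "klin \<equiv> module_hom smul smul"

abbreviation submod :: "('x \<Rightarrow>\<^sub>0 'k::comm_ring_1) set \<Rightarrow> bool" where
  "submod \<equiv> smul.subspace"

lemma klinI:
  assumes "\<And>x y. f (x + y) = f x + f y" "\<And>c x. f (smul c x) = smul c (f x)"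
  shows "klin f"
  by unfold_locales (use assms in auto)

lemma klin_add: "klin f \<Longrightarrow> f (x + y) = f x + f y" by (rule module_hom.add)
lemma klin_smul: "klin f \<Longrightarrow> f (smul c x) = smul c (f x)" by (rule module_hom.scale)
lemma klin_zero: "klin f \<Longrightarrow> f 0 = 0" by (rule module_hom.zero)
lemma klin_diff: "klin f \<Longrightarrow> f (x - y) = f x - f y" by (rule module_hom.diff)
lemma klin_sum: "klin f \<Longrightarrow> f (sum g A) = (\<Sum>i\<in>A. f (g i))" by (rule module_hom.sum)
lemma klin_neg: "klin f \<Longrightarrow> f (- x) = - f x" by (rule module_hom.neg)

lemma lin_superset:
  assumes "finite A" "Poly_Mapping.keys p \<subseteq> A"
  shows "lin \<phi> p = (\<Sum>x\<in>A. smul (Poly_Mapping.lookup p x) (\<phi> x))"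
  unfolding lin_def using assms
  by (intro sum.mono_neutral_left) (auto simp: in_keys_iff)

lemma klin_lin: "klin (lin (\<phi> :: 'x \<Rightarrow> ('y \<Rightarrow>\<^sub>0 'k::comm_ring_1)))"
proof (rule klinI)
  fix p q :: "'x \<Rightarrow>\<^sub>0 'k::comm_ring_1"
  let ?A = "Poly_Mapping.keys p \<union> Poly_Mapping.keys q"
  have "Poly_Mapping.keys (p + q) \<subseteq> ?A" by (rule Poly_Mapping.keys_add)
  then show "lin \<phi> (p + q) = lin \<phi> p + lin \<phi> q"
    by (simp add: lin_superset[of ?A] lookup_add smul.scale_left_distrib sum.distrib)
next
  fix c and p :: "'x \<Rightarrow>\<^sub>0 'k::comm_ring_1"
  have "Poly_Mapping.keys (smul c p) \<subseteq> Poly_Mapping.keys p" by (auto simp: in_keys_iff)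
  then show "lin \<phi> (smul c p) = smul c (lin \<phi> p)"
    by (simp add: lin_superset[of "Poly_Mapping.keys p"] smul.scale_sum_right)
qed

lemma lin_single [simp]: "lin \<phi> (Poly_Mapping.single x c) = smul c (\<phi> x)"
  by (subst lin_superset[of "{x}"]) auto

lemma expand_keys: "p = (\<Sum>x\<in>Poly_Mapping.keys p. smul (Poly_Mapping.lookup p x) (Poly_Mapping.single x 1))"
  by (rule poly_mapping_eqI)
     (simp add: lookup_sum lookup_single when_def in_keys_iff if_distrib[of "(*) _"] cong: if_cong)

lemma klin_mem:
  assumes "klin F" "submod W" "\<And>x. x \<in> Poly_Mapping.keys p \<Longrightarrow> F (Poly_Mapping.single x 1) \<in> W"
  shows "F p \<in> W"
proof -
  have "F p = (\<Sum>x\<in>Poly_Mapping.keys p. smul (Poly_Mapping.lookup p x) (F (Poly_Mapping.single x 1)))"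
    by (subst expand_keys[of p]) (simp add: klin_sum[OF assms(1)] klin_smul[OF assms(1)])
  also have "\<dots> \<in> W"
    by (intro smul.subspace_sum smul.subspace_scale assms)
  finally show ?thesis .
qed

lemma klin_eqI:
  assumes "klin F" "klin G" "\<And>x. F (Poly_Mapping.single x 1) = G (Poly_Mapping.single x 1)"
  shows "F p = G p"
proof -
  have "(\<lambda>p. F p - G p) p \<in> {0}"
    by (rule klin_mem) (auto intro!: klinI simp: klin_add[OF assms(1)] klin_add[OF assms(2)]
       klin_smul[OF assms(1)] klin_smul[OF assms(2)] assms(3) smul.scale_right_diff_distrib)
  then show ?thesis by simp
qed

named_theorems klin_intros

lemma klin_id [klin_intros]: "klin (\<lambda>x. x)" by (rule klinI) auto
lemma klin_const0 [klin_intros]: "klin (\<lambda>x. 0)" by (rule klinI) auto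
lemma klin_plus [klin_intros]: "klin f \<Longrightarrow> klin g \<Longrightarrow> klin (\<lambda>x. f x + g x)"
  by (rule klinI) (auto simp: klin_add klin_smul smul.scale_right_distrib)
lemma klin_minus [klin_intros]: "klin f \<Longrightarrow> klin g \<Longrightarrow> klin (\<lambda>x. f x - g x)"
  by (rule klinI) (auto simp: klin_add klin_smul smul.scale_right_diff_distrib)
lemma klin_scale [klin_intros]: "klin f \<Longrightarrow> klin (\<lambda>x. smul c (f x))"
  by (rule klinI) (auto simp: klin_add klin_smul smul.scale_right_distrib mult.commute)
lemma klin_setsum [klin_intros]: "(\<And>i. i \<in> A \<Longrightarrow> klin (f i)) \<Longrightarrow> klin (\<lambda>x. \<Sum>i\<in>A. f i x)"
  by (rule klinI)
     (auto simp: sum.distrib[symmetric] smul.scale_sum_right klin_add klin_smul intro!: sum.cong)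
lemma klin_lin' [klin_intros]: "klin g \<Longrightarrow> klin (\<lambda>x. lin \<phi> (g x))"
  by (rule klinI) (simp_all add: klin_add klin_smul klin_add[OF klin_lin] klin_smul[OF klin_lin])
lemma klin_comp: "klin f \<Longrightarrow> klin g \<Longrightarrow> klin (\<lambda>x. f (g x))"
  by (rule klinI) (simp_all add: klin_add klin_smul)
lemma klin_funpow: "klin f \<Longrightarrow> klin (f ^^ n)"
  for f :: "('x \<Rightarrow>\<^sub>0 'k::comm_ring_1) \<Rightarrow> ('x \<Rightarrow>\<^sub>0 'k)"
proof (induction n)
  case (Suc n)
  then show ?case using klin_comp[of f "f ^^ n"] by (simp add: comp_def)
qed (simp add: klin_id id_def)
lemma klin_if [klin_intros]: "klin f \<Longrightarrow> klin g \<Longrightarrow> klin (\<lambda>x. if P then f x else g x)"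
  by (cases P) auto

lemma smul_eq_mult: "smul c f = Poly_Mapping.single 0 c * (f :: ('g, 'k::comm_ring_1) falg)"
  unfolding smul_def by (rule mult_map_scale_conv_mult)

lemma smul_mult_left: "smul c f * g = smul c (f * (g :: ('g, 'k::comm_ring_1) falg))"
  by (simp add: smul_eq_mult mult.assoc)

lemma single_eq_mon: "Poly_Mapping.single w 1 = mon (letters w)"
  by (simp add: mon_def)

lemma mon_append: "mon (u @ v) = mon u * mon v"
  by (simp add: mon_def mult_single plus_word_def)

lemma mon_Nil [simp]: "mon [] = 1"
  by (simp add: mon_def flip: single_one zero_word_def)

lemma mon_Cons: "mon (l # w) = gen l * mon w"
  using mon_append[of "[l]" w] by simp

lemma const_commute:
  fixes f :: "('g, 'k::comm_ring_1) falg"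
  shows "Poly_Mapping.single 0 c * f = f * Poly_Mapping.single 0 c"
proof (rule klin_eqI[of "\<lambda>f. Poly_Mapping.single 0 c * f" "\<lambda>f. f * Poly_Mapping.single 0 c"])
  show "klin (\<lambda>f :: ('g, 'k) falg. Poly_Mapping.single 0 c * f)"
    by (rule klinI) (simp_all add: distrib_left flip: smul_eq_mult, simp add: mult.commute)
  show "klin (\<lambda>f :: ('g, 'k) falg. f * Poly_Mapping.single 0 c)"
    by (rule klinI) (simp_all add: distrib_right smul_mult_left)
qed (simp add: mult_single mult.commute)

lemma smul_mult_right: "f * smul c g = smul c (f * (g :: ('g, 'k::comm_ring_1) falg))"
  unfolding smul_eq_mult by (simp add: const_commute[of c f] flip: mult.assoc)

lemma klin_mult_left [klin_intros]: "klin g \<Longrightarrow> klin (\<lambda>x. (a :: ('g, 'k::comm_ring_1) falg) * g x)"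
  by (rule klinI) (simp_all add: klin_add klin_smul distrib_left smul_mult_right)
lemma klin_mult_right [klin_intros]: "klin g \<Longrightarrow> klin (\<lambda>x. g x * (a :: ('g, 'k::comm_ring_1) falg))"
  by (rule klinI) (simp_all add: klin_add klin_smul distrib_right smul_mult_left)

lemma falg_mem:
  assumes "klin F" "submod W" "\<And>w. Word w \<in> Poly_Mapping.keys p \<Longrightarrow> F (mon w) \<in> W"
  shows "F p \<in> W"
proof (rule klin_mem[OF assms(1,2)])
  fix x assume "x \<in> Poly_Mapping.keys p"
  then show "F (Poly_Mapping.single x 1) \<in> W" using assms(3)[of "letters x"] by (simp add: single_eq_mon)
qed

lemma falg_eqI:
  assumes "klin F" "klin G" "\<And>w. F (mon w) = G (mon w)"
  shows "F p = G p"
  by (rule klin_eqI[OF assms(1,2)]) (simp add: single_eq_mon assms(3))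

section \<open>Congruence modulo submodules and two-sided ideals\<close>

definition eqv :: "'x::ab_group_add \<Rightarrow> 'x set \<Rightarrow> 'x \<Rightarrow> bool" ("(_ \<simeq>[_] _)" [51, 0, 51] 50) where
  "x \<simeq>[W] y \<longleftrightarrow> x - y \<in> W"

locale submodule =
  fixes W :: "('x \<Rightarrow>\<^sub>0 'k::comm_ring_1) set"
  assumes sub: "submod W"
begin

lemma refl [simp, intro]: "x \<simeq>[W] x" by (simp add: eqv_def smul.subspace_0 sub)
lemma sym: "x \<simeq>[W] y \<Longrightarrow> y \<simeq>[W] x"
  unfolding eqv_def using smul.subspace_neg[OF sub, of "x - y"] by simp
lemma trans [trans]: "x \<simeq>[W] y \<Longrightarrow> y \<simeq>[W] z \<Longrightarrow> x \<simeq>[W] z"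
  unfolding eqv_def using smul.subspace_add[OF sub, of "x - y" "y - z"] by simp
lemma add: "x \<simeq>[W] y \<Longrightarrow> x' \<simeq>[W] y' \<Longrightarrow> x + x' \<simeq>[W] y + y'"
  unfolding eqv_def using smul.subspace_add[OF sub, of "x - y" "x' - y'"] by (simp add: algebra_simps)
lemma diff: "x \<simeq>[W] y \<Longrightarrow> x' \<simeq>[W] y' \<Longrightarrow> x - x' \<simeq>[W] y - y'"
  unfolding eqv_def using smul.subspace_diff[OF sub, of "x - y" "x' - y'"] by (simp add: algebra_simps)
lemma uminus: "x \<simeq>[W] y \<Longrightarrow> - x \<simeq>[W] - y"
  unfolding eqv_def using smul.subspace_neg[OF sub, of "x - y"] by (simp add: algebra_simps)
lemma scale: "x \<simeq>[W] y \<Longrightarrow> smul c x \<simeq>[W] smul c y"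
  unfolding eqv_def using smul.subspace_scale[OF sub, of "x - y"] by (simp add: algebra_simps)
lemma sum: "(\<And>i. i \<in> A \<Longrightarrow> f i \<simeq>[W] g i) \<Longrightarrow> sum f A \<simeq>[W] sum g A"
  unfolding eqv_def by (simp add: sub smul.subspace_sum flip: sum_subtractf)
lemma iff0: "x \<in> W \<longleftrightarrow> x \<simeq>[W] 0" by (simp add: eqv_def)
lemma mem_cong: "x \<simeq>[W] y \<Longrightarrow> x \<in> W \<longleftrightarrow> y \<in> W"
  unfolding iff0 using sym trans by blast
lemma klin: "klin F \<Longrightarrow> (\<And>x. x \<in> V \<Longrightarrow> F x \<in> W) \<Longrightarrow> x \<simeq>[V] y \<Longrightarrow> F x \<simeq>[W] F y"
  unfolding eqv_def by (simp add: klin_diff[symmetric])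

lemmas closed = smul.subspace_add[OF sub] smul.subspace_diff[OF sub] smul.subspace_neg[OF sub]
  smul.subspace_scale[OF sub] smul.subspace_0[OF sub] smul.subspace_sum[OF sub]

lemma eq_trans1 [trans]: "x = y \<Longrightarrow> y \<simeq>[W] z \<Longrightarrow> x \<simeq>[W] z" by simp
lemma eq_trans2 [trans]: "x \<simeq>[W] y \<Longrightarrow> y = z \<Longrightarrow> x \<simeq>[W] z" by simp

end

lemma eqv_mono: "V \<subseteq> W \<Longrightarrow> x \<simeq>[V] y \<Longrightarrow> x \<simeq>[W] y" by (auto simp: eqv_def)

locale tsideal = submodule W for W :: "('g word \<Rightarrow>\<^sub>0 'k::comm_ring_1) set" +
  assumes absorb_r: "x \<in> W \<Longrightarrow> x * y \<in> W" and absorb_l: "x \<in> W \<Longrightarrow> y * x \<in> W"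
begin
lemma mult: "x \<simeq>[W] y \<Longrightarrow> x' \<simeq>[W] y' \<Longrightarrow> x * x' \<simeq>[W] y * y'"
proof -
  assume "x \<simeq>[W] y" "x' \<simeq>[W] y'"
  then have "(x - y) * x' + y * (x' - y') \<in> W" unfolding eqv_def
    by (rule closed(1)[OF absorb_r absorb_l])
  then show ?thesis by (simp add: eqv_def algebra_simps)
qed
end

section \<open>Tests for spans and ideals on generators\<close>

lemma span_k_submod [simp, intro]: "submod (span_k S)"
  unfolding span_k_def by (rule smul.subspace_span)

lemma span_k_base: "x \<in> S \<Longrightarrow> x \<in> span_k S"
  unfolding span_k_def by (rule smul.span_base)

lemma span_k_mono: "S \<subseteq> T \<Longrightarrow> span_k S \<subseteq> span_k T"
  unfolding span_k_def by (rule smul.span_mono)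

lemma span_k_least: "S \<subseteq> W \<Longrightarrow> submod W \<Longrightarrow> span_k S \<subseteq> W"
  unfolding span_k_def by (rule smul.span_minimal)

lemma klin_vimage: "klin F \<Longrightarrow> submod W \<Longrightarrow> submod {x. F x \<in> W}"
  by (rule smul.subspaceI)
     (auto simp: klin_add klin_smul klin_zero smul.subspace_add smul.subspace_scale smul.subspace_0)

lemma klin_span:
  assumes "klin F" "submod W" "\<And>s. s \<in> S \<Longrightarrow> F s \<in> W" "x \<in> span_k S"
  shows "F x \<in> W"
proof -
  have "span_k S \<subseteq> {x. F x \<in> W}"
    by (rule span_k_least) (use assms in \<open>auto intro: klin_vimage\<close>)
  then show ?thesis using assms(4) by auto
qed

lemma ideal_k_base: "r \<in> S \<Longrightarrow> r \<in> ideal_k S"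
  unfolding ideal_k_def by (rule span_k_base) (metis (mono_tags, lifting) mem_Collect_eq mult_1_left mult_1_right)

lemma tsideal_ideal_k: "tsideal (ideal_k S)"
proof
  show "submod (ideal_k S)" by (simp add: ideal_k_def)
next
  fix x y :: "('a, 'b) falg" assume x: "x \<in> ideal_k S"
  let ?S = "{p * r * q | p r q. r \<in> S}"
  have "(\<lambda>x. x * y) x \<in> span_k ?S"
  proof (rule klin_span[OF _ _ _ x[unfolded ideal_k_def]])
    fix s assume "s \<in> ?S"
    then obtain p r q where "s = p * r * q" "r \<in> S" by auto
    then show "s * y \<in> span_k ?S"
      by (intro span_k_base CollectI exI[of _ p] exI[of _ r] exI[of _ "q * y"]) (simp add: mult.assoc)
  qed (auto intro!: klin_intros)
  then show "x * y \<in> ideal_k S" by (simp add: ideal_k_def)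
  have "(\<lambda>x. y * x) x \<in> span_k ?S"
  proof (rule klin_span[OF _ _ _ x[unfolded ideal_k_def]])
    fix s assume "s \<in> ?S"
    then obtain p r q where "s = p * r * q" "r \<in> S" by auto
    then show "y * s \<in> span_k ?S"
      by (intro span_k_base CollectI exI[of _ "y * p"] exI[of _ r] exI[of _ q]) (simp add: mult.assoc)
  qed (auto intro!: klin_intros)
  then show "y * x \<in> ideal_k S" by (simp add: ideal_k_def)
qed

text \<open>By linearity of F the two outer factors may be taken to be words. Words are homogeneous,
  so signed Leibniz rules apply to them.\<close>

lemma ideal_k_mem:
  assumes "klin F" "submod W" "\<And>u v r. r \<in> S \<Longrightarrow> F (mon u * r * mon v) \<in> W" "x \<in> ideal_k S"
  shows "F x \<in> W"
proof (rule klin_span[OF assms(1,2) _ assms(4)[unfolded ideal_k_def]])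
  fix s assume "s \<in> {p * r * q | p r q. r \<in> S}"
  then obtain p r q where s: "s = p * r * q" and r: "r \<in> S" by auto
  have "F (p * r * q) \<in> W"
  proof (rule falg_mem[of "\<lambda>p. F (p * r * q)"])
    fix u show "F (mon u * r * q) \<in> W"
      by (rule falg_mem[of "\<lambda>q. F (mon u * r * q)"])
         (auto intro!: klin_comp[OF assms(1)] klin_intros assms r)
  qed (auto intro!: klin_comp[OF assms(1)] klin_intros assms)
  then show "F s \<in> W" by (simp add: s)
qed

section \<open>Gradings, signs and derivations\<close>

text \<open>The exponent is an integer because degrees are shifted down and may be negative. The
  target is any ring because the same signs act on forms and on power series.\<close>

definition sg :: "int \<Rightarrow> 'r::ring_1" where
  "sg n = (if even n then 1 else -1)"

lemma sg_simps [simp]: "sg 0 = 1" "sg 1 = - 1" "sg (- n) = sg n"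
  by (auto simp: sg_def)

lemma sg_add: "sg (m + n) = sg m * sg n" by (auto simp: sg_def)

lemma power_sg: "(-1) ^ n = sg (int n)" by (simp add: sg_def minus_one_power_iff)

lemma sg_sq [simp]: "sg n * sg n = 1" by (auto simp: sg_def)

lemma klin_sg [klin_intros]: "klin f \<Longrightarrow> klin (\<lambda>x. sg n * (f x :: ('g, 'k::comm_ring_1) falg))"
  by (rule klin_mult_left)

lemma piece_submod [simp, intro]: "submod (piece deg p)"
  by (rule smul.subspaceI)
     (auto simp: piece_def in_keys_iff lookup_add dest!: subsetD[OF Poly_Mapping.keys_add])

lemma piece_0 [simp]: "0 \<in> piece deg p" by (simp add: piece_def)

lemma piece_add [intro]: "f \<in> piece deg p \<Longrightarrow> g \<in> piece deg p \<Longrightarrow> f + g \<in> piece deg p"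
  by (rule smul.subspace_add) auto
lemma piece_diff [intro]: "f \<in> piece deg p \<Longrightarrow> g \<in> piece deg p \<Longrightarrow> f - g \<in> piece deg p"
  by (rule smul.subspace_diff) auto
lemma piece_smul [intro]: "f \<in> piece deg p \<Longrightarrow> smul c f \<in> piece deg p"
  by (rule smul.subspace_scale) auto
lemma piece_neg [intro]: "f \<in> piece deg p \<Longrightarrow> - f \<in> piece deg p"
  by (rule smul.subspace_neg) auto
lemma piece_sum [intro]: "(\<And>i. i \<in> A \<Longrightarrow> f i \<in> piece deg p) \<Longrightarrow> sum f A \<in> piece deg p"
  by (rule smul.subspace_sum) auto
lemma piece_sg [intro]: "f \<in> piece deg p \<Longrightarrow> sg n * f \<in> piece deg p"
  by (auto simp: sg_def)

lemma piece_mon: "mon w \<in> piece deg p \<longleftrightarrow> int (sum_list (map deg w)) = p"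
  by (auto simp: piece_def mon_def wdeg_def)

lemma piece_mon' [simp, intro]: "mon w \<in> piece deg (int (sum_list (map deg w)))"
  by (simp add: piece_mon)

lemma piece_mem:
  assumes "f \<in> piece deg p" "klin F" "submod W"
    "\<And>w. int (sum_list (map deg w)) = p \<Longrightarrow> F (mon w) \<in> W"
  shows "F f \<in> W"
  using assms(2,3) by (rule falg_mem) (use assms(1,4) in \<open>auto simp: piece_def wdeg_def\<close>)

lemma piece_eqI:
  assumes "f \<in> piece deg p" "klin F" "klin G"
    "\<And>w. int (sum_list (map deg w)) = p \<Longrightarrow> F (mon w) = G (mon w)"
  shows "F f = G f"
proof -
  have "F f - G f \<in> {0}"
    by (rule piece_mem[OF assms(1), of "\<lambda>f. F f - G f"]) (auto intro!: klin_intros assms)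
  then show ?thesis by simp
qed

lemma piece_mult [intro]:
  assumes "f \<in> piece deg p" "g \<in> piece deg q"
  shows "f * g \<in> piece deg (p + q)"
proof (rule piece_mem[OF assms(1), of "\<lambda>f. f * g"])
  fix w assume w: "int (sum_list (map deg w)) = p"
  show "mon w * g \<in> piece deg (p + q)"
    by (rule piece_mem[OF assms(2), of "\<lambda>g. mon w * g"])
       (auto intro!: klin_intros simp: w piece_mon simp flip: mon_append)
qed (auto intro!: klin_intros)

lemma piece_mult': "f \<in> piece deg p \<Longrightarrow> g \<in> piece deg q \<Longrightarrow> r = p + q \<Longrightarrow> f * g \<in> piece deg r"
  by auto

lemma piece_one [simp]: "1 \<in> piece deg 0"
  using piece_mon'[of "[]" deg] by simp

text \<open>In a chain of degree l the coefficient of u^-r has degree l - 2r. Hence families of such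
  coefficients have finite support, and recursions over r stop.\<close>

lemma piece_neg_deg: "p < 0 \<Longrightarrow> f \<in> piece deg p \<Longrightarrow> f = 0"
  unfolding piece_def by (metis (mono_tags, lifting) all_not_in_conv keys_eq_empty linorder_not_less
      mem_Collect_eq of_nat_0_le_iff)

lemma klin_derivation: "klin (derivation e deg \<delta>)"
  unfolding derivation_def by (rule klin_lin)

lemma klin_derivation' [klin_intros]: "klin g \<Longrightarrow> klin (\<lambda>x. derivation e deg \<delta> (g x))"
  by (rule klin_comp[OF klin_derivation])

lemma derivation_mon: "derivation e deg \<delta> (mon w) = deriv_word e deg \<delta> w"
  by (simp add: derivation_def mon_def)

lemma derivation_gen [simp]: "derivation e deg \<delta> (gen l) = \<delta> l"
  by (simp add: derivation_mon)

lemma derivation_one [simp]: "derivation e deg \<delta> 1 = 0"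
  using derivation_mon[of e deg \<delta> "[]"] by simp

lemma deriv_word_append:
  "deriv_word e deg \<delta> (u @ v) = deriv_word e deg \<delta> u * mon v
     + sg (int e * int (sum_list (map deg u))) * (mon u * deriv_word e deg \<delta> v)"
proof (induction u)
  case (Cons l u)
  define s where "s = int (sum_list (map deg u))"
  show ?case
    using Cons
    by (simp add: mon_Cons[of l u] mon_append power_sg distrib_left distrib_right flip: s_def)
       (cases "even e"; cases "even (deg l)"; cases "even s"; simp add: sg_def algebra_simps)
qed simp

lemma derivation_mon_append:
  "derivation e deg \<delta> (mon (u @ v)) = derivation e deg \<delta> (mon u) * mon v
     + sg (int e * int (sum_list (map deg u))) * (mon u * derivation e deg \<delta> (mon v))"
  by (simp add: derivation_mon deriv_word_append)

lemma derivation_mult: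
  assumes "f \<in> piece deg p"
  shows "derivation e deg \<delta> (f * g) = derivation e deg \<delta> f * g + sg (int e * p) * (f * derivation e deg \<delta> g)"
proof (rule piece_eqI[OF assms, of "\<lambda>f. derivation e deg \<delta> (f * g)"
      "\<lambda>f. derivation e deg \<delta> f * g + sg (int e * p) * (f * derivation e deg \<delta> g)"])
  fix w assume w: "int (sum_list (map deg w)) = p"
  show "derivation e deg \<delta> (mon w * g) =
    derivation e deg \<delta> (mon w) * g + sg (int e * p) * (mon w * derivation e deg \<delta> g)"
    by (rule falg_eqI[of "\<lambda>g. derivation e deg \<delta> (mon w * g)"
      "\<lambda>g. derivation e deg \<delta> (mon w) * g + sg (int e * p) * (mon w * derivation e deg \<delta> g)"])
       (auto intro!: klin_intros simp: derivation_mon_append w simp flip: mon_append)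
qed (auto intro!: klin_intros)

text \<open>The grading \<open>deg'\<close> whose shift is tracked may differ from the grading
  \<open>deg\<close> that gives the signs: d and i_t are signed by form degree, but their effect on
  the degree in t matters as well.\<close>

lemma derivation_piece:
  assumes "\<And>l. \<delta> l \<in> piece deg' (int (deg' l) + s)" "f \<in> piece deg' p"
  shows "derivation e deg \<delta> f \<in> piece deg' (p + s)"
proof (rule piece_mem[OF assms(2) klin_derivation piece_submod])
  fix w assume "int (sum_list (map deg' w)) = p"
  then show "derivation e deg \<delta> (mon w) \<in> piece deg' (p + s)"
  proof (induction w arbitrary: p)
    case (Cons l w)
    have p: "p = int (deg' l) + int (sum_list (map deg' w))" using Cons.prems by simp
    have "\<delta> l * mon w \<in> piece deg' (p + s)"
      by (rule piece_mult'[OF assms(1) piece_mon']) (simp add: p)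
    moreover have "gen l * derivation e deg \<delta> (mon w) \<in> piece deg' (p + s)"
      by (rule piece_mult'[OF piece_mon' Cons.IH[OF HOL.refl]]) (simp add: p)
    ultimately show ?case
      unfolding derivation_mon deriv_word.simps power_sg by (intro piece_add piece_sg)
  qed simp
qed

lemma (in tsideal) absorb3: "x \<in> W \<Longrightarrow> a * x * b \<in> W"
  by (intro absorb_r absorb_l)

lemma (in tsideal) sgW: "x \<in> W \<Longrightarrow> sg n * x \<in> W"
  by (rule absorb_l)

text \<open>The Leibniz rule has a definite sign only for a homogeneous left factor. With
  homogeneous relations, every term in the derivative of u r v contains r or the derivative of
  r.\<close>

lemma derivation_ideal:
  assumes "\<And>r. r \<in> S \<Longrightarrow> derivation e deg \<delta> r \<in> ideal_k S" "\<And>r. r \<in> S \<Longrightarrow> \<exists>p. r \<in> piece deg p"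
    and "x \<in> ideal_k S"
  shows "derivation e deg \<delta> x \<in> ideal_k S"
proof (rule ideal_k_mem[OF klin_derivation _ _ assms(3)])
  interpret tsideal "ideal_k S" by (rule tsideal_ideal_k)
  show "submod (ideal_k S)" by (rule sub)
  fix u v r assume r: "r \<in> S"
  then obtain p where p: "r \<in> piece deg p" using assms(2) by auto
  show "derivation e deg \<delta> (mon u * r * mon v) \<in> ideal_k S"
    unfolding derivation_mult[OF piece_mult[OF piece_mon' p]] derivation_mult[OF piece_mon'] distrib_right
    by (rule closed(1)[OF closed(1)[OF absorb3[OF ideal_k_base[OF r]]
          absorb_r[OF absorb_l[OF absorb_l[OF assms(1)[OF r]]]]] absorb_l[OF absorb3[OF ideal_k_base[OF r]]]])
qed

section \<open>Supercommutators\<close>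

lemma supercommutators_span:
  assumes "f \<in> piece deg p" "g \<in> piece deg q"
  shows "f * g - sg (p * q) * (g * f) \<in> span_k (supercommutators deg)"
proof (cases "p < 0 \<or> q < 0")
  case True
  then have "f = 0 \<or> g = 0" using assms piece_neg_deg by blast
  then show ?thesis using smul.subspace_0[OF span_k_submod] by auto
next
  case False
  have "f * g - (-1) ^ (nat p * nat q) * (g * f) \<in> supercommutators deg"
    unfolding supercommutators_def
    by (rule CollectI, rule exI[of _ f], rule exI[of _ g], rule exI[of _ "nat p"], rule exI[of _ "nat q"])
       (use assms False in auto)
  then show ?thesis
    using False by (simp add: power_sg span_k_base)
qed

lemma supercommutators_mem:
  assumes "klin F" "submod W"
    "\<And>u v. F (mon u * mon v - sg (int (sum_list (map deg u)) * int (sum_list (map deg v))) * (mon v * mon u)) \<in> W"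
    and "x \<in> supercommutators deg"
  shows "F x \<in> W"
proof -
  from assms(4) obtain f g p q where x: "x = f * g - (-1) ^ (p * q) * (g * f)"
    and f: "f \<in> piece deg (int p)" and g: "g \<in> piece deg (int q)"
    by (auto simp: supercommutators_def)
  have "F (f * g - sg (int p * int q) * (g * f)) \<in> W"
  proof (rule piece_mem[OF f, of "\<lambda>f. F (f * g - sg (int p * int q) * (g * f))"])
    fix u assume u: "int (sum_list (map deg u)) = int p"
    show "F (mon u * g - sg (int p * int q) * (g * mon u)) \<in> W"
      by (rule piece_mem[OF g, of "\<lambda>g. F (mon u * g - sg (int p * int q) * (g * mon u))"])
         (use assms(3)[of u] u in \<open>auto intro!: klin_comp[OF assms(1)] klin_intros assms(2)\<close>)
  qed (auto intro!: klin_comp[OF assms(1)] klin_intros assms(2))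
  then show ?thesis by (simp add: x power_sg)
qed

text \<open>A derivation D sends [u, v] to [Du, v] plus or minus [u, Dv]. Both terms are
  supercommutators with the right signs because the parity \<open>e\<close> in the Leibniz rule is
  that of the degree shift \<open>s\<close>.\<close>

lemma derivation_supercommutators:
  assumes "\<And>l. \<delta> l \<in> piece deg (int (deg l) + s)" "even s \<longleftrightarrow> even e" "x \<in> supercommutators deg"
  shows "derivation e deg \<delta> x \<in> span_k (supercommutators deg)"
proof (rule supercommutators_mem[OF klin_derivation span_k_submod _ assms(3)])
  fix u v
  let ?D = "derivation e deg \<delta>"
  define p q where "p = int (sum_list (map deg u))" "q = int (sum_list (map deg v))"
  have u: "mon u \<in> piece deg p" and v: "mon v \<in> piece deg q" by (auto simp: p_q_def)
  note Du = derivation_piece[where deg=deg and e=e, OF assms(1) u] and Dv = derivation_piece[where deg=deg and e=e, OF assms(1) v]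
  have "?D (mon u * mon v - sg (p * q) * (mon v * mon u)) =
    (?D (mon u) * mon v - sg ((p + s) * q) * (mon v * ?D (mon u)))
    + sg (int e * p) * (mon u * ?D (mon v) - sg (p * (q + s)) * (?D (mon v) * mon u))"
    using assms(2)
    by (cases "even p"; cases "even q"; cases "even e")
       (auto simp: sg_def derivation_mult[OF u] derivation_mult[OF v] klin_diff[OF klin_derivation]
         klin_add[OF klin_derivation] algebra_simps)
  moreover have "sg n * x \<in> span_k S" if "x \<in> span_k S" for n :: int and x :: "('a, 'b) falg" and S
    using that by (auto simp: sg_def smul.subspace_neg)
  ultimately show "?D (mon u * mon v - sg (int (sum_list (map deg u)) * int (sum_list (map deg v))) * (mon v * mon u))
      \<in> span_k (supercommutators deg)"
    unfolding p_q_def[symmetric]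
    by (auto intro!: smul.subspace_add supercommutators_span Du Dv u v)
qed

declare One_nat_def [simp del]

text \<open>The square of an odd superderivation is an unsigned derivation, so its vanishing on
  letters suffices.\<close>

lemma derivation_sq:
  assumes "\<And>l. \<delta> l \<in> piece deg (int (deg l) + s)" "odd s" "\<And>l. derivation 1 deg \<delta> (\<delta> l) = 0"
  shows "derivation 1 deg \<delta> (derivation 1 deg \<delta> f) = 0"
proof (rule falg_eqI[of "\<lambda>f. derivation 1 deg \<delta> (derivation 1 deg \<delta> f)" "\<lambda>_. 0"])
  fix w
  let ?D = "derivation 1 deg \<delta>"
  show "?D (?D (mon w)) = 0"
  proof (induction w)
    case (Cons l w)
    have l: "gen l \<in> piece deg (int (deg l))" by (simp add: piece_mon)
    have "?D (mon (l # w)) = \<delta> l * mon w + sg (int (deg l)) * (gen l * ?D (mon w))"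
      using derivation_mult[OF l, of 1 \<delta> "mon w"] by (simp flip: mon_Cons)
    then have "?D (?D (mon (l # w))) = ?D (\<delta> l * mon w) + ?D (sg (int (deg l)) * (gen l * ?D (mon w)))"
      by (simp add: klin_add[OF klin_derivation])
    also have "?D (\<delta> l * mon w) = sg (int (deg l) + s) * (\<delta> l * ?D (mon w))"
      using derivation_mult[OF assms(1)[of l], of 1 \<delta> "mon w"] by (simp add: assms(3))
    also have "?D (sg (int (deg l)) * (gen l * ?D (mon w))) = sg (int (deg l)) * (\<delta> l * ?D (mon w))"
      using derivation_mult[OF l, of 1 \<delta> "?D (mon w)"] Cons
      by (auto simp: sg_def klin_neg[OF klin_derivation])
    finally show ?case using assms(2) by (auto simp: sg_def)
  qed (simp add: klin_zero[OF klin_derivation])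
qed (auto intro!: klin_intros)

text \<open>The anticommutator of two odd superderivations is an unsigned derivation, hence equal to
  any derivation E that agrees with it on the letters.\<close>

lemma derivation_anticomm:
  assumes "\<And>l. \<delta> l \<in> piece deg (int (deg l) + s)" "odd s" "\<And>l. \<delta>' l \<in> piece deg (int (deg l) + s')" "odd s'"
    and "klin E" "E 1 = 0" "\<And>f g. E (f * g) = E f * g + f * E g"
    and "\<And>l. derivation 1 deg \<delta> (\<delta>' l) + derivation 1 deg \<delta>' (\<delta> l) = E (gen l)"
  shows "derivation 1 deg \<delta> (derivation 1 deg \<delta>' f) + derivation 1 deg \<delta>' (derivation 1 deg \<delta> f) = E f"
proof (rule falg_eqI[of "\<lambda>f. derivation 1 deg \<delta> (derivation 1 deg \<delta>' f) + derivation 1 deg \<delta>' (derivation 1 deg \<delta> f)"])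
  fix w
  let ?D = "derivation 1 deg \<delta>" and ?D' = "derivation 1 deg \<delta>'"
  show "?D (?D' (mon w)) + ?D' (?D (mon w)) = E (mon w)"
  proof (induction w)
    case (Cons l w)
    have l: "gen l \<in> piece deg (int (deg l))" by (simp add: piece_mon)
    have "?D (mon (l # w)) = \<delta> l * mon w + sg (int (deg l)) * (gen l * ?D (mon w))"
      using derivation_mult[OF l, of 1 \<delta> "mon w"] by (simp flip: mon_Cons)
    moreover have "?D' (mon (l # w)) = \<delta>' l * mon w + sg (int (deg l)) * (gen l * ?D' (mon w))"
      using derivation_mult[OF l, of 1 \<delta>' "mon w"] by (simp flip: mon_Cons)
    moreover have "?D' (\<delta> l * mon w) = ?D' (\<delta> l) * mon w + sg (int (deg l) + s) * (\<delta> l * ?D' (mon w))"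
      using derivation_mult[OF assms(1)[of l], of 1 \<delta>' "mon w"] by simp
    moreover have "?D (\<delta>' l * mon w) = ?D (\<delta>' l) * mon w + sg (int (deg l) + s') * (\<delta>' l * ?D (mon w))"
      using derivation_mult[OF assms(3)[of l], of 1 \<delta> "mon w"] by simp
    moreover have "?D' (sg (int (deg l)) * (gen l * ?D (mon w)))
        = sg (int (deg l)) * (\<delta>' l * ?D (mon w)) + gen l * ?D' (?D (mon w))"
      using derivation_mult[OF l, of 1 \<delta>' "?D (mon w)"]
      by (auto simp: sg_def klin_neg[OF klin_derivation])
    moreover have "?D (sg (int (deg l)) * (gen l * ?D' (mon w)))
        = sg (int (deg l)) * (\<delta> l * ?D' (mon w)) + gen l * ?D (?D' (mon w))"
      using derivation_mult[OF l, of 1 \<delta> "?D' (mon w)"]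
      by (auto simp: sg_def klin_neg[OF klin_derivation])
    ultimately have "?D (?D' (mon (l # w))) + ?D' (?D (mon (l # w)))
      = (?D (\<delta>' l) + ?D' (\<delta> l)) * mon w + gen l * (?D (?D' (mon w)) + ?D' (?D (mon w)))"
      using assms(2,4) by (auto simp: sg_def klin_add[OF klin_derivation] algebra_simps)
    also have "\<dots> = E (mon (l # w))"
      by (simp only: assms(8) Cons assms(7)[symmetric] flip: mon_Cons)
    finally show ?case .
  qed (simp add: assms(6) klin_zero[OF klin_derivation])
qed (auto intro!: klin_intros assms(5))

section \<open>Calculus modulo the relations between forms\<close>

text \<open>One calculus serves three ideals: for noncommutative forms, for extended forms, and for
  Kaehler forms with polynomial coefficients on the representation scheme. In the last case
  \<open>J\<close> is the ideal of relations between the coordinate functions.\<close>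

locale form_calculus = tsideal W for W :: "('g word \<Rightarrow>\<^sub>0 'k::comm_ring_1) set" +
  fixes sc :: "'k \<Rightarrow> 'a::ring_1 \<Rightarrow> 'a" and J :: "'a set" and e :: "'a form \<Rightarrow> 'g"
  assumes relations: "form_relations sc J e \<subseteq> W" and alg: "k_algebra sc"
begin

abbreviation "el a \<equiv> gen (e (El a)) :: ('g, 'k) falg"
abbreviation "df a \<equiv> gen (e (Df a)) :: ('g, 'k) falg"

lemma rel: "r \<in> form_relations sc J e \<Longrightarrow> r \<in> W" using relations by auto

lemma el_add: "el (a + b) \<simeq>[W] el a + el b"
  unfolding eqv_def by (rule rel) (auto simp: form_relations_def)
lemma el_sc: "el (sc c a) \<simeq>[W] smul c (el a)"
  unfolding eqv_def by (rule rel) (auto simp: form_relations_def)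
lemma el_mult: "el (a * b) \<simeq>[W] el a * el b"
  unfolding eqv_def by (rule rel) (auto simp: form_relations_def)
lemma el_one: "el 1 \<simeq>[W] 1"
  unfolding eqv_def by (rule rel) (auto simp: form_relations_def)
lemma el_J: "a \<in> J \<Longrightarrow> el a \<simeq>[W] 0"
  unfolding eqv_def by (rule rel) (auto simp: form_relations_def)
lemma df_add: "df (a + b) \<simeq>[W] df a + df b"
  unfolding eqv_def by (rule rel) (auto simp: form_relations_def)
lemma df_sc: "df (sc c a) \<simeq>[W] smul c (df a)"
  unfolding eqv_def by (rule rel) (auto simp: form_relations_def)
lemma df_scalar: "df (sc c 1) \<simeq>[W] 0"
  unfolding eqv_def by (rule rel) (auto simp: form_relations_def)
lemma df_J: "a \<in> J \<Longrightarrow> df a \<simeq>[W] 0"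
  unfolding eqv_def by (rule rel) (auto simp: form_relations_def)
lemma df_mult: "df (a * b) \<simeq>[W] df a * el b + el a * df b"
  unfolding eqv_def by (rule rel) (auto simp: form_relations_def)

lemma sc_mod: "module sc" using alg by (simp add: k_algebra_def)
lemma sc_one [simp]: "sc 1 a = a" using sc_mod by (simp add: module_def)
lemma sc_left: "sc c a * b = sc c (a * b)" using alg by (simp add: k_algebra_def)
lemma sc_right: "a * sc c b = sc c (a * b)" using alg unfolding k_algebra_def by metis
lemma df_one: "df 1 \<simeq>[W] 0" using df_scalar[of 1] by simp
lemma el_scalar: "el (sc c 1) \<simeq>[W] smul c 1"
  using trans[OF el_sc scale[OF el_one]] .

lemma additive_diff:
  fixes F :: "'a \<Rightarrow> ('g, 'k) falg"
  assumes "\<And>a b. F (a + b) \<simeq>[W] F a + F b"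
  shows "F (a - b) \<simeq>[W] F a - F b"
  using sym[OF diff[OF assms[of "a - b" b] refl[of "F b"]]] by simp

lemmas el_diff = additive_diff[of "\<lambda>a. el a", OF el_add]
lemmas df_diff = additive_diff[of "\<lambda>a. df a", OF df_add]

lemma el_0: "el 0 \<simeq>[W] 0" using el_diff[of 0 0] by simp
lemma df_0: "df 0 \<simeq>[W] 0" using df_diff[of 0 0] by simp

lemma additive_sum:
  fixes F :: "'a \<Rightarrow> ('g, 'k) falg"
  assumes "\<And>a b. F (a + b) \<simeq>[W] F a + F b" "F 0 \<simeq>[W] 0"
  shows "F (sum g A) \<simeq>[W] (\<Sum>i\<in>A. F (g i))"
proof (induction A rule: infinite_finite_induct)
  case (insert x A)
  then show ?case using trans[OF assms(1) add[OF refl insert.IH]] by simp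
qed (use assms(2) in auto)

lemmas el_sum = additive_sum[of "\<lambda>a. el a", OF el_add el_0]
lemmas df_sum = additive_sum[of "\<lambda>a. df a", OF df_add df_0]

end

lemma form_relations_cases [consumes 1]:
  assumes "r \<in> form_relations sc J e"
  obtains a b where "r = gen (e (El (a + b))) - (gen (e (El a)) + gen (e (El b)))"
    | c a where "r = gen (e (El (sc c a))) - smul c (gen (e (El a)))"
    | a b where "r = gen (e (El (a * b))) - gen (e (El a)) * gen (e (El b))"
    | "r = gen (e (El 1)) - 1"
    | a where "a \<in> J" "r = gen (e (El a))"
    | a b where "r = gen (e (Df (a + b))) - (gen (e (Df a)) + gen (e (Df b)))"
    | c a where "r = gen (e (Df (sc c a))) - smul c (gen (e (Df a)))"
    | c where "r = gen (e (Df (sc c 1)))"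
    | a where "a \<in> J" "r = gen (e (Df a))"
    | a b where "r = gen (e (Df (a * b))) - (gen (e (Df a)) * gen (e (El b)) + gen (e (El a)) * gen (e (Df b)))"
  using assms unfolding form_relations_def Let_def Un_iff mem_Collect_eq by auto

lemma form_relations_piece:
  fixes deg :: "'g \<Rightarrow> nat"
  assumes "r \<in> form_relations sc J e" "\<And>l. deg (e l) = c * fdeg l"
  shows "\<exists>p. r \<in> piece deg p"
proof -
  have el: "gen (e (El a)) \<in> piece deg 0" and df: "gen (e (Df a)) \<in> piece deg (int c)" for a
    by (auto simp: piece_mon assms(2))
  note m = piece_mult'[OF el el, of 0] piece_mult'[OF df el, of "int c"] piece_mult'[OF el df, of "int c"]
  have "r \<in> piece deg 0 \<or> r \<in> piece deg (int c)"
    using assms(1)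
    by (cases rule: form_relations_cases)
       (simp_all only: el df m piece_add piece_diff piece_smul piece_one simp_thms)
  then show ?thesis by auto
qed

text \<open>Each relation between elements a differentiates to the matching relation between symbols
  da. The Leibniz relation goes to zero because its two terms da db cancel.\<close>

lemma d_relations:
  assumes "r \<in> form_relations sc {} e" "k_algebra sc" "\<And>l. deg (e l) = fdeg l"
    "\<And>a. \<delta> (e (El a)) = gen (e (Df a))" "\<And>a. \<delta> (e (Df a)) = 0"
  shows "derivation 1 deg \<delta> r \<in> ideal_k (form_relations sc {} e)"
proof -
  interpret tsideal "ideal_k (form_relations sc {} e)" by (rule tsideal_ideal_k)
  interpret form_calculus "ideal_k (form_relations sc {} e)" sc "{}" e
    by unfold_locales (auto intro: ideal_k_base assms)
  have el: "el a \<in> piece deg 0" and df: "df a \<in> piece deg 1" for a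
    by (auto simp: piece_mon assms)
  let ?D = "derivation 1 deg \<delta>"
  note [simp] = assms(4,5)
  have D [simp]: "?D (el a * g) = df a * g + el a * ?D g" "?D (df a * g) = - (df a * ?D g)" for a g
    using derivation_mult[OF el, of 1 \<delta> a g] derivation_mult[OF df, of 1 \<delta> a g] by simp_all
  note [simp] = klin_add[OF klin_derivation] klin_diff[OF klin_derivation] klin_smul[OF klin_derivation]
  show ?thesis
    using assms(1)
  proof (cases rule: form_relations_cases)
    case (1 a b) then show ?thesis using df_add[of a b] by (simp add: eqv_def)
  next
    case (2 c a) then show ?thesis using df_sc[of c a] by (simp add: eqv_def)
  next
    case (3 a b) then show ?thesis using df_mult[of a b] by (simp add: eqv_def)
  next
    case 4 then show ?thesis using df_one by (simp add: eqv_def)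
  qed (simp_all add: closed(5))
qed

section \<open>Normal forms\<close>

lemma lin_lin: "lin \<phi> (lin \<psi> p) = lin (\<lambda>x. lin \<phi> (\<psi> x)) p"
  by (rule klin_eqI[of "\<lambda>p. lin \<phi> (lin \<psi> p)" "lin (\<lambda>x. lin \<phi> (\<psi> x))"])
     (auto intro!: klin_intros klin_lin simp: klin_smul[OF klin_lin])

lemma lin_mem: "submod W \<Longrightarrow> (\<And>x. x \<in> Poly_Mapping.keys p \<Longrightarrow> \<phi> x \<in> W) \<Longrightarrow> lin \<phi> p \<in> W"
  by (rule klin_mem[OF klin_lin]) auto

lemma lin_minus: "lin (\<lambda>x. \<phi> x - \<psi> x) p = lin \<phi> p - lin \<psi> p"
  by (simp add: lin_def smul.scale_right_diff_distrib sum_subtractf)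

lemma lin_plus: "lin (\<lambda>x. \<phi> x + \<psi> x) p = lin \<phi> p + lin \<psi> p"
  by (simp add: lin_def smul.scale_right_distrib sum.distrib)

lemma klin_lin_fun: "klin L \<Longrightarrow> lin (\<lambda>x. L (\<phi> x)) p = L (lin \<phi> p)"
  by (simp add: lin_def klin_sum klin_smul)

text \<open>Left multiplication by a letter, transposed to formulas: evaluating
  \<open>\<phi>\<close> on l f amounts to evaluating \<open>shift l \<phi>\<close> on f. The second
  case is da a_0 = d(a a_0) - a da_0.\<close>

definition shift :: "'a::ring_1 form \<Rightarrow> ('a \<Rightarrow> 'a list \<Rightarrow> 'y \<Rightarrow>\<^sub>0 'k::comm_ring_1) \<Rightarrow> 'a \<Rightarrow> 'a list \<Rightarrow> 'y \<Rightarrow>\<^sub>0 'k" where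
  "shift l \<phi> a0 as = (case l of El a \<Rightarrow> \<phi> (a * a0) as | Df a \<Rightarrow> \<phi> 1 ((a * a0) # as) - \<phi> a (a0 # as))"

lemma klin_on_normal: "klin (on_normal \<phi>)"
  unfolding on_normal_def by (rule klin_lin)

lemma klin_on_normal' [klin_intros]: "klin g \<Longrightarrow> klin (\<lambda>x. on_normal \<phi> (g x))"
  by (rule klin_comp[OF klin_on_normal])

lemma on_normal_mon: "on_normal \<phi> (mon w) = lin (\<lambda>(a0, as). \<phi> a0 as) (normal_word w)"
  by (simp add: on_normal_def mon_def)

lemma on_normal_one [simp]: "on_normal \<phi> 1 = \<phi> 1 []"
  using on_normal_mon[of \<phi> "[]"] by simp

lemma on_normal_gen: "on_normal \<phi> (gen l * f) = on_normal (shift l \<phi>) f"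
proof (rule falg_eqI[of "\<lambda>f. on_normal \<phi> (gen l * f)" "on_normal (shift l \<phi>)"])
  fix w
  show "on_normal \<phi> (gen l * mon w) = on_normal (shift l \<phi>) (mon w)"
    unfolding mon_Cons[symmetric] on_normal_mon normal_word.simps lin_lin
    by (rule arg_cong[of _ _ "\<lambda>h. lin h _"])
       (auto simp: fun_eq_iff shift_def klin_diff[OF klin_lin] split: form.splits)
qed (auto intro!: klin_intros klin_on_normal)

lemma on_normal_minus: "on_normal (\<lambda>a0 as. \<phi> a0 as - \<psi> a0 as) f = on_normal \<phi> f - on_normal \<psi> f"
  by (simp add: on_normal_def lin_minus case_prod_unfold)

lemma on_normal_plus: "on_normal (\<lambda>a0 as. \<phi> a0 as + \<psi> a0 as) f = on_normal \<phi> f + on_normal \<psi> f"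
  by (simp add: on_normal_def lin_plus case_prod_unfold)

lemma on_normal_klin: "klin L \<Longrightarrow> on_normal (\<lambda>a0 as. L (\<phi> a0 as)) f = L (on_normal \<phi> f)"
  by (simp add: on_normal_def case_prod_unfold klin_lin_fun[of L "\<lambda>x. \<phi> (fst x) (snd x)"]
      klin_lin_fun[of L "\<lambda>w. lin (\<lambda>p. \<phi> (fst p) (snd p)) (normal_word (letters w))"])

lemma submod_keys: "submod {p. \<forall>x\<in>Poly_Mapping.keys p. P x}"
  by (rule smul.subspaceI)
     (auto simp: in_keys_iff lookup_add dest!: subsetD[OF Poly_Mapping.keys_add])

lemma normal_word_length:
  "\<forall>x\<in>Poly_Mapping.keys (normal_word w :: ('a::ring_1 \<times> 'a list) \<Rightarrow>\<^sub>0 'k::comm_ring_1).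
     length (snd x) = sum_list (map fdeg w)"
proof (induction w)
  case (Cons l w)
  let ?M = "{p :: ('a \<times> 'a list) \<Rightarrow>\<^sub>0 'k. \<forall>x\<in>Poly_Mapping.keys p. length (snd x) = sum_list (map fdeg (l # w))}"
  have sub: "submod ?M" by (rule submod_keys)
  have s: "Poly_Mapping.single (b, bs) 1 \<in> ?M" if "length bs = sum_list (map fdeg (l # w))" for b bs
    using that by simp
  have "normal_word (l # w) \<in> ?M" unfolding normal_word.simps
  proof (rule lin_mem[OF sub])
    fix x assume "x \<in> Poly_Mapping.keys (normal_word w :: ('a \<times> 'a list) \<Rightarrow>\<^sub>0 'k)"
    with Cons have len: "length (snd x) = sum_list (map fdeg w)" by blast
    show "(case x of (a0, as) \<Rightarrow> (case l of El a \<Rightarrow> Poly_Mapping.single (a * a0, as) 1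
         | Df a \<Rightarrow> Poly_Mapping.single (1, (a * a0) # as) 1 - Poly_Mapping.single (a, a0 # as) 1)) \<in> ?M"
    proof (cases l)
      case (El a)
      show ?thesis unfolding El case_prod_unfold form.case by (rule s[unfolded El]) (simp add: len)
    next
      case (Df a)
      show ?thesis unfolding Df case_prod_unfold form.case
        by (rule smul.subspace_diff[OF sub[unfolded Df] s[unfolded Df] s[unfolded Df]]) (simp_all add: len)
    qed
  qed
  then show ?case by blast
qed simp

lemma on_normal_mem:
  fixes \<phi> :: "'a::ring_1 \<Rightarrow> 'a list \<Rightarrow> 'y \<Rightarrow>\<^sub>0 'k::comm_ring_1"
  assumes "f \<in> piece fdeg p" "submod W" "\<And>a0 as. int (length as) = p \<Longrightarrow> \<phi> a0 as \<in> W"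
  shows "on_normal \<phi> f \<in> W"
proof (rule piece_mem[OF assms(1) klin_on_normal assms(2)])
  fix w :: "'a form list" assume "int (sum_list (map fdeg w)) = p"
  then show "on_normal \<phi> (mon w) \<in> W"
    using assms(3) normal_word_length[of w, where 'k='k]
    unfolding on_normal_mon by (intro lin_mem[OF assms(2)]) (simp add: case_prod_unfold)
qed

lemma on_normal_cong:
  assumes "f \<in> piece fdeg p" "submod W" "\<And>a0 as. int (length as) = p \<Longrightarrow> \<phi> a0 as \<simeq>[W] \<psi> a0 as"
  shows "on_normal \<phi> f \<simeq>[W] on_normal \<psi> f"
  unfolding eqv_def on_normal_minus[symmetric]
  by (rule on_normal_mem[OF assms(1,2)]) (use assms(3) in \<open>simp add: eqv_def\<close>)

lemma on_normal_mem':
  assumes "submod W" "\<And>a0 as. \<phi> a0 as \<in> W"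
  shows "on_normal \<phi> f \<in> W"
proof (rule falg_mem[OF klin_on_normal assms(1)])
  fix w show "on_normal \<phi> (mon w) \<in> W"
    unfolding on_normal_mon by (rule lin_mem[OF assms(1)]) (simp add: case_prod_unfold assms(2))
qed

lemma on_normal_cong':
  assumes "submod W" "\<And>a0 as. \<phi> a0 as \<simeq>[W] \<psi> a0 as"
  shows "on_normal \<phi> f \<simeq>[W] on_normal \<psi> f"
  unfolding eqv_def on_normal_minus[symmetric]
  by (rule on_normal_mem'[OF assms(1)]) (use assms(2) in \<open>simp add: eqv_def\<close>)

section \<open>Formulas on normal forms that descend to classes of forms\<close>

locale k_alg =
  fixes sc :: "'k::comm_ring_1 \<Rightarrow> 'a::ring_1 \<Rightarrow> 'a"
  assumes alg: "k_algebra sc"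
begin

sublocale F: form_calculus "forms_ideal sc" sc "{}" "\<lambda>l. l"
proof -
  interpret tsideal "forms_ideal sc" unfolding forms_ideal_def by (rule tsideal_ideal_k)
  show "form_calculus (forms_ideal sc) sc {} (\<lambda>l. l)"
    by unfold_locales (auto simp: forms_ideal_def intro: ideal_k_base alg)
qed

abbreviation "FI \<equiv> forms_ideal sc"

text \<open>The formulas on normal forms \<open>a\<^sub>0 da\<^sub>1 \<dots> da\<^sub>n\<close> that define a linear map on forms modulo \<open>W\<close>.\<close>

definition admissible :: "('y \<Rightarrow>\<^sub>0 'k) set \<Rightarrow> ('a \<Rightarrow> 'a list \<Rightarrow> 'y \<Rightarrow>\<^sub>0 'k) \<Rightarrow> bool" where
  "admissible W \<phi> \<longleftrightarrow>
     (\<forall>a b as. \<phi> (a + b) as \<simeq>[W] \<phi> a as + \<phi> b as) \<and>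
     (\<forall>c a as. \<phi> (sc c a) as \<simeq>[W] smul c (\<phi> a as)) \<and>
     (\<forall>a0 xs a b ys. \<phi> a0 (xs @ (a + b) # ys) \<simeq>[W] \<phi> a0 (xs @ a # ys) + \<phi> a0 (xs @ b # ys)) \<and>
     (\<forall>a0 xs c a ys. \<phi> a0 (xs @ sc c a # ys) \<simeq>[W] smul c (\<phi> a0 (xs @ a # ys))) \<and>
     (\<forall>a0 xs ys. \<phi> a0 (xs @ 1 # ys) \<simeq>[W] 0)"

lemma admissibleI:
  assumes "\<And>a b as. \<phi> (a + b) as \<simeq>[W] \<phi> a as + \<phi> b as"
    "\<And>c a as. \<phi> (sc c a) as \<simeq>[W] smul c (\<phi> a as)"
    "\<And>a0 xs a b ys. \<phi> a0 (xs @ (a + b) # ys) \<simeq>[W] \<phi> a0 (xs @ a # ys) + \<phi> a0 (xs @ b # ys)"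
    "\<And>a0 xs c a ys. \<phi> a0 (xs @ sc c a # ys) \<simeq>[W] smul c (\<phi> a0 (xs @ a # ys))"
    "\<And>a0 xs ys. \<phi> a0 (xs @ 1 # ys) \<simeq>[W] 0"
  shows "admissible W \<phi>"
  unfolding admissible_def by (intro conjI allI assms)

lemma admissibleD:
  assumes "admissible W \<phi>"
  shows "\<phi> (a + b) as \<simeq>[W] \<phi> a as + \<phi> b as"
    "\<phi> (sc c a) as \<simeq>[W] smul c (\<phi> a as)"
    "\<phi> a0 (xs @ (a + b) # ys) \<simeq>[W] \<phi> a0 (xs @ a # ys) + \<phi> a0 (xs @ b # ys)"
    "\<phi> a0 (xs @ sc c a # ys) \<simeq>[W] smul c (\<phi> a0 (xs @ a # ys))"
    "\<phi> a0 (xs @ 1 # ys) \<simeq>[W] 0"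
    "\<phi> a0 ((a + b) # ys) \<simeq>[W] \<phi> a0 (a # ys) + \<phi> a0 (b # ys)"
    "\<phi> a0 (sc c a # ys) \<simeq>[W] smul c (\<phi> a0 (a # ys))"
    "\<phi> a0 (1 # ys) \<simeq>[W] 0"
proof -
  show A: "\<phi> (a + b) as \<simeq>[W] \<phi> a as + \<phi> b as" "\<phi> (sc c a) as \<simeq>[W] smul c (\<phi> a as)"
    "\<phi> a0 (xs @ (a + b) # ys) \<simeq>[W] \<phi> a0 (xs @ a # ys) + \<phi> a0 (xs @ b # ys)"
    "\<phi> a0 (xs @ sc c a # ys) \<simeq>[W] smul c (\<phi> a0 (xs @ a # ys))"
    "\<phi> a0 (xs @ 1 # ys) \<simeq>[W] 0" for a b c a0 as xs ys
    using assms by (simp_all add: admissible_def)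
  show "\<phi> a0 ((a + b) # ys) \<simeq>[W] \<phi> a0 (a # ys) + \<phi> a0 (b # ys)"
    "\<phi> a0 (sc c a # ys) \<simeq>[W] smul c (\<phi> a0 (a # ys))"
    "\<phi> a0 (1 # ys) \<simeq>[W] 0"
    using A(3)[of a0 "[]"] A(4)[of a0 "[]"] A(5)[of a0 "[]"] by simp_all
qed

text \<open>Left multiplication by da moves a_0 among the differentials, so the conditions on the
  entry a_0 of the new formula come from those on the first differential in
  \<open>\<phi>\<close>.\<close>

lemma admissible_shift:
  assumes "submod W" "admissible W \<phi>"
  shows "admissible W (shift l \<phi>)"
proof (cases l)
  case (El a)
  interpret W: submodule W by unfold_locales (rule assms)
  note D = admissibleD[OF assms(2)]
  show ?thesis
    by (rule admissibleI) (simp_all add: El shift_def distrib_left F.sc_right D)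
next
  case (Df a)
  interpret W: submodule W by unfold_locales (rule assms)
  note D = admissibleD[OF assms(2)]
  note D' = D(3)[of _ "_ # _", simplified] D(4)[of _ "_ # _", simplified] D(5)[of _ "_ # _", simplified]
  have eq: "(x + x') - (y + y') = (x - y) + (x' - y')" for x x' y y' :: "'b \<Rightarrow>\<^sub>0 'k" by simp
  show ?thesis
  proof (rule admissibleI)
    fix b c as show "shift l \<phi> (b + c) as \<simeq>[W] shift l \<phi> b as + shift l \<phi> c as"
      using W.diff[OF D(6) D(6)] by (simp add: Df shift_def distrib_left flip: eq)
  next
    fix c b as show "shift l \<phi> (sc c b) as \<simeq>[W] smul c (shift l \<phi> b as)"
      using W.diff[OF D(7) D(7)] by (simp add: Df shift_def F.sc_right smul.scale_right_diff_distrib)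
  next
    fix a0 xs b c ys
    show "shift l \<phi> a0 (xs @ (b + c) # ys) \<simeq>[W] shift l \<phi> a0 (xs @ b # ys) + shift l \<phi> a0 (xs @ c # ys)"
      using W.diff[OF D'(1) D'(1)] by (simp add: Df shift_def flip: eq)
  next
    fix a0 xs b c ys
    show "shift l \<phi> a0 (xs @ sc c b # ys) \<simeq>[W] smul c (shift l \<phi> a0 (xs @ b # ys))"
      using W.diff[OF D'(2) D'(2)] by (simp add: Df shift_def smul.scale_right_diff_distrib)
  next
    fix a0 xs ys
    show "shift l \<phi> a0 (xs @ 1 # ys) \<simeq>[W] 0"
      using W.diff[OF D'(3) D'(3)] by (simp add: Df shift_def)
  qed
qed

text \<open>The multiplicative relations hold exactly, since the reduction to normal form is built
  on associativity and the Leibniz rule. Admissibility is used for the relations that express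
  linearity and d1 = 0.\<close>

lemma on_normal_relation:
  assumes "submod W" "admissible W \<phi>" "r \<in> form_relations sc {} (\<lambda>l. l)"
  shows "on_normal \<phi> (r * f) \<in> W"
proof -
  interpret W: submodule W by unfold_locales (rule assms)
  note D = admissibleD[OF assms(2)]
  note [simp] = left_diff_distrib distrib_right klin_diff[OF klin_on_normal] klin_add[OF klin_on_normal]
    klin_smul[OF klin_on_normal] smul_mult_left on_normal_gen mult.assoc
  have 0: "on_normal \<psi> f \<in> W" if "\<And>a0 as. \<psi> a0 as \<in> W" for \<psi>
    by (rule on_normal_mem'[OF assms(1) that])
  note m = on_normal_minus[symmetric] on_normal_plus[symmetric] on_normal_klin[OF klin_scale[OF klin_id], symmetric]
  have [simp]: "1 * x = x" for x :: 'a by simp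
  show ?thesis using assms(3)
  proof (cases rule: form_relations_cases)
    case (1 a b)
    then show ?thesis
      using D(1) by (simp add: m) (rule 0, simp add: shift_def distrib_right eqv_def)
  next
    case (2 c a)
    then show ?thesis
      using D(2) by (simp add: m) (rule 0, simp add: shift_def F.sc_left eqv_def)
  next
    case (3 a b)
    then show ?thesis
      by (simp add: m) (rule 0, simp add: shift_def mult.assoc W.closed(5))
  next
    case 4
    then show ?thesis
      by (simp add: m) (rule 0, simp add: shift_def W.closed(5))
  next
    case (6 a b)
    have "shift (Df (a + b)) \<phi> a0 as \<simeq>[W] shift (Df a) \<phi> a0 as + shift (Df b) \<phi> a0 as" for a0 as
      using W.diff[OF D(6)[of 1 "a * a0" "b * a0" as] D(1)[of a b "a0 # as"]]
      by (simp add: shift_def distrib_right algebra_simps)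
    then show ?thesis unfolding 6
      by (simp add: m) (rule 0, simp add: eqv_def)
  next
    case (7 c a)
    have "shift (Df (sc c a)) \<phi> a0 as \<simeq>[W] smul c (shift (Df a) \<phi> a0 as)" for a0 as
      using W.diff[OF D(7)[of 1 c "a * a0" as] D(2)[of c a "a0 # as"]]
      by (simp add: shift_def F.sc_left smul.scale_right_diff_distrib)
    then show ?thesis unfolding 7
      by (simp add: m) (rule 0, simp add: eqv_def)
  next
    case (8 c)
    have "shift (Df (sc c 1)) \<phi> a0 as \<simeq>[W] 0" for a0 as
      using W.diff[OF D(7)[of 1 c "a0" as] D(2)[of c 1 "a0 # as"]]
      by (simp add: shift_def F.sc_left)
    then show ?thesis unfolding 8
      by (simp add: m) (rule 0, simp add: eqv_def)
  next
    case (10 a b)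
    then show ?thesis
      by (simp add: m) (rule 0, simp add: shift_def mult.assoc W.closed(5))
  qed auto
qed

text \<open>The letters to the left of a relation are absorbed into the formula one at a time, so
  the induction generalizes over \<open>\<phi>\<close>; the word on the right remains an
  argument.\<close>

lemma on_normal_ideal:
  assumes "submod W" "admissible W \<phi>" "f \<in> FI"
  shows "on_normal \<phi> f \<in> W"
proof (rule ideal_k_mem[OF klin_on_normal assms(1) _ assms(3)[unfolded forms_ideal_def]])
  fix u v r assume r: "r \<in> form_relations sc {} (\<lambda>l. l)"
  show "on_normal \<phi> (mon u * r * mon v) \<in> W"
    using assms(2)
  proof (induction u arbitrary: \<phi>)
    case Nil
    then show ?case using on_normal_relation[OF assms(1) _ r] by simp
  next
    case (Cons l u)
    have "on_normal \<phi> (mon (l # u) * r * mon v) = on_normal (shift l \<phi>) (mon u * r * mon v)"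
      by (simp add: mon_Cons[of l u] mult.assoc on_normal_gen)
    then show ?case using Cons admissible_shift[OF assms(1)] by simp
  qed
qed

text \<open>A product of differentials is not literally its own normal form: the reduction also
  produces terms with d1, and an admissible formula kills them.\<close>

lemma on_normal_std_form:
  assumes "submod W" "admissible W \<phi>"
  shows "on_normal \<phi> (std_form a0 as) \<simeq>[W] \<phi> a0 as"
proof -
  interpret W: submodule W by unfold_locales (rule assms)
  have *: "on_normal \<phi> (mon (map Df as)) \<simeq>[W] \<phi> 1 as" if "admissible W \<phi>" for \<phi> using that
  proof (induction as arbitrary: \<phi>)
    case (Cons a as)
    have "on_normal \<phi> (mon (map Df (a # as))) = on_normal (shift (Df a) \<phi>) (mon (map Df as))"
      unfolding list.map by (subst mon_Cons) (rule on_normal_gen)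
    also have "\<dots> \<simeq>[W] shift (Df a) \<phi> 1 as"
      by (rule Cons.IH) (rule admissible_shift[OF assms(1) Cons.prems])
    also have "\<dots> = \<phi> 1 (a # as) - \<phi> a (1 # as)" by (simp add: shift_def)
    also have "\<dots> \<simeq>[W] \<phi> 1 (a # as)"
      using W.diff[OF W.refl admissibleD(8)[OF Cons.prems]] by simp
    finally show ?case .
  qed simp
  have "on_normal \<phi> (std_form a0 as) = on_normal (shift (El a0) \<phi>) (mon (map Df as))"
    unfolding std_form_def by (subst mon_Cons) (rule on_normal_gen)
  also have "\<dots> \<simeq>[W] shift (El a0) \<phi> 1 as" by (rule *) (rule admissible_shift[OF assms])
  also have "\<dots> = \<phi> a0 as" by (simp add: shift_def)
  finally show ?thesis .
qed

lemma std_form_Cons: "std_form a0 as = F.el a0 * mon (map Df as)"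
  by (simp add: std_form_def flip: mon_Cons)

lemma admissible_std_form: "admissible FI std_form"
proof (rule admissibleI)
  fix a b :: 'a and as
  show "std_form (a + b) as \<simeq>[FI] std_form a as + std_form b as"
    using F.mult[OF F.el_add F.refl] by (simp add: std_form_Cons distrib_right)
next
  fix c and a :: 'a and as
  show "std_form (sc c a) as \<simeq>[FI] smul c (std_form a as)"
    using F.mult[OF F.el_sc F.refl] by (simp add: std_form_Cons smul_mult_left)
next
  have *: "std_form a0 (xs @ a # ys) = std_form a0 xs * F.df a * mon (map Df ys)" for a0 xs a ys
    by (simp add: std_form_def flip: mon_append)
  fix a0 xs and a b :: 'a and ys
  show "std_form a0 (xs @ (a + b) # ys) \<simeq>[FI] std_form a0 (xs @ a # ys) + std_form a0 (xs @ b # ys)"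
    unfolding * using F.mult[OF F.mult[OF F.refl F.df_add] F.refl]
    by (simp add: distrib_right distrib_left)
  fix c
  show "std_form a0 (xs @ sc c a # ys) \<simeq>[FI] smul c (std_form a0 (xs @ a # ys))"
    unfolding * using F.mult[OF F.mult[OF F.refl F.df_sc] F.refl]
    by (simp add: smul_mult_left smul_mult_right)
  show "std_form a0 (xs @ 1 # ys) \<simeq>[FI] 0"
    unfolding * using F.mult[OF F.mult[OF F.refl F.df_one] F.refl] by (simp add: distrib_right distrib_left)
qed

lemma normal_form: "on_normal std_form f \<simeq>[FI] f"
  unfolding eqv_def
proof (rule falg_mem[of "\<lambda>f. on_normal std_form f - f"])
  fix w
  have "on_normal std_form (mon w) \<simeq>[FI] mon w"
  proof (induction w)
    case Nil
    then show ?case using F.el_one by (simp add: std_form_def)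
  next
    case (Cons l w)
    have "on_normal std_form (mon (l # w)) = on_normal (shift l std_form) (mon w)"
      by (subst mon_Cons) (simp add: on_normal_gen)
    also have "\<dots> \<simeq>[FI] on_normal (\<lambda>a0 as. gen l * std_form a0 as) (mon w)"
    proof (rule on_normal_cong'[OF F.sub])
      fix a0 as
      show "shift l std_form a0 as \<simeq>[FI] gen l * std_form a0 as"
      proof (cases l)
        case (El a)
        then show ?thesis using F.mult[OF F.el_mult[of a a0] F.refl]
          by (simp add: shift_def std_form_Cons mult.assoc)
      next
        case (Df a)
        have *: "mon (Df b # map Df as) = F.df b * mon (map Df as)" for b :: 'a by (simp flip: mon_Cons)
        have "shift l std_form a0 as \<simeq>[FI]
          1 * ((F.df a * F.el a0 + F.el a * F.df a0) * mon (map Df as)) - F.el a * (F.df a0 * mon (map Df as))"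
          unfolding Df shift_def form.case std_form_Cons list.map *
          by (intro F.diff F.mult F.el_one F.df_mult F.refl)
        then show ?thesis by (simp add: Df std_form_Cons distrib_right mult.assoc)
      qed
    qed
    also have "\<dots> = gen l * on_normal std_form (mon w)"
      by (rule on_normal_klin) (intro klin_intros)
    also have "\<dots> \<simeq>[FI] gen l * mon w" by (rule F.mult[OF F.refl Cons])
    finally show ?case by (simp flip: mon_Cons)
  qed
  then show "on_normal std_form (mon w) - mon w \<in> FI" by (simp add: eqv_def)
qed (auto intro!: klin_intros F.sub)

lemma std_form_mem:
  assumes "f \<in> piece fdeg p" "klin L" "submod W" "\<And>x. x \<in> FI \<Longrightarrow> L x \<in> W"
    and "\<And>a0 as. int (length as) = p \<Longrightarrow> L (std_form a0 as) \<in> W"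
  shows "L f \<in> W"
proof -
  have "L (f - on_normal std_form f) \<in> W"
    by (rule assms(4)) (use F.sym[OF normal_form] in \<open>simp add: eqv_def\<close>)
  moreover have "L (on_normal std_form f) \<in> W"
    unfolding on_normal_klin[OF assms(2), symmetric]
    by (rule on_normal_mem[OF assms(1,3,5)])
  ultimately have "L (f - on_normal std_form f) + L (on_normal std_form f) \<in> W"
    by (rule smul.subspace_add[OF assms(3)])
  then show ?thesis by (simp add: klin_diff[OF assms(2)])
qed

lemma std_form_eqv:
  assumes "f \<in> piece fdeg p" "klin L" "klin L'" "submod W" "\<And>x. x \<in> FI \<Longrightarrow> L x \<in> W" "\<And>x. x \<in> FI \<Longrightarrow> L' x \<in> W"
    and "\<And>a0 as. int (length as) = p \<Longrightarrow> L (std_form a0 as) \<simeq>[W] L' (std_form a0 as)"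
  shows "L f \<simeq>[W] L' f"
  unfolding eqv_def
  by (rule std_form_mem[OF assms(1), of "\<lambda>f. L f - L' f"])
     (use assms in \<open>auto intro!: klin_intros smul.subspace_diff simp: eqv_def\<close>)

end

section \<open>The operators on noncommutative forms\<close>

definition b_formula :: "'a::ring_1 \<Rightarrow> 'a list \<Rightarrow> ('a, 'k::comm_ring_1) nc_forms" where
  "b_formula a0 as = (if as = [] then 0 else
     sg (int (length as) - 1) * (std_form a0 (butlast as) * gen (El (last as)) - gen (El (last as)) * std_form a0 (butlast as)))"

lemma b_op_formula: "b_op = on_normal b_formula"
  unfolding b_op_def b_formula_def
proof (rule arg_cong[of _ _ on_normal], intro ext)
  fix a0 :: 'a and as :: "'a list"
  show "(if as = [] then 0 else
     (let n = length as; \<alpha> = std_form a0 (butlast as); a = gen (El (last as))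
      in (-1) ^ (n - 1) * (\<alpha> * a - a * \<alpha>))) = (if as = [] then 0 else
     sg (int (length as) - 1) * (std_form a0 (butlast as) * gen (El (last as)) - gen (El (last as)) * std_form a0 (butlast as)))"
    by (cases as) (simp_all add: Let_def power_sg)
qed

lemma klin_b_op [klin_intros]: "klin g \<Longrightarrow> klin (\<lambda>x. b_op (g x))"
  unfolding b_op_def by (rule klin_on_normal')
lemma klin_kappa [klin_intros]: "klin g \<Longrightarrow> klin (\<lambda>x. kappa (g x))"
  unfolding kappa_def by (rule klin_on_normal')
lemma klin_d_form [klin_intros]: "klin g \<Longrightarrow> klin (\<lambda>x. d_form (g x))"
  unfolding d_form_def by (rule klin_derivation')
lemma klin_B_op [klin_intros]: "klin g \<Longrightarrow> klin (\<lambda>x. B_op (g x))"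
  unfolding B_op_def by (rule klin_on_normal')
lemma klin_kappa_pow [klin_intros]: "klin g \<Longrightarrow> klin (\<lambda>x. (kappa ^^ n) (g x))"
  by (rule klin_comp[OF klin_funpow[OF klin_kappa[OF klin_id]]])

lemmas op_simps =
  klin_add[OF klin_b_op[OF klin_id]] klin_diff[OF klin_b_op[OF klin_id]] klin_neg[OF klin_b_op[OF klin_id]]
  klin_smul[OF klin_b_op[OF klin_id]] klin_zero[OF klin_b_op[OF klin_id]] klin_sum[OF klin_b_op[OF klin_id]]
  klin_add[OF klin_d_form[OF klin_id]] klin_diff[OF klin_d_form[OF klin_id]] klin_neg[OF klin_d_form[OF klin_id]]
  klin_smul[OF klin_d_form[OF klin_id]] klin_zero[OF klin_d_form[OF klin_id]] klin_sum[OF klin_d_form[OF klin_id]]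
  klin_add[OF klin_kappa[OF klin_id]] klin_diff[OF klin_kappa[OF klin_id]] klin_neg[OF klin_kappa[OF klin_id]]
  klin_smul[OF klin_kappa[OF klin_id]] klin_zero[OF klin_kappa[OF klin_id]] klin_sum[OF klin_kappa[OF klin_id]]
  klin_add[OF klin_B_op[OF klin_id]] klin_diff[OF klin_B_op[OF klin_id]] klin_neg[OF klin_B_op[OF klin_id]]
  klin_smul[OF klin_B_op[OF klin_id]] klin_zero[OF klin_B_op[OF klin_id]] klin_sum[OF klin_B_op[OF klin_id]]
  klin_add[OF klin_kappa_pow[OF klin_id]] klin_diff[OF klin_kappa_pow[OF klin_id]] klin_neg[OF klin_kappa_pow[OF klin_id]]
  klin_smul[OF klin_kappa_pow[OF klin_id]] klin_zero[OF klin_kappa_pow[OF klin_id]] klin_sum[OF klin_kappa_pow[OF klin_id]]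

lemma klin_sgI: "klin L \<Longrightarrow> L (sg n * x) = sg n * L x"
  by (simp add: sg_def klin_neg)

lemma d_mult: "f \<in> piece fdeg p \<Longrightarrow> d_form (f * g) = d_form f * g + sg p * (f * d_form g)"
  unfolding d_form_def using derivation_mult[of f fdeg p 1] by simp

lemma d_gen [simp]: "d_form (gen l) = d_letter l" "d_form 1 = 0"
  by (simp_all add: d_form_def)

lemma d_letter_piece: "d_letter l \<in> piece fdeg (int (fdeg l) + 1)"
  by (cases l) (simp_all add: piece_mon)

lemma d_piece: "f \<in> piece fdeg p \<Longrightarrow> d_form f \<in> piece fdeg (p + 1)"
  unfolding d_form_def by (rule derivation_piece[OF d_letter_piece])

lemma d_d [simp]: "d_form (d_form f) = 0"
  unfolding d_form_def
proof (rule derivation_sq[OF d_letter_piece])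
  fix l :: "'a form"
  show "derivation 1 fdeg d_letter (d_letter l) = (0 :: ('a, 'b) nc_forms)"
    by (cases l) (simp_all add: klin_zero[OF klin_derivation])
qed simp

lemma std_form_piece: "std_form a0 as \<in> piece fdeg (int (length as))"
  by (simp add: std_form_def piece_mon comp_def sum_list_triv)

lemma Df_piece: "mon (map Df as) \<in> piece fdeg (int (length as))"
  by (simp add: piece_mon comp_def sum_list_triv)

lemma El_piece: "gen (El a) \<in> piece fdeg 0" and Df1_piece: "gen (Df a) \<in> piece fdeg 1"
  by (simp_all add: piece_mon)

lemma d_mon_Df [simp]: "d_form (mon (map Df as)) = 0"
proof (induction as)
  case (Cons a as)
  then show ?case
    unfolding list.map by (subst mon_Cons) (simp add: d_mult[OF Df1_piece])
qed simp

lemma std_form_snoc: "std_form a0 (as @ [a]) = std_form a0 as * gen (Df a)"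
  by (simp add: std_form_def flip: mon_append)

lemma std_form_append: "std_form a0 (as @ bs) = std_form a0 as * mon (map Df bs)"
  by (simp add: std_form_def flip: mon_append)

lemma b_formula_snoc: "b_formula a0 (as @ [a]) =
    sg (int (length as)) * (std_form a0 as * gen (El a) - gen (El a) * std_form a0 as)"
  by (simp add: b_formula_def)

lemma b_formula_Nil [simp]: "b_formula a0 [] = 0"
  by (simp add: b_formula_def)

lemma b_piece: "f \<in> piece fdeg p \<Longrightarrow> b_op f \<in> piece fdeg (p - 1)"
  unfolding b_op_formula
proof (rule on_normal_mem)
  fix a0 :: 'a and as :: "'a list" assume p: "int (length as) = p"
  show "b_formula a0 as \<in> piece fdeg (p - 1)"
    using p
    by (cases as rule: rev_exhaust)
       (auto simp: b_formula_snoc intro!: piece_sg piece_diff piece_mult'[OF std_form_piece El_piece]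
          piece_mult'[OF El_piece std_form_piece])
qed auto

lemma b_piece0: "f \<in> piece fdeg 0 \<Longrightarrow> b_op f = 0"
  by (rule piece_neg_deg[OF _ b_piece[of f 0]]) auto

lemma b_std_form_Nil [simp]: "b_op (std_form a0 []) = 0"
  by (rule b_piece0) (simp add: std_form_def piece_mon)

lemma kappa_piece: "f \<in> piece fdeg p \<Longrightarrow> kappa f \<in> piece fdeg p"
  unfolding kappa_def
proof (rule on_normal_mem)
  fix a0 :: 'a and as :: "'a list" assume p: "int (length as) = p"
  show "(if as = [] then std_form a0 [] else
     (-1) ^ (length as - 1) * (gen (Df (last as)) * std_form a0 (butlast as))) \<in> piece fdeg p"
    using p std_form_piece[of a0 "[]"]
    by (cases as rule: rev_exhaust)
       (auto simp: power_sg intro!: piece_sg piece_mult'[OF Df1_piece std_form_piece])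
qed auto

lemma kappa_pow_piece: "f \<in> piece fdeg p \<Longrightarrow> (kappa ^^ n) f \<in> piece fdeg p"
  by (induction n) (auto intro: kappa_piece)

context k_alg
begin

text \<open>If the entry that varies is the last differential, it enters through a commutator, and
  the entry 1 gives [\<alpha>, 1] = 0. Otherwise it stays inside a standard form, whose own
  admissibility applies.\<close>

lemma admissible_b: "admissible FI b_formula"
proof -
  have C: "sg n * (X * Y - Y * X) \<simeq>[FI] sg n * (X' * Y' - Y' * X')"
    if "X \<simeq>[FI] X'" "Y \<simeq>[FI] Y'" for n and X X' Y Y' :: "('a, 'k) nc_forms"
    by (intro F.mult F.diff F.refl that)
  note S = admissibleD[OF admissible_std_form]
  show ?thesis
  proof (rule admissibleI)
    fix a b :: 'a and as
    show "b_formula (a + b) as \<simeq>[FI] b_formula a as + b_formula b as"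
    proof (cases as rule: rev_exhaust)
      case (snoc as' x)
      show ?thesis unfolding snoc b_formula_snoc
        by (rule F.eq_trans2[OF C[OF S(1) F.refl]]) (simp add: algebra_simps)
    qed simp
  next
    fix c and a :: 'a and as
    show "b_formula (sc c a) as \<simeq>[FI] smul c (b_formula a as)"
    proof (cases as rule: rev_exhaust)
      case (snoc as' x)
      show ?thesis unfolding snoc b_formula_snoc
        by (rule F.eq_trans2[OF C[OF S(2) F.refl]])
           (simp add: smul_mult_left smul_mult_right smul.scale_right_diff_distrib algebra_simps)
    qed simp
  next
    fix a0 xs and a b :: 'a and ys
    show "b_formula a0 (xs @ (a + b) # ys) \<simeq>[FI] b_formula a0 (xs @ a # ys) + b_formula a0 (xs @ b # ys)"
    proof (cases ys rule: rev_exhaust)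
      case Nil
      show ?thesis unfolding Nil b_formula_snoc
        by (rule F.eq_trans2[OF C[OF F.refl F.el_add]]) (simp add: algebra_simps)
    next
      case (snoc ys' y)
      have *: "b_formula a0 (xs @ z # ys) = sg (int (length (xs @ z # ys'))) *
          (std_form a0 (xs @ z # ys') * F.el y - F.el y * std_form a0 (xs @ z # ys'))" for z
        using b_formula_snoc[of a0 "xs @ z # ys'" y] by (simp add: snoc)
      show ?thesis unfolding *
        by (rule F.eq_trans2[OF C[OF S(3) F.refl]]) (simp add: algebra_simps)
    qed
  next
    fix a0 xs and c and a :: 'a and ys
    show "b_formula a0 (xs @ sc c a # ys) \<simeq>[FI] smul c (b_formula a0 (xs @ a # ys))"
    proof (cases ys rule: rev_exhaust)
      case Nil
      show ?thesis unfolding Nil b_formula_snoc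
        by (rule F.eq_trans2[OF C[OF F.refl F.el_sc]])
           (simp add: smul_mult_left smul_mult_right smul.scale_right_diff_distrib algebra_simps)
    next
      case (snoc ys' y)
      have *: "b_formula a0 (xs @ z # ys) = sg (int (length (xs @ z # ys'))) *
          (std_form a0 (xs @ z # ys') * F.el y - F.el y * std_form a0 (xs @ z # ys'))" for z
        using b_formula_snoc[of a0 "xs @ z # ys'" y] by (simp add: snoc)
      show ?thesis unfolding *
        by (rule F.eq_trans2[OF C[OF S(4) F.refl]])
           (simp add: smul_mult_left smul_mult_right smul.scale_right_diff_distrib algebra_simps)
    qed
  next
    fix a0 :: 'a and xs ys
    show "b_formula a0 (xs @ 1 # ys) \<simeq>[FI] 0"
    proof (cases ys rule: rev_exhaust)
      case Nil
      show ?thesis unfolding Nil b_formula_snoc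
        by (rule F.eq_trans2[OF C[OF F.refl F.el_one]]) simp
    next
      case (snoc ys' y)
      have *: "b_formula a0 (xs @ z # ys) = sg (int (length (xs @ z # ys'))) *
          (std_form a0 (xs @ z # ys') * F.el y - F.el y * std_form a0 (xs @ z # ys'))" for z
        using b_formula_snoc[of a0 "xs @ z # ys'" y] by (simp add: snoc)
      show ?thesis unfolding *
        by (rule F.eq_trans2[OF C[OF S(5) F.refl]]) simp
    qed
  qed
qed

lemma b_FI: "x \<in> FI \<Longrightarrow> b_op x \<in> FI"
  unfolding b_op_formula by (rule on_normal_ideal[OF F.sub admissible_b])

lemma d_FI: "x \<in> FI \<Longrightarrow> d_form x \<in> FI"
  unfolding forms_ideal_def d_form_def
  by (rule derivation_ideal[rotated 2], assumption)
     (auto intro!: d_relations alg form_relations_piece[of _ _ _ _ _ 1])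

lemma b_cong: "x \<simeq>[FI] y \<Longrightarrow> b_op x \<simeq>[FI] b_op y"
  by (rule F.klin[OF klin_b_op[OF klin_id] b_FI])
lemma d_cong: "x \<simeq>[FI] y \<Longrightarrow> d_form x \<simeq>[FI] d_form y"
  by (rule F.klin[OF klin_d_form[OF klin_id] d_FI])

text \<open>The defining formula of b becomes available for every homogeneous \<alpha>, which frees
  the computations below from normal forms.\<close>

lemma b_snoc:
  assumes "\<alpha> \<in> piece fdeg n"
  shows "b_op (\<alpha> * F.df a) \<simeq>[FI] sg n * (\<alpha> * F.el a - F.el a * \<alpha>)"
proof (rule std_form_eqv[OF assms, of "\<lambda>\<alpha>. b_op (\<alpha> * F.df a)" "\<lambda>\<alpha>. sg n * (\<alpha> * F.el a - F.el a * \<alpha>)"])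
  fix a0 :: 'a and as :: "'a list" assume "int (length as) = n"
  then show "b_op (std_form a0 as * F.df a) \<simeq>[FI] sg n * (std_form a0 as * F.el a - F.el a * std_form a0 as)"
    using on_normal_std_form[OF F.sub admissible_b, of a0 "as @ [a]"]
    by (simp add: b_op_formula std_form_snoc b_formula_snoc)
qed (auto intro!: klin_intros F.sub intro: b_FI F.absorb_r F.absorb_l F.closed)

text \<open>The commutators of d\<alpha> with a that come from bd and from db cancel, as does
  \<alpha> da; only da \<alpha> survives.\<close>

lemma kappa_formula:
  assumes "\<alpha> \<in> piece fdeg n"
  shows "\<alpha> * F.df a - b_op (d_form (\<alpha> * F.df a)) - d_form (b_op (\<alpha> * F.df a)) \<simeq>[FI] sg n * (F.df a * \<alpha>)"
proof -
  have d1: "d_form (\<alpha> * F.df a) = d_form \<alpha> * F.df a" using d_mult[OF assms] by simp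
  have "d_form (b_op (\<alpha> * F.df a)) \<simeq>[FI] d_form (sg n * (\<alpha> * F.el a - F.el a * \<alpha>))"
    by (intro d_cong b_snoc assms)
  also have "\<dots> = sg n * (d_form \<alpha> * F.el a + sg n * (\<alpha> * F.df a) - (F.df a * \<alpha> + F.el a * d_form \<alpha>))"
    by (simp add: klin_sgI[OF klin_d_form[OF klin_id]] op_simps d_mult[OF assms] d_mult[OF El_piece])
  finally have 1: "d_form (b_op (\<alpha> * F.df a)) \<simeq>[FI] \<dots>" .
  have "\<alpha> * F.df a - b_op (d_form (\<alpha> * F.df a)) - d_form (b_op (\<alpha> * F.df a)) \<simeq>[FI]
    \<alpha> * F.df a - sg (n + 1) * (d_form \<alpha> * F.el a - F.el a * d_form \<alpha>)
    - sg n * (d_form \<alpha> * F.el a + sg n * (\<alpha> * F.df a) - (F.df a * \<alpha> + F.el a * d_form \<alpha>))"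
    unfolding d1 by (intro F.diff F.refl b_snoc d_piece assms 1[unfolded d1])
  also have "\<dots> = sg n * (F.df a * \<alpha>)"
    by (cases "even n") (auto simp: sg_def algebra_simps)
  finally show ?thesis .
qed

text \<open>The Karoubi identity acts as the working definition of \<kappa>: compatibility with the
  relations is inherited from b and d. It includes degree 0, where bd a_0 is a commutator with
  1.\<close>

lemma kappa_bd: "kappa f \<simeq>[FI] f - b_op (d_form f) - d_form (b_op f)"
proof -
  let ?L = "\<lambda>x :: ('a, 'k) nc_forms. x - b_op (d_form x) - d_form (b_op x)"
  have L: "klin ?L" by (intro klin_intros)
  have "kappa f \<simeq>[FI] on_normal (\<lambda>a0 as. ?L (std_form a0 as)) f"
    unfolding kappa_def
  proof (rule on_normal_cong'[OF F.sub])
    fix a0 :: 'a and as :: "'a list"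
    show "(if as = [] then std_form a0 [] else
      (-1) ^ (length as - 1) * (F.df (last as) * std_form a0 (butlast as))) \<simeq>[FI] ?L (std_form a0 as)"
    proof (cases as rule: rev_exhaust)
      case Nil
      have "b_op (d_form (std_form a0 [])) \<simeq>[FI] 0"
        using b_snoc[of 1 0 a0] by (simp add: std_form_def)
      then show ?thesis
        using F.diff[OF F.refl F.sym, of "b_op (d_form (std_form a0 []))" 0 "std_form a0 []"]
        by (simp add: Nil op_simps)
    next
      case (snoc as' a)
      then show ?thesis
        using F.sym[OF kappa_formula[OF std_form_piece]] by (simp add: std_form_snoc power_sg)
    qed
  qed
  also have "on_normal (\<lambda>a0 as. ?L (std_form a0 as)) f = ?L (on_normal std_form f)"
    by (rule on_normal_klin[OF L])
  also have "\<dots> \<simeq>[FI] ?L f"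
    by (intro F.diff b_cong d_cong normal_form)
  finally show ?thesis .
qed

lemma kappa_cong: "x \<simeq>[FI] y \<Longrightarrow> kappa x \<simeq>[FI] kappa y"
  by (rule F.trans[OF F.trans[OF kappa_bd] F.sym[OF kappa_bd]]) (intro F.diff b_cong d_cong)

lemma kappa_pow_cong: "x \<simeq>[FI] y \<Longrightarrow> (kappa ^^ n) x \<simeq>[FI] (kappa ^^ n) y"
  by (induction n) (auto intro: kappa_cong)

lemma kappa_snoc: "\<alpha> \<in> piece fdeg n \<Longrightarrow> kappa (\<alpha> * F.df a) \<simeq>[FI] sg n * (F.df a * \<alpha>)"
  by (rule F.trans[OF kappa_bd kappa_formula])

text \<open>Each power of \<kappa> carries the last differential to the front past p + k - 1 others
  in degree, where k is the length of \<open>ys\<close>; k such moves give the sign.\<close>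

lemma kappa_pow_rotate:
  assumes "f \<in> piece fdeg p"
  shows "(kappa ^^ length ys) (f * mon (map Df ys)) \<simeq>[FI]
    sg (int (length ys) * (p + int (length ys) - 1)) * (mon (map Df ys) * f)"
  using assms
proof (induction ys arbitrary: f p rule: rev_induct)
  case (snoc y ys)
  define m where "m = int (length ys)"
  have 1: "f * mon (map Df ys) \<in> piece fdeg (p + m)"
    unfolding m_def by (rule piece_mult'[OF snoc.prems Df_piece HOL.refl])
  have 2: "F.df y * f \<in> piece fdeg (p + 1)" by (rule piece_mult'[OF Df1_piece snoc.prems]) simp
  have "(kappa ^^ length (ys @ [y])) (f * mon (map Df (ys @ [y])))
      = (kappa ^^ length ys) (kappa (f * mon (map Df ys) * F.df y))"
    by (simp add: funpow_swap1 mon_append mult.assoc)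
  also have "\<dots> \<simeq>[FI] (kappa ^^ length ys) (sg (p + m) * (F.df y * (f * mon (map Df ys))))"
    by (intro kappa_pow_cong kappa_snoc 1)
  also have "\<dots> = sg (p + m) * (kappa ^^ length ys) (F.df y * f * mon (map Df ys))"
    by (simp add: klin_sgI[OF klin_kappa_pow[OF klin_id]] mult.assoc)
  also have "\<dots> \<simeq>[FI] sg (p + m) * (sg (m * (p + 1 + m - 1)) * (mon (map Df ys) * (F.df y * f)))"
    unfolding m_def by (intro F.mult F.refl snoc.IH 2)
  also have "\<dots> = sg (int (length (ys @ [y])) * (p + int (length (ys @ [y])) - 1)) * (mon (map Df (ys @ [y])) * f)"
    by (cases "even p"; cases "even m") (auto simp: sg_def mon_append mult.assoc simp flip: m_def)
  finally show ?case .
qed simp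

text \<open>\<open>b_snoc\<close> needs a form that ends in a differential, so X da' a is rewritten
  as X d(a' a) - X a' da. The remaining products cancel in pairs, as the faces do in the Hochschild
  complex.\<close>

lemma b_b:
  assumes "f \<in> piece fdeg p"
  shows "b_op (b_op f) \<in> FI"
proof (rule std_form_mem[OF assms, of "\<lambda>f. b_op (b_op f)"])
  fix a0 :: 'a and as :: "'a list"
  show "b_op (b_op (std_form a0 as :: ('a, 'k) nc_forms)) \<in> FI"
  proof (cases as rule: rev_exhaust)
    case Nil
    then show ?thesis by (simp add: op_simps F.closed(5))
  next
    case (snoc as' a)
    show ?thesis
    proof (cases as' rule: rev_exhaust)
      case Nil
      have "b_op (std_form a0 as :: ('a, 'k) nc_forms) \<in> piece fdeg 0"
        using b_piece[OF std_form_piece[of a0 as]] by (simp add: Nil snoc)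
      then show ?thesis by (simp add: b_piece0 F.closed(5))
    next
      case (snoc bs a')
      define X :: "('a, 'k) nc_forms" where "X = std_form a0 bs"
      define n where "n = int (length bs)"
      have X: "X \<in> piece fdeg n" unfolding X_def n_def by (rule std_form_piece)
      have f: "std_form a0 as = X * F.df a' * F.df a"
        by (simp only: X_def snoc \<open>as = as' @ [a]\<close> std_form_snoc)
      have X1: "X * F.df a' \<in> piece fdeg (n + 1)" by (rule piece_mult'[OF X Df1_piece]) simp
      have da: "F.df a' * F.el a \<simeq>[FI] F.df (a' * a) - F.el a' * F.df a"
        using F.diff[OF F.sym[OF F.df_mult] F.refl, of a' a "F.el a' * F.df a"] by simp
      have e: "X * F.df a' * F.el a \<simeq>[FI] X * F.df (a' * a) - (X * F.el a') * F.df a"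
        using F.mult[OF F.refl da, of X] by (simp add: mult.assoc right_diff_distrib)
      have "b_op (b_op (std_form a0 as)) \<simeq>[FI] b_op (sg (n + 1) * (X * F.df a' * F.el a - F.el a * (X * F.df a')))"
        unfolding f by (intro b_cong b_snoc X1)
      also have "\<dots> = sg (n + 1) * (b_op (X * F.df a' * F.el a) - b_op (F.el a * X * F.df a'))"
        by (simp add: klin_sgI[OF klin_b_op[OF klin_id]] op_simps mult.assoc)
      also have "\<dots> \<simeq>[FI] sg (n + 1) * (b_op (X * F.df (a' * a) - (X * F.el a') * F.df a) - b_op (F.el a * X * F.df a'))"
        by (intro F.mult F.diff F.refl b_cong e)
      also have "\<dots> = sg (n + 1) * (b_op (X * F.df (a' * a)) - b_op ((X * F.el a') * F.df a) - b_op (F.el a * X * F.df a'))"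
        by (simp add: op_simps)
      also have "\<dots> \<simeq>[FI] sg (n + 1) * (sg n * (X * F.el (a' * a) - F.el (a' * a) * X)
          - sg n * (X * F.el a' * F.el a - F.el a * (X * F.el a'))
          - sg n * (F.el a * X * F.el a' - F.el a' * (F.el a * X)))"
        by (intro F.mult F.diff F.refl b_snoc X piece_mult'[OF X El_piece] piece_mult'[OF El_piece X]) simp_all
      also have "\<dots> \<simeq>[FI] sg (n + 1) * (sg n * (X * (F.el a' * F.el a) - (F.el a' * F.el a) * X)
          - sg n * (X * F.el a' * F.el a - F.el a * (X * F.el a'))
          - sg n * (F.el a * X * F.el a' - F.el a' * (F.el a * X)))"
        by (intro F.mult F.diff F.refl F.el_mult)
      also have "\<dots> = 0" by (simp add: algebra_simps)
      finally show ?thesis by (simp add: eqv_def)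
    qed
  qed
qed (auto intro!: klin_intros F.sub b_FI)

lemma d_std_form: "d_form (std_form a0 as :: ('a, 'k) nc_forms) = mon (map Df (a0 # as))"
  unfolding std_form_Cons d_mult[OF El_piece] by (simp flip: mon_Cons)

text \<open>Rotating all n differentials takes a_0 da_1 ... da_n to da_1 ... da_n a_0. The
  difference is a commutator with a_0, which is b of da_1 ... da_n da_0 up to sign.\<close>

lemma kappa_n:
  assumes "f \<in> piece fdeg (int n)"
  shows "(kappa ^^ n) f \<simeq>[FI] f + b_op ((kappa ^^ n) (d_form f))"
proof (rule std_form_eqv[OF assms, of "\<lambda>f. (kappa ^^ n) f" "\<lambda>f. f + b_op ((kappa ^^ n) (d_form f))"])
  fix a0 :: 'a and as :: "'a list" assume "int (length as) = int n"
  then have n: "n = length as" by simp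
  have 1: "(kappa ^^ n) (std_form a0 as) \<simeq>[FI] mon (map Df as) * F.el a0"
    using kappa_pow_rotate[OF El_piece, of as a0] by (simp add: std_form_Cons n sg_def)
  have "(kappa ^^ n) (d_form (std_form a0 as)) \<simeq>[FI] sg (int n) * (mon (map Df as) * F.df a0)"
    using kappa_pow_rotate[OF Df1_piece, of as a0]
    by (simp add: d_std_form n sg_def flip: mon_Cons)
  then have "b_op ((kappa ^^ n) (d_form (std_form a0 as))) \<simeq>[FI] b_op (sg (int n) * (mon (map Df as) * F.df a0))"
    by (rule b_cong)
  also have "\<dots> = sg (int n) * b_op (mon (map Df as) * F.df a0)"
    by (simp add: klin_sgI[OF klin_b_op[OF klin_id]])
  also have "\<dots> \<simeq>[FI] sg (int n) * (sg (int n) * (mon (map Df as) * F.el a0 - F.el a0 * mon (map Df as)))"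
    unfolding n by (intro F.mult F.refl b_snoc Df_piece)
  finally have "b_op ((kappa ^^ n) (d_form (std_form a0 as))) \<simeq>[FI] mon (map Df as) * F.el a0 - std_form a0 as"
    by (simp add: std_form_Cons flip: mult.assoc)
  from F.add[OF F.refl[of "std_form a0 as"] this]
  have "std_form a0 as + b_op ((kappa ^^ n) (d_form (std_form a0 as))) \<simeq>[FI] mon (map Df as) * F.el a0"
    by simp
  then show "(kappa ^^ n) (std_form a0 as) \<simeq>[FI] std_form a0 as + b_op ((kappa ^^ n) (d_form (std_form a0 as)))"
    using 1 F.sym F.trans by blast
next
  fix x assume "x \<in> FI"
  then have 0: "x \<simeq>[FI] 0" by (simp add: F.iff0[symmetric])
  show "(kappa ^^ n) x \<in> FI" "x + b_op ((kappa ^^ n) (d_form x)) \<in> FI"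
    unfolding F.iff0 using kappa_pow_cong[OF 0, of n] F.add[OF 0 b_cong[OF kappa_pow_cong[OF d_cong[OF 0], of n]]]
    by (simp_all add: op_simps)
qed (auto intro!: klin_intros F.sub)

text \<open>On a product of n + 1 differentials \<kappa> is a signed rotation, and the sign of a
  full turn has the even exponent n (n + 1).\<close>

lemma kappa_n_d:
  assumes "f \<in> piece fdeg (int n)"
  shows "(kappa ^^ Suc n) (d_form f) \<simeq>[FI] d_form f"
proof (rule std_form_eqv[OF assms, of "\<lambda>f. (kappa ^^ Suc n) (d_form f)" "\<lambda>f. d_form f"])
  fix a0 :: 'a and as :: "'a list" assume "int (length as) = int n"
  then show "(kappa ^^ Suc n) (d_form (std_form a0 as)) \<simeq>[FI] d_form (std_form a0 as)"
    using kappa_pow_rotate[OF piece_one, of "a0 # as"] unfolding d_std_form by (simp add: sg_def)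
next
  fix x assume "x \<in> FI"
  then have 0: "x \<simeq>[FI] 0" by (simp add: F.iff0[symmetric])
  show "(kappa ^^ Suc n) (d_form x) \<in> FI"
    unfolding F.iff0 using kappa_pow_cong[OF d_cong[OF 0], of "Suc n"] by (simp add: op_simps del: funpow.simps)
qed (auto intro!: klin_intros F.sub d_FI simp del: funpow.simps)

lemma B_kappa:
  assumes "f \<in> piece fdeg (int n)"
  shows "B_op f \<simeq>[FI] (\<Sum>j\<le>n. (kappa ^^ j) (d_form f))"
proof -
  have "B_op f \<simeq>[FI] on_normal (\<lambda>a0 as. \<Sum>j\<le>n. (kappa ^^ j) (d_form (std_form a0 as))) f"
    unfolding B_op_def by (rule on_normal_cong[OF assms F.sub]) auto
  also have "\<dots> = (\<Sum>j\<le>n. (kappa ^^ j) (d_form (on_normal std_form f)))"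
    by (rule on_normal_klin) (intro klin_intros)
  also have "\<dots> \<simeq>[FI] (\<Sum>j\<le>n. (kappa ^^ j) (d_form f))"
    by (intro F.sum kappa_pow_cong d_cong normal_form)
  finally show ?thesis .
qed

text \<open>After n - l rotations the differential of a_l stands last, and b then produces the
  commutator with a_l. So the terms of i are b applied to the powers of \<kappa>.\<close>

lemma i_kappa:
  assumes "f \<in> piece fdeg (int n)"
  shows "i_op f \<simeq>[FI] (\<Sum>j<n. b_op ((kappa ^^ j) f))"
proof -
  have "i_op f \<simeq>[FI] on_normal (\<lambda>a0 as. \<Sum>j<n. b_op ((kappa ^^ j) (std_form a0 as))) f"
    unfolding i_op_def
  proof (rule on_normal_cong[OF assms F.sub])
    fix a0 :: 'a and as :: "'a list" assume "int (length as) = int n"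
    then have n: "length as = n" by simp
    have *: "(-1) ^ ((l - 1) * (n - 1) + 1) * (F.el (as ! (l - 1)) * \<omega> - \<omega> * F.el (as ! (l - 1)))
        \<simeq>[FI] b_op ((kappa ^^ (n - l)) (std_form a0 as))"
      if l: "l \<in> {1..n}" and \<omega>: "\<omega> = mon (map Df (drop l as) @ El a0 # map Df (take (l - 1) as))" for l \<omega>
    proof -
      define a where "a = as ! (l - 1)"
      have t: "take l as = take (l - 1) as @ [a]"
        using take_Suc_conv_app_nth[of "l - 1" as] l n by (cases l) (simp_all add: a_def)
      have len: "length (drop l as) = n - l" "length (take l as) = l" using l n by auto
      have \<omega>p: "\<omega> \<in> piece fdeg (int n - 1)"
        using l n by (cases l) (simp_all add: \<omega> piece_mon comp_def sum_list_triv of_nat_diff)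
      have w: "mon (map Df (drop l as)) * std_form a0 (take l as) = \<omega> * F.df a"
        by (simp add: \<omega> t std_form_snoc std_form_def flip: mon_append mult.assoc)
      have "(kappa ^^ (n - l)) (std_form a0 (take l as @ drop l as)) \<simeq>[FI]
        sg ((int n - int l) * (int n - 1)) * (\<omega> * F.df a)"
        using kappa_pow_rotate[OF std_form_piece[of a0 "take l as"], of "drop l as"] l
        unfolding len w std_form_append by (simp add: of_nat_diff)
      then have "b_op ((kappa ^^ (n - l)) (std_form a0 as)) \<simeq>[FI] b_op (sg ((int n - int l) * (int n - 1)) * (\<omega> * F.df a))"
        by (intro b_cong) simp
      also have "\<dots> = sg ((int n - int l) * (int n - 1)) * b_op (\<omega> * F.df a)"
        by (simp add: klin_sgI[OF klin_b_op[OF klin_id]])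
      also have "\<dots> \<simeq>[FI] sg ((int n - int l) * (int n - 1)) * (sg (int n - 1) * (\<omega> * F.el a - F.el a * \<omega>))"
        by (intro F.mult F.refl b_snoc \<omega>p)
      also have "\<dots> = (-1) ^ ((l - 1) * (n - 1) + 1) * (F.el a * \<omega> - \<omega> * F.el a)"
        using l by (cases "even n"; cases "even l") (auto simp: sg_def minus_one_power_iff)
      finally show ?thesis unfolding a_def by (rule F.sym)
    qed
    have "(\<Sum>l = 1..n. (let a = F.el (as ! (l - 1)); \<omega> = mon (map Df (drop l as) @ El a0 # map Df (take (l - 1) as))
           in (-1) ^ ((l - 1) * (n - 1) + 1) * (a * \<omega> - \<omega> * a)))
        \<simeq>[FI] (\<Sum>l = 1..n. b_op ((kappa ^^ (n - l)) (std_form a0 as)))"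
      unfolding Let_def by (rule F.sum) (rule *, auto)
    also have "(\<Sum>l = 1..n. b_op ((kappa ^^ (n - l)) (std_form a0 as))) = (\<Sum>j<n. b_op ((kappa ^^ j) (std_form a0 as)))"
      by (rule sum.reindex_bij_witness[of _ "\<lambda>j. n - j" "\<lambda>l. n - l"]) auto
    finally show "(let n = length as in \<Sum>l = 1..n. (let a = F.el (as ! (l - 1));
             \<omega> = mon (map Df (drop l as) @ El a0 # map Df (take (l - 1) as))
           in (-1) ^ ((l - 1) * (n - 1) + 1) * (a * \<omega> - \<omega> * a)))
        \<simeq>[FI] (\<Sum>j<n. b_op ((kappa ^^ j) (std_form a0 as)))"
      by (simp add: n Let_def)
  qed
  also have "\<dots> = (\<Sum>j<n. b_op ((kappa ^^ j) (on_normal std_form f)))"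
    by (rule on_normal_klin) (intro klin_intros)
  also have "\<dots> \<simeq>[FI] (\<Sum>j<n. b_op ((kappa ^^ j) f))"
    by (intro F.sum kappa_pow_cong b_cong normal_form)
  finally show ?thesis .
qed

end

section \<open>Division by positive integers\<close>

locale rat_alg =
  fixes \<rho> :: "rat \<Rightarrow> 'k::comm_ring_1"
  assumes rat: "rat_algebra \<rho>"
begin

lemma rho_of_nat: "\<rho> (of_nat n) = of_nat n"
proof (induction n)
  case 0
  have "\<rho> (0 + 0) = \<rho> 0 + \<rho> 0" using rat unfolding rat_algebra_def by blast
  then show ?case by simp
next
  case (Suc n)
  then show ?case using rat unfolding rat_algebra_def of_nat_Suc by simp
qed

lemma rho_mult: "\<rho> (x * y) = \<rho> x * \<rho> y"
  using rat unfolding rat_algebra_def by blast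

lemma rho_inverse: "n > 0 \<Longrightarrow> \<rho> (1 / of_nat n) * of_nat n = 1"
  using rat rho_mult[of "1 / of_nat n" "of_nat n"] rho_of_nat[of n] by (simp add: rat_algebra_def)

lemma smul_inverse: "n > 0 \<Longrightarrow> smul (\<rho> (1 / of_nat n)) (smul (of_nat n) x) = x"
  by (simp add: rho_inverse)

end

section \<open>Contraction of d given by a splitting of the scalars\<close>

locale split_alg = k_alg sc for sc :: "'k::comm_ring_1 \<Rightarrow> 'a::ring_1 \<Rightarrow> 'a" +
  fixes pr :: "'a \<Rightarrow> 'k"
  assumes pr_hom: "module_hom sc (*) pr" and pr_scalar: "pr (sc c 1) = c"
begin

lemmas pr_simps = module_hom.add[OF pr_hom] module_hom.scale[OF pr_hom] module_hom.diff[OF pr_hom]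

lemma pr_one [simp]: "pr 1 = 1" using pr_scalar[of 1] by simp

lemmas sc_simps = module.scale_left_distrib[OF F.sc_mod] module.scale_right_diff_distrib[OF F.sc_mod]
  module.scale_right_distrib[OF F.sc_mod] module.scale_scale[OF F.sc_mod] module.scale_zero_left[OF F.sc_mod]

text \<open>The contraction of reduced forms for the decomposition of A into scalars and the kernel
  of \<open>pr\<close>. Subtracting the scalar part of a_1 makes the value zero for a_1 = 1, as
  admissibility requires.\<close>

definition s_formula :: "'a \<Rightarrow> 'a list \<Rightarrow> ('a, 'k) nc_forms" where
  "s_formula a0 as = (case as of [] \<Rightarrow> 0 | a # as' \<Rightarrow> smul (pr a0) (std_form (a - sc (pr a) 1) as'))"

definition s_op :: "('a, 'k) nc_forms \<Rightarrow> ('a, 'k) nc_forms" where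
  "s_op = on_normal s_formula"

text \<open>The scalar part of a form of degree 0. The alphabet of the target is arbitrary, so that
  the same projection takes values in forms and in extended forms.\<close>

definition pi_op :: "('a, 'k) nc_forms \<Rightarrow> ('g, 'k) falg" where
  "pi_op = on_normal (\<lambda>a0 as. if as = [] then smul (pr a0) 1 else 0)"

lemma klin_s_op [klin_intros]: "klin g \<Longrightarrow> klin (\<lambda>x. s_op (g x))"
  unfolding s_op_def by (rule klin_on_normal')
lemma klin_pi_op [klin_intros]: "klin g \<Longrightarrow> klin (\<lambda>x. pi_op (g x))"
  unfolding pi_op_def by (rule klin_on_normal')

lemma std_form_0: "std_form 0 as \<simeq>[FI] 0"
  using admissibleD(2)[OF admissible_std_form, of 0 0 as] by (simp add: sc_simps)

lemma admissible_s: "admissible FI s_formula"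
proof -
  note S = admissibleD[OF admissible_std_form]
  show ?thesis
  proof (rule admissibleI)
    fix a b :: 'a and as
    show "s_formula (a + b) as \<simeq>[FI] s_formula a as + s_formula b as"
      by (cases as) (simp_all add: s_formula_def pr_simps smul.scale_left_distrib)
  next
    fix c and a :: 'a and as
    show "s_formula (sc c a) as \<simeq>[FI] smul c (s_formula a as)"
      by (cases as) (simp_all add: s_formula_def pr_simps)
  next
    fix a0 xs and a b :: 'a and ys
    show "s_formula a0 (xs @ (a + b) # ys) \<simeq>[FI] s_formula a0 (xs @ a # ys) + s_formula a0 (xs @ b # ys)"
    proof (cases xs)
      case Nil
      have "a + b - sc (pr (a + b)) 1 = (a - sc (pr a) 1) + (b - sc (pr b) 1)"
        by (simp add: pr_simps sc_simps)
      then have e: "a + b - sc (pr (a + b)) 1 = (a - sc (pr a) 1) + (b - sc (pr b) 1)" .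
      show ?thesis unfolding Nil s_formula_def append_Nil list.case e smul.scale_right_distrib[symmetric]
        by (rule F.scale[OF S(1)])
    next
      case (Cons x xs')
      then show ?thesis using F.scale[OF S(3)]
        by (simp add: s_formula_def smul.scale_right_distrib[symmetric])
    qed
  next
    fix a0 xs and c and a :: 'a and ys
    show "s_formula a0 (xs @ sc c a # ys) \<simeq>[FI] smul c (s_formula a0 (xs @ a # ys))"
    proof (cases xs)
      case Nil
      have "sc c a - sc (pr (sc c a)) 1 = sc c (a - sc (pr a) 1)"
        by (simp add: pr_simps sc_simps)
      then show ?thesis using F.scale[OF S(2), of "pr a0"]
        by (simp add: Nil s_formula_def mult.commute)
    next
      case (Cons x xs')
      then show ?thesis using F.scale[OF S(4), of "pr a0"]
        by (simp add: s_formula_def mult.commute)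
    qed
  next
    fix a0 xs ys
    show "s_formula a0 (xs @ 1 # ys) \<simeq>[FI] 0"
    proof (cases xs)
      case Nil
      then show ?thesis using F.scale[OF std_form_0, of "pr a0"] by (simp add: s_formula_def)
    next
      case (Cons x xs')
      then show ?thesis using F.scale[OF S(5), of "pr a0"] by (simp add: s_formula_def)
    qed
  qed
qed

lemma s_FI: "x \<in> FI \<Longrightarrow> s_op x \<in> FI"
  unfolding s_op_def by (rule on_normal_ideal[OF F.sub admissible_s])

lemma s_cong: "x \<simeq>[FI] y \<Longrightarrow> s_op x \<simeq>[FI] s_op y"
  by (rule F.klin[OF klin_s_op[OF klin_id] s_FI])

lemma submod_0: "submod {0}" by (rule smul.subspaceI) auto

lemma admissible_pi: "admissible {0} (\<lambda>a0 as. if as = [] then smul (pr a0) (1 :: ('g, 'k) falg) else 0)"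
  by (rule admissibleI) (auto simp: eqv_def pr_simps smul.scale_left_distrib)

lemma pi_FI: "x \<in> FI \<Longrightarrow> pi_op x = (0 :: ('g, 'k) falg)"
  unfolding pi_op_def using on_normal_ideal[OF submod_0 admissible_pi] by blast

lemma s_piece: "f \<in> piece fdeg p \<Longrightarrow> s_op f \<in> piece fdeg (p - 1)"
  unfolding s_op_def
proof (rule on_normal_mem)
  fix a0 :: 'a and as :: "'a list" assume "int (length as) = p"
  then show "s_formula a0 as \<in> piece fdeg (p - 1)"
    using std_form_piece[where 'a='a and 'b='k] by (cases as) (auto simp: s_formula_def intro!: piece_smul)
qed auto

lemma pi_pos: "f \<in> piece fdeg p \<Longrightarrow> p \<noteq> 0 \<Longrightarrow> pi_op f = (0 :: ('g, 'k) falg)"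
  unfolding pi_op_def
  using on_normal_mem[OF _ submod_0, of f p "\<lambda>a0 as. if as = [] then smul (pr a0) (1 :: ('g, 'k) falg) else 0"]
  by fastforce

lemma s_std: "s_op (std_form a0 as) \<simeq>[FI] s_formula a0 as"
  unfolding s_op_def by (rule on_normal_std_form[OF F.sub admissible_s])

lemma std_form_one: "std_form 1 as \<simeq>[FI] mon (map Df as)"
  using F.mult[OF F.el_one F.refl] by (simp add: std_form_Cons)

text \<open>For a_0 \<omega> with \<omega> a product of differentials, sd returns (a_0 - pr a_0)
  \<omega>. In positive degree ds returns the missing pr a_0 times \<omega>; in degree 0 it vanishes
  and the scalar remains.\<close>

lemma homotopy: "s_op (d_form f) + d_form (s_op f) \<simeq>[FI] f - pi_op f"
  unfolding eqv_def
proof (rule falg_mem[of "\<lambda>f. s_op (d_form f) + d_form (s_op f) - (f - pi_op f)"])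
  fix w :: "'a form list"
  have "s_op (d_form (mon w)) + d_form (s_op (mon w)) \<simeq>[FI] mon w - pi_op (mon w)"
  proof (rule std_form_eqv[OF piece_mon', of "\<lambda>f. s_op (d_form f) + d_form (s_op f)" "\<lambda>f. f - pi_op f"])
    fix a0 :: 'a and as :: "'a list"
    have "s_op (d_form (std_form a0 as)) \<simeq>[FI] s_op (std_form 1 (a0 # as))"
      unfolding d_std_form by (intro s_cong F.sym[OF std_form_one])
    also have "\<dots> \<simeq>[FI] s_formula 1 (a0 # as)" by (rule s_std)
    also have "\<dots> = std_form (a0 - sc (pr a0) 1) as" by (simp add: s_formula_def)
    also have "\<dots> \<simeq>[FI] (F.el a0 - smul (pr a0) 1) * mon (map Df as)"
      unfolding std_form_Cons
      by (intro F.mult F.refl F.trans[OF F.el_diff] F.diff F.el_scalar)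
    also have "\<dots> = std_form a0 as - smul (pr a0) (mon (map Df as))"
      by (simp add: std_form_Cons left_diff_distrib smul_mult_left)
    finally have 1: "s_op (d_form (std_form a0 as)) \<simeq>[FI] \<dots>" .
    have 2: "d_form (s_op (std_form a0 as)) \<simeq>[FI] smul (pr a0) (mon (map Df as)) - pi_op (std_form a0 as)"
    proof (cases as)
      case Nil
      have "pi_op (std_form a0 []) = (smul (pr a0) 1 :: ('a, 'k) nc_forms)"
        using on_normal_std_form[OF submod_0 admissible_pi, of a0 "[]"] by (simp add: pi_op_def eqv_def)
      then show ?thesis
        using d_cong[OF s_std[of a0 "[]"]] by (simp add: Nil s_formula_def op_simps)
    next
      case (Cons a as')
      have pi: "pi_op (std_form a0 as) = (0 :: ('a, 'k) nc_forms)"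
        by (rule pi_pos[OF std_form_piece]) (simp add: Cons)
      have "d_form (s_op (std_form a0 as)) \<simeq>[FI] d_form (s_formula a0 as)"
        by (intro d_cong s_std)
      also have "\<dots> = smul (pr a0) (mon (map Df ((a - sc (pr a) 1) # as')))"
        by (simp add: Cons s_formula_def op_simps d_std_form)
      also have "\<dots> = smul (pr a0) (F.df (a - sc (pr a) 1) * mon (map Df as'))"
        by (simp flip: mon_Cons)
      also have "\<dots> \<simeq>[FI] smul (pr a0) ((F.df a - 0) * mon (map Df as'))"
        by (intro F.scale F.mult F.refl F.trans[OF F.df_diff] F.diff F.df_scalar)
      finally show ?thesis by (simp add: pi[unfolded Cons] Cons flip: mon_Cons)
    qed
    show "s_op (d_form (std_form a0 as)) + d_form (s_op (std_form a0 as)) \<simeq>[FI] std_form a0 as - pi_op (std_form a0 as)"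
      using F.add[OF 1 2] by simp
  qed (auto intro!: klin_intros F.sub intro: F.closed s_FI d_FI simp: pi_FI)
  then show "s_op (d_form (mon w)) + d_form (s_op (mon w)) - (mon w - pi_op (mon w)) \<in> FI"
    by (simp add: eqv_def)
qed (auto intro!: klin_intros F.sub)

end

section \<open>Reduced forms\<close>

lemma forms_relations_homogeneous: "r \<in> form_relations sc J (\<lambda>l. l) \<Longrightarrow> \<exists>p. r \<in> piece fdeg p"
  by (rule form_relations_piece[of _ _ _ _ _ 1]) auto

definition proj_deg :: "('g \<Rightarrow> nat) \<Rightarrow> int \<Rightarrow> ('g, 'k::comm_ring_1) falg \<Rightarrow> ('g, 'k) falg" where
  "proj_deg deg p = lin (\<lambda>w. if int (wdeg deg w) = p then Poly_Mapping.single w 1 else 0)"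

lemma klin_proj_deg [klin_intros]: "klin g \<Longrightarrow> klin (\<lambda>x. proj_deg deg p (g x))"
  unfolding proj_deg_def by (rule klin_lin')

lemma proj_deg_same: "f \<in> piece deg p \<Longrightarrow> proj_deg deg q f = (if p = q then f else 0)"
  by (rule piece_eqI[of f deg p "proj_deg deg q" "\<lambda>f. if p = q then f else 0"])
     (auto intro!: klin_intros klin_lin simp: proj_deg_def mon_def wdeg_def)

lemma proj_deg_ideal:
  assumes "\<And>r. r \<in> S \<Longrightarrow> \<exists>p. r \<in> piece deg p" "x \<in> ideal_k S"
  shows "proj_deg deg q x \<in> ideal_k S"
proof (rule ideal_k_mem[OF klin_proj_deg[OF klin_id] _ _ assms(2)])
  interpret tsideal "ideal_k S" by (rule tsideal_ideal_k)
  show "submod (ideal_k S)" by (rule sub)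
  fix u v r assume r: "r \<in> S"
  then obtain p where p: "r \<in> piece deg p" using assms(1) by auto
  show "proj_deg deg q (mon u * r * mon v) \<in> ideal_k S"
    unfolding proj_deg_same[OF piece_mult[OF piece_mult[OF piece_mon' p] piece_mon']]
    using absorb3[OF ideal_k_base[OF r]] closed(5) by simp
qed

context k_alg
begin

abbreviation "ON \<equiv> omega_null sc"
abbreviation "DN \<equiv> dr_null sc"

sublocale O: submodule ON by unfold_locales (simp add: omega_null_def)
sublocale DR: submodule DN by unfold_locales (simp add: dr_null_def)

lemma FI_ON: "FI \<subseteq> ON" unfolding omega_null_def using span_k_base by blast
lemma ON_DN: "ON \<subseteq> DN" unfolding omega_null_def dr_null_def by (rule span_k_mono) auto
lemma one_ON: "1 \<in> ON" unfolding omega_null_def by (rule span_k_base) auto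

lemma ON_mem:
  assumes "klin L" "submod W" "\<And>x. x \<in> FI \<Longrightarrow> L x \<in> W" "L 1 \<in> W" "x \<in> ON"
  shows "L x \<in> W"
  by (rule klin_span[OF assms(1,2) _ assms(5)[unfolded omega_null_def]]) (use assms in auto)

lemma FI_O: "x \<simeq>[FI] y \<Longrightarrow> x \<simeq>[ON] y" by (rule eqv_mono[OF FI_ON])

lemma bO: "x \<simeq>[ON] y \<Longrightarrow> b_op x \<simeq>[ON] b_op y"
  by (rule O.klin[OF klin_b_op[OF klin_id] ON_mem[OF klin_b_op[OF klin_id] O.sub]])
     (use b_FI FI_ON O.closed(5) in \<open>auto simp: b_op_formula\<close>)
lemma dO: "x \<simeq>[ON] y \<Longrightarrow> d_form x \<simeq>[ON] d_form y"
  by (rule O.klin[OF klin_d_form[OF klin_id] ON_mem[OF klin_d_form[OF klin_id] O.sub]])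
     (use d_FI FI_ON O.closed(5) in auto)
lemma kO: "x \<simeq>[ON] y \<Longrightarrow> kappa x \<simeq>[ON] kappa y"
  by (rule O.trans[OF O.trans[OF FI_O[OF kappa_bd] O.diff[OF O.diff[OF _ bO[OF dO]] dO[OF bO]]] O.sym[OF FI_O[OF kappa_bd]]])
lemma kpO: "x \<simeq>[ON] y \<Longrightarrow> (kappa ^^ n) x \<simeq>[ON] (kappa ^^ n) y"
  by (induction n) (auto intro: kO)

text \<open>The norm operator of \<kappa>. In degree n, B is \<open>Nk (Suc n)\<close> after d, and
  i is b after \<open>Nk n\<close>.\<close>

definition Nk :: "nat \<Rightarrow> ('a, 'k) nc_forms \<Rightarrow> ('a, 'k) nc_forms" where
  "Nk n x = (\<Sum>j<n. (kappa ^^ j) x)"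

lemma klin_Nk [klin_intros]: "klin g \<Longrightarrow> klin (\<lambda>x. Nk n (g x))"
  unfolding Nk_def by (intro klin_intros)

lemmas Nk_simps = klin_add[OF klin_Nk[OF klin_id]] klin_diff[OF klin_Nk[OF klin_id]] klin_smul[OF klin_Nk[OF klin_id]]
  klin_zero[OF klin_Nk[OF klin_id]] klin_neg[OF klin_Nk[OF klin_id]]

lemma NO: "x \<simeq>[ON] y \<Longrightarrow> Nk n x \<simeq>[ON] Nk n y"
  unfolding Nk_def by (intro O.sum kpO)

lemma Nk_piece: "f \<in> piece fdeg p \<Longrightarrow> Nk n f \<in> piece fdeg p"
  unfolding Nk_def by (intro piece_sum kappa_pow_piece)

lemma Nk_tele: "Nk n x - kappa (Nk n x) = x - (kappa ^^ n) x"
proof (induction n)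
  case (Suc n)
  have "Nk (Suc n) x = Nk n x + (kappa ^^ n) x" by (simp add: Nk_def)
  then have "Nk (Suc n) x - kappa (Nk (Suc n) x) = (Nk n x - kappa (Nk n x)) + ((kappa ^^ n) x - (kappa ^^ Suc n) x)"
    by (simp add: op_simps)
  then show ?case unfolding Suc by simp
qed (simp add: Nk_def op_simps)

lemma Nk_kappa: "kappa (Nk n x) = Nk n (kappa x)"
  by (simp add: Nk_def op_simps funpow_swap1)

lemma Nk_inv: "kappa x \<simeq>[ON] x \<Longrightarrow> Nk n x \<simeq>[ON] smul (of_nat n) x"
proof -
  assume k: "kappa x \<simeq>[ON] x"
  have "(kappa ^^ j) x \<simeq>[ON] x" for j
    by (induction j) (auto intro: O.trans[OF kO k])
  then have "Nk n x \<simeq>[ON] (\<Sum>j<n. x)" unfolding Nk_def by (intro O.sum)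
  also have "(\<Sum>j<n. x) = smul (of_nat n) x"
    by (induction n) (simp_all add: smul.scale_left_distrib del: sum_constant)
  finally show ?thesis .
qed

text \<open>By \<kappa> = 1 - bd - db and dd = 0 both sides equal d - dbd. The lemma for b is the
  same with b - bdb.\<close>

lemma d_kappa: "d_form (kappa x) \<simeq>[ON] kappa (d_form x)"
proof (rule FI_O)
  have "d_form (kappa x) \<simeq>[FI] d_form x - d_form (b_op (d_form x))"
    using d_cong[OF kappa_bd[of x]] by (simp add: op_simps)
  moreover have "kappa (d_form x) \<simeq>[FI] d_form x - d_form (b_op (d_form x))"
    using kappa_bd[of "d_form x"] by (simp add: op_simps)
  ultimately show "d_form (kappa x) \<simeq>[FI] kappa (d_form x)" by (rule F.trans[OF _ F.sym])
qed

lemma b_kappa: "x \<in> piece fdeg p \<Longrightarrow> b_op (kappa x) \<simeq>[ON] kappa (b_op x)"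
proof (rule FI_O)
  assume x: "x \<in> piece fdeg p"
  have "b_op (kappa x) \<simeq>[FI] b_op x - b_op (b_op (d_form x)) - b_op (d_form (b_op x))"
    using b_cong[OF kappa_bd[of x]] by (simp add: op_simps)
  also have "\<dots> \<simeq>[FI] b_op x - 0 - b_op (d_form (b_op x))"
    by (intro F.diff F.refl) (use b_b[OF d_piece[OF x]] in \<open>simp add: F.iff0\<close>)
  finally have 1: "b_op (kappa x) \<simeq>[FI] b_op x - 0 - b_op (d_form (b_op x))" .
  have "kappa (b_op x) \<simeq>[FI] b_op x - b_op (d_form (b_op x)) - d_form (b_op (b_op x))"
    by (rule kappa_bd)
  also have "\<dots> \<simeq>[FI] b_op x - b_op (d_form (b_op x)) - 0"
    by (intro F.diff F.refl) (use d_FI[OF b_b[OF x]] in \<open>simp add: F.iff0\<close>)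
  finally have "kappa (b_op x) \<simeq>[FI] b_op x - 0 - b_op (d_form (b_op x))" by simp
  then show "b_op (kappa x) \<simeq>[FI] kappa (b_op x)" by (rule F.trans[OF 1 F.sym])
qed

lemma d_kappa_pow: "d_form ((kappa ^^ n) x) \<simeq>[ON] (kappa ^^ n) (d_form x)"
  by (induction n) (simp_all add: O.trans[OF d_kappa kO])

lemma b_kappa_pow: "x \<in> piece fdeg p \<Longrightarrow> b_op ((kappa ^^ n) x) \<simeq>[ON] (kappa ^^ n) (b_op x)"
proof (induction n)
  case (Suc n)
  then show ?case using O.trans[OF b_kappa[OF kappa_pow_piece[OF Suc.prems]] kO[OF Suc.IH]] by simp
qed simp

lemma d_Nk: "d_form (Nk n x) \<simeq>[ON] Nk n (d_form x)"
  unfolding Nk_def klin_sum[OF klin_d_form[OF klin_id]] by (rule O.sum) (rule d_kappa_pow)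

lemma b_Nk: "x \<in> piece fdeg p \<Longrightarrow> b_op (Nk n x) \<simeq>[ON] Nk n (b_op x)"
  unfolding Nk_def klin_sum[OF klin_b_op[OF klin_id]] by (rule O.sum) (rule b_kappa_pow)

lemma bbO: "x \<in> piece fdeg p \<Longrightarrow> b_op (b_op x) \<simeq>[ON] 0"
  using subsetD[OF FI_ON b_b] by (simp add: O.iff0[symmetric])

lemma BO_Nk: "x \<in> piece fdeg (int n) \<Longrightarrow> B_op x \<simeq>[ON] Nk (Suc n) (d_form x)"
  using FI_O[OF B_kappa] by (simp add: Nk_def lessThan_Suc_atMost)

lemma B_piece:
  fixes f :: "('a, 'k) nc_forms"
  shows "f \<in> piece fdeg p \<Longrightarrow> B_op f \<in> piece fdeg (p + 1)"
  unfolding B_op_def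
proof (rule on_normal_mem)
  fix a0 :: 'a and as :: "'a list" assume "int (length as) = p"
  then show "(\<Sum>j\<le>length as. (kappa ^^ j) (d_form (std_form a0 as))) \<in> piece fdeg (p + 1)"
    by (intro piece_sum kappa_pow_piece) (erule subst, rule d_piece[OF std_form_piece])
qed auto

text \<open>\<open>bB + Bb = N (bd + db) + \<kappa>\<^sup>n b d = 1 - \<kappa>\<^sup>n + b \<kappa>\<^sup>n d\<close> on \<open>\<Omega>\<^sup>n\<close>.\<close>

lemma bB_Bb:
  assumes "x \<in> piece fdeg p"
  shows "b_op (B_op x) + B_op (b_op x) \<simeq>[ON] 0"
proof (cases "p \<le> 0")
  case True
  show ?thesis
  proof (cases "p = 0")
    case True
    have x: "x \<in> piece fdeg (int 0)" using assms True by simp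
    have "B_op x \<simeq>[ON] d_form x" using BO_Nk[OF x] by (simp add: Nk_def)
    then have "b_op (B_op x) \<simeq>[ON] b_op (d_form x)" by (rule bO)
    also have "\<dots> \<simeq>[ON] 0"
      using O.diff[OF O.sym[OF FI_O[OF kappa_n[OF x]]] O.refl[of x]] by simp
    finally show ?thesis using b_piece0[of x] assms True by (simp add: op_simps)
  next
    case False
    then have "x = 0" using True assms piece_neg_deg[of p x fdeg] by simp
    then show ?thesis by (simp add: op_simps)
  qed
next
  case False
  then have n': "p = int (Suc (nat (p - 1)))" by simp
  define n where "n = nat (p - 1)"
  have n: "p = int (Suc n)" using n' by (simp add: n_def)
  have x: "x \<in> piece fdeg (int (Suc n))" and bx: "b_op x \<in> piece fdeg (int n)"
    using assms b_piece[OF assms] by (simp_all add: n)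
  have "b_op (B_op x) \<simeq>[ON] b_op (Nk (Suc (Suc n)) (d_form x))" by (intro bO BO_Nk x)
  also have "\<dots> = b_op (Nk (Suc n) (d_form x)) + b_op ((kappa ^^ Suc n) (d_form x))"
    by (simp add: Nk_def op_simps)
  also have "\<dots> \<simeq>[ON] Nk (Suc n) (b_op (d_form x)) + ((kappa ^^ Suc n) x - x)"
  proof (rule O.add[OF b_Nk[OF d_piece[OF x]]])
    show "b_op ((kappa ^^ Suc n) (d_form x)) \<simeq>[ON] (kappa ^^ Suc n) x - x"
      using O.diff[OF O.sym[OF FI_O[OF kappa_n[OF x]]] O.refl[of x]] by simp
  qed
  finally have 1: "b_op (B_op x) \<simeq>[ON] Nk (Suc n) (b_op (d_form x)) + ((kappa ^^ Suc n) x - x)" .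
  have 2: "B_op (b_op x) \<simeq>[ON] Nk (Suc n) (d_form (b_op x))" by (rule BO_Nk[OF bx])
  have "b_op (B_op x) + B_op (b_op x) \<simeq>[ON] Nk (Suc n) (b_op (d_form x)) + ((kappa ^^ Suc n) x - x) + Nk (Suc n) (d_form (b_op x))"
    by (rule O.add[OF 1 2])
  also have "\<dots> = Nk (Suc n) (b_op (d_form x) + d_form (b_op x)) + ((kappa ^^ Suc n) x - x)"
    by (simp add: Nk_simps)
  also have "\<dots> \<simeq>[ON] Nk (Suc n) (x - kappa x) + ((kappa ^^ Suc n) x - x)"
  proof (intro O.add O.refl NO)
    show "b_op (d_form x) + d_form (b_op x) \<simeq>[ON] x - kappa x"
      using O.sym[OF O.diff[OF O.refl[of x] FI_O[OF kappa_bd[of x]]]] by (simp add: add.commute)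
  qed
  also have "\<dots> = 0"
    using Nk_tele[of "Suc n" x] by (simp add: Nk_simps Nk_kappa del: funpow.simps)
  finally show ?thesis .
qed

end

section \<open>Subquotients and homology\<close>

lemma lookup_scale_R [simp]: "Poly_Mapping.lookup (scale_R c x) r = smul c (Poly_Mapping.lookup x r)"
  unfolding scale_R_def by (transfer fixing: c) (auto simp: when_def)

interpretation scale_R: module "scale_R :: 'k::comm_ring_1 \<Rightarrow> ('x \<Rightarrow>\<^sub>0 'k) tensor_R \<Rightarrow> ('x \<Rightarrow>\<^sub>0 'k) tensor_R"
  by standard
     (rule poly_mapping_eqI; simp add: lookup_add smul.scale_left_distrib smul.scale_right_distrib)+

lemma lookup_map0: "f 0 = 0 \<Longrightarrow> Poly_Mapping.lookup (Poly_Mapping.map f x) r = f (Poly_Mapping.lookup x r)"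
  by transfer (auto simp: when_def)

lemma lookup_u_act: "Poly_Mapping.lookup (u_act x) r = Poly_Mapping.lookup x (Suc r)"
proof -
  have "{r. Poly_Mapping.lookup x (Suc r) \<noteq> 0} = Suc -` Poly_Mapping.keys x"
    by (auto simp: in_keys_iff)
  then have "finite {r. Poly_Mapping.lookup x (Suc r) \<noteq> 0}"
    by (simp add: finite_vimageI)
  then show ?thesis by (simp add: u_act_def)
qed

lemma lookup_mixed_diff: "f 0 = 0 \<Longrightarrow> g 0 = 0 \<Longrightarrow>
    Poly_Mapping.lookup (mixed_diff f g x) r = f (Poly_Mapping.lookup x r) - g (Poly_Mapping.lookup x (Suc r))"
  by (simp add: mixed_diff_def lookup_minus lookup_u_act lookup_map0)

lemma lookup_mixed_diff':
  "klin f \<Longrightarrow> klin g \<Longrightarrow> Poly_Mapping.lookup (mixed_diff f g x) r = f (Poly_Mapping.lookup x r) - g (Poly_Mapping.lookup x (Suc r))"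
  by (simp add: lookup_mixed_diff klin_zero)

lemma mixed_diff_linear:
  assumes "klin f" "klin g"
  shows "mixed_diff f g (x + y) = mixed_diff f g x + mixed_diff f g y"
    "mixed_diff f g (scale_R c x) = scale_R c (mixed_diff f g x)"
  by (rule poly_mapping_eqI; simp add: lookup_mixed_diff'[OF assms] lookup_add klin_add[OF assms(1)] klin_add[OF assms(2)]
      klin_smul[OF assms(1)] klin_smul[OF assms(2)] smul.scale_right_diff_distrib)+

abbreviation subspace_R :: "('x \<Rightarrow>\<^sub>0 'k::comm_ring_1) tensor_R set \<Rightarrow> bool" where
  "subspace_R \<equiv> scale_R.subspace"

lemma subspace_null_R: "submod W \<Longrightarrow> subspace_R (null_R W)"
  by (rule scale_R.subspaceI)
     (auto simp: null_R_def lookup_add smul.subspace_0 smul.subspace_add smul.subspace_scale)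

lemma subspace_homology:
  assumes "\<And>l. subspace_R (C l)" "subspace_R W"
    and D: "\<And>x y. D (x + y) = D x + D y" "\<And>c x. D (scale_R c x) = scale_R c (D x)"
  shows "subspace_R (fst (homology C W D l))" "subspace_R (snd (homology C W D l))"
proof -
  have D0: "D 0 = 0" using D(1)[of 0 0] by simp
  show "subspace_R (fst (homology C W D l))"
    by (rule scale_R.subspaceI)
       (auto simp: homology_def D D0 assms scale_R.subspace_0 scale_R.subspace_add scale_R.subspace_scale)
  show "subspace_R (snd (homology C W D l))"
  proof (rule scale_R.subspaceI)
    show "0 \<in> snd (homology C W D l)"
      unfolding homology_def snd_conv
      by (intro CollectI exI[of _ 0]) (simp add: D0 assms scale_R.subspace_0)
  next
    fix x y assume "x \<in> snd (homology C W D l)" "y \<in> snd (homology C W D l)"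
    then obtain a w b v where x: "x = D a + w" "a \<in> C (l + 1)" "w \<in> W \<inter> C l"
      and y: "y = D b + v" "b \<in> C (l + 1)" "v \<in> W \<inter> C l"
      by (auto simp: homology_def)
    have "x + y = D (a + b) + (w + v)" by (simp add: x y D algebra_simps)
    then show "x + y \<in> snd (homology C W D l)"
      unfolding homology_def snd_conv using x y assms
      by (intro CollectI exI[of _ "a + b"] exI[of _ "w + v"]) (simp add: scale_R.subspace_add)
  next
    fix c x assume "x \<in> snd (homology C W D l)"
    then obtain a w where x: "x = D a + w" "a \<in> C (l + 1)" "w \<in> W \<inter> C l"
      by (auto simp: homology_def)
    have "scale_R c x = D (scale_R c a) + scale_R c w" by (simp add: x D scale_R.scale_right_distrib)
    then show "scale_R c x \<in> snd (homology C W D l)"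
      unfolding homology_def snd_conv using x assms
      by (intro CollectI exI[of _ "scale_R c a"] exI[of _ "scale_R c w"]) (simp add: scale_R.subspace_scale)
  qed
qed

text \<open>Three maps are treated this way: cyclic homology to the kernel of i, cyclic to extended
  cyclic homology, and the latter to Deligne cohomology. All are linear on representatives, so only
  the numerators and denominators need attention.\<close>

locale subquotient_map =
  S: module s + T: module t
  for s :: "'k::comm_ring_1 \<Rightarrow> 'x::ab_group_add \<Rightarrow> 'x" and t :: "'k \<Rightarrow> 'y::ab_group_add \<Rightarrow> 'y" +
  fixes M :: "'x subquotient" and N :: "'y subquotient" and f :: "'x \<Rightarrow> 'y"
  assumes fstM: "S.subspace (fst M)" and sndM: "S.subspace (snd M)" and sndN: "T.subspace (snd N)"
    and add: "\<And>x y. f (x + y) = f x + f y" and scale: "\<And>c x. f (s c x) = t c (f x)"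
    and fst_map: "\<And>x. x \<in> fst M \<Longrightarrow> f x \<in> fst N" and snd_map: "\<And>x. x \<in> snd M \<Longrightarrow> f x \<in> snd N"
begin

lemma induced_coset: "induced N f (coset M x) = coset N (f x)"
proof (intro equalityI subsetI)
  fix z assume "z \<in> induced N f (coset M x)"
  then obtain b c where "b \<in> snd M" "c \<in> snd N" "z = f (x + b) + c" by (auto simp: induced_def coset_def)
  then show "z \<in> coset N (f x)"
    unfolding coset_def using snd_map T.subspace_add[OF sndN]
    by (intro CollectI exI[of _ "f b + c"]) (simp add: add add.assoc)
next
  fix z assume "z \<in> coset N (f x)"
  then obtain c where "c \<in> snd N" "z = f x + c" by (auto simp: coset_def)
  then show "z \<in> induced N f (coset M x)"
    unfolding induced_def coset_def using S.subspace_0[OF sndM]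
    by (intro CollectI exI[of _ x] exI[of _ c]) force
qed

end

lemma coset_add_coset:
  assumes "module s" "module.subspace s (snd M)"
  shows "coset_add M (coset M x) (coset M y) = coset M (x + y)"
proof -
  interpret module s by fact
  have "z \<in> coset M (x + y)" if "z \<in> coset_add M (coset M x) (coset M y)" for z
  proof -
    from that obtain a b c where "a \<in> snd M" "b \<in> snd M" "c \<in> snd M" "z = (x + a) + (y + b) + c"
      by (auto simp: coset_add_def coset_def)
    then show ?thesis unfolding coset_def using subspace_add[OF assms(2)]
      by (intro CollectI exI[of _ "a + b + c"]) (simp add: algebra_simps)
  qed
  moreover have "z \<in> coset_add M (coset M x) (coset M y)" if "z \<in> coset M (x + y)" for z
  proof -
    from that obtain c where "c \<in> snd M" "z = x + y + c" by (auto simp: coset_def)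
    then show ?thesis unfolding coset_add_def coset_def using subspace_0[OF assms(2)]
      by (intro CollectI exI[of _ x] exI[of _ y] exI[of _ c]) force
  qed
  ultimately show ?thesis by blast
qed

lemma coset_scale_coset:
  assumes "module s" "module.subspace s (snd M)"
  shows "coset_scale s M c (coset M x) = coset M (s c x)"
proof -
  interpret module s by fact
  have "z \<in> coset M (s c x)" if "z \<in> coset_scale s M c (coset M x)" for z
  proof -
    from that obtain a b where "a \<in> snd M" "b \<in> snd M" "z = s c (x + a) + b"
      by (auto simp: coset_scale_def coset_def)
    then show ?thesis unfolding coset_def using subspace_add[OF assms(2) subspace_scale[OF assms(2)]]
      by (intro CollectI exI[of _ "s c a + b"]) (simp add: algebra_simps scale_right_distrib)
  qed
  moreover have "z \<in> coset_scale s M c (coset M x)" if "z \<in> coset M (s c x)" for z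
  proof -
    from that obtain b where "b \<in> snd M" "z = s c x + b" by (auto simp: coset_def)
    then show ?thesis unfolding coset_scale_def coset_def using subspace_0[OF assms(2)]
      by (intro CollectI exI[of _ x] exI[of _ b]) force
  qed
  ultimately show ?thesis by blast
qed

lemma coset_eq_iff:
  assumes "module s" "module.subspace s (snd M)"
  shows "coset M x = coset M y \<longleftrightarrow> x - y \<in> snd M"
proof
  interpret module s by fact
  assume "coset M x = coset M y"
  moreover have "x \<in> coset M x" unfolding coset_def using subspace_0[OF assms(2)] by force
  ultimately show "x - y \<in> snd M" by (auto simp: coset_def)
next
  interpret module s by fact
  have *: "coset M x \<subseteq> coset M y" if "x - y \<in> snd M" for x y
  proof
    fix z assume "z \<in> coset M x"
    then obtain b where "b \<in> snd M" "z = x + b" by (auto simp: coset_def)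
    then show "z \<in> coset M y" unfolding coset_def using subspace_add[OF assms(2) that]
      by (intro CollectI exI[of _ "x - y + b"]) simp
  qed
  assume "x - y \<in> snd M"
  moreover from this have "y - x \<in> snd M" using subspace_neg[OF assms(2)] by fastforce
  ultimately show "coset M x = coset M y" using * by blast
qed

context subquotient_map
begin

lemma k_linear_induced: "k_linear s t M N (induced N f)"
  unfolding k_linear_def
proof (intro conjI ballI allI)
  fix X assume "X \<in> elements M"
  then obtain x where x: "x \<in> fst M" "X = coset M x" by (auto simp: elements_def)
  then show "induced N f X \<in> elements N"
    using fst_map by (auto simp: induced_coset elements_def)
  show "induced N f (coset_scale s M c X) = coset_scale t N c (induced N f X)" for c
    by (simp add: x induced_coset coset_scale_coset[OF S.module_axioms sndM]
        coset_scale_coset[OF T.module_axioms sndN] scale)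
  fix Y assume "Y \<in> elements M"
  then obtain y where y: "y \<in> fst M" "Y = coset M y" by (auto simp: elements_def)
  show "induced N f (coset_add M X Y) = coset_add N (induced N f X) (induced N f Y)"
    by (simp add: x y induced_coset coset_add_coset[OF S.module_axioms sndM]
        coset_add_coset[OF T.module_axioms sndN] add)
qed

end

lemma k_linear_comp:
  assumes "k_linear s t M N \<phi>" "k_linear t u N P \<psi>"
  shows "k_linear s u M P (\<psi> \<circ> \<phi>)"
  using assms unfolding k_linear_def by simp

section \<open>Reduced cyclic homology\<close>

context k_alg
begin

text \<open>A commutator with a is b of f da up to sign, and one with da is (1 - \<kappa>)(f da),
  which lies in the image of bd + db. For longer words [f, l v] is [f l, v] plus or minus
  [v f, l].\<close>

lemma commutators_bd:
  assumes "f \<in> piece fdeg p"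
  shows "\<exists>g h. g \<in> piece fdeg (p + int (sum_list (map fdeg v)) + 1) \<and> h \<in> piece fdeg (p + int (sum_list (map fdeg v)) - 1) \<and>
    f * mon v - sg (p * int (sum_list (map fdeg v))) * (mon v * f) \<simeq>[FI] b_op g + d_form h"
  using assms
proof (induction v arbitrary: f p)
  case Nil
  show ?case by (rule exI[of _ 0], rule exI[of _ 0]) (simp add: op_simps)
next
  case (Cons l v)
  define q where "q = int (sum_list (map fdeg v))"
  have 1: "\<exists>g h. g \<in> piece fdeg (p + int (fdeg l) + 1) \<and> h \<in> piece fdeg (p + int (fdeg l) - 1) \<and>
    f * gen l - sg (p * int (fdeg l)) * (gen l * f) \<simeq>[FI] b_op g + d_form h" if f: "f \<in> piece fdeg p" for f p
  proof (cases l)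
    case (El a)
    have "sg p * b_op (f * F.df a) \<simeq>[FI] sg p * (sg p * (f * F.el a - F.el a * f))"
      by (intro F.mult F.refl b_snoc f)
    then have "b_op (sg p * (f * F.df a)) + d_form 0 \<simeq>[FI] f * F.el a - F.el a * f"
      by (simp add: klin_sgI[OF klin_b_op[OF klin_id]] op_simps) (simp flip: mult.assoc)
    then have "f * F.el a - F.el a * f \<simeq>[FI] b_op (sg p * (f * F.df a)) + d_form 0" by (rule F.sym)
    then show ?thesis
      by (intro exI[of _ "sg p * (f * F.df a)"] exI[of _ 0])
         (auto simp: El intro!: piece_sg piece_mult'[OF f Df1_piece])
  next
    case (Df a)
    have X: "f * F.df a \<in> piece fdeg (p + 1)" by (rule piece_mult'[OF f Df1_piece]) simp
    have "f * F.df a - sg p * (F.df a * f) \<simeq>[FI] f * F.df a - (f * F.df a - b_op (d_form (f * F.df a)) - d_form (b_op (f * F.df a)))"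
      by (intro F.diff F.refl F.sym[OF kappa_formula[OF f]])
    then have "f * F.df a - sg p * (F.df a * f) \<simeq>[FI] b_op (d_form (f * F.df a)) + d_form (b_op (f * F.df a))"
      by (simp add: add.commute)
    then show ?thesis
      using d_piece[OF X] b_piece[OF X]
      by (intro exI[of _ "d_form (f * F.df a)"] exI[of _ "b_op (f * F.df a)"]) (simp add: Df)
  qed
  have fl: "f * gen l \<in> piece fdeg (p + int (fdeg l))" by (intro piece_mult Cons.prems) (simp add: piece_mon)
  have vf: "mon v * f \<in> piece fdeg (q + p)" unfolding q_def by (intro piece_mult Cons.prems piece_mon')
  from Cons.IH[OF fl] obtain g h where gh: "g \<in> piece fdeg (p + int (fdeg l) + q + 1)" "h \<in> piece fdeg (p + int (fdeg l) + q - 1)"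
    "f * gen l * mon v - sg ((p + int (fdeg l)) * q) * (mon v * (f * gen l)) \<simeq>[FI] b_op g + d_form h" unfolding q_def by blast
  from 1[OF vf] obtain g' h' where gh': "g' \<in> piece fdeg (q + p + int (fdeg l) + 1)" "h' \<in> piece fdeg (q + p + int (fdeg l) - 1)"
    "mon v * f * gen l - sg ((q + p) * int (fdeg l)) * (gen l * (mon v * f)) \<simeq>[FI] b_op g' + d_form h'" by blast
  let ?s = "sg ((p + int (fdeg l)) * q)"
  have "f * mon (l # v) - sg (p * int (sum_list (map fdeg (l # v)))) * (mon (l # v) * f) =
    (f * gen l * mon v - ?s * (mon v * (f * gen l)))
    + ?s * (mon v * f * gen l - sg ((q + p) * int (fdeg l)) * (gen l * (mon v * f)))"
    unfolding mon_Cons[of l v]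
    by (cases "even p"; cases "even q"; cases "even (fdeg l)")
       (auto simp: sg_def algebra_simps simp flip: q_def)
  also have "\<dots> \<simeq>[FI] (b_op g + d_form h) + ?s * (b_op g' + d_form h')"
    by (intro F.add F.mult F.refl gh gh')
  also have "\<dots> = b_op (g + ?s * g') + d_form (h + ?s * h')"
    by (simp add: op_simps klin_sgI[OF klin_b_op[OF klin_id]] klin_sgI[OF klin_d_form[OF klin_id]] distrib_left)
  finally show ?case
    using gh(1,2) gh'(1,2)
    by (intro exI[of _ "g + ?s * g'"] exI[of _ "h + ?s * h'"])
       (auto simp: q_def ac_simps intro!: piece_add piece_sg)
qed

text \<open>Zero elements of DR modulo exact forms in degree l, with commutators replaced by the
  image of b. In this form they can be compared with boundaries for b - uB.\<close>

definition bd_null :: "int \<Rightarrow> ('a, 'k) nc_forms set" where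
  "bd_null l = {b_op g + d_form h + w | g h w. g \<in> piece fdeg (l + 1) \<and> h \<in> piece fdeg (l - 1) \<and> w \<in> ON}"

lemma bd_nullI: "g \<in> piece fdeg (l + 1) \<Longrightarrow> h \<in> piece fdeg (l - 1) \<Longrightarrow> x \<simeq>[ON] b_op g + d_form h \<Longrightarrow> x \<in> bd_null l"
  unfolding bd_null_def eqv_def
  by (rule CollectI, rule exI[of _ g], rule exI[of _ h], rule exI[of _ "x - (b_op g + d_form h)"]) simp

lemma bd_nullE:
  assumes "x \<in> bd_null l"
  obtains g h where "g \<in> piece fdeg (l + 1)" "h \<in> piece fdeg (l - 1)" "x \<simeq>[ON] b_op g + d_form h"
  using assms unfolding bd_null_def eqv_def by auto

lemma submod_bd_null: "submod (bd_null l)"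
proof (rule smul.subspaceI)
  show "0 \<in> bd_null l" by (rule bd_nullI[of 0 _ 0]) (auto simp: op_simps)
next
  fix x y assume "x \<in> bd_null l" "y \<in> bd_null l"
  then obtain g h g' h' where "g \<in> piece fdeg (l + 1)" "h \<in> piece fdeg (l - 1)" "x \<simeq>[ON] b_op g + d_form h"
    "g' \<in> piece fdeg (l + 1)" "h' \<in> piece fdeg (l - 1)" "y \<simeq>[ON] b_op g' + d_form h'"
    by (elim bd_nullE)
  then show "x + y \<in> bd_null l"
    using O.add[of x "b_op g + d_form h" y "b_op g' + d_form h'"]
    by (intro bd_nullI[of "g + g'" _ "h + h'"]) (auto simp: op_simps add.assoc add.left_commute)
next
  fix c x assume "x \<in> bd_null l"
  then obtain g h where "g \<in> piece fdeg (l + 1)" "h \<in> piece fdeg (l - 1)" "x \<simeq>[ON] b_op g + d_form h"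
    by (elim bd_nullE)
  then show "smul c x \<in> bd_null l"
    using O.scale[of x "b_op g + d_form h" c]
    by (intro bd_nullI[of "smul c g" _ "smul c h"]) (auto simp: op_simps smul.scale_right_distrib)
qed

lemma proj_deg_FI: "x \<in> FI \<Longrightarrow> proj_deg fdeg q x \<in> FI"
  unfolding forms_ideal_def by (rule proj_deg_ideal[OF forms_relations_homogeneous])

text \<open>The spanning set of \<open>dr_null\<close> is not confined to degree l, so membership is
  proved for the projection to degree l, which fixes x.\<close>

lemma DN_bd_null:
  assumes "x \<in> DN" "x \<in> piece fdeg l"
  shows "x \<in> bd_null l"
proof -
  have ON_bd: "w \<in> bd_null l" if "w \<in> ON" for w
    using that by (intro bd_nullI[of 0 _ 0]) (auto simp: op_simps O.iff0[symmetric])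
  have "proj_deg fdeg l x \<in> bd_null l"
  proof (rule klin_span[OF klin_proj_deg[OF klin_id] submod_bd_null _ assms(1)[unfolded dr_null_def]])
    fix s :: "('a, 'k) nc_forms" assume "s \<in> FI \<union> supercommutators fdeg \<union> {1}"
    then consider "s \<in> FI" | "s \<in> supercommutators fdeg" | "s = 1" by auto
    then show "proj_deg fdeg l s \<in> bd_null l"
    proof cases
      case 1
      then show ?thesis using proj_deg_FI FI_ON by (intro ON_bd) auto
    next
      case 3
      then show ?thesis using one_ON O.closed(5) by (intro ON_bd) (simp add: proj_deg_same[OF piece_one])
    next
      case 2
      then show ?thesis
      proof (rule supercommutators_mem[OF klin_proj_deg[OF klin_id] submod_bd_null, rotated])
        fix u v :: "'a form list"
        let ?p = "int (sum_list (map fdeg u))" and ?q = "int (sum_list (map fdeg v))"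
        let ?c = "mon u * mon v - sg (?p * ?q) * (mon v * mon u) :: ('a, 'k) nc_forms"
        from commutators_bd[OF piece_mon', of u v] obtain g h where
          gh: "g \<in> piece fdeg (?p + ?q + 1)" "h \<in> piece fdeg (?p + ?q - 1)" "?c \<simeq>[FI] b_op g + d_form h" by blast
        have "?c \<in> piece fdeg (?p + ?q)"
          by (intro piece_diff piece_sg piece_mult'[OF piece_mon' piece_mon']) simp_all
        moreover have "?c \<in> bd_null (?p + ?q)" by (rule bd_nullI[OF gh(1,2) FI_O[OF gh(3)]])
        ultimately show "proj_deg fdeg l ?c \<in> bd_null l"
          using smul.subspace_0[OF submod_bd_null] by (auto simp: proj_deg_same)
      qed
    qed
  qed
  then show ?thesis by (simp add: proj_deg_same[OF assms(2)])
qed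

lemma FI_DN: "FI \<subseteq> DN" using FI_ON ON_DN by blast

lemma b_DN:
  assumes "f \<in> piece fdeg p"
  shows "b_op f \<in> DN"
proof (rule std_form_mem[OF assms, of b_op])
  fix a0 :: 'a and as :: "'a list"
  show "b_op (std_form a0 as) \<in> DN"
  proof (cases as rule: rev_exhaust)
    case (snoc as' a)
    have "std_form a0 as' * F.el a - sg (int (length as') * 0) * (F.el a * std_form a0 as') \<in> span_k (supercommutators fdeg)"
      by (rule supercommutators_span[OF std_form_piece El_piece])
    moreover have "span_k (supercommutators fdeg) \<subseteq> DN" unfolding dr_null_def by (rule span_k_mono) auto
    ultimately have "std_form a0 as' * F.el a - F.el a * std_form a0 as' \<in> DN" by auto
    then have "sg (int (length as')) * (std_form a0 as' * F.el a - F.el a * std_form a0 as') \<in> DN"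
      using DR.closed(3)[of "std_form a0 as' * F.el a - F.el a * std_form a0 as'"] by (auto simp: sg_def)
    moreover have "b_op (std_form a0 as) \<simeq>[DN] sg (int (length as')) * (std_form a0 as' * F.el a - F.el a * std_form a0 as')"
      using eqv_mono[OF FI_DN b_snoc[OF std_form_piece]] by (simp add: snoc std_form_snoc)
    ultimately show ?thesis using DR.mem_cong by blast
  qed (simp add: DR.closed(5))
qed (use b_FI FI_DN in \<open>auto intro!: klin_intros DR.sub\<close>)

end

section \<open>Construction and uniqueness of cycles for b - uB\<close>

locale cyclic = split_alg sc pr + rat_alg \<rho>
  for sc :: "'k::comm_ring_1 \<Rightarrow> 'a::ring_1 \<Rightarrow> 'a" and pr and \<rho> :: "rat \<Rightarrow> 'k"
begin

lemma pi_ON: "pi_op f \<in> ON"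
  unfolding pi_op_def
  by (rule on_normal_mem'[OF O.sub]) (use one_ON in \<open>simp add: O.closed\<close>)

lemma s_one: "s_op 1 = 0"
  by (simp add: s_op_def s_formula_def)

lemma sO: "x \<simeq>[ON] y \<Longrightarrow> s_op x \<simeq>[ON] s_op y"
  by (rule O.klin[OF klin_s_op[OF klin_id] ON_mem[OF klin_s_op[OF klin_id] O.sub]])
     (use s_FI FI_ON O.closed(5) s_one in auto)

text \<open>The term \<pi> x of the homotopy formula is a scalar and vanishes in reduced
  forms.\<close>

lemma exact:
  assumes "d_form x \<simeq>[ON] 0"
  shows "x \<simeq>[ON] d_form (s_op x)"
proof -
  have "x - pi_op x \<simeq>[ON] s_op (d_form x) + d_form (s_op x)" by (rule O.sym[OF FI_O[OF homotopy]])
  also have "\<dots> \<simeq>[ON] 0 + d_form (s_op x)"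
    using sO[OF assms] by (intro O.add) (simp_all add: klin_zero[OF klin_s_op[OF klin_id]])
  finally have "(x - pi_op x) + pi_op x \<simeq>[ON] 0 + d_form (s_op x) + 0"
    by (rule O.add) (use pi_ON[of x] in \<open>simp add: O.iff0\<close>)
  then show ?thesis by simp
qed

lemma cancel:
  assumes "n > 0" "smul (of_nat n) x \<simeq>[ON] smul (of_nat n) y"
  shows "x \<simeq>[ON] y"
  using O.scale[OF assms(2), of "\<rho> (1 / of_nat n)"] by (simp only: smul_inverse[OF assms(1)])

text \<open>On \<open>d\<Omega>\<^sup>p\<^sup>-\<^sup>1\<close> one has \<open>\<kappa>\<^sup>p = 1\<close>, and \<open>1 - \<kappa>\<close> annihilates both \<open>B w\<close> and \<open>(1 - \<kappa>) X\<close>.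
  Hence \<open>X\<close> is invariant under \<open>\<kappa>\<close> and equals \<open>N X / p\<close>.\<close>

lemma closed_in_image_B:
  assumes X: "X \<in> piece fdeg p" and z: "z \<in> piece fdeg (p - 1)" "X \<simeq>[ON] d_form z"
    and w: "w \<in> piece fdeg (p - 2)" "b_op X \<simeq>[ON] B_op w"
  shows "\<exists>z'. z' \<in> piece fdeg (p - 1) \<and> X \<simeq>[ON] B_op z'"
proof (cases "p \<le> 0")
  case True
  then have "z = 0" using piece_neg_deg[of "p - 1" z fdeg] z(1) by simp
  then have "X \<simeq>[ON] B_op 0" using z(2) by (simp add: op_simps)
  then show ?thesis by (intro exI[of _ 0]) simp
next
  case False
  define n where "n = nat (p - 1)"
  have p: "p = int (Suc n)" using False by (simp add: n_def)
  have zn: "z \<in> piece fdeg (int n)" using z(1) p by simp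
  define e where "e = X - kappa X"
  have dX: "d_form X \<simeq>[ON] 0" using dO[OF z(2)] by simp
  have de: "d_form e \<simeq>[ON] 0"
  proof -
    have "d_form e \<simeq>[ON] d_form X - kappa (d_form X)"
      unfolding e_def op_simps by (rule O.diff[OF O.refl d_kappa])
    also have "\<dots> \<simeq>[ON] 0 - kappa 0" by (rule O.diff[OF dX kO[OF dX]])
    finally show ?thesis by (simp add: op_simps)
  qed
  have kBw: "B_op w - kappa (B_op w) \<simeq>[ON] 0"
  proof (cases n)
    case 0
    then have "w = 0" using w(1) piece_neg_deg[of "p - 2" w fdeg] p by simp
    then show ?thesis by (simp add: op_simps)
  next
    case (Suc m)
    then have wm: "w \<in> piece fdeg (int m)" using w(1) p by simp
    have "B_op w - kappa (B_op w) \<simeq>[ON] Nk (Suc m) (d_form w) - kappa (Nk (Suc m) (d_form w))"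
      by (rule O.diff[OF BO_Nk[OF wm] kO[OF BO_Nk[OF wm]]])
    also have "\<dots> = d_form w - (kappa ^^ Suc m) (d_form w)" by (rule Nk_tele)
    also have "\<dots> \<simeq>[ON] d_form w - d_form w" by (rule O.diff[OF O.refl FI_O[OF kappa_n_d[OF wm]]])
    finally show ?thesis by simp
  qed
  have be: "b_op e \<simeq>[ON] 0"
  proof -
    have "b_op e \<simeq>[ON] b_op X - kappa (b_op X)"
      unfolding e_def op_simps by (rule O.diff[OF O.refl b_kappa[OF X]])
    also have "\<dots> \<simeq>[ON] B_op w - kappa (B_op w)" by (rule O.diff[OF w(2) kO[OF w(2)]])
    also have "\<dots> \<simeq>[ON] 0" by (rule kBw)
    finally show ?thesis .
  qed
  \<comment> \<open>Both b and d annihilate e, so \<kappa> = 1 - bd - db fixes it. Its norm is then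
    p e, which is also (1 - \<kappa>^p) X = 0.\<close>
  have ke: "kappa e \<simeq>[ON] e"
  proof -
    have "kappa e \<simeq>[ON] e - b_op (d_form e) - d_form (b_op e)" by (rule FI_O[OF kappa_bd])
    also have "\<dots> \<simeq>[ON] e - b_op 0 - d_form 0" by (rule O.diff[OF O.diff[OF O.refl bO[OF de]] dO[OF be]])
    finally show ?thesis by (simp add: op_simps)
  qed
  have "smul (of_nat (Suc n)) e \<simeq>[ON] Nk (Suc n) e" by (rule O.sym[OF Nk_inv[OF ke]])
  also have "\<dots> = X - (kappa ^^ Suc n) X"
    using Nk_tele[of "Suc n" X] by (simp add: e_def Nk_simps Nk_kappa del: funpow.simps)
  also have "\<dots> \<simeq>[ON] d_form z - (kappa ^^ Suc n) (d_form z)" by (rule O.diff[OF z(2) kpO[OF z(2)]])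
  also have "\<dots> \<simeq>[ON] d_form z - d_form z" by (rule O.diff[OF O.refl FI_O[OF kappa_n_d[OF zn]]])
  finally have "smul (of_nat (Suc n)) e \<simeq>[ON] smul (of_nat (Suc n)) 0" by simp
  then have "e \<simeq>[ON] 0" by (rule cancel[rotated]) simp
  then have kX: "kappa X \<simeq>[ON] X" using O.diff[OF O.refl[of X], of e 0] by (simp add: e_def)
  have "smul (of_nat (Suc n)) X \<simeq>[ON] Nk (Suc n) X" by (rule O.sym[OF Nk_inv[OF kX]])
  also have "\<dots> \<simeq>[ON] Nk (Suc n) (d_form z)" by (rule NO[OF z(2)])
  also have "\<dots> \<simeq>[ON] B_op z" by (rule O.sym[OF BO_Nk[OF zn]])
  finally have "smul (\<rho> (1 / of_nat (Suc n))) (smul (of_nat (Suc n)) X) \<simeq>[ON] smul (\<rho> (1 / of_nat (Suc n))) (B_op z)"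
    by (rule O.scale)
  then have "X \<simeq>[ON] B_op (smul (\<rho> (1 / of_nat (Suc n))) z)"
    by (simp only: smul_inverse op_simps zero_less_Suc)
  then show ?thesis using z(1) by (intro exI[of _ "smul (\<rho> (1 / of_nat (Suc n))) z"]) (simp add: piece_smul)
qed

text \<open>If \<open>B X = 0\<close> then \<open>(1 - \<kappa>) G dX = dX\<close> for \<open>G = -\<Sum>\<^sub>j\<^sub><\<^sub>m j \<kappa>\<^sup>j / m\<close>, which inverts \<open>1 - \<kappa>\<close>
  on the kernel of \<open>N\<close> in \<open>d\<Omega>\<^sup>m\<^sup>-\<^sup>1\<close>.\<close>

lemma kernel_B:
  assumes X: "X \<in> piece fdeg (int n)" "B_op X \<simeq>[ON] 0"
  shows "\<exists>y. y \<in> piece fdeg (int n + 1) \<and> B_op y \<simeq>[ON] 0 \<and> d_form (X - b_op y) \<simeq>[ON] 0"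
proof -
  define m where "m = Suc n"
  define c where "c = \<rho> (1 / of_nat m)"
  define S where "S k u = (\<Sum>j<k. smul (of_nat j) ((kappa ^^ j) u))" for k and u :: "('a, 'k) nc_forms"
  define u where "u = d_form X"
  define y where "y = smul (- c) (S m u)"
  have u: "u \<in> piece fdeg (int n + 1)" unfolding u_def by (rule d_piece[OF X(1)])
  have yp: "y \<in> piece fdeg (int n + 1)"
    unfolding y_def S_def by (intro piece_smul piece_sum kappa_pow_piece u)
  have dy: "d_form y \<simeq>[ON] 0"
  proof -
    have "d_form (S m u) \<simeq>[ON] (\<Sum>j<m. smul (of_nat j) ((kappa ^^ j) (d_form u)))"
      unfolding S_def klin_sum[OF klin_d_form[OF klin_id]] klin_smul[OF klin_d_form[OF klin_id]]
      by (intro O.sum O.scale d_kappa_pow)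
    also have "\<dots> = 0" by (simp add: u_def op_simps)
    finally show ?thesis using O.scale[of "d_form (S m u)" 0 "- c"] by (simp add: y_def op_simps)
  qed
  \<comment> \<open>The form y is a combination of powers of \<kappa> applied to dX, hence closed,
    and B factors through d.\<close>
  have By: "B_op y \<simeq>[ON] 0"
  proof -
    have "B_op y \<simeq>[ON] Nk (Suc (Suc n)) (d_form y)" by (rule BO_Nk) (use yp in \<open>simp add: add.commute\<close>)
    also have "\<dots> \<simeq>[ON] Nk (Suc (Suc n)) 0" by (rule NO[OF dy])
    finally show ?thesis by (simp add: Nk_simps)
  qed
  have tele: "S (Suc k) u - kappa (S (Suc k) u) = Nk (Suc k) u - u - smul (of_nat k) ((kappa ^^ Suc k) u)" for k
  proof (induction k)
    case 0
    show ?case by (simp add: S_def Nk_def op_simps)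
  next
    case (Suc k)
    define v where "v = (kappa ^^ Suc k) u"
    have S: "S (Suc (Suc k)) u = S (Suc k) u + smul (of_nat (Suc k)) v"
      and N: "Nk (Suc (Suc k)) u = Nk (Suc k) u + v" and v: "(kappa ^^ Suc (Suc k)) u = kappa v"
      by (simp_all add: S_def Nk_def v_def)
    have "S (Suc (Suc k)) u - kappa (S (Suc (Suc k)) u)
        = (S (Suc k) u - kappa (S (Suc k) u)) + smul (of_nat (Suc k)) v - smul (of_nat (Suc k)) (kappa v)"
      unfolding S op_simps by simp
    also have "\<dots> = Nk (Suc (Suc k)) u - u - smul (of_nat (Suc k)) (kappa v)"
      unfolding Suc N v_def[symmetric] by (simp add: smul.scale_left_distrib)
    finally show ?case unfolding v .
  qed
  have mc: "c * of_nat m = 1" unfolding c_def m_def by (rule rho_inverse) simp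
  have Nu: "Nk m u \<simeq>[ON] 0"
    using O.trans[OF O.sym[OF BO_Nk[OF X(1)]] X(2)] by (simp add: m_def u_def)
  have ku: "(kappa ^^ m) u \<simeq>[ON] u"
    unfolding m_def u_def by (rule FI_O[OF kappa_n_d[OF X(1)]])
  have "y - kappa y = smul (- c) (S m u - kappa (S m u))"
    by (simp add: y_def op_simps smul.scale_right_diff_distrib)
  also have "S m u - kappa (S m u) = Nk m u - u - smul (of_nat n) ((kappa ^^ m) u)"
    unfolding m_def by (rule tele)
  also have "smul (- c) \<dots> \<simeq>[ON] smul (- c) (0 - u - smul (of_nat n) u)"
    by (intro O.scale O.diff Nu ku O.refl)
  also have "\<dots> = smul (c * of_nat m) u"
    by (simp add: m_def smul.scale_left_distrib smul.scale_right_diff_distrib smul.scale_right_distrib distrib_left)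
  also have "\<dots> = u" by (simp add: mc)
  finally have yu: "y - kappa y \<simeq>[ON] u" .
  have "d_form (b_op y) \<simeq>[ON] u"
  proof -
    have "y - kappa y \<simeq>[ON] y - (y - b_op (d_form y) - d_form (b_op y))"
      by (rule O.diff[OF O.refl FI_O[OF kappa_bd]])
    also have "\<dots> = b_op (d_form y) + d_form (b_op y)" by simp
    also have "\<dots> \<simeq>[ON] b_op 0 + d_form (b_op y)" by (rule O.add[OF bO[OF dy] O.refl])
    finally have "y - kappa y \<simeq>[ON] d_form (b_op y)" by (simp add: op_simps)
    then show ?thesis by (rule O.trans[OF O.sym yu])
  qed
  from O.diff[OF O.refl[of u] this] have "d_form (X - b_op y) \<simeq>[ON] 0"
    by (simp add: op_simps u_def)
  with yp By show ?thesis by blast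
qed

text \<open>The coefficients are an arbitrary family, so that they can be built recursively; finite
  support is a consequence of the degrees.\<close>

definition cycle :: "int \<Rightarrow> (nat \<Rightarrow> ('a, 'k) nc_forms) \<Rightarrow> bool" where
  "cycle l x \<longleftrightarrow> (\<forall>r. x r \<in> piece fdeg (l - 2 * int r)) \<and> (\<forall>r. b_op (x r) \<simeq>[ON] B_op (x (Suc r)))"

text \<open>Adding the boundary of z u^-(k+1), which is b z u^-(k+1) - B z u^-k, removes X1 at u^-k.
  Here X1 is what is left of the lowest component once another boundary has been split off. The new
  lowest component is killed by B because b X1 = B x_(k+1) and bB + Bb = 0.\<close>

lemma kill_step:
  assumes x: "cycle l x" and z: "z \<in> piece fdeg (l - 2 * int k - 1)" "X1 \<simeq>[ON] B_op z" "b_op X1 \<simeq>[ON] B_op (x (Suc k))"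
  shows "cycle l (\<lambda>r. if r \<le> k then 0 else if r = Suc k then x r + b_op z else x r)"
    "B_op (x (Suc k) + b_op z) \<simeq>[ON] 0"
proof -
  have xp: "x r \<in> piece fdeg (l - 2 * int r)" and xc: "b_op (x r) \<simeq>[ON] B_op (x (Suc r))" for r
    using x by (auto simp: cycle_def)
  have bz: "b_op z \<in> piece fdeg (l - 2 * int (Suc k))" using b_piece[OF z(1)] by (simp add: algebra_simps)
  have "B_op (x (Suc k)) + B_op (b_op z) \<simeq>[ON] b_op X1 + (0 - b_op X1)"
  proof (rule O.add[OF O.sym[OF z(3)]])
    have "B_op (b_op z) \<simeq>[ON] 0 - b_op (B_op z)"
      using O.diff[OF bB_Bb[OF z(1)] O.refl[of "b_op (B_op z)"]] by simp
    also have "\<dots> \<simeq>[ON] 0 - b_op X1" by (rule O.diff[OF O.refl bO[OF O.sym[OF z(2)]]])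
    finally show "B_op (b_op z) \<simeq>[ON] 0 - b_op X1" .
  qed
  then show B: "B_op (x (Suc k) + b_op z) \<simeq>[ON] 0" by (simp add: op_simps)
  show "cycle l (\<lambda>r. if r \<le> k then 0 else if r = Suc k then x r + b_op z else x r)"
    unfolding cycle_def
  proof (intro conjI allI)
    fix r
    show "(if r \<le> k then 0 else if r = Suc k then x r + b_op z else x r) \<in> piece fdeg (l - 2 * int r)"
      using xp[of r] bz piece_add[OF xp bz] by simp
    have bb: "b_op (x (Suc k) + b_op z) \<simeq>[ON] B_op (x (Suc (Suc k)))"
      using O.add[OF xc[of "Suc k"] bbO[OF z(1)]] by (simp add: op_simps)
    consider "r < k" | "r = k" | "r = Suc k" | "r > Suc k" by linarith
    then show "b_op (if r \<le> k then 0 else if r = Suc k then x r + b_op z else x r) \<simeq>[ON]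
      B_op (if Suc r \<le> k then 0 else if Suc r = Suc k then x (Suc r) + b_op z else x (Suc r))"
    proof cases
      case 2
      then show ?thesis using O.sym[OF B] by (simp add: klin_zero[OF klin_b_op[OF klin_id]])
    qed (use bb xc[of r] in \<open>simp_all add: klin_zero[OF klin_b_op[OF klin_id]] klin_zero[OF klin_B_op[OF klin_id]]\<close>)
  qed
qed

text \<open>Induction on the degree that remains at u^-k. \<open>kernel_B\<close> and
  \<open>closed_in_image_B\<close> write the lowest component as b y1 + B z with B y1 = 0, and
  \<open>kill_step\<close> moves on to k + 1. The witness is required to vanish below k and to
  satisfy B y_k = 0, for otherwise its boundary would have a component at u^-(k-1).\<close>

lemma cycle_boundary:
  assumes "cycle l x" "\<And>r. r < k \<Longrightarrow> x r = 0" "B_op (x k) \<simeq>[ON] 0"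
  shows "\<exists>y. (\<forall>r. y r \<in> piece fdeg (l + 1 - 2 * int r)) \<and> (\<forall>r<k. y r = 0) \<and> B_op (y k) \<simeq>[ON] 0
    \<and> (\<forall>r. x r \<simeq>[ON] b_op (y r) - B_op (y (Suc r)))"
  using assms
proof (induction "nat (l + 1 - 2 * int k)" arbitrary: x k rule: less_induct)
  case less
  have xp: "x r \<in> piece fdeg (l - 2 * int r)" and xc: "b_op (x r) \<simeq>[ON] B_op (x (Suc r))" for r
    using less.prems(1) by (auto simp: cycle_def)
  show ?case
  proof (cases "l - 2 * int k < 0")
    case True
    have "x r = 0" for r
    proof (cases "r < k")
      case False
      then show ?thesis using piece_neg_deg[OF _ xp[of r]] True by simp
    qed (use less.prems in auto)
    then show ?thesis by (intro exI[of _ "\<lambda>_. 0"]) (simp add: op_simps)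
  next
    case False
    define n where "n = nat (l - 2 * int k)"
    have n: "l - 2 * int k = int n" using False by (simp add: n_def)
    obtain y1 where y1: "y1 \<in> piece fdeg (int n + 1)" "B_op y1 \<simeq>[ON] 0" "d_form (x k - b_op y1) \<simeq>[ON] 0"
      using kernel_B[of "x k" n] xp[of k] less.prems(3) n by auto
    define X where "X = x k - b_op y1"
    have Xp: "X \<in> piece fdeg (int n)"
      unfolding X_def using piece_diff[OF xp[of k, unfolded n]] b_piece[OF y1(1)] by simp
    have bX: "b_op X \<simeq>[ON] B_op (x (Suc k))"
      using O.diff[OF xc[of k] bbO[OF y1(1)]] by (simp add: X_def op_simps)
    have "x (Suc k) \<in> piece fdeg (int n - 2)" using xp[of "Suc k"] n by (simp add: algebra_simps)
    from closed_in_image_B[OF Xp s_piece[OF Xp] exact[OF y1(3)[folded X_def]] this bX]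
    obtain z where z: "z \<in> piece fdeg (int n - 1)" "X \<simeq>[ON] B_op z" by blast
    have z1: "z \<in> piece fdeg (l - 2 * int k - 1)" using z(1) n by simp
    let ?x = "\<lambda>r. if r \<le> k then 0 else if r = Suc k then x r + b_op z else x r"
    note step = kill_step[OF less.prems(1) z1 z(2) bX]
    have "\<exists>y. (\<forall>r. y r \<in> piece fdeg (l + 1 - 2 * int r)) \<and> (\<forall>r<Suc k. y r = 0) \<and> B_op (y (Suc k)) \<simeq>[ON] 0
      \<and> (\<forall>r. ?x r \<simeq>[ON] b_op (y r) - B_op (y (Suc r)))"
      by (rule less.hyps[OF _ step(1)]) (use False step(2) in auto)
    then obtain y where yp: "\<And>r. y r \<in> piece fdeg (l + 1 - 2 * int r)" and y0: "\<And>r. r \<le> k \<Longrightarrow> y r = 0"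
      and By: "B_op (y (Suc k)) \<simeq>[ON] 0" and y: "\<And>r. ?x r \<simeq>[ON] b_op (y r) - B_op (y (Suc r))"
      by (auto simp: less_Suc_eq_le)
    \<comment> \<open>The term -z undoes the boundary added by \<open>kill_step\<close>: at u^-k the
      boundary of y' is b y1 + B z, because B kills the old component at k + 1.\<close>
    define y' where "y' r = (if r = k then y1 else if r = Suc k then y r - z else y r)" for r
    have y1p: "y1 \<in> piece fdeg (l + 1 - 2 * int k)" using y1(1) n by (simp add: algebra_simps)
    have zp: "z \<in> piece fdeg (l + 1 - 2 * int (Suc k))" using z1 by (simp add: algebra_simps)
    have y'p: "y' r \<in> piece fdeg (l + 1 - 2 * int r)" for r
      using yp[of r] y1p piece_diff[OF yp zp] by (simp add: y'_def)
    have "x r \<simeq>[ON] b_op (y' r) - B_op (y' (Suc r))" for r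
    proof -
      consider "Suc r < k" | "Suc r = k" | "r = k" | "r = Suc k" | "r > Suc k" by linarith
      then show ?thesis
      proof cases
        case 1
        then show ?thesis
          using less.prems(2)[of r] y0[of r] y0[of "Suc r"] by (simp add: y'_def op_simps)
      next
        case 2
        then show ?thesis
          using less.prems(2)[of r] y0[of r] O.diff[OF O.refl[of 0] O.sym[OF y1(2)]] by (simp add: y'_def op_simps)
      next
        case 3
        have "x k - 0 \<simeq>[ON] b_op y1 + B_op z - B_op (y (Suc k))"
        proof (rule O.diff[OF _ O.sym[OF By]])
          show "x k \<simeq>[ON] b_op y1 + B_op z"
            using O.add[OF O.refl[of "b_op y1"] z(2)] by (simp add: X_def)
        qed
        then show ?thesis by (simp add: 3 y'_def op_simps algebra_simps)
      next
        case 4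
        have "x r + b_op z - b_op z \<simeq>[ON] b_op (y r) - B_op (y (Suc r)) - b_op z"
          using y[of r] 4 by (intro O.diff O.refl) simp
        then show ?thesis by (simp add: 4 y'_def op_simps algebra_simps)
      next
        case 5
        then show ?thesis using y[of r] by (simp add: y'_def)
      qed
    qed
    then show ?thesis
      using y'p y0 y1(2) by (intro exI[of _ y']) (simp add: y'_def)
  qed
qed

text \<open>(1 - \<kappa>) b N f = b (1 - \<kappa>^n) f, and 1 - \<kappa>^n has values in the image
  of b by \<open>kappa_n\<close>.\<close>

lemma invariant_b_Nk:
  assumes "f \<in> piece fdeg (int n)"
  shows "kappa (b_op (Nk n f)) \<simeq>[ON] b_op (Nk n f)"
proof -
  have "b_op (Nk n f) - kappa (b_op (Nk n f)) \<simeq>[ON] b_op (Nk n f) - b_op (kappa (Nk n f))"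
    by (rule O.diff[OF O.refl O.sym[OF b_kappa[OF Nk_piece[OF assms]]]])
  also have "\<dots> = b_op (f - (kappa ^^ n) f)"
    unfolding Nk_tele[symmetric] by (simp add: op_simps)
  also have "\<dots> \<simeq>[ON] b_op (f - (f + b_op ((kappa ^^ n) (d_form f))))"
    by (rule bO[OF O.diff[OF O.refl FI_O[OF kappa_n[OF assms]]]])
  also have "\<dots> = - b_op (b_op ((kappa ^^ n) (d_form f)))" by (simp add: op_simps)
  also have "\<dots> \<simeq>[ON] - 0" by (rule O.uminus[OF bbO[OF kappa_pow_piece[OF d_piece[OF assms]]]])
  finally have "b_op (Nk n f) - kappa (b_op (Nk n f)) \<simeq>[ON] 0" by simp
  from O.diff[OF O.refl[of "b_op (Nk n f)"] this] show ?thesis by simp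
qed

text \<open>The first coefficient f is a multiple of N h with B f = dh. Then b f is closed,
  invariant and killed by b, so it is dh1 with h1 two degrees lower, and the recursion supplies the
  remaining coefficients.\<close>

lemma cycle_exists:
  assumes "h \<in> piece fdeg p" "kappa (d_form h) \<simeq>[ON] d_form h" "b_op (d_form h) \<simeq>[ON] 0"
  shows "\<exists>x. cycle p x \<and> B_op (x 0) \<simeq>[ON] d_form h"
  using assms
proof (induction "nat p" arbitrary: p h rule: less_induct)
  case less
  note h = less.prems(1)
  consider "p < 0" | "p = 0" | "p > 0" by linarith
  then show ?case
  proof cases
    case 1
    then have "h = 0" using h piece_neg_deg[of p h fdeg] by simp
    then show ?thesis by (intro exI[of _ "\<lambda>_. 0"]) (simp add: cycle_def op_simps)
  next
    case 2
    have "B_op h \<simeq>[ON] Nk (Suc 0) (d_form h)" using BO_Nk[of h 0] h 2 by simp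
    then have "B_op h \<simeq>[ON] d_form h" by (simp add: Nk_def)
    then show ?thesis
      using h 2 b_piece0[of h] by (intro exI[of _ "\<lambda>r. if r = 0 then h else 0"]) (simp add: cycle_def op_simps)
  next
    case 3
    define n where "n = nat p"
    have p: "p = int n" and n: "n > 0" using 3 by (simp_all add: n_def)
    note hn = h[unfolded p] and kg = less.prems(2) and bg = less.prems(3)
    \<comment> \<open>Both N in f and the norm in B f act on the invariant form dh as multiplication
      by an integer, n and n + 1 respectively.\<close>
    define c where "c = \<rho> (1 / of_nat (Suc n)) * \<rho> (1 / of_nat n)"
    define f where "f = smul c (Nk n h)"
    have f: "f \<in> piece fdeg (int n)" unfolding f_def by (intro piece_smul Nk_piece hn)
    have Bf: "B_op f \<simeq>[ON] d_form h"
    proof -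
      have "B_op f \<simeq>[ON] Nk (Suc n) (d_form f)" by (rule BO_Nk[OF f])
      also have "\<dots> = smul c (Nk (Suc n) (d_form (Nk n h)))" by (simp add: f_def op_simps Nk_simps)
      also have "\<dots> \<simeq>[ON] smul c (Nk (Suc n) (Nk n (d_form h)))" by (intro O.scale NO d_Nk)
      also have "\<dots> \<simeq>[ON] smul c (Nk (Suc n) (smul (of_nat n) (d_form h)))" by (intro O.scale NO Nk_inv kg)
      also have "\<dots> = smul c (smul (of_nat n) (Nk (Suc n) (d_form h)))" by (simp add: Nk_simps)
      also have "\<dots> \<simeq>[ON] smul c (smul (of_nat n) (smul (of_nat (Suc n)) (d_form h)))" by (intro O.scale Nk_inv kg)
      also have "\<dots> = smul (\<rho> (1 / of_nat (Suc n)) * of_nat (Suc n) * (\<rho> (1 / of_nat n) * of_nat n)) (d_form h)"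
        by (simp add: c_def ac_simps)
      also have "\<dots> = d_form h" using rho_inverse[of "Suc n"] rho_inverse[OF n] by simp
      finally show ?thesis .
    qed
    have ke: "kappa (b_op f) \<simeq>[ON] b_op f"
      using O.scale[OF invariant_b_Nk[OF hn], of c] by (simp add: f_def op_simps)
    have dbh: "d_form (b_op h) \<simeq>[ON] h - kappa h"
    proof -
      have "h - kappa h \<simeq>[ON] h - (h - b_op (d_form h) - d_form (b_op h))"
        by (rule O.diff[OF O.refl FI_O[OF kappa_bd]])
      also have "\<dots> = b_op (d_form h) + d_form (b_op h)" by simp
      also have "\<dots> \<simeq>[ON] 0 + d_form (b_op h)" by (rule O.add[OF bg O.refl])
      finally show ?thesis by (simp add: O.sym)
    qed
    \<comment> \<open>Up to the factor c this is N db h = N (1 - \<kappa>) h = (1 - \<kappa>^n) h,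
      which equals -b \<kappa>^n dh = -b dh = 0.\<close>
    have de: "d_form (b_op f) \<simeq>[ON] 0"
    proof -
      have kdh: "(kappa ^^ j) (d_form h) \<simeq>[ON] d_form h" for j
      proof (induction j)
        case (Suc j)
        then show ?case using O.trans[OF kO[OF Suc] kg] by simp
      qed simp
      have "d_form (b_op (Nk n h)) \<simeq>[ON] d_form (Nk n (b_op h))" by (rule dO[OF b_Nk[OF hn]])
      also have "\<dots> \<simeq>[ON] Nk n (d_form (b_op h))" by (rule d_Nk)
      also have "\<dots> \<simeq>[ON] Nk n (h - kappa h)" by (rule NO[OF dbh])
      also have "\<dots> = h - (kappa ^^ n) h" unfolding Nk_tele[symmetric] by (simp add: Nk_simps Nk_kappa)
      also have "\<dots> \<simeq>[ON] h - (h + b_op ((kappa ^^ n) (d_form h)))" by (rule O.diff[OF O.refl FI_O[OF kappa_n[OF hn]]])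
      also have "\<dots> = - b_op ((kappa ^^ n) (d_form h))" by simp
      also have "\<dots> \<simeq>[ON] - b_op (d_form h)" by (rule O.uminus[OF bO[OF kdh]])
      also have "\<dots> \<simeq>[ON] - 0" by (rule O.uminus[OF bg])
      finally show ?thesis using O.scale[of "d_form (b_op (Nk n h))" 0 c] by (simp add: f_def op_simps)
    qed
    define h1 where "h1 = s_op (b_op f)"
    have h1: "h1 \<in> piece fdeg (p - 2)" unfolding h1_def p using s_piece[OF b_piece[OF f]] by simp
    have e: "b_op f \<simeq>[ON] d_form h1" unfolding h1_def by (rule exact[OF de])
    have k1: "kappa (d_form h1) \<simeq>[ON] d_form h1"
      by (rule O.trans[OF kO[OF O.sym[OF e]] O.trans[OF ke e]])
    have b1: "b_op (d_form h1) \<simeq>[ON] 0" by (rule O.trans[OF bO[OF O.sym[OF e]] bbO[OF f]])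
    have "\<exists>x. cycle (p - 2) x \<and> B_op (x 0) \<simeq>[ON] d_form h1"
      by (rule less.hyps[OF _ h1 k1 b1]) (use 3 in simp)
    then obtain x where x: "cycle (p - 2) x" "B_op (x 0) \<simeq>[ON] d_form h1" by blast
    define x' where "x' r = (case r of 0 \<Rightarrow> f | Suc r \<Rightarrow> x r)" for r
    have "cycle p x'"
      unfolding cycle_def
    proof (intro conjI allI)
      fix r
      show "x' r \<in> piece fdeg (p - 2 * int r)"
        using x(1) f p by (cases r) (auto simp: x'_def cycle_def algebra_simps)
      show "b_op (x' r) \<simeq>[ON] B_op (x' (Suc r))"
        using x O.trans[OF e O.sym[OF x(2)]] by (cases r) (auto simp: x'_def cycle_def)
    qed
    then show ?thesis using Bf by (intro exI[of _ x']) (simp add: x'_def)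
  qed
qed

lemma kappa_bd_null:
  assumes "f \<in> piece fdeg l"
  shows "(kappa ^^ j) f - f \<in> bd_null l"
proof (induction j)
  case 0
  show ?case using smul.subspace_0[OF submod_bd_null] by simp
next
  case (Suc j)
  let ?g = "(kappa ^^ j) f"
  have g: "?g \<in> piece fdeg l" by (rule kappa_pow_piece[OF assms])
  have "kappa ?g - ?g \<simeq>[ON] b_op (- d_form ?g) + d_form (- b_op ?g)"
    using O.diff[OF FI_O[OF kappa_bd[of ?g]] O.refl[of ?g]] by (simp add: op_simps)
  then have "kappa ?g - ?g \<in> bd_null l"
    by (rule bd_nullI[rotated 2]) (auto intro: piece_neg d_piece[OF g] b_piece[OF g])
  from smul.subspace_add[OF submod_bd_null this Suc] show ?case by simp
qed

text \<open>The hypothesis concerns i f = b N f, so f is replaced by its average N f / l. The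
  average has the same class, since 1 - \<kappa> = bd + db, and its b is exact and invariant, as
  \<open>cycle_exists\<close> demands.\<close>

lemma kernel_lift:
  assumes f: "f \<in> fst (ker_i sc (int l))"
  shows "\<exists>x. cycle (int l) x \<and> x 0 - f \<in> bd_null (int l)"
proof -
  from f obtain h where fp: "f \<in> piece fdeg (int l)" and h: "h \<in> piece fdeg (int l - 2)" "i_op f \<simeq>[ON] d_form h"
    by (auto simp: ker_i_def eqv_def)
  show ?thesis
  proof (cases "l = 0")
    \<comment> \<open>In degree 0 there is no average to take, but b vanishes and f alone is a
      cycle.\<close>
    case True
    then show ?thesis
      using fp b_piece0[of f] smul.subspace_0[OF submod_bd_null]
      by (intro exI[of _ "\<lambda>r. if r = 0 then f else 0"]) (simp add: cycle_def op_simps)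
  next
    case False
    define c where "c = \<rho> (1 / of_nat l)"
    define f0 where "f0 = smul c (Nk l f)"
    define h' where "h' = smul c h"
    have c: "c * of_nat l = 1" unfolding c_def using False by (intro rho_inverse) simp
    have h'p: "h' \<in> piece fdeg (int l - 2)" unfolding h'_def by (intro piece_smul h)
    have f0p: "f0 \<in> piece fdeg (int l)" unfolding f0_def by (intro piece_smul Nk_piece fp)
    have "b_op (Nk l f) \<simeq>[ON] d_form h"
    proof -
      have "b_op (Nk l f) = (\<Sum>j<l. b_op ((kappa ^^ j) f))" by (simp add: Nk_def op_simps)
      also have "\<dots> \<simeq>[ON] i_op f" by (rule O.sym[OF FI_O[OF i_kappa[OF fp]]])
      also have "\<dots> \<simeq>[ON] d_form h" by (rule h)
      finally show ?thesis .
    qed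
    from O.scale[OF this, of c] have b0: "b_op f0 \<simeq>[ON] d_form h'"
      by (simp add: f0_def h'_def op_simps)
    have kb0: "kappa (b_op f0) \<simeq>[ON] b_op f0"
      using O.scale[OF invariant_b_Nk[OF fp], of c] by (simp add: f0_def op_simps)
    have "kappa (d_form h') \<simeq>[ON] d_form h'"
      by (rule O.trans[OF kO[OF O.sym[OF b0]] O.trans[OF kb0 b0]])
    moreover have "b_op (d_form h') \<simeq>[ON] 0" by (rule O.trans[OF bO[OF O.sym[OF b0]] bbO[OF f0p]])
    ultimately obtain x where x: "cycle (int l - 2) x" "B_op (x 0) \<simeq>[ON] d_form h'"
      using cycle_exists[OF h'p] by blast
    define x' where "x' r = (case r of 0 \<Rightarrow> f0 | Suc r \<Rightarrow> x r)" for r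
    have "cycle (int l) x'"
      unfolding cycle_def
    proof (intro conjI allI)
      fix r
      show "x' r \<in> piece fdeg (int l - 2 * int r)"
        using x(1) f0p by (cases r) (auto simp: x'_def cycle_def algebra_simps)
      show "b_op (x' r) \<simeq>[ON] B_op (x' (Suc r))"
        using x O.trans[OF b0 O.sym[OF x(2)]] by (cases r) (auto simp: x'_def cycle_def)
    qed
    moreover have "x' 0 - f \<in> bd_null (int l)"
    proof -
      have "(\<Sum>j<l. f) = smul (of_nat l) f"
        by (induction l) (simp_all add: smul.scale_left_distrib del: sum_constant)
      then have "smul c (\<Sum>j<l. f) = f" by (simp add: c del: sum_constant)
      then have "f0 - f = smul c (\<Sum>j<l. (kappa ^^ j) f - f)"
        by (simp add: f0_def Nk_def sum_subtractf smul.scale_right_diff_distrib del: sum_constant)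
      also have "\<dots> \<in> bd_null (int l)"
        by (intro smul.subspace_scale[OF submod_bd_null] smul.subspace_sum[OF submod_bd_null] kappa_bd_null fp)
      finally show ?thesis by (simp add: x'_def)
    qed
    ultimately show ?thesis by blast
  qed
qed

text \<open>After the boundary of g is removed, the constant coefficient is dh. It lies in the image
  of B by \<open>closed_in_image_B\<close>, so \<open>kill_step\<close> reduces to a cycle that
  starts at u^-1, where \<open>cycle_boundary\<close> applies.\<close>

lemma cycle_null:
  assumes x: "cycle (int l) x" and x0: "x 0 \<in> bd_null (int l)"
  shows "\<exists>y. (\<forall>r. y r \<in> piece fdeg (int l + 1 - 2 * int r)) \<and> (\<forall>r. x r \<simeq>[ON] b_op (y r) - B_op (y (Suc r)))"
proof -
  from x0 obtain g h where g: "g \<in> piece fdeg (int l + 1)" and h: "h \<in> piece fdeg (int l - 1)"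
    and gh: "x 0 \<simeq>[ON] b_op g + d_form h"
    by (elim bd_nullE)
  have xp: "x r \<in> piece fdeg (int l - 2 * int r)" and xc: "b_op (x r) \<simeq>[ON] B_op (x (Suc r))" for r
    using x by (auto simp: cycle_def)
  define X where "X = d_form h"
  have Xp: "X \<in> piece fdeg (int l)" unfolding X_def using d_piece[OF h] by simp
  have "b_op X \<simeq>[ON] b_op (x 0 - b_op g)"
    using bO[OF O.diff[OF gh O.refl[of "b_op g"]]] by (simp add: X_def O.sym)
  also have "\<dots> = b_op (x 0) - b_op (b_op g)" by (simp add: op_simps)
  also have "\<dots> \<simeq>[ON] B_op (x (Suc 0)) - 0" by (rule O.diff[OF xc bbO[OF g]])
  finally have bX: "b_op X \<simeq>[ON] B_op (x (Suc 0))" by simp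
  have "x (Suc 0) \<in> piece fdeg (int l - 2)" using xp[of "Suc 0"] by simp
  from closed_in_image_B[OF Xp h _ this bX] obtain z where z: "z \<in> piece fdeg (int l - 1)" "X \<simeq>[ON] B_op z"
    unfolding X_def by blast
  have z0: "z \<in> piece fdeg (int l - 2 * int 0 - 1)" using z(1) by simp
  let ?x = "\<lambda>r. if r \<le> 0 then 0 else if r = Suc 0 then x r + b_op z else x r"
  note step = kill_step[OF x z0 z(2) bX]
  have "\<exists>y. (\<forall>r. y r \<in> piece fdeg (int l + 1 - 2 * int r)) \<and> (\<forall>r<Suc 0. y r = 0) \<and> B_op (y (Suc 0)) \<simeq>[ON] 0
      \<and> (\<forall>r. ?x r \<simeq>[ON] b_op (y r) - B_op (y (Suc r)))"
    by (rule cycle_boundary[OF step(1)]) (use step(2) in auto)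
  then obtain y where yp: "\<And>r. y r \<in> piece fdeg (int l + 1 - 2 * int r)"
    and By: "B_op (y (Suc 0)) \<simeq>[ON] 0" and y: "\<And>r. ?x r \<simeq>[ON] b_op (y r) - B_op (y (Suc r))"
    by auto
  define y' where "y' r = (if r = 0 then g else if r = Suc 0 then y r - z else y r)" for r
  have zp: "z \<in> piece fdeg (int l + 1 - 2 * int (Suc 0))" using z(1) by simp
  have "y' r \<in> piece fdeg (int l + 1 - 2 * int r)" for r
    using yp[of r] g piece_diff[OF yp zp] by (simp add: y'_def)
  moreover have "x r \<simeq>[ON] b_op (y' r) - B_op (y' (Suc r))" for r
  proof -
    consider "r = 0" | "r = Suc 0" | "r > Suc 0" by linarith
    then show ?thesis
    proof cases
      case 1
      have "x 0 - 0 \<simeq>[ON] b_op g + B_op z - B_op (y (Suc 0))"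
        by (rule O.diff[OF O.trans[OF gh O.add[OF O.refl z(2)[unfolded X_def]]] O.sym[OF By]])
      then show ?thesis by (simp add: 1 y'_def op_simps algebra_simps)
    next
      case 2
      have "x r + b_op z - b_op z \<simeq>[ON] b_op (y r) - B_op (y (Suc r)) - b_op z"
        using y[of r] 2 by (intro O.diff O.refl) simp
      then show ?thesis by (simp add: 2 y'_def op_simps algebra_simps)
    next
      case 3
      then show ?thesis using y[of r] by (simp add: y'_def)
    qed
  qed
  ultimately show ?thesis by blast
qed

end

lemma finite_support_pieces:
  assumes "\<And>r. x r \<in> piece deg (l - 2 * int r)"
  shows "Poly_Mapping.lookup (Poly_Mapping.Abs_poly_mapping x) = x"
proof (rule Abs_poly_mapping_inverse, rule CollectI)
  have "x r = 0" if "r > nat l" for r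
    using piece_neg_deg[OF _ assms[of r]] that by simp
  then have "{r. x r \<noteq> 0} \<subseteq> {..nat l}" by (auto intro: leI)
  then show "finite {r. x r \<noteq> 0}" by (rule finite_subset) simp
qed

section \<open>Reduced cyclic homology as the kernel of i\<close>

context cyclic
begin

abbreviation "DHC \<equiv> mixed_diff b_op B_op"

lemma lookup_DHC: "Poly_Mapping.lookup (DHC x) r = b_op (Poly_Mapping.lookup x r) - B_op (Poly_Mapping.lookup x (Suc r))"
  by (rule lookup_mixed_diff'[OF klin_b_op[OF klin_id] klin_B_op[OF klin_id]])

lemma HC_fst: "x \<in> fst (HC sc l) \<longleftrightarrow> cycle l (Poly_Mapping.lookup x)"
  by (auto simp: HC_def homology_def omega_R_chains_def null_R_def lookup_DHC cycle_def eqv_def)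

lemma HC_snd: "x \<in> snd (HC sc l) \<longleftrightarrow> (\<forall>r. Poly_Mapping.lookup x r \<in> piece fdeg (l - 2 * int r)) \<and>
    (\<exists>y. (\<forall>r. y r \<in> piece fdeg (l + 1 - 2 * int r)) \<and> (\<forall>r. Poly_Mapping.lookup x r \<simeq>[ON] b_op (y r) - B_op (y (Suc r))))"
  (is "?L \<longleftrightarrow> ?R")
proof
  have Dp: "b_op (y r) - B_op (y (Suc r)) \<in> piece fdeg (l - 2 * int r)"
    if "\<And>r. y r \<in> piece fdeg (l + 1 - 2 * int r)" for y :: "nat \<Rightarrow> ('a, 'k) nc_forms" and r
    using b_piece[OF that[of r]] B_piece[OF that[of "Suc r"]] by (intro piece_diff) (simp_all add: algebra_simps)
  {
    assume ?L
    then obtain y w where x: "x = DHC y + w" and y: "\<And>r. Poly_Mapping.lookup y r \<in> piece fdeg (l + 1 - 2 * int r)"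
      and w: "\<And>r. Poly_Mapping.lookup w r \<in> ON" "\<And>r. Poly_Mapping.lookup w r \<in> piece fdeg (l - 2 * int r)"
      by (auto simp: HC_def homology_def omega_R_chains_def null_R_def)
    have "Poly_Mapping.lookup x r \<in> piece fdeg (l - 2 * int r)" for r
      unfolding x lookup_add lookup_DHC by (intro piece_add w Dp y)
    moreover have "Poly_Mapping.lookup x r \<simeq>[ON] b_op (Poly_Mapping.lookup y r) - B_op (Poly_Mapping.lookup y (Suc r))" for r
      using w(1) by (simp add: x lookup_add lookup_DHC eqv_def)
    ultimately show ?R using y by blast
  }
  {
    assume ?R
    then obtain y where x: "\<And>r. Poly_Mapping.lookup x r \<in> piece fdeg (l - 2 * int r)"
      and y: "\<And>r. y r \<in> piece fdeg (l + 1 - 2 * int r)"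
      and xy: "\<And>r. Poly_Mapping.lookup x r \<simeq>[ON] b_op (y r) - B_op (y (Suc r))" by blast
    define Y where "Y = Poly_Mapping.Abs_poly_mapping y"
    have Y: "Poly_Mapping.lookup Y = y" unfolding Y_def by (rule finite_support_pieces[OF y])
    have "x = DHC Y + (x - DHC Y)" by simp
    moreover have "Y \<in> omega_R_chains (l + 1)" using y by (simp add: omega_R_chains_def Y)
    moreover have "x - DHC Y \<in> null_R ON \<inter> omega_R_chains l"
      using xy piece_diff[OF x Dp[OF y]]
      by (simp add: null_R_def omega_R_chains_def lookup_minus lookup_DHC Y eqv_def)
    ultimately show ?L unfolding HC_def homology_def snd_conv by blast
  }
qed

text \<open>Commutators are traded for values of b in both directions, by \<open>DN_bd_null\<close>
  and \<open>b_DN\<close>.\<close>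

lemma ker_i_snd: "f \<in> snd (ker_i sc (int l)) \<longleftrightarrow> f \<in> piece fdeg (int l) \<and> f \<in> bd_null (int l)"
proof
  assume "f \<in> snd (ker_i sc (int l))"
  then obtain h w where f: "f = d_form h + w" "h \<in> piece fdeg (int l - 1)" "w \<in> DN" "w \<in> piece fdeg (int l)"
    by (auto simp: ker_i_def)
  have "d_form h \<in> bd_null (int l)" by (rule bd_nullI[of 0 _ h]) (auto simp: f op_simps)
  moreover have "w \<in> bd_null (int l)" by (rule DN_bd_null[OF f(3,4)])
  ultimately show "f \<in> piece fdeg (int l) \<and> f \<in> bd_null (int l)"
    using d_piece[OF f(2)] f(4) smul.subspace_add[OF submod_bd_null] by (auto simp: f(1))
next
  assume f: "f \<in> piece fdeg (int l) \<and> f \<in> bd_null (int l)"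
  then obtain g h where g: "g \<in> piece fdeg (int l + 1)" and h: "h \<in> piece fdeg (int l - 1)"
    and gh: "f \<simeq>[ON] b_op g + d_form h" by (auto elim: bd_nullE)
  have "f - (b_op g + d_form h) \<in> DN" using gh ON_DN by (auto simp: eqv_def)
  from DR.closed(1)[OF this b_DN[OF g]] have "f - d_form h \<in> DN" by simp
  moreover have "f - d_form h \<in> piece fdeg (int l)" using f d_piece[OF h] by auto
  ultimately show "f \<in> snd (ker_i sc (int l))"
    unfolding ker_i_def snd_conv using h
    by (intro CollectI exI[of _ h] exI[of _ "f - d_form h"]) simp
qed

lemma HC_subspace: "subspace_R (fst (HC sc l))" "subspace_R (snd (HC sc l))"
  unfolding HC_def
  by (intro subspace_homology subspace_null_R O.sub mixed_diff_linear klin_b_op klin_B_op klin_id;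
      rule scale_R.subspaceI; auto simp: omega_R_chains_def lookup_add)+

text \<open>For a cycle, i x_0 = N b x_0 = N B x_1 is d of an iterated norm of x_1. For a boundary,
  the constant coefficient is b y_0 - B y_1, and B y_1 is d of a norm.\<close>

lemma HC_map: "subquotient_map scale_R smul (HC sc (int l)) (ker_i sc (int l)) (\<lambda>x. Poly_Mapping.lookup x 0)"
proof (unfold_locales; (rule HC_subspace)?)
  show "submod (snd (ker_i sc (int l)))"
  proof -
    have "snd (ker_i sc (int l)) = piece fdeg (int l) \<inter> bd_null (int l)" using ker_i_snd by blast
    then show ?thesis using smul.subspace_inter[OF piece_submod submod_bd_null] by simp
  qed
next
  fix x assume "x \<in> fst (HC sc (int l))"
  then have x: "cycle (int l) (Poly_Mapping.lookup x)" by (simp add: HC_fst)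
  let ?x = "Poly_Mapping.lookup x"
  have x0: "?x 0 \<in> piece fdeg (int l)" and x1: "?x (Suc 0) \<in> piece fdeg (int l - 2)"
    and xc: "b_op (?x 0) \<simeq>[ON] B_op (?x (Suc 0))"
    using x spec[OF conjunct1[OF x[unfolded cycle_def]], of "Suc 0"] spec[OF conjunct1[OF x[unfolded cycle_def]], of 0]
    by (auto simp: cycle_def)
  have i: "i_op (?x 0) \<simeq>[ON] Nk l (b_op (?x 0))"
  proof -
    have "i_op (?x 0) \<simeq>[ON] b_op (Nk l (?x 0))"
      using FI_O[OF i_kappa[OF x0]] by (simp add: Nk_def op_simps)
    also have "\<dots> \<simeq>[ON] Nk l (b_op (?x 0))" by (rule b_Nk[OF x0])
    finally show ?thesis .
  qed
  have "\<exists>h\<in>piece fdeg (int l - 2). i_op (?x 0) \<simeq>[ON] d_form h"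
  proof (cases "l < 2")
    case True
    then have "?x (Suc 0) = 0" using piece_neg_deg[OF _ x1] by simp
    then have "i_op (?x 0) \<simeq>[ON] Nk l 0" using O.trans[OF i NO[OF xc]] by (simp add: op_simps)
    then show ?thesis by (intro bexI[of _ 0]) (simp_all add: op_simps Nk_simps)
  next
    case False
    define n where "n = l - 2"
    have n: "int l - 2 = int n" using False by (simp add: n_def)
    have x1n: "?x (Suc 0) \<in> piece fdeg (int n)" using x1 by (simp add: n)
    have "i_op (?x 0) \<simeq>[ON] Nk l (B_op (?x (Suc 0)))" by (rule O.trans[OF i NO[OF xc]])
    also have "\<dots> \<simeq>[ON] Nk l (Nk (Suc n) (d_form (?x (Suc 0))))" by (rule NO[OF BO_Nk[OF x1n]])
    also have "\<dots> \<simeq>[ON] Nk l (d_form (Nk (Suc n) (?x (Suc 0))))" by (rule NO[OF O.sym[OF d_Nk]])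
    also have "\<dots> \<simeq>[ON] d_form (Nk l (Nk (Suc n) (?x (Suc 0))))" by (rule O.sym[OF d_Nk])
    finally show ?thesis using Nk_piece[OF Nk_piece[OF x1]] by blast
  qed
  then show "?x 0 \<in> fst (ker_i sc (int l))"
    using x0 by (auto simp: ker_i_def eqv_def)
next
  fix x assume "x \<in> snd (HC sc (int l))"
  then obtain y where xp: "\<And>r. Poly_Mapping.lookup x r \<in> piece fdeg (int l - 2 * int r)"
    and yp: "\<And>r. y r \<in> piece fdeg (int l + 1 - 2 * int r)"
    and xy: "\<And>r. Poly_Mapping.lookup x r \<simeq>[ON] b_op (y r) - B_op (y (Suc r))"
    unfolding HC_snd by blast
  have y0: "y 0 \<in> piece fdeg (int l + 1)" and y1: "y (Suc 0) \<in> piece fdeg (int l - 1)"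
    using yp[of 0] yp[of "Suc 0"] by simp_all
  have "Poly_Mapping.lookup x 0 \<in> bd_null (int l)"
  proof (cases "l = 0")
    case True
    then have "y (Suc 0) = 0" using piece_neg_deg[OF _ y1] by simp
    then show ?thesis using xy[of 0] by (intro bd_nullI[of "y 0" _ 0] y0) (simp_all add: op_simps)
  next
    case False
    define n where "n = l - 1"
    have n: "int l - 1 = int n" using False by (simp add: n_def)
    have "Poly_Mapping.lookup x 0 \<simeq>[ON] b_op (y 0) - B_op (y (Suc 0))" by (rule xy)
    also have "\<dots> \<simeq>[ON] b_op (y 0) - d_form (Nk (Suc n) (y (Suc 0)))"
      by (rule O.diff[OF O.refl O.trans[OF BO_Nk[OF y1[unfolded n]] O.sym[OF d_Nk]]])
    also have "\<dots> = b_op (y 0) + d_form (- Nk (Suc n) (y (Suc 0)))" by (simp add: op_simps)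
    finally show ?thesis by (intro bd_nullI[of "y 0" _ "- Nk (Suc n) (y (Suc 0))"] y0 piece_neg Nk_piece y1)
  qed
  then show "Poly_Mapping.lookup x 0 \<in> snd (ker_i sc (int l))"
    using xp[of 0] by (simp add: ker_i_snd)
qed (simp_all add: lookup_add)

lemma HC_bij: "bij_betw (HC_to_ker_i sc (int l)) (elements (HC sc (int l))) (elements (ker_i sc (int l)))"
proof -
  interpret M: subquotient_map scale_R smul "HC sc (int l)" "ker_i sc (int l)" "\<lambda>x. Poly_Mapping.lookup x 0"
    by (rule HC_map)
  have eq: "HC_to_ker_i sc (int l) (coset (HC sc (int l)) x) = coset (ker_i sc (int l)) (Poly_Mapping.lookup x 0)" for x
    unfolding HC_to_ker_i_def by (rule M.induced_coset)
  show ?thesis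
  proof (rule bij_betw_imageI)
    show "inj_on (HC_to_ker_i sc (int l)) (elements (HC sc (int l)))"
    proof (rule inj_onI)
      fix X Y assume "X \<in> elements (HC sc (int l))" "Y \<in> elements (HC sc (int l))"
        and e: "HC_to_ker_i sc (int l) X = HC_to_ker_i sc (int l) Y"
      then obtain x y where X: "X = coset (HC sc (int l)) x" "x \<in> fst (HC sc (int l))"
        and Y: "Y = coset (HC sc (int l)) y" "y \<in> fst (HC sc (int l))"
        by (auto simp: elements_def)
      have "Poly_Mapping.lookup x 0 - Poly_Mapping.lookup y 0 \<in> snd (ker_i sc (int l))"
        using e unfolding X Y eq by (simp add: coset_eq_iff[OF smul.module_axioms M.sndN])
      then have "Poly_Mapping.lookup (x - y) 0 \<in> bd_null (int l)" by (simp add: lookup_minus ker_i_snd)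
      moreover have c: "cycle (int l) (Poly_Mapping.lookup (x - y))"
        using scale_R.subspace_diff[OF HC_subspace(1) X(2) Y(2)] by (simp add: HC_fst)
      ultimately have "x - y \<in> snd (HC sc (int l))"
        unfolding HC_snd using cycle_null[OF c] by (auto simp: cycle_def)
      then show "X = Y" unfolding X Y by (simp add: coset_eq_iff[OF scale_R.module_axioms M.sndM])
    qed
    show "HC_to_ker_i sc (int l) ` elements (HC sc (int l)) = elements (ker_i sc (int l))"
    proof (intro equalityI subsetI)
      fix Z assume "Z \<in> HC_to_ker_i sc (int l) ` elements (HC sc (int l))"
      then show "Z \<in> elements (ker_i sc (int l))"
        using M.fst_map by (auto simp: elements_def eq)
    next
      fix Z assume "Z \<in> elements (ker_i sc (int l))"
      then obtain f where f: "f \<in> fst (ker_i sc (int l))" "Z = coset (ker_i sc (int l)) f" by (auto simp: elements_def)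
      from kernel_lift[OF f(1)] obtain x where x: "cycle (int l) x" "x 0 - f \<in> bd_null (int l)" by blast
      define T where "T = Poly_Mapping.Abs_poly_mapping x"
      have T: "Poly_Mapping.lookup T = x"
        unfolding T_def by (rule finite_support_pieces[of _ fdeg "int l"]) (use x(1) in \<open>simp add: cycle_def\<close>)
      have "T \<in> fst (HC sc (int l))" using x(1) by (simp add: HC_fst T)
      moreover have "x 0 - f \<in> snd (ker_i sc (int l))"
      proof -
        have "x 0 \<in> piece fdeg (int l)" using spec[OF conjunct1[OF x(1)[unfolded cycle_def]], of 0] by simp
        moreover have "f \<in> piece fdeg (int l)" using f(1) by (simp add: ker_i_def)
        ultimately show ?thesis using x(2) by (simp add: ker_i_snd piece_diff)
      qed
      then have "HC_to_ker_i sc (int l) (coset (HC sc (int l)) T) = Z"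
        unfolding eq T f(2) by (simp add: coset_eq_iff[OF smul.module_axioms M.sndN])
      ultimately show "Z \<in> HC_to_ker_i sc (int l) ` elements (HC sc (int l))"
        by (auto simp: elements_def)
    qed
  qed
qed

end

section \<open>Extended forms\<close>

lemma klin_d_ext [klin_intros]: "klin g \<Longrightarrow> klin (\<lambda>x. d_ext (g x))"
  unfolding d_ext_def by (rule klin_derivation')
lemma klin_i_t [klin_intros]: "klin g \<Longrightarrow> klin (\<lambda>x. i_t (g x))"
  unfolding i_t_def by (rule klin_derivation')

lemmas ext_simps =
  klin_add[OF klin_d_ext[OF klin_id]] klin_diff[OF klin_d_ext[OF klin_id]] klin_neg[OF klin_d_ext[OF klin_id]]
  klin_smul[OF klin_d_ext[OF klin_id]] klin_zero[OF klin_d_ext[OF klin_id]] klin_sum[OF klin_d_ext[OF klin_id]]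
  klin_add[OF klin_i_t[OF klin_id]] klin_diff[OF klin_i_t[OF klin_id]] klin_neg[OF klin_i_t[OF klin_id]]
  klin_smul[OF klin_i_t[OF klin_id]] klin_zero[OF klin_i_t[OF klin_id]] klin_sum[OF klin_i_t[OF klin_id]]

lemma d_ext_mult: "f \<in> piece ldeg p \<Longrightarrow> d_ext (f * g) = d_ext f * g + sg p * (f * d_ext g)"
  unfolding d_ext_def using derivation_mult[of f ldeg p 1] by simp
lemma i_t_mult: "f \<in> piece ldeg p \<Longrightarrow> i_t (f * g) = i_t f * g + sg p * (f * i_t g)"
  unfolding i_t_def using derivation_mult[of f ldeg p 1] by simp

lemma d_ext_gen [simp]: "d_ext (gen (Form (El a))) = gen (Form (Df a))" "d_ext (gen (Form (Df a))) = 0"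
  "d_ext (gen (Var v)) = 0" "d_ext 1 = 0"
  by (simp_all add: d_ext_def d_ext_letter_def)
lemma i_t_gen [simp]: "i_t (gen (Form (El a))) = 0" "i_t (gen t_letter) = 0" "i_t 1 = 0"
  "i_t (gen (Form (Df a))) = gen (Form (El a)) * gen t_letter - gen t_letter * gen (Form (El a))"
  by (simp_all add: i_t_def it_letter_def)

lemma gen_ldeg: "gen (Form (El a)) \<in> piece ldeg 0" "gen (Form (Df a)) \<in> piece ldeg 1" "gen (Var v) \<in> piece ldeg 0"
  by (simp_all add: piece_mon)
lemma gen_vdeg: "gen (Form (El a)) \<in> piece vdeg 0" "gen (Form (Df a)) \<in> piece vdeg 0" "gen (Var v) \<in> piece vdeg 1"
  by (simp_all add: piece_mon)

lemma d_ext_letter_ldeg: "d_ext_letter l \<in> piece ldeg (int (ldeg l) + 1)"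
  by (auto simp: d_ext_letter_def piece_mon split: letter.splits form.splits)
lemma d_ext_letter_vdeg: "d_ext_letter l \<in> piece vdeg (int (vdeg l) + 0)"
  by (auto simp: d_ext_letter_def piece_mon split: letter.splits form.splits)
lemma it_letter_ldeg: "it_letter l \<in> piece ldeg (int (ldeg l) + (- 1))"
  by (auto simp: it_letter_def split: letter.splits form.splits
      intro!: piece_diff piece_mult'[OF gen_ldeg(1) gen_ldeg(3)] piece_mult'[OF gen_ldeg(3) gen_ldeg(1)])
lemma it_letter_vdeg: "it_letter l \<in> piece vdeg (int (vdeg l) + 1)"
  by (auto simp: it_letter_def split: letter.splits form.splits
      intro!: piece_diff piece_mult'[OF gen_vdeg(1) gen_vdeg(3)] piece_mult'[OF gen_vdeg(3) gen_vdeg(1)])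

lemma d_ext_bipiece: "f \<in> bipiece p q \<Longrightarrow> d_ext f \<in> bipiece (p + 1) q"
  unfolding bipiece_def d_ext_def
  using derivation_piece[OF d_ext_letter_ldeg, of f p] derivation_piece[OF d_ext_letter_vdeg, of f q] by auto
lemma i_t_bipiece: "f \<in> bipiece p q \<Longrightarrow> i_t f \<in> bipiece (p - 1) (q + 1)"
  unfolding bipiece_def i_t_def
  using derivation_piece[OF it_letter_ldeg, of f p] derivation_piece[OF it_letter_vdeg, of f q] by auto
lemma d_ext_ldeg: "f \<in> piece ldeg p \<Longrightarrow> d_ext f \<in> piece ldeg (p + 1)"
  unfolding d_ext_def by (rule derivation_piece[OF d_ext_letter_ldeg])

lemma bipiece_submod [simp, intro]: "submod (bipiece p q)"
  unfolding bipiece_def by (intro smul.subspace_inter piece_submod)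
lemma bipiece_neg: "f \<in> bipiece p q \<Longrightarrow> p < 0 \<or> q < 0 \<Longrightarrow> f = 0"
  unfolding bipiece_def using piece_neg_deg by blast

lemma i_t_i_t [simp]: "i_t (i_t f) = 0"
  unfolding i_t_def
proof (rule derivation_sq[OF it_letter_ldeg])
  fix l :: "('a, unit) letter"
  show "derivation 1 ldeg it_letter (it_letter l) = (0 :: ('a, 'b) ext_forms)"
    unfolding i_t_def[symmetric]
    by (auto simp: it_letter_def ext_simps i_t_mult[OF gen_ldeg(1)] i_t_mult[OF gen_ldeg(3)]
        split: letter.splits form.splits)
qed simp

text \<open>Both sides are derivations, and on the letters a, da and t they give [a, t], [da, t] and
  0. The two differentials therefore anticommute only after commutators are divided out.\<close>

lemma d_i_t: "d_ext (i_t f) + i_t (d_ext f) = f * gen t_letter - gen t_letter * f"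
  unfolding d_ext_def i_t_def
proof (rule derivation_anticomm[OF d_ext_letter_ldeg _ it_letter_ldeg, of "\<lambda>f. f * gen t_letter - gen t_letter * f"])
  fix l :: "('a, unit) letter"
  show "derivation 1 ldeg d_ext_letter (it_letter l) + derivation 1 ldeg it_letter (d_ext_letter l)
    = gen l * gen t_letter - gen t_letter * (gen l :: ('a, 'b) ext_forms)"
    unfolding i_t_def[symmetric] d_ext_def[symmetric]
    by (auto simp: it_letter_def d_ext_letter_def ext_simps i_t_mult[OF gen_ldeg(1)] i_t_mult[OF gen_ldeg(3)]
        d_ext_mult[OF gen_ldeg(1)] d_ext_mult[OF gen_ldeg(3)] split: letter.splits form.splits)
qed (auto intro!: klin_intros simp: algebra_simps)

lemma replicate_t: "mon (replicate q t_letter) = gen t_letter ^ q"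
proof (induction q)
  case (Suc q)
  then show ?case unfolding replicate.simps power_Suc by (subst mon_Cons) simp
qed simp

lemma t_pow_ldeg: "gen t_letter ^ q \<in> piece ldeg 0"
  unfolding replicate_t[symmetric] by (simp add: piece_mon sum_list_replicate)
lemma t_pow_vdeg: "gen t_letter ^ q \<in> piece vdeg (int q)"
  unfolding replicate_t[symmetric] by (simp add: piece_mon sum_list_replicate)

lemma d_ext_t_pow [simp]: "d_ext (gen t_letter ^ q) = 0"
  by (induction q) (simp_all add: d_ext_mult[OF gen_ldeg(3)])
lemma i_t_t_pow [simp]: "i_t (gen t_letter ^ q) = 0"
  by (induction q) (simp_all add: i_t_mult[OF gen_ldeg(3)])

text \<open>A relation between symbols da goes to the commutator with t of the matching relation
  between elements a; the Leibniz relation goes to that of the product relation.\<close>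

lemma it_relations:
  assumes "r \<in> form_relations sc {} Form" "k_algebra sc"
  shows "i_t r \<in> ideal_k (form_relations sc {} Form)"
proof -
  interpret tsideal "ideal_k (form_relations sc {} Form)" by (rule tsideal_ideal_k)
  interpret form_calculus "ideal_k (form_relations sc {} Form)" sc "{}" Form
    by unfold_locales (auto intro: ideal_k_base assms)
  let ?c = "\<lambda>x. x * gen t_letter - gen t_letter * x"
  have c: "?c x \<simeq>[ideal_k (form_relations sc {} Form)] ?c y" if "x \<simeq>[ideal_k (form_relations sc {} Form)] y" for x y
    by (rule diff[OF mult[OF that refl] mult[OF refl that]])
  have m [simp]: "i_t (el a * g) = el a * i_t g" "i_t (df a * g) = ?c (el a) * g - df a * i_t g" for a g
    using i_t_mult[OF gen_ldeg(1), of a g] i_t_mult[OF gen_ldeg(2), of a g] by simp_all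
  note [simp] = ext_simps
  show ?thesis
    using assms(1)
  proof (cases rule: form_relations_cases)
    case (6 a b)
    show ?thesis unfolding 6 using c[OF el_add[of a b]] by (simp add: eqv_def algebra_simps)
  next
    case (7 k a)
    then show ?thesis using c[OF el_sc[of k a]]
      by (simp add: eqv_def smul_mult_left smul_mult_right smul.scale_right_diff_distrib)
  next
    case (8 k)
    then show ?thesis using c[OF el_scalar[of k]] by (simp add: eqv_def smul_mult_left smul_mult_right)
  next
    case (10 a b)
    show ?thesis unfolding 10 using c[OF el_mult[of a b]] by (simp add: eqv_def algebra_simps)
  qed (simp_all add: closed(5))
qed

section \<open>Extended forms modulo relations, commutators and k[t]\<close>

context k_alg
begin

abbreviation "XI \<equiv> ext_ideal sc"

sublocale X: form_calculus "ext_ideal sc" sc "{}" Form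
proof -
  interpret tsideal "ext_ideal sc" unfolding ext_ideal_def by (rule tsideal_ideal_k)
  show "form_calculus (ext_ideal sc) sc {} Form"
    by unfold_locales (auto simp: ext_ideal_def intro: ideal_k_base alg)
qed

abbreviation "DT \<equiv> drt_null sc"

sublocale D: submodule DT by unfold_locales (simp add: drt_null_def)

lemma XI_DT: "XI \<subseteq> DT" unfolding drt_null_def by (intro subsetI span_k_base UnI1)

lemma X_D: "x \<simeq>[XI] y \<Longrightarrow> x \<simeq>[DT] y" by (rule eqv_mono[OF XI_DT])

lemma t_pow_DT: "gen t_letter ^ q \<in> DT"
  unfolding drt_null_def replicate_t[symmetric] by (intro span_k_base UnI2 CollectI exI[of _ q] conjI TrueI HOL.refl)

lemma commutator_DT:
  assumes "f \<in> piece ldeg p" "g \<in> piece ldeg q"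
  shows "f * g \<simeq>[DT] sg (p * q) * (g * f)"
proof -
  have "span_k (supercommutators ldeg) \<subseteq> DT" unfolding drt_null_def by (rule span_k_mono) auto
  then show ?thesis unfolding eqv_def using supercommutators_span[OF assms] by auto
qed

lemma relations_ldeg: "r \<in> form_relations sc J Form \<Longrightarrow> \<exists>p. r \<in> piece ldeg p"
  by (rule form_relations_piece[of _ _ _ _ _ 1]) auto

lemma DT_mem:
  assumes "klin L" "submod W" "\<And>x. x \<in> XI \<Longrightarrow> L x \<in> W" "\<And>x. x \<in> supercommutators ldeg \<Longrightarrow> L x \<in> W"
    "\<And>q. L (gen t_letter ^ q) \<in> W" "x \<in> DT"
  shows "L x \<in> W"
  by (rule klin_span[OF assms(1,2) _ assms(6)[unfolded drt_null_def]]) (use assms in \<open>auto simp: replicate_t\<close>)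

lemma supercommutators_DT: "span_k (supercommutators ldeg) \<subseteq> DT"
  unfolding drt_null_def by (rule span_k_mono) auto

lemma i_t_XI: "x \<in> XI \<Longrightarrow> i_t x \<in> XI"
  unfolding ext_ideal_def i_t_def
  by (rule derivation_ideal[rotated 2], assumption)
     (auto intro!: it_relations[unfolded i_t_def] alg relations_ldeg)

lemma i_t_DT: "x \<in> DT \<Longrightarrow> i_t x \<in> DT"
proof (rule DT_mem[OF klin_i_t[OF klin_id] D.sub])
  fix x :: "('a, 'k) ext_forms" assume "x \<in> supercommutators ldeg"
  then show "i_t x \<in> DT" unfolding i_t_def
    by (intro subsetD[OF supercommutators_DT derivation_supercommutators[OF it_letter_ldeg]]) simp_all
qed (simp_all add: subsetD[OF XI_DT i_t_XI] D.closed(5))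

lemma i_t_cong: "x \<simeq>[DT] y \<Longrightarrow> i_t x \<simeq>[DT] i_t y"
  by (rule D.klin[OF klin_i_t[OF klin_id] i_t_DT])

lemma d_i_t_DT: "d_ext (i_t f) + i_t (d_ext f) \<in> DT"
  unfolding d_i_t
proof (rule falg_mem[of "\<lambda>f. f * gen t_letter - gen t_letter * f"])
  fix w :: "('a, unit) letter list"
  show "mon w * gen t_letter - gen t_letter * mon w \<in> DT"
    using commutator_DT[OF piece_mon'[of w] gen_ldeg(3)[of "()"]] by (simp add: eqv_def)
qed (auto intro!: klin_intros D.sub)

end

section \<open>Power series with coefficients in a free algebra\<close>

text \<open>The variable z of the series records the degree in t, so congruence is imposed on each
  coefficient.\<close>

definition feq :: "'x::ab_group_add fps \<Rightarrow> 'x set \<Rightarrow> 'x fps \<Rightarrow> bool" ("(_ \<approx>[_] _)" [51, 0, 51] 50) where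
  "F \<approx>[W] G \<longleftrightarrow> (\<forall>q. fps_nth F q \<simeq>[W] fps_nth G q)"

lemma fps_nth_sg [simp]: "fps_nth (sg n * F) q = sg n * fps_nth F q"
  by (simp add: sg_def)

context submodule
begin
lemma f_refl [simp, intro]: "F \<approx>[W] F" by (simp add: feq_def)
lemma f_sym: "F \<approx>[W] G \<Longrightarrow> G \<approx>[W] F" by (simp add: feq_def sym)
lemma f_trans [trans]: "F \<approx>[W] G \<Longrightarrow> G \<approx>[W] H \<Longrightarrow> F \<approx>[W] H" unfolding feq_def using trans by blast
lemma f_trans1 [trans]: "F = G \<Longrightarrow> G \<approx>[W] H \<Longrightarrow> F \<approx>[W] H" by simp
lemma f_trans2 [trans]: "F \<approx>[W] G \<Longrightarrow> G = H \<Longrightarrow> F \<approx>[W] H" by simp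
lemma f_add: "F \<approx>[W] G \<Longrightarrow> F' \<approx>[W] G' \<Longrightarrow> F + F' \<approx>[W] G + G'" by (simp add: feq_def add)
lemma f_diff: "F \<approx>[W] G \<Longrightarrow> F' \<approx>[W] G' \<Longrightarrow> F - F' \<approx>[W] G - G'" by (simp add: feq_def diff)
lemma f_const: "x \<simeq>[W] y \<Longrightarrow> fps_const x \<approx>[W] fps_const y" by (simp add: feq_def)
end

context tsideal
begin
lemma f_mult: "F \<approx>[W] G \<Longrightarrow> F' \<approx>[W] G' \<Longrightarrow> F * F' \<approx>[W] G * G'"
  unfolding feq_def fps_mult_nth by (intro allI sum mult) auto
end

definition fpiece :: "('g \<Rightarrow> nat) \<Rightarrow> int \<Rightarrow> ('g, 'k::comm_ring_1) falg fps set" where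
  "fpiece deg p = {F. \<forall>q. fps_nth F q \<in> piece deg p}"

lemma fpiece_mult: "F \<in> fpiece deg p \<Longrightarrow> G \<in> fpiece deg q \<Longrightarrow> r = p + q \<Longrightarrow> F * G \<in> fpiece deg r"
  by (auto simp: fpiece_def fps_mult_nth intro!: piece_sum piece_mult)

lemma fpiece_const: "x \<in> piece deg p \<Longrightarrow> fps_const x \<in> fpiece deg p"
  by (simp add: fpiece_def)

definition fmap :: "(('g, 'k::comm_ring_1) falg \<Rightarrow> ('h, 'k) falg) \<Rightarrow> ('g, 'k) falg fps \<Rightarrow> ('h, 'k) falg fps" where
  "fmap L F = Abs_fps (\<lambda>q. L (fps_nth F q))"

lemma fmap_nth [simp]: "fps_nth (fmap L F) q = L (fps_nth F q)" by (simp add: fmap_def)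

lemma fmap_const: "klin L \<Longrightarrow> fmap L (fps_const x) = fps_const (L x)"
  by (rule fps_ext) (simp add: klin_zero)

lemma fmap_derivation:
  assumes "klin D" "\<And>f g p. f \<in> piece deg p \<Longrightarrow> D (f * g) = D f * g + sg p * (f * D g)" "F \<in> fpiece deg p"
  shows "fmap D (F * G) = fmap D F * G + sg p * (F * fmap D G)"
proof (rule fps_ext)
  fix q
  have "D (fps_nth (F * G) q) = (\<Sum>i=0..q. D (fps_nth F i * fps_nth G (q - i)))"
    by (simp add: fps_mult_nth klin_sum[OF assms(1)])
  also have "\<dots> = (\<Sum>i=0..q. D (fps_nth F i) * fps_nth G (q - i) + sg p * (fps_nth F i * D (fps_nth G (q - i))))"
    by (intro sum.cong assms(2)) (use assms(3) in \<open>auto simp: fpiece_def\<close>)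
  finally show "fps_nth (fmap D (F * G)) q = fps_nth (fmap D F * G + sg p * (F * fmap D G)) q"
    unfolding fmap_nth fps_add_nth fps_nth_sg by (simp add: fps_mult_nth sum.distrib sum_distrib_left)
qed

definition T :: "('a, 'k::comm_ring_1) ext_forms fps" where
  "T = Abs_fps (\<lambda>q. gen t_letter ^ q)"

abbreviation "C \<equiv> fps_const"

lemma T_unfold: "T = 1 + fps_X * (C (gen t_letter) * T)" "T = 1 + fps_X * (T * C (gen t_letter))"
proof -
  show "T = 1 + fps_X * (C (gen t_letter) * T)"
  proof (rule fps_ext)
    fix q show "fps_nth T q = fps_nth (1 + fps_X * (C (gen t_letter) * T)) q"
      by (cases q) (simp_all add: T_def)
  qed
  show "T = 1 + fps_X * (T * C (gen t_letter))"
  proof (rule fps_ext)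
    fix q show "fps_nth T q = fps_nth (1 + fps_X * (T * C (gen t_letter))) q"
      by (cases q) (simp_all add: T_def power_commutes)
  qed
qed

lemma X_left: "A * (fps_X * B) = fps_X * (A * (B :: 'r::ring_1 fps))"
  by (metis fps_mult_fps_X_commute mult.assoc)

text \<open>\<open>T = (1 - z t)\<^sup>-\<^sup>1\<close>, hence \<open>aT - Ta = T ((1 - z t) a - a (1 - z t)) T\<close>.\<close>

lemma T_commutator:
  "C a * T - T * C a = fps_X * (T * C (a * gen t_letter - gen t_letter * a) * T)"
proof -
  have "fps_X * (T * C (a * gen t_letter - gen t_letter * a) * T)
     = (T * C a) * (fps_X * (C (gen t_letter) * T)) - (fps_X * (T * C (gen t_letter))) * (C a * T)"
    by (simp add: X_left fps_const_mult[symmetric] fps_const_sub[symmetric] algebra_simps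
        del: fps_const_mult fps_const_sub)
  also have "\<dots> = (T * C a) * (T - 1) - (T - 1) * (C a * T)"
    using T_unfold by (metis add_diff_cancel_left')
  finally show ?thesis by (simp add: algebra_simps)
qed

lemma T_ldeg: "T \<in> fpiece ldeg 0"
  by (simp add: fpiece_def T_def t_pow_ldeg)

lemma fmap_i_t_T [simp]: "fmap i_t T = 0" and fmap_d_T [simp]: "fmap d_ext T = 0"
  by (rule fps_ext, simp add: T_def)+

lemma fmap_i_t_mult: "F \<in> fpiece ldeg p \<Longrightarrow> fmap i_t (F * G) = fmap i_t F * G + sg p * (F * fmap i_t G)"
  by (rule fmap_derivation[OF klin_i_t[OF klin_id] i_t_mult])
lemma fmap_d_mult: "F \<in> fpiece ldeg p \<Longrightarrow> fmap d_ext (F * G) = fmap d_ext F * G + sg p * (F * fmap d_ext G)"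
  by (rule fmap_derivation[OF klin_d_ext[OF klin_id] d_ext_mult])

section \<open>The Tsygan map\<close>

text \<open>The series a_0 T da_1 T ... T da_n, with the final T left off: right multiplication by
  an element inserts it just before that factor.\<close>

definition hser :: "'a \<Rightarrow> 'a list \<Rightarrow> ('a, 'k::comm_ring_1) ext_forms fps" where
  "hser a0 as = foldl (\<lambda>F a. F * T * C (gen (Form (Df a)))) (C (gen (Form (El a0)))) as"

definition qser :: "'a list \<Rightarrow> ('a, 'k::comm_ring_1) ext_forms fps" where
  "qser as = foldr (\<lambda>a F. C (gen (Form (Df a))) * (T * F)) as 1"

lemma hser_Nil [simp]: "hser a0 [] = C (gen (Form (El a0)))"
  by (simp add: hser_def)

lemma hser_snoc: "hser a0 (as @ [a]) = hser a0 as * T * C (gen (Form (Df a)))"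
  by (simp add: hser_def)

lemma qser_simps [simp]: "qser [] = 1" "qser (a # as) = C (gen (Form (Df a))) * (T * qser as)"
  by (simp_all add: qser_def)

lemma qser_append: "qser (xs @ ys) = qser xs * qser ys"
  by (induction xs) (simp_all add: mult.assoc)

lemma hser_qser: "hser a0 as * T = C (gen (Form (El a0))) * (T * qser as)"
proof -
  have "foldl (\<lambda>F a. F * T * C (gen (Form (Df a)))) F as * T = F * (T * qser as)" for F :: "('a, 'b) ext_forms fps"
    by (induction as arbitrary: F) (simp_all add: mult.assoc)
  then show ?thesis by (simp add: hser_def)
qed

lemma hser_ldeg: "hser a0 as \<in> fpiece ldeg (int (length as))"
proof (induction as rule: rev_induct)
  case Nil
  show ?case by (simp add: fpiece_const gen_ldeg)
next
  case (snoc a as)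
  show ?case unfolding hser_snoc
    by (rule fpiece_mult[OF fpiece_mult[OF snoc T_ldeg HOL.refl] fpiece_const[OF gen_ldeg(2)]]) simp
qed

lemma qser_ldeg: "qser as \<in> fpiece ldeg (int (length as))"
proof (induction as)
  case Nil
  show ?case by (simp add: fpiece_def)
next
  case (Cons a as)
  show ?case unfolding qser_simps
    by (rule fpiece_mult[OF fpiece_const[OF gen_ldeg(2)] fpiece_mult[OF T_ldeg Cons HOL.refl]]) simp
qed

definition tgraded :: "('a, 'k::comm_ring_1) ext_forms fps set" where
  "tgraded = {F. \<forall>q. fps_nth F q \<in> piece vdeg (int q)}"

lemma tgraded_mult: "F \<in> tgraded \<Longrightarrow> G \<in> tgraded \<Longrightarrow> F * G \<in> tgraded"
  unfolding tgraded_def mem_Collect_eq fps_mult_nth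
proof (intro allI piece_sum)
  fix q i :: nat assume F: "\<forall>q. fps_nth F q \<in> piece vdeg (int q)" and G: "\<forall>q. fps_nth G q \<in> piece vdeg (int q)"
    and i: "i \<in> {0..q}"
  show "fps_nth F i * fps_nth G (q - i) \<in> piece vdeg (int q)"
    by (rule piece_mult'[OF F[rule_format] G[rule_format]]) (use i in auto)
qed

lemma tgraded_qser: "qser as \<in> tgraded"
proof (induction as)
  case (Cons a as)
  have "C (gen (Form (Df a))) \<in> tgraded" by (simp add: tgraded_def gen_vdeg)
  moreover have "T \<in> tgraded" by (simp add: tgraded_def T_def t_pow_vdeg)
  ultimately show ?case unfolding qser_simps by (intro tgraded_mult Cons)
qed (simp add: tgraded_def)

lemma hser_T_bipiece:
  "fps_nth (hser a0 as * T) q \<in> (bipiece (int (length as)) (int q) :: ('a, 'k::comm_ring_1) ext_forms set)"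
proof -
  have "C (gen (Form (El a0))) \<in> (tgraded :: ('a, 'k) ext_forms fps set)" by (simp add: tgraded_def gen_vdeg)
  moreover have "T \<in> (tgraded :: ('a, 'k) ext_forms fps set)" by (simp add: tgraded_def T_def t_pow_vdeg)
  ultimately have "hser a0 as * T \<in> (tgraded :: ('a, 'k) ext_forms fps set)"
    unfolding hser_qser by (intro tgraded_mult tgraded_qser)
  moreover have "hser a0 as * T \<in> (fpiece ldeg (int (length as)) :: ('a, 'k) ext_forms fps set)"
    by (rule fpiece_mult[OF hser_ldeg T_ldeg]) simp
  ultimately show ?thesis by (simp add: bipiece_def tgraded_def fpiece_def)
qed

text \<open>The Tsygan map without factorials. On n-forms the factorial depends only on q + n, so it
  can be restored coefficient by coefficient.\<close>

definition hf :: "('a::ring_1, 'k::comm_ring_1) nc_forms \<Rightarrow> ('a, 'k) ext_forms fps" where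
  "hf f = Abs_fps (\<lambda>q. on_normal (\<lambda>a0 as. fps_nth (hser a0 as * T) q) f)"

lemma hf_nth: "fps_nth (hf f) q = on_normal (\<lambda>a0 as. fps_nth (hser a0 as * T) q) f"
  by (simp add: hf_def)

lemma klin_hf [klin_intros]: "klin g \<Longrightarrow> klin (\<lambda>x. fps_nth (hf (g x)) q)"
  unfolding hf_nth by (rule klin_on_normal')

lemma hf_add: "hf (f + g) = hf f + hf g" and hf_diff: "hf (f - g) = hf f - hf g" and hf_neg: "hf (- f) = - hf f"
  by (rule fps_ext, simp add: klin_add[OF klin_hf[OF klin_id]] klin_diff[OF klin_hf[OF klin_id]] klin_neg[OF klin_hf[OF klin_id]])+

lemma hf_0 [simp]: "hf 0 = 0"
  using hf_diff[of 0 0] by simp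

lemma hf_sg: "hf (sg n * f) = sg n * hf f"
  by (simp add: sg_def hf_neg)

lemma hf_sum: "hf (sum f A) = (\<Sum>i\<in>A. hf (f i))"
  by (rule fps_ext) (simp add: fps_sum_nth klin_sum[OF klin_hf[OF klin_id]])

lemma klin_fps_mult:
  fixes F :: "('x \<Rightarrow>\<^sub>0 'k::comm_ring_1) \<Rightarrow> ('g, 'k) falg fps"
  shows "(\<And>i. klin (\<lambda>x. fps_nth (F x) i)) \<Longrightarrow> klin (\<lambda>x. fps_nth (F x * G) q)"
  unfolding fps_mult_nth by (intro klin_intros)

section \<open>Generating functions for E b and E B\<close>

context k_alg
begin

lemma smul_slot:
  fixes F :: "('a, 'k) ext_forms fps"
  shows "fps_nth (F * (C (smul c x) * G)) q = smul c (fps_nth (F * (C x * G)) q)"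
  by (simp add: fps_mult_nth[of F] smul_mult_left smul_mult_right smul.scale_sum_right)

lemma admissible_hser: "admissible XI (\<lambda>a0 as. fps_nth (hser a0 as * T) q)"
proof -
  have slot: "hser a0 (xs @ a # ys) * T = (C (X.el a0) * (T * qser xs)) * (C (X.df a) * (T * qser ys))" for a0 a :: 'a and xs ys
    by (simp add: hser_qser qser_append mult.assoc)
  have nth: "fps_nth F q \<simeq>[XI] fps_nth G q" if "F \<approx>[XI] G" for F G :: "('a, 'k) ext_forms fps"
    using that by (simp add: feq_def)
  have add: "F * (C (x + y) * G) = F * (C x * G) + F * (C y * G)" for F G :: "('a, 'k) ext_forms fps" and x y
    by (simp add: fps_const_add[symmetric] distrib_left distrib_right del: fps_const_add)
  have one: "hser a0 as * T = 1 * (C (X.el a0) * (T * qser as))" for a0 :: 'a and as by (simp add: hser_qser)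
  show ?thesis
  proof (rule admissibleI)
    fix a b :: 'a and as
    show "fps_nth (hser (a + b) as * T) q \<simeq>[XI] fps_nth (hser a as * T) q + fps_nth (hser b as * T) q"
      unfolding one fps_add_nth[symmetric] add[symmetric]
      by (intro nth X.f_mult X.f_refl X.f_const X.el_add)
  next
    fix c and a :: 'a and as
    show "fps_nth (hser (sc c a) as * T) q \<simeq>[XI] smul c (fps_nth (hser a as * T) q)"
      unfolding one smul_slot[symmetric] by (intro nth X.f_mult X.f_refl X.f_const X.el_sc)
  next
    fix a0 xs and a b :: 'a and ys
    show "fps_nth (hser a0 (xs @ (a + b) # ys) * T) q \<simeq>[XI]
      fps_nth (hser a0 (xs @ a # ys) * T) q + fps_nth (hser a0 (xs @ b # ys) * T) q"
      unfolding slot fps_add_nth[symmetric] add[symmetric]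
      by (intro nth X.f_mult X.f_refl X.f_const X.df_add)
  next
    fix a0 xs and c and a :: 'a and ys
    show "fps_nth (hser a0 (xs @ sc c a # ys) * T) q \<simeq>[XI] smul c (fps_nth (hser a0 (xs @ a # ys) * T) q)"
      unfolding slot smul_slot[symmetric] by (intro nth X.f_mult X.f_refl X.f_const X.df_sc)
  next
    fix a0 :: 'a and xs ys
    have "hser a0 (xs @ 1 # ys) * T \<approx>[XI] (C (X.el a0) * (T * qser xs)) * (C 0 * (T * qser ys))"
      unfolding slot by (intro X.f_mult X.f_refl X.f_const X.df_one)
    from nth[OF this] show "fps_nth (hser a0 (xs @ 1 # ys) * T) q \<simeq>[XI] 0" by simp
  qed
qed

lemma hf_std: "hf (std_form a0 as) \<approx>[XI] hser a0 as * T"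
  unfolding feq_def hf_nth by (intro allI on_normal_std_form[OF X.sub admissible_hser])

lemma hf_FI: "x \<in> FI \<Longrightarrow> fps_nth (hf x) q \<in> XI"
  unfolding hf_nth by (rule on_normal_ideal[OF X.sub admissible_hser])

lemma hf_cong: "x \<simeq>[FI] y \<Longrightarrow> hf x \<approx>[XI] hf y"
  unfolding feq_def by (intro allI X.klin[OF klin_hf[OF klin_id] hf_FI])

lemma hf_snoc:
  assumes "\<alpha> \<in> piece fdeg n"
  shows "hf (\<alpha> * F.df a) \<approx>[XI] hf \<alpha> * C (X.df a) * T"
  unfolding feq_def
proof
  fix q
  show "fps_nth (hf (\<alpha> * F.df a)) q \<simeq>[XI] fps_nth (hf \<alpha> * C (X.df a) * T) q"
    unfolding mult.assoc[of "hf _"]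
  proof (rule std_form_eqv[OF assms, of "\<lambda>\<alpha>. fps_nth (hf (\<alpha> * F.df a)) q" "\<lambda>\<alpha>. fps_nth (hf \<alpha> * (C (X.df a) * T)) q"])
    fix a0 :: 'a and as :: "'a list"
    have "hf (std_form a0 as * F.df a) \<approx>[XI] hser a0 (as @ [a]) * T"
      using hf_std[of a0 "as @ [a]"] by (simp add: std_form_snoc)
    also have "\<dots> = hser a0 as * T * (C (X.df a) * T)" by (simp add: hser_snoc mult.assoc)
    also have "\<dots> \<approx>[XI] hf (std_form a0 as) * (C (X.df a) * T)" by (intro X.f_mult X.f_sym[OF hf_std] X.f_refl)
    finally show "fps_nth (hf (std_form a0 as * F.df a)) q \<simeq>[XI] fps_nth (hf (std_form a0 as) * (C (X.df a) * T)) q"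
      by (simp add: feq_def)
  next
    fix x assume x: "x \<in> FI"
    show "fps_nth (hf (x * F.df a)) q \<in> XI" by (rule hf_FI[OF F.absorb_r[OF x]])
    show "fps_nth (hf x * (C (X.df a) * T)) q \<in> XI"
      unfolding fps_mult_nth[of "hf x"] by (rule X.closed(6)) (rule X.absorb_r[OF hf_FI[OF x]])
  qed (auto intro!: klin_intros klin_fps_mult X.sub)
qed

abbreviation it_ser :: "('a, 'k) ext_forms fps \<Rightarrow> ('a, 'k) ext_forms fps" where
  "it_ser \<equiv> fmap i_t"

lemma it_ser_hser_T: "it_ser (hser a0 as * T) = it_ser (hser a0 as) * T"
  using fmap_i_t_mult[OF hser_ldeg[of a0 as], of T] by simp

lemma it_ser_snoc: "it_ser (hser a0 (as @ [a])) = it_ser (hser a0 as) * T * C (X.df a)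
   + sg (int (length as)) * (hser a0 as * T * C (X.el a * gen t_letter - gen t_letter * X.el a))"
proof -
  have "hser a0 as * T \<in> fpiece ldeg (int (length as))" by (rule fpiece_mult[OF hser_ldeg T_ldeg]) simp
  from fmap_i_t_mult[OF this, of "C (X.df a)"] show ?thesis
    unfolding hser_snoc by (simp add: it_ser_hser_T fmap_const[OF klin_i_t[OF klin_id]])
qed

lemma sg_fps: "sg n * (F * G) = F * (sg n * (G :: ('a, 'k) ext_forms fps))"
  by (simp add: sg_def)

text \<open>Right multiplication by a leaves the standard forms, so a is pushed to the left by da' a
  = d(a' a) - a' da. Every step leaves a commutator of some a' with T, that is z T [a', t] T with
  [a', t] = i_t(da'), and these terms add up to i_t of the series.\<close>

lemma hf_mult_el:
  "hf (std_form a0 as * F.el a) \<approx>[XI]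
     hser a0 as * C (X.el a) * T + sg (int (length as)) * (fps_X * (it_ser (hser a0 as) * T * C (X.df a) * T))"
proof (induction as arbitrary: a rule: rev_induct)
  case Nil
  have "std_form a0 [] * F.el a \<simeq>[FI] std_form (a0 * a) []"
    using F.sym[OF F.el_mult] by (simp add: std_form_Cons)
  then have "hf (std_form a0 [] * F.el a) \<approx>[XI] hf (std_form (a0 * a) [])" by (rule hf_cong)
  also have "\<dots> \<approx>[XI] C (X.el (a0 * a)) * T" using hf_std[of "a0 * a" "[]"] by simp
  also have "\<dots> \<approx>[XI] C (X.el a0 * X.el a) * T" by (intro X.f_mult X.f_const X.el_mult X.f_refl)
  finally show ?case by (simp add: fmap_const[OF klin_i_t[OF klin_id]])
next
  case (snoc a' as)
  define s where "s = (sg (int (length as)) :: ('a, 'k) ext_forms fps)"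
  define H where "H = (hser a0 as :: ('a, 'k) ext_forms fps)"
  have ss: "s * s = 1" "sg (int (length (as @ [a']))) = - s" by (simp_all add: s_def sg_add)
  have sX: "s * (A * B) = A * (s * B)" for A B by (simp add: s_def sg_fps)
  have e: "std_form a0 (as @ [a']) * F.el a \<simeq>[FI] std_form a0 as * F.df (a' * a) - (std_form a0 as * F.el a') * F.df a"
  proof -
    have "F.df a' * F.el a \<simeq>[FI] F.df (a' * a) - F.el a' * F.df a"
      using F.diff[OF F.sym[OF F.df_mult] F.refl, of a' a "F.el a' * F.df a"] by simp
    from F.mult[OF F.refl[of "std_form a0 as"] this] show ?thesis
      by (simp add: std_form_snoc mult.assoc right_diff_distrib)
  qed
  have p: "std_form a0 as * F.el a' \<in> piece fdeg (int (length as))"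
    by (rule piece_mult'[OF std_form_piece El_piece]) simp
  have "hf (std_form a0 (as @ [a']) * F.el a) \<approx>[XI] hf (std_form a0 as * F.df (a' * a)) - hf ((std_form a0 as * F.el a') * F.df a)"
    using hf_cong[OF e] by (simp add: hf_diff)
  also have "\<dots> \<approx>[XI] (H * T) * C (X.df a' * X.el a + X.el a' * X.df a) * T
     - (H * C (X.el a') * T + s * (fps_X * (it_ser H * T * C (X.df a') * T))) * C (X.df a) * T"
    unfolding H_def s_def
  proof (rule X.f_diff)
    show "hf (std_form a0 as * F.df (a' * a)) \<approx>[XI] hser a0 as * T * C (X.df a' * X.el a + X.el a' * X.df a) * T"
      by (rule X.f_trans[OF hf_snoc[OF std_form_piece]]) (intro X.f_mult X.f_refl X.f_const X.df_mult hf_std)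
    show "hf (std_form a0 as * F.el a' * F.df a) \<approx>[XI]
      (hser a0 as * C (X.el a') * T + sg (int (length as)) * (fps_X * (it_ser (hser a0 as) * T * C (X.df a') * T))) * C (X.df a) * T"
      by (rule X.f_trans[OF hf_snoc[OF p]]) (intro X.f_mult X.f_refl snoc.IH)
  qed
  \<comment> \<open>The term a' da of d(a' a) combines with -a' da of the other summand to the
    commutator of a' with T.\<close>
  also have "\<dots> = H * T * C (X.df a') * C (X.el a) * T
     - (H * (C (X.el a') * T - T * C (X.el a')) + s * (fps_X * (it_ser H * T * C (X.df a') * T))) * C (X.df a) * T"
    by (simp add: fps_const_add[symmetric] fps_const_mult[symmetric] algebra_simps del: fps_const_add fps_const_mult)
  also have "\<dots> = H * T * C (X.df a') * C (X.el a) * T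
     - fps_X * ((H * T * C (X.el a' * gen t_letter - gen t_letter * X.el a') * T + s * (it_ser H * T * C (X.df a') * T)) * C (X.df a) * T)"
    unfolding T_commutator X_left sX[of fps_X] by (simp add: algebra_simps)
  also have "\<dots> = hser a0 (as @ [a']) * C (X.el a) * T
     + sg (int (length (as @ [a']))) * (fps_X * (it_ser (hser a0 (as @ [a'])) * T * C (X.df a) * T))"
  proof -
    define Y where "Y = H * T * C (X.el a' * gen t_letter - gen t_letter * X.el a')"
    define Z where "Z = it_ser H * T * C (X.df a')"
    have "(Y * T + s * (Z * T)) * C (X.df a) * T = s * ((Z + s * Y) * T * C (X.df a) * T)"
      using ss(1) by (simp add: distrib_left distrib_right flip: mult.assoc)
    then have "fps_X * ((Y * T + s * (Z * T)) * C (X.df a) * T) = s * (fps_X * ((Z + s * Y) * T * C (X.df a) * T))"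
      by (simp add: sX)
    then have "H * T * C (X.df a') * C (X.el a) * T - fps_X * ((Y * T + s * (Z * T)) * C (X.df a) * T)
      = H * T * C (X.df a') * C (X.el a) * T + (- s) * (fps_X * ((Z + s * Y) * T * C (X.df a) * T))"
      by simp
    then show ?thesis unfolding it_ser_snoc unfolding hser_snoc H_def[symmetric] ss(2) s_def[symmetric] Y_def Z_def .
  qed
  finally show ?case .
qed

lemma hf_el_mult: "hf (F.el a * std_form a0 as) \<approx>[XI] C (X.el a) * (hser a0 as * T)"
proof -
  have "F.el a * std_form a0 as \<simeq>[FI] std_form (a * a0) as"
    using F.mult[OF F.sym[OF F.el_mult] F.refl] by (simp add: std_form_Cons mult.assoc)
  then have "hf (F.el a * std_form a0 as) \<approx>[XI] hf (std_form (a * a0) as)" by (rule hf_cong)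
  also have "\<dots> \<approx>[XI] C (X.el (a * a0)) * (T * qser as)" using hf_std[of "a * a0" as] by (simp add: hser_qser)
  also have "\<dots> \<approx>[XI] C (X.el a * X.el a0) * (T * qser as)" by (intro X.f_mult X.f_const X.el_mult X.f_refl)
  finally show ?thesis by (simp add: hser_qser fps_const_mult[symmetric] mult.assoc del: fps_const_mult)
qed

lemma f_X_D: "F \<approx>[XI] G \<Longrightarrow> F \<approx>[DT] G" unfolding feq_def using X_D by blast

lemma f_commute:
  assumes "F \<in> fpiece ldeg p" "G \<in> fpiece ldeg q"
  shows "F * G \<approx>[DT] sg (p * q) * (G * F)"
  unfolding feq_def
proof
  fix m
  have "fps_nth (F * G) m \<simeq>[DT] (\<Sum>i=0..m. sg (p * q) * (fps_nth G (m - i) * fps_nth F i))"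
    unfolding fps_mult_nth by (intro D.sum commutator_DT) (use assms in \<open>auto simp: fpiece_def\<close>)
  also have "\<dots> = sg (p * q) * (\<Sum>i=0..m. fps_nth G (m - i) * fps_nth F (m - (m - i)))"
    by (simp add: sum_distrib_left)
  also have "(\<Sum>i=0..m. fps_nth G (m - i) * fps_nth F (m - (m - i))) = fps_nth (G * F) m"
    unfolding fps_mult_nth by (rule sum.reindex_bij_witness[of _ "\<lambda>i. m - i" "\<lambda>i. m - i"]) auto
  finally show "fps_nth (F * G) m \<simeq>[DT] fps_nth (sg (p * q) * (G * F)) m" by simp
qed

text \<open>The difference of \<open>hf_mult_el\<close> and \<open>hf_el_mult\<close> contains i_t
  on all differentials but the last; the commutator of a_n with T supplies the last one. What
  remains is a commutator with a_n, where passing to DR_t is used.\<close>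

lemma hf_b_formula: "hf (b_formula a0 as) \<approx>[DT] fps_X * it_ser (hser a0 as * T)"
proof (cases as rule: rev_exhaust)
  case Nil
  have "hser a0 [] \<in> (fpiece ldeg 0 :: ('a, 'k) ext_forms fps set)" using hser_ldeg[of a0 "[]"] by simp
  from fmap_i_t_mult[OF this, of T] show ?thesis
    by (simp add: Nil fmap_const[OF klin_i_t[OF klin_id]])
next
  case (snoc as' a)
  define n where "n = int (length as')"
  define H where "H = (hser a0 as' :: ('a, 'k) ext_forms fps)"
  have HT: "H * T \<in> fpiece ldeg n" unfolding H_def n_def by (rule fpiece_mult[OF hser_ldeg T_ldeg]) simp
  have "hf (b_formula a0 as) = sg n * (hf (std_form a0 as' * F.el a) - hf (F.el a * std_form a0 as'))"
    by (simp add: snoc b_formula_snoc hf_sg hf_diff n_def)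
  also have "\<dots> \<approx>[XI] sg n * (H * C (X.el a) * T + sg n * (fps_X * (it_ser H * T * C (X.df a) * T)) - C (X.el a) * (H * T))"
    unfolding H_def n_def by (intro X.f_mult X.f_refl X.f_diff hf_mult_el hf_el_mult)
  finally have "hf (b_formula a0 as) \<approx>[DT] \<dots>" by (rule f_X_D)
  also have "\<dots> = fps_X * (it_ser H * T * C (X.df a) * T) + sg n * (H * (C (X.el a) * T - T * C (X.el a)))
      + sg n * (H * T * C (X.el a) - C (X.el a) * (H * T))"
    by (simp add: distrib_left right_diff_distrib flip: mult.assoc)
  also have "\<dots> = fps_X * (it_ser (hser a0 as) * T) + sg n * (H * T * C (X.el a) - C (X.el a) * (H * T))"
  proof -
    have "fps_X * (it_ser (hser a0 as) * T) = fps_X * (it_ser H * T * C (X.df a) * T)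
        + fps_X * (sg n * (H * T * C (X.el a * gen t_letter - gen t_letter * X.el a) * T))"
      unfolding snoc it_ser_snoc H_def[symmetric] n_def[symmetric] by (simp add: algebra_simps)
    moreover have "sg n * (H * (C (X.el a) * T - T * C (X.el a)))
        = fps_X * (sg n * (H * T * C (X.el a * gen t_letter - gen t_letter * X.el a) * T))"
      unfolding T_commutator by (simp add: sg_def X_left mult.assoc)
    ultimately show ?thesis by simp
  qed
  also have "\<dots> \<approx>[DT] fps_X * (it_ser (hser a0 as) * T) + 0"
  proof (rule D.f_add[OF D.f_refl])
    have "H * T * C (X.el a) - C (X.el a) * (H * T) \<approx>[DT] sg (n * 0) * (C (X.el a) * (H * T)) - C (X.el a) * (H * T)"
      by (rule D.f_diff[OF f_commute[OF HT fpiece_const[OF gen_ldeg(1)]] D.f_refl])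
    then show "sg n * (H * T * C (X.el a) - C (X.el a) * (H * T)) \<approx>[DT] 0"
      using D.uminus by (auto simp: sg_def feq_def) fastforce
  qed
  finally show ?thesis by (simp add: it_ser_hser_T)
qed

lemma hf_Df: "hf (mon (map Df as)) \<approx>[XI] T * qser as"
proof -
  have "hf (mon (map Df as)) \<approx>[XI] hf (std_form 1 as)"
    using F.mult[OF F.sym[OF F.el_one] F.refl] by (intro hf_cong) (simp add: std_form_Cons)
  also have "\<dots> \<approx>[XI] C (X.el 1) * (T * qser as)" using hf_std[of 1 as] by (simp add: hser_qser)
  also have "\<dots> \<approx>[XI] C 1 * (T * qser as)" by (intro X.f_mult X.f_const X.el_one X.f_refl)
  finally show ?thesis by simp
qed

text \<open>The Euler operator z d/dz.\<close>

definition eul :: "('a, 'k) ext_forms fps \<Rightarrow> ('a, 'k) ext_forms fps" where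
  "eul F = Abs_fps (\<lambda>q. smul (of_nat q) (fps_nth F q))"

lemma eul_mult: "eul (F * G) = eul F * G + F * eul G"
proof (rule fps_ext)
  fix q
  have "fps_nth (eul (F * G)) q = (\<Sum>i=0..q. smul (of_nat (i + (q - i))) (fps_nth F i * fps_nth G (q - i)))"
    by (simp add: eul_def fps_mult_nth smul.scale_sum_right)
  also have "\<dots> = fps_nth (eul F * G + F * eul G) q"
    unfolding of_nat_add smul.scale_left_distrib
    by (simp add: eul_def fps_mult_nth sum.distrib smul_mult_left smul_mult_right)
  finally show "fps_nth (eul (F * G)) q = fps_nth (eul F * G + F * eul G) q" .
qed

lemma eul_const: "eul (C x) = 0"
  by (rule fps_ext) (simp add: eul_def)

lemma sum_const_smul: "(\<Sum>i\<in>A. x) = smul (of_nat (card A)) (x :: 'x \<Rightarrow>\<^sub>0 'k)"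
  by (induction A rule: infinite_finite_induct) (simp_all add: smul.scale_left_distrib del: sum_constant)

lemma T_square: "T * T = eul T + T"
proof (rule fps_ext)
  fix q
  have "fps_nth (T * T) q = (\<Sum>i=0..q. gen t_letter ^ q :: ('a, 'k) ext_forms)"
    unfolding fps_mult_nth by (intro sum.cong) (simp_all add: T_def flip: power_add)
  also have "\<dots> = smul (of_nat (Suc q)) (gen t_letter ^ q)"
    unfolding sum_const_smul by simp
  finally show "fps_nth (T * T) q = fps_nth (eul T + T) q"
    by (simp add: eul_def T_def smul.scale_left_distrib)
qed

text \<open>Each factor T is doubled in turn. These are the terms of B: the T that heads a rotated
  product ends up between its two blocks.\<close>

definition insertions :: "'a list \<Rightarrow> ('a, 'k) ext_forms fps" where
  "insertions cs = (\<Sum>i=1..length cs. qser (take i cs) * (T * qser (drop i cs)))"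

lemma insertions_Cons: "insertions (c # cs) = C (X.df c) * (T * (T * qser cs)) + C (X.df c) * (T * insertions cs)"
proof -
  have "insertions (c # cs) = (\<Sum>i=0..length cs. qser (take (Suc i) (c # cs)) * (T * qser (drop (Suc i) (c # cs))))"
    unfolding insertions_def
    by (rule sum.reindex_bij_witness[of _ Suc "\<lambda>i. i - 1"]) auto
  also have "\<dots> = C (X.df c) * (T * (T * qser cs)) + (\<Sum>i=1..length cs. qser (take (Suc i) (c # cs)) * (T * qser (drop (Suc i) (c # cs))))"
    by (subst sum.atLeast_Suc_atMost) (simp_all add: mult.assoc One_nat_def)
  also have "(\<Sum>i=1..length cs. qser (take (Suc i) (c # cs)) * (T * qser (drop (Suc i) (c # cs)))) = C (X.df c) * (T * insertions cs)"
    unfolding insertions_def sum_distrib_left by (intro sum.cong) (simp_all add: mult.assoc)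
  finally show ?thesis .
qed

text \<open>By T T = eul T + T, doubling a factor T gives its Euler derivative plus an unchanged
  copy of the product. The sum over all factors is the Leibniz rule.\<close>

lemma insertions_eul: "insertions cs = eul (qser cs) + of_nat (length cs) * qser cs"
proof (induction cs)
  case Nil
  show ?case by (simp add: insertions_def) (metis eul_const fps_const_1_eq_1)
next
  case (Cons c cs)
  have c: "C x * (T * (of_nat n * G)) = of_nat n * (C x * (T * G))" for x n and G :: "('a, 'k) ext_forms fps"
    by (metis mult.assoc mult_of_nat_commute)
  have "insertions (c # cs) = C (X.df c) * ((T * T) * qser cs) + C (X.df c) * (T * (eul (qser cs) + of_nat (length cs) * qser cs))"
    unfolding insertions_Cons Cons by (simp add: mult.assoc)
  also have "\<dots> = eul (qser (c # cs)) + of_nat (length (c # cs)) * qser (c # cs)"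
    unfolding T_square distrib_left c by (simp add: eul_mult eul_const algebra_simps)
  finally show ?case .
qed

lemma of_nat_mult_smul: "of_nat n * x = smul (of_nat n) (x :: ('g, 'k) falg)"
  by (induction n) (simp_all add: smul.scale_left_distrib distrib_right)

lemma insertions_nth: "fps_nth (insertions cs) q = smul (of_nat (q + length cs)) (fps_nth (qser cs) q)"
  unfolding insertions_eul by (simp add: of_nat_mult_smul eul_def smul.scale_left_distrib)

lemma f_sg: "F \<approx>[DT] G \<Longrightarrow> sg n * F \<approx>[DT] sg n * G"
  by (cases "even n") (simp_all add: feq_def sg_def D.uminus)

text \<open>A power of \<kappa> rotates the differentials, and commuting the two blocks modulo
  commutators restores their order, leaving one doubled T. The factor q + n + 1, with n the length
  of \<open>as\<close>, later turns (q + n + 1)! into (q + n)!.\<close>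

lemma hf_B_formula:
  "fps_nth (hf (\<Sum>j\<le>length as. (kappa ^^ j) (d_form (std_form a0 as)))) q \<simeq>[DT]
     smul (of_nat (q + Suc (length as))) (fps_nth (qser (a0 # as)) q)"
proof -
  define cs where "cs = a0 # as"
  define n where "n = length as"
  have len: "length cs = Suc n" by (simp add: cs_def n_def)
  have *: "hf ((kappa ^^ j) (mon (map Df cs))) \<approx>[DT] qser (take (Suc n - j) cs) * (T * qser (drop (Suc n - j) cs))"
    if j: "j \<le> n" for j
  proof -
    define xs ys where "xs = take (Suc n - j) cs" and "ys = drop (Suc n - j) cs"
    have lx: "int (length xs) = int n + 1 - int j" and ly: "length ys = j"
      using j len by (simp_all add: xs_def ys_def)
    have cs: "cs = xs @ ys" by (simp add: xs_def ys_def)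
    have "(kappa ^^ j) (mon (map Df cs)) \<simeq>[FI] sg (int j * int n) * mon (map Df (ys @ xs))"
      using kappa_pow_rotate[OF Df_piece, of ys xs] by (simp add: cs mon_append lx ly)
    then have "hf ((kappa ^^ j) (mon (map Df cs))) \<approx>[XI] sg (int j * int n) * hf (mon (map Df (ys @ xs)))"
      by (metis hf_cong hf_sg)
    also have "\<dots> \<approx>[XI] sg (int j * int n) * ((T * qser ys) * qser xs)"
      using X.f_mult[OF X.f_refl hf_Df[of "ys @ xs"], of "sg (int j * int n)"] by (simp only: qser_append mult.assoc)
    finally have "hf ((kappa ^^ j) (mon (map Df cs))) \<approx>[DT] sg (int j * int n) * ((T * qser ys) * qser xs)" by (rule f_X_D)
    also have "\<dots> \<approx>[DT] sg (int j * int n) * (sg (int j * (int n + 1 - int j)) * (qser xs * (T * qser ys)))"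
    proof -
      have "T * qser ys \<in> fpiece ldeg (int j)"
        by (rule fpiece_mult[OF T_ldeg qser_ldeg]) (simp add: ly)
      from f_commute[OF this qser_ldeg[of xs, unfolded lx]]
      have "(T * qser ys) * qser xs \<approx>[DT] sg (int j * (int n + 1 - int j)) * (qser xs * (T * qser ys))" .
      then show ?thesis by (rule f_sg)
    qed
    \<comment> \<open>The total exponent j n + j (n + 1 - j) is even: the sign of the rotation
      cancels that of the commutation.\<close>
    also have "\<dots> = qser xs * (T * qser ys)"
      by (cases "even j"; cases "even n") (auto simp: sg_def)
    finally show ?thesis unfolding xs_def ys_def .
  qed
  have "fps_nth (hf (\<Sum>j\<le>length as. (kappa ^^ j) (d_form (std_form a0 as :: ('a, 'k) nc_forms)))) q
      = (\<Sum>j\<le>n. fps_nth (hf ((kappa ^^ j) (mon (map Df cs)))) q)"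
    by (simp add: hf_sum fps_sum_nth d_std_form n_def cs_def)
  also have "\<dots> \<simeq>[DT] (\<Sum>j\<le>n. fps_nth (qser (take (Suc n - j) cs) * (T * qser (drop (Suc n - j) cs))) q)"
    by (rule D.sum) (use * in \<open>auto simp: feq_def\<close>)
  also have "\<dots> = (\<Sum>i=1..Suc n. fps_nth (qser (take i cs) * (T * qser (drop i cs))) q)"
    by (rule sum.reindex_bij_witness[of _ "\<lambda>i. Suc n - i" "\<lambda>j. Suc n - j"]) auto
  also have "\<dots> = fps_nth (insertions cs) q" by (simp add: insertions_def fps_sum_nth len)
  finally show ?thesis by (simp add: insertions_nth len n_def cs_def)
qed

lemma d_hser: "fmap d_ext (hser a0 as * T) = (qser (a0 # as) :: ('a, 'k) ext_forms fps)"
proof -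
  have q0: "fmap d_ext (qser as) = (0 :: ('a, 'k) ext_forms fps)" for as :: "'a list"
  proof (induction as)
    case Nil
    show ?case by (rule fps_ext) (simp add: ext_simps)
  next
    case (Cons a as)
    then show ?case
      by (simp add: fmap_d_mult[OF fpiece_const[OF gen_ldeg(2)]] fmap_d_mult[OF T_ldeg] fmap_const[OF klin_d_ext[OF klin_id]])
  qed
  show ?thesis
    unfolding hser_qser
    by (simp add: fmap_d_mult[OF fpiece_const[OF gen_ldeg(1)]] fmap_d_mult[OF T_ldeg] fmap_const[OF klin_d_ext[OF klin_id]] q0)
qed

end

text \<open>Every factor T contributes one power of t, so the coefficient of z^q in the product runs
  over the ways to distribute q letters t.\<close>

lemma compositions_sum:
  "(\<Sum>ks\<in>{ks :: nat list. length ks = length ls \<and> sum_list ks = q}.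
      mon (concat (map2 (\<lambda>l k. Form l # replicate k t_letter) ls ks)))
   = fps_nth (foldr (\<lambda>l F. C (gen (Form l)) * (T * F)) ls 1 :: ('a, 'k::comm_ring_1) ext_forms fps) q"
proof (induction ls arbitrary: q)
  case Nil
  have "{ks :: nat list. length ks = length [] \<and> sum_list ks = q} = (if q = 0 then {[]} else {})" by auto
  then show ?case by simp
next
  case (Cons l ls)
  let ?S = "\<lambda>q ls. {ks :: nat list. length ks = length ls \<and> sum_list ks = q}"
  have fin: "finite (?S q ls)" for q and ls :: "'a form list"
  proof (rule finite_subset)
    show "?S q ls \<subseteq> {ks. set ks \<subseteq> {..q} \<and> length ks = length ls}"
      using member_le_sum_list by fastforce
    show "finite {ks. set ks \<subseteq> {..q} \<and> length ks = length ls}" by (rule finite_lists_length_eq) simp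
  qed
  have S: "?S q (l # ls) = (\<lambda>(k, ks). k # ks) ` (SIGMA k:{0..q}. ?S (q - k) ls)"
  proof (intro equalityI subsetI)
    fix ks assume "ks \<in> ?S q (l # ls)"
    then show "ks \<in> (\<lambda>(k, ks). k # ks) ` (SIGMA k:{0..q}. ?S (q - k) ls)"
      by (cases ks) force+
  qed auto
  have "(\<Sum>ks\<in>?S q (l # ls). mon (concat (map2 (\<lambda>l k. Form l # replicate k t_letter) (l # ls) ks)))
    = (\<Sum>k=0..q. \<Sum>ks\<in>?S (q - k) ls. mon (concat (map2 (\<lambda>l k. Form l # replicate k t_letter) (l # ls) (k # ks))) :: ('a, 'k) ext_forms)"
    unfolding S by (subst sum.reindex) (auto simp: inj_on_def fin sum.Sigma case_prod_unfold)
  also have "\<dots> = (\<Sum>k=0..q. gen (Form l) * (gen t_letter ^ k * fps_nth (foldr (\<lambda>l F. C (gen (Form l)) * (T * F)) ls 1) (q - k)))"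
    unfolding Cons.IH[symmetric] sum_distrib_left
  proof (intro sum.cong HOL.refl)
    fix k and ks :: "nat list"
    show "mon (concat (map2 (\<lambda>l k. Form l # replicate k t_letter) (l # ls) (k # ks)))
      = gen (Form l) * (gen t_letter ^ k * (mon (concat (map2 (\<lambda>l k. Form l # replicate k t_letter) ls ks)) :: ('a, 'k) ext_forms))"
      using mon_Cons[of "Form l" "replicate k t_letter @ concat (map2 (\<lambda>l k. Form l # replicate k t_letter) ls ks)"]
      by (simp add: mon_append replicate_t)
  qed
  also have "\<dots> = fps_nth (foldr (\<lambda>l F. C (gen (Form l)) * (T * F)) (l # ls) 1) q"
  proof -
    have "fps_nth T k = (gen t_letter ^ k :: ('a, 'k) ext_forms)" for k by (simp add: T_def)
    then show ?thesis by (simp add: fps_mult_nth[of T] sum_distrib_left)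
  qed
  finally show ?case .
qed

lemma hser_foldr: "hser a0 as * T = foldr (\<lambda>l F. C (gen (Form l)) * (T * F)) (El a0 # map Df as) 1"
  by (simp add: hser_qser qser_def foldr_map comp_def)

definition tsygan_formula :: "(rat \<Rightarrow> 'k::comm_ring_1) \<Rightarrow> nat \<Rightarrow> 'a \<Rightarrow> 'a list \<Rightarrow> ('a, 'k) ext_forms" where
  "tsygan_formula \<rho> q a0 as = smul (\<rho> (1 / fact (q + length as))) (fps_nth (hser a0 as * T) q)"

lemma tsygan_formula: "tsygan \<rho> f q = on_normal (tsygan_formula \<rho> q) f"
proof -
  have "(\<Sum>ks\<in>{ks :: nat list. length ks = Suc (length as) \<and> sum_list ks = q}.
       smul (\<rho> (1 / fact (sum_list ks + length as)))
         (mon (concat (map2 (\<lambda>l k. Form l # replicate k t_letter) (El a0 # map Df as) ks))))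
     = tsygan_formula \<rho> q a0 as" for a0 :: 'a and as
    using compositions_sum[of "El a0 # map Df as" q, where 'k='b]
    by (simp add: tsygan_formula_def hser_foldr flip: smul.scale_sum_right)
  then show ?thesis unfolding tsygan_def by simp
qed

lemma klin_tsygan [klin_intros]: "klin g \<Longrightarrow> klin (\<lambda>x. tsygan \<rho> (g x) q)"
  unfolding tsygan_formula by (rule klin_on_normal')

lemma tsygan_hf:
  assumes "f \<in> piece fdeg (int n)"
  shows "tsygan \<rho> f q = smul (\<rho> (1 / fact (q + n))) (fps_nth (hf f) q)"
proof -
  have "tsygan \<rho> f q \<simeq>[{0}] on_normal (\<lambda>a0 as. smul (\<rho> (1 / fact (q + n))) (fps_nth (hser a0 as * T) q)) f"
    unfolding tsygan_formula
    by (rule on_normal_cong[OF assms]) (auto simp: eqv_def tsygan_formula_def smul.subspace_single_0)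
  then show ?thesis
    by (simp add: eqv_def hf_nth on_normal_klin[OF klin_scale[OF klin_id]])
qed

lemma tsygan_bipiece:
  assumes "f \<in> piece fdeg p"
  shows "tsygan \<rho> f q \<in> bipiece p (int q)"
  unfolding tsygan_formula
  by (rule on_normal_mem[OF assms])
     (use hser_T_bipiece in \<open>force simp: tsygan_formula_def intro!: smul.subspace_scale\<close>)+

section \<open>The Tsygan map exchanges b, B with i_t, d\<close>

locale tsygan_alg = k_alg sc + rat_alg \<rho>
  for sc :: "'k::comm_ring_1 \<Rightarrow> 'a::ring_1 \<Rightarrow> 'a" and \<rho> :: "rat \<Rightarrow> 'k"
begin

abbreviation "E \<equiv> tsygan \<rho>"

lemma E_FI: "x \<in> FI \<Longrightarrow> E x q \<in> XI"
proof -
  note D = admissibleD[OF admissible_hser]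
  have "admissible XI (tsygan_formula \<rho> q)"
  proof (rule admissibleI)
    fix a b :: 'a and as
    show "tsygan_formula \<rho> q (a + b) as \<simeq>[XI] tsygan_formula \<rho> q a as + tsygan_formula \<rho> q b as"
      using X.scale[OF D(1)] by (simp add: tsygan_formula_def smul.scale_right_distrib[symmetric])
  next
    fix c and a :: 'a and as
    show "tsygan_formula \<rho> q (sc c a) as \<simeq>[XI] smul c (tsygan_formula \<rho> q a as)"
      using X.scale[OF D(2), of "\<rho> (1 / fact (q + length as))"]
      by (simp add: tsygan_formula_def mult.commute)
  next
    fix a0 xs and a b :: 'a and ys
    show "tsygan_formula \<rho> q a0 (xs @ (a + b) # ys) \<simeq>[XI] tsygan_formula \<rho> q a0 (xs @ a # ys) + tsygan_formula \<rho> q a0 (xs @ b # ys)"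
      using X.scale[OF D(3)] by (simp add: tsygan_formula_def smul.scale_right_distrib[symmetric])
  next
    fix a0 xs and c and a :: 'a and ys
    show "tsygan_formula \<rho> q a0 (xs @ sc c a # ys) \<simeq>[XI] smul c (tsygan_formula \<rho> q a0 (xs @ a # ys))"
      using X.scale[OF D(4), of "\<rho> (1 / fact (q + length (xs @ a # ys)))"]
      by (simp add: tsygan_formula_def mult.commute)
  next
    fix a0 :: 'a and xs ys
    show "tsygan_formula \<rho> q a0 (xs @ 1 # ys) \<simeq>[XI] 0"
      using X.scale[OF D(5), of "\<rho> (1 / fact (q + length (xs @ 1 # ys)))"]
      by (simp add: tsygan_formula_def)
  qed
  then show "x \<in> FI \<Longrightarrow> E x q \<in> XI"
    unfolding tsygan_formula by (rule on_normal_ideal[OF X.sub])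
qed

lemma E_ON: "x \<in> ON \<Longrightarrow> E x q \<in> DT"
proof (rule ON_mem[OF klin_tsygan[OF klin_id] D.sub])
  fix x :: "('a, 'k) nc_forms" assume "x \<in> FI"
  then show "E x q \<in> DT" by (rule subsetD[OF XI_DT E_FI])
next
  have "C (X.el 1) * (T * qser []) \<approx>[XI] C 1 * (T * 1)"
    unfolding qser_simps by (intro X.f_mult X.f_const X.el_one X.f_refl)
  then have "fps_nth (hser 1 [] * T) q \<simeq>[DT] gen t_letter ^ q"
    unfolding hser_qser by (intro X_D) (simp add: feq_def T_def)
  then have "fps_nth (hser 1 [] * T) q \<in> DT" using t_pow_DT D.mem_cong by blast
  then show "E 1 q \<in> DT"
    unfolding tsygan_formula on_normal_one tsygan_formula_def by (rule D.closed(4))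
qed

lemma E_cong: "x \<simeq>[ON] y \<Longrightarrow> E x q \<simeq>[DT] E y q"
  by (rule D.klin[OF klin_tsygan[OF klin_id] E_ON])

text \<open>The number of letters t plus the number of differentials is the same on both sides, so
  the factorials agree. The factor z in \<open>hf_b_formula\<close> gives the shift of q and the
  vanishing component of degree 0.\<close>

lemma E_b:
  assumes "f \<in> piece fdeg p"
  shows "E (b_op f) (Suc q) \<simeq>[DT] i_t (E f q)" "E (b_op f) 0 \<simeq>[DT] 0"
proof -
  have b: "fps_nth (hf (b_op f)) q \<simeq>[DT] fps_nth (fps_X * fmap i_t (hf f)) q" for q
  proof -
    have "fps_nth (hf (b_op f)) q = on_normal (\<lambda>a0 as. fps_nth (hf (b_formula a0 as)) q) f"
      unfolding b_op_formula by (rule on_normal_klin[OF klin_hf[OF klin_id], symmetric])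
    also have "\<dots> \<simeq>[DT] on_normal (\<lambda>a0 as. fps_nth (fps_X * it_ser (hser a0 as * T)) q) f"
      using hf_b_formula by (intro on_normal_cong' D.sub) (simp only: feq_def)
    also have "\<dots> = fps_nth (fps_X * fmap i_t (hf f)) q"
    proof (cases q)
      case 0
      then show ?thesis by (simp add: on_normal_klin[OF klin_const0])
    next
      case (Suc m)
      then show ?thesis by (simp add: on_normal_klin[OF klin_i_t[OF klin_id]] hf_nth)
    qed
    finally show ?thesis .
  qed
  have main: "E (b_op f) (Suc q) \<simeq>[DT] i_t (E f q) \<and> E (b_op f) 0 \<simeq>[DT] 0"
  proof (cases "p \<le> 0")
    case True
    have "b_op f = 0"
    proof (cases "p = 0")
      case False
      then have "f = 0" using True piece_neg_deg[OF _ assms] by simp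
      then show ?thesis by (simp add: op_simps)
    qed (use assms b_piece0 in simp)
    moreover have "i_t (E f q) = 0"
      using bipiece_neg[OF i_t_bipiece[OF tsygan_bipiece[OF assms]]] True by simp
    ultimately show ?thesis by (simp add: klin_zero[OF klin_tsygan[OF klin_id]])
  next
    case False
    define n where "n = nat (p - 1)"
    have f: "f \<in> piece fdeg (int (Suc n))" using assms False by (simp add: n_def)
    have bf: "b_op f \<in> piece fdeg (int n)" using b_piece[OF f] by simp
    have "E (b_op f) (Suc q) \<simeq>[DT] smul (\<rho> (1 / fact (Suc q + n))) (i_t (fps_nth (hf f) q))"
      unfolding tsygan_hf[OF bf] using D.scale[OF b[of "Suc q"]] by simp
    moreover have "E (b_op f) 0 \<simeq>[DT] 0"
      unfolding tsygan_hf[OF bf] using D.scale[OF b[of 0], of "\<rho> (1 / fact (0 + n))"] by simp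
    ultimately show ?thesis unfolding tsygan_hf[OF f] by (simp add: ext_simps)
  qed
  from main show "E (b_op f) (Suc q) \<simeq>[DT] i_t (E f q)" "E (b_op f) 0 \<simeq>[DT] 0" by auto
qed

lemma rho_fact: "\<rho> (1 / fact (Suc m)) * of_nat (Suc m) = \<rho> (1 / fact m)"
proof -
  have "\<rho> (1 / fact (Suc m)) * of_nat (Suc m) = \<rho> (1 / fact (Suc m) * of_nat (Suc m))"
    unfolding rho_mult rho_of_nat ..
  also have "1 / fact (Suc m) * of_nat (Suc m) = (1 / fact m :: rat)"
    by (simp add: field_simps del: of_nat_Suc)
  finally show ?thesis .
qed

text \<open>The factorial of E B f has one factor more than that of E f, and this factor cancels the
  one in \<open>hf_B_formula\<close>.\<close>

lemma E_B:
  assumes "f \<in> piece fdeg p"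
  shows "E (B_op f) q \<simeq>[DT] d_ext (E f q)"
proof (cases "p < 0")
  case True
  then have "f = 0" using piece_neg_deg[OF _ assms] by simp
  then show ?thesis by (simp add: op_simps ext_simps klin_zero[OF klin_tsygan[OF klin_id]])
next
  case False
  define n where "n = nat p"
  have f: "f \<in> piece fdeg (int n)" using assms False by (simp add: n_def)
  have Bf: "B_op f \<in> piece fdeg (int (Suc n))" using B_piece[OF f] by (simp add: add.commute)
  have "fps_nth (hf (B_op f)) q = on_normal (\<lambda>a0 as. fps_nth (hf (\<Sum>j\<le>length as. (kappa ^^ j) (d_form (std_form a0 as)))) q) f"
    unfolding B_op_def by (rule on_normal_klin[OF klin_hf[OF klin_id], symmetric])
  also have "\<dots> \<simeq>[DT] on_normal (\<lambda>a0 as. smul (of_nat (q + Suc n)) (d_ext (fps_nth (hser a0 as * T) q))) f"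
  proof (rule on_normal_cong[OF f D.sub])
    fix a0 :: 'a and as :: "'a list" assume "int (length as) = int n"
    then have n: "length as = n" by simp
    have "d_ext (fps_nth (hser a0 as * T) q) = (fps_nth (qser (a0 # as)) q :: ('a, 'k) ext_forms)"
      by (simp only: d_hser flip: fmap_nth)
    then show "fps_nth (hf (\<Sum>j\<le>length as. (kappa ^^ j) (d_form (std_form a0 as)))) q
      \<simeq>[DT] smul (of_nat (q + Suc n)) (d_ext (fps_nth (hser a0 as * T) q))"
      using hf_B_formula[where ?a0.0=a0 and as=as and q=q] n by simp
  qed
  also have "\<dots> = smul (of_nat (q + Suc n)) (d_ext (fps_nth (hf f) q))"
    unfolding hf_nth by (rule on_normal_klin[OF klin_scale[OF klin_d_ext[OF klin_id]]])
  finally have "E (B_op f) q \<simeq>[DT] smul (\<rho> (1 / fact (q + Suc n))) (smul (of_nat (q + Suc n)) (d_ext (fps_nth (hf f) q)))"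
    unfolding tsygan_hf[OF Bf] by (rule D.scale)
  also have "\<dots> = smul (\<rho> (1 / fact (q + n))) (d_ext (fps_nth (hf f) q))"
    using rho_fact[of "q + n"] by (simp del: of_nat_Suc of_nat_add fact_Suc)
  finally show ?thesis unfolding tsygan_hf[OF f] by (simp add: ext_simps)
qed

end

section \<open>Acyclicity of extended forms of positive degree in \<open>t\<close>\<close>

lemma klin_forms_to_ext [klin_intros]: "klin g \<Longrightarrow> klin (\<lambda>x. forms_to_ext (g x))"
  unfolding forms_to_ext_def by (rule klin_lin')

lemma forms_to_ext_mon [simp]: "forms_to_ext (mon w) = mon (map Form w)"
  by (simp add: forms_to_ext_def mon_def)

lemma forms_to_ext_gen [simp]: "forms_to_ext (gen l) = gen (Form l)" "forms_to_ext 1 = 1"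
  using forms_to_ext_mon[of "[l]"] forms_to_ext_mon[of "[]"] by simp_all

lemma forms_to_ext_mult [simp]: "forms_to_ext (f * g) = forms_to_ext f * forms_to_ext g"
proof (rule falg_eqI[of "\<lambda>f. forms_to_ext (f * g)" "\<lambda>f. forms_to_ext f * forms_to_ext g"])
  fix u
  show "forms_to_ext (mon u * g) = forms_to_ext (mon u) * forms_to_ext g"
    by (rule falg_eqI[of "\<lambda>g. forms_to_ext (mon u * g)" "\<lambda>g. forms_to_ext (mon u) * forms_to_ext g"])
       (auto intro!: klin_intros simp flip: mon_append)
qed (auto intro!: klin_intros)

lemmas fe_simps = klin_add[OF klin_forms_to_ext[OF klin_id]] klin_diff[OF klin_forms_to_ext[OF klin_id]]
  klin_smul[OF klin_forms_to_ext[OF klin_id]] klin_zero[OF klin_forms_to_ext[OF klin_id]]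
  klin_neg[OF klin_forms_to_ext[OF klin_id]]

lemma sum_deg_Form [simp]: "sum_list (map (ldeg \<circ> Form) w) = sum_list (map fdeg w)"
    "sum_list (map (vdeg \<circ> Form) w) = 0"
  by (induction w) auto

lemma forms_to_ext_bipiece: "f \<in> piece fdeg p \<Longrightarrow> forms_to_ext f \<in> bipiece p 0"
proof (rule piece_mem[OF _ klin_forms_to_ext[OF klin_id]])
  fix w :: "'a form list" assume "int (sum_list (map fdeg w)) = p"
  then show "forms_to_ext (mon w) \<in> bipiece p 0" by (simp add: bipiece_def piece_mon)
qed auto

lemma d_ext_forms: "d_ext (forms_to_ext f) = forms_to_ext (d_form f)"
proof (rule falg_eqI[of "\<lambda>f. d_ext (forms_to_ext f)" "\<lambda>f. forms_to_ext (d_form f)"])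
  fix w :: "'a form list"
  show "d_ext (forms_to_ext (mon w)) = forms_to_ext (d_form (mon w))"
  proof (induction w)
    case (Cons l w)
    have l: "gen l \<in> piece fdeg (int (fdeg l))" and l': "gen (Form l) \<in> piece ldeg (int (fdeg l))"
      by (simp_all add: piece_mon)
    have 1: "forms_to_ext (mon (l # w)) = gen (Form l) * forms_to_ext (mon w)"
      by (subst mon_Cons) (simp del: forms_to_ext_mon)
    have 2: "d_form (mon (l # w)) = d_letter l * mon w + sg (int (fdeg l)) * (gen l * d_form (mon w))"
      by (subst mon_Cons) (simp add: d_mult[OF l])
    have 3: "d_ext (gen (Form l)) = forms_to_ext (d_letter l)"
      by (cases l) (simp_all add: fe_simps)
    have 4: "forms_to_ext (sg n) = sg n" for n by (simp add: sg_def fe_simps)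
    show ?case
      unfolding 1 2 d_ext_mult[OF l'] 3 Cons by (simp add: fe_simps 4 del: forms_to_ext_mon)
  qed (simp add: fe_simps ext_simps)
qed (auto intro!: klin_intros)

lemma form_relations_forms_to_ext:
  assumes "r \<in> form_relations sc {} Form"
  shows "\<exists>r'\<in>form_relations sc {} (\<lambda>l. l). r = forms_to_ext r'"
  using assms
proof (cases rule: form_relations_cases)
  case (1 a b)
  then show ?thesis by (intro bexI[of _ "gen (El (a + b)) - (gen (El a) + gen (El b))"])
     (auto simp: fe_simps form_relations_def)
next
  case (2 c a)
  then show ?thesis by (intro bexI[of _ "gen (El (sc c a)) - smul c (gen (El a))"])
     (auto simp: fe_simps form_relations_def)
next
  case (3 a b)
  then show ?thesis by (intro bexI[of _ "gen (El (a * b)) - gen (El a) * gen (El b)"])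
     (auto simp: fe_simps form_relations_def)
next
  case 4
  then show ?thesis by (intro bexI[of _ "gen (El 1) - 1"]) (auto simp: fe_simps form_relations_def)
next
  case (6 a b)
  then show ?thesis by (intro bexI[of _ "gen (Df (a + b)) - (gen (Df a) + gen (Df b))"])
     (auto simp: fe_simps form_relations_def)
next
  case (7 c a)
  then show ?thesis by (intro bexI[of _ "gen (Df (sc c a)) - smul c (gen (Df a))"])
     (auto simp: fe_simps form_relations_def)
next
  case (8 c)
  then show ?thesis by (intro bexI[of _ "gen (Df (sc c 1))"]) (auto simp: fe_simps form_relations_def)
next
  case (10 a b)
  then show ?thesis by (intro bexI[of _ "gen (Df (a * b)) - (gen (Df a) * gen (El b) + gen (El a) * gen (Df b))"])
     (auto simp: fe_simps form_relations_def)
qed auto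

section \<open>The cyclic derivative with respect to t\<close>

context k_alg
begin

lemma forms_to_ext_FI: "x \<in> FI \<Longrightarrow> forms_to_ext x \<in> XI"
  unfolding forms_ideal_def
proof (rule ideal_k_mem[OF klin_forms_to_ext[OF klin_id] X.sub])
  fix u v and r :: "('a, 'k) nc_forms" assume r: "r \<in> form_relations sc {} (\<lambda>l. l)"
  have "forms_to_ext r \<in> XI"
    using r
  proof (cases rule: form_relations_cases)
    case (1 a b) then show ?thesis using X.el_add[of a b] by (simp add: fe_simps eqv_def)
  next
    case (2 c a) then show ?thesis using X.el_sc[of c a] by (simp add: fe_simps eqv_def)
  next
    case (3 a b) then show ?thesis using X.el_mult[of a b] by (simp add: fe_simps eqv_def)
  next
    case 4 then show ?thesis using X.el_one by (simp add: fe_simps eqv_def)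
  next
    case (6 a b) then show ?thesis using X.df_add[of a b] by (simp add: fe_simps eqv_def)
  next
    case (7 c a) then show ?thesis using X.df_sc[of c a] by (simp add: fe_simps eqv_def)
  next
    case (8 c) then show ?thesis using X.df_scalar[of c] by (simp add: fe_simps eqv_def)
  next
    case (10 a b) then show ?thesis using X.df_mult[of a b] by (simp add: fe_simps eqv_def)
  qed auto
  then show "forms_to_ext (mon u * r * mon v) \<in> XI" by (simp add: X.absorb3)
qed

text \<open>The relations contain no t, so they come from relations between ordinary forms and fit
  into one of the factors between consecutive letters t.\<close>

lemma XI_mem:
  assumes "klin L" "submod W"
    "\<And>u v r p. r \<in> form_relations sc {} (\<lambda>l. l) \<Longrightarrow> r \<in> piece fdeg p \<Longrightarrow> L (mon u * forms_to_ext r * mon v) \<in> W" "x \<in> XI"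
  shows "L x \<in> W"
proof (rule ideal_k_mem[OF assms(1,2) _ assms(4)[unfolded ext_ideal_def]])
  fix u v and r :: "('a, 'k) ext_forms" assume "r \<in> form_relations sc {} Form"
  then obtain r' where r': "r' \<in> form_relations sc {} (\<lambda>l. l)" "r = forms_to_ext r'"
    using form_relations_forms_to_ext by blast
  obtain p where "r' \<in> piece fdeg p" using forms_relations_homogeneous[OF r'(1)] by blast
  then show "L (mon u * r * mon v) \<in> W" using assms(3) r' by blast
qed

text \<open>Extended forms are divided by k[t] but not by commutators: the cyclic derivative ignores
  commutators, but its values are noncommutative words.\<close>

definition NT :: "('a, 'k) ext_forms set" where
  "NT = span_k (XI \<union> {gen t_letter ^ q | q. True})"

sublocale N: submodule NT by unfold_locales (simp add: NT_def)

lemma XI_NT: "XI \<subseteq> NT" unfolding NT_def by (intro subsetI span_k_base UnI1)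

lemma t_pow_NT: "gen t_letter ^ q \<in> NT"
  unfolding NT_def by (intro span_k_base UnI2 CollectI exI[of _ q] conjI TrueI HOL.refl)

lemma NT_mem:
  assumes "klin L" "submod W" "\<And>x. x \<in> XI \<Longrightarrow> L x \<in> W" "\<And>q. L (gen t_letter ^ q) \<in> W" "x \<in> NT"
  shows "L x \<in> W"
  by (rule klin_span[OF assms(1,2) _ assms(5)[unfolded NT_def]]) (use assms(3,4) in auto)

lemma NT_t_left: "x \<in> NT \<Longrightarrow> gen t_letter * x \<in> NT"
proof (rule NT_mem[of "\<lambda>x. gen t_letter * x"])
  fix x assume "x \<in> XI" then show "gen t_letter * x \<in> NT" by (intro subsetD[OF XI_NT] X.absorb_l)
next
  fix q show "gen t_letter * gen t_letter ^ q \<in> NT" using t_pow_NT[of "Suc q"] by simp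
qed (auto intro!: klin_intros N.sub)

lemma NT_t_right: "x \<in> NT \<Longrightarrow> x * gen t_letter \<in> DT"
proof (rule NT_mem[of "\<lambda>x. x * gen t_letter"])
  fix x assume "x \<in> XI" then show "x * gen t_letter \<in> DT" by (intro subsetD[OF XI_DT] X.absorb_r)
next
  fix q show "gen t_letter ^ q * gen t_letter \<in> DT" using t_pow_DT[of "Suc q"] by (simp add: power_commutes)
qed (auto intro!: klin_intros D.sub)

text \<open>The cyclic derivative with respect to \<open>t\<close> sends \<open>u t v\<close> to \<open>\<plusminus> v u\<close>. In general
  \<open>cyc w p x\<close> is the sum of \<open>\<plusminus> v x u\<close> over the decompositions \<open>w = u t v\<close>, where \<open>x\<close> has degree \<open>p\<close>.\<close>

primrec cyc :: "('a, unit) letter list \<Rightarrow> int \<Rightarrow> ('a, 'k) ext_forms \<Rightarrow> ('a, 'k) ext_forms" where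
  "cyc [] p x = 0"
| "cyc (l # w) p x = (if l = t_letter then mon w * x else 0)
     + sg (int (ldeg l) * (int (sum_list (map ldeg w)) + p)) * cyc w (p + int (ldeg l)) (x * gen l)"

definition cder :: "('a, 'k) ext_forms \<Rightarrow> int \<Rightarrow> ('a, 'k) ext_forms \<Rightarrow> ('a, 'k) ext_forms" where
  "cder g p x = lin (\<lambda>w. cyc (letters w) p x) g"

lemma klin_cyc [klin_intros]: "klin g \<Longrightarrow> klin (\<lambda>x. cyc w p (g x))"
proof (induction w arbitrary: p g)
  case (Cons l w)
  have "klin (\<lambda>x. cyc w (p + int (ldeg l)) (g x * gen l))"
    by (rule Cons.IH) (rule klin_mult_right[OF Cons.prems])
  then show ?case unfolding cyc.simps by (intro klin_intros Cons.prems)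
qed (simp add: klin_const0)

lemma klin_cder [klin_intros]: "klin g \<Longrightarrow> klin (\<lambda>x. cder (g x) p y)"
  unfolding cder_def by (rule klin_lin')

lemma cder_mon [simp]: "cder (mon w) p x = cyc w p x"
  by (simp add: cder_def mon_def)

lemma sg_assoc: "sg m * (sg n * b) = sg (m + n) * (b :: 'r::ring_1)" by (simp add: sg_add mult.assoc)
lemma sg_cong: "even (m - n) \<Longrightarrow> sg m = sg n" by (auto simp: sg_def)

lemma cyc_append: "cyc (v @ w) p x = cyc v (p + int (sum_list (map ldeg w))) (mon w * x)
   + sg (int (sum_list (map ldeg v)) * (int (sum_list (map ldeg w)) + p)) * cyc w (p + int (sum_list (map ldeg v))) (x * mon v)"
proof (induction v arbitrary: p x)
  case (Cons l v)
  define a b c where "a = int (sum_list (map ldeg v))" and "b = int (sum_list (map ldeg w))" and "c = int (ldeg l)"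
  have s: "sg (c * (a + b + p)) * (sg (a * (b + (p + c))) * Y) = sg ((c + a) * (b + p)) * Y" for Y :: "('a, 'k) ext_forms"
    unfolding sg_assoc by (rule arg_cong[of _ _ "\<lambda>s. s * Y"], rule sg_cong) (simp add: algebra_simps)
  have "cyc ((l # v) @ w) p x = (if l = t_letter then mon v * (mon w * x) else 0)
     + sg (c * (a + b + p)) * cyc (v @ w) (p + c) (x * gen l)"
    by (simp add: a_def b_def c_def mon_append mult.assoc)
  then have 1: "cyc ((l # v) @ w) p x = (if l = t_letter then mon v * (mon w * x) else 0)
     + sg (c * (a + b + p)) * cyc v (p + c + b) (mon w * (x * gen l))
     + sg ((c + a) * (b + p)) * cyc w (p + c + a) (x * gen l * mon v)"
    unfolding Cons[folded a_def b_def] distrib_left[of "sg (c * (a + b + p)) :: ('a, 'k) ext_forms"] s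
    by (simp only: add.assoc)
  show ?case
    unfolding 1 mon_Cons[of l v]
    by (simp add: mult.assoc ac_simps flip: a_def b_def c_def)
qed simp

lemma cyc_forms [simp]: "cyc (map Form z) p x = 0"
  by (induction z arbitrary: p x) simp_all

text \<open>The cuts of u v at its letters t correspond to the cuts of v u, and a cut reads off the
  same word up to the sign of the rotation.\<close>

lemma cder_supercommutator: "x \<in> supercommutators ldeg \<Longrightarrow> cder x 0 1 = 0"
proof -
  have "x \<in> supercommutators ldeg \<Longrightarrow> cder x 0 1 \<in> {0}"
  proof (rule supercommutators_mem[OF klin_cder[OF klin_id]])
    fix u v :: "('a, unit) letter list"
    define a b where "a = int (sum_list (map ldeg u))" and "b = int (sum_list (map ldeg v))"
    have "cder (mon u * mon v - sg (a * b) * (mon v * mon u)) 0 1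
      = cyc (u @ v) 0 1 - sg (a * b) * cyc (v @ u) 0 1"
      by (simp add: klin_diff[OF klin_cder[OF klin_id]] klin_sgI[OF klin_cder[OF klin_id]] flip: mon_append)
    also have "\<dots> = 0"
      unfolding cyc_append by (cases "even a"; cases "even b") (auto simp: sg_def simp flip: a_def b_def)
    finally show "cder (mon u * mon v - sg (int (sum_list (map ldeg u)) * int (sum_list (map ldeg v))) * (mon v * mon u)) 0 1 \<in> {0}"
      by (simp add: a_def b_def)
  qed (simp add: smul.subspace_single_0)
  then show "x \<in> supercommutators ldeg \<Longrightarrow> cder x 0 1 = 0" by simp
qed

lemma cyc_XI: "y \<in> XI \<Longrightarrow> cyc w p y \<in> XI"
proof (induction w arbitrary: p y)
  case (Cons l w)
  have "(if l = t_letter then mon w * y else 0) \<in> XI" using Cons.prems X.closed(5) by (simp add: X.absorb_l)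
  then show ?case unfolding cyc.simps
    by (rule X.closed(1)) (intro X.absorb_l Cons.IH X.absorb_r Cons.prems)
qed (simp add: X.closed(5))

text \<open>A relation contains no t, hence no cut goes through it, and it remains a factor of every
  term.\<close>

lemma cder_XI: "x \<in> XI \<Longrightarrow> cder x 0 1 \<in> XI"
proof (rule XI_mem[OF klin_cder[OF klin_id] X.sub])
  fix u v :: "('a, unit) letter list" and r :: "('a, 'k) nc_forms" and p
  assume r: "r \<in> form_relations sc {} (\<lambda>l. l)" "r \<in> piece fdeg p"
  define a b where "a = int (sum_list (map ldeg u))" and "b = int (sum_list (map ldeg v))"
  let ?R = "\<lambda>r. cyc u (p + b) (forms_to_ext r * mon v)
     + sg (a * (p + b)) * (sg (p * (b + a)) * cyc v (a + p) (mon u * forms_to_ext r))"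
  have "cder (mon u * forms_to_ext r * mon v) 0 1 = ?R r"
  proof (rule piece_eqI[OF r(2), of "\<lambda>r. cder (mon u * forms_to_ext r * mon v) 0 1" ?R])
    fix z :: "'a form list" assume z: "int (sum_list (map fdeg z)) = p"
    have z': "int (sum_list (map ldeg (map Form z))) = p" using z by (simp add: comp_def)
    have "cder (mon u * forms_to_ext (mon z) * mon v) 0 1 = cyc (u @ (map Form z @ v)) 0 1"
      by (simp add: mult.assoc flip: mon_append)
    also have "\<dots> = cyc u (p + b) (mon (map Form z) * mon v) + sg (a * (p + b)) * cyc (map Form z @ v) a (mon u)"
      unfolding cyc_append[of u] using z' by (simp add: mon_append a_def b_def)
    also have "cyc (map Form z @ v) a (mon u) = sg (p * (b + a)) * cyc v (a + p) (mon u * mon (map Form z))"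
      unfolding cyc_append z' by (simp add: b_def)
    finally show "cder (mon u * forms_to_ext (mon z) * mon v) 0 1 = ?R (mon z)" by simp
  qed (auto intro!: klin_intros)
  also have "\<dots> \<in> XI"
  proof -
    have "r \<in> FI" unfolding forms_ideal_def by (rule ideal_k_base[OF r(1)])
    then have "forms_to_ext r \<in> XI" by (rule forms_to_ext_FI)
    then show ?thesis
      by (intro X.closed(1)[OF cyc_XI[OF X.absorb_r] X.sgW[OF X.sgW[OF cyc_XI[OF X.absorb_l]]]])
  qed
  finally show "cder (mon u * forms_to_ext r * mon v) 0 1 \<in> XI" .
qed

text \<open>All terms are powers of t. The power t^j collects the letters already moved to the
  end.\<close>

lemma cyc_t_pow: "cyc (replicate q t_letter) p (gen t_letter ^ j) \<in> NT"
proof (induction q arbitrary: j)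
  case (Suc q)
  have "mon (replicate q t_letter) * gen t_letter ^ j \<in> NT"
    using t_pow_NT[of "q + j"] by (simp add: replicate_t power_add)
  moreover have "cyc (replicate q t_letter) p (gen t_letter ^ j * gen t_letter) \<in> NT"
    using Suc[of "Suc j"] by (simp add: power_commutes)
  ultimately show ?case by (simp add: N.closed(1))
qed (simp add: N.closed(5))

lemma cder_DT: "x \<in> DT \<Longrightarrow> cder x 0 1 \<in> NT"
proof (rule DT_mem[OF klin_cder[OF klin_id] N.sub])
  fix q show "cder (gen t_letter ^ q) 0 1 \<in> NT"
    using cyc_t_pow[of q 0 0] by (simp flip: replicate_t)
qed (use cder_XI XI_NT N.closed(5) cder_supercommutator in auto)

lemma cder_gen:
  assumes "g \<in> piece ldeg m"
  shows "cder (gen l * g) p x = (if l = t_letter then g * x else 0) + sg (int (ldeg l) * (m + p)) * cder g (p + int (ldeg l)) (x * gen l)"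
  by (rule piece_eqI[OF assms, of "\<lambda>g. cder (gen l * g) p x"
        "\<lambda>g. (if l = t_letter then g * x else 0) + sg (int (ldeg l) * (m + p)) * cder g (p + int (ldeg l)) (x * gen l)"])
     (auto intro!: klin_intros simp flip: mon_Cons)

text \<open>The last term differentiates x, the part already moved to the end. It is absent for x =
  1, so d commutes with the cyclic derivative.\<close>

lemma d_cyc:
  assumes "x \<in> piece ldeg p"
  shows "d_ext (cyc w p x) = cder (d_ext (mon w)) p x + sg (int (sum_list (map ldeg w))) * cyc w (p + 1) (d_ext x)"
  using assms
proof (induction w arbitrary: p x)
  case Nil
  show ?case by (simp add: ext_simps klin_zero[OF klin_cder[OF klin_id]])
next
  case (Cons l w)
  define m where "m = int (sum_list (map ldeg w))"
  have w: "mon w \<in> piece ldeg m" by (simp add: m_def)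
  have dw: "d_ext (mon w) \<in> piece ldeg (m + 1)" by (rule d_ext_ldeg[OF w])
  note [simp] = klin_add[OF klin_cder[OF klin_id]] klin_diff[OF klin_cder[OF klin_id]] klin_neg[OF klin_cder[OF klin_id]]
    klin_add[OF klin_cyc[OF klin_id]] klin_neg[OF klin_cyc[OF klin_id]] ext_simps d_ext_mult[OF Cons.prems]
    klin_sgI[OF klin_cyc[OF klin_id]] klin_sgI[OF klin_cder[OF klin_id]] klin_sgI[OF klin_d_ext[OF klin_id]]
    cder_gen[OF w, unfolded cder_mon] cder_gen[OF dw]
  have mon: "mon (l # w) = gen l * mon w" by (rule mon_Cons)
  note IH = Cons.IH[folded m_def]
  consider a where "l = Form (El a)" | a where "l = Form (Df a)" | "l = t_letter"
    by (cases l) (metis form.exhaust, metis old.unit.exhaust)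
  then show ?case
  proof cases
    case (1 a)
    have x: "x * gen l \<in> piece ldeg p" by (rule piece_mult'[OF Cons.prems]) (auto simp: 1 gen_ldeg)
    show ?thesis
      unfolding mon using IH[OF x] by (simp add: 1 d_ext_mult[OF gen_ldeg(1)] sg_def flip: m_def)
  next
    case (2 a)
    have x: "x * gen l \<in> piece ldeg (p + 1)" by (rule piece_mult'[OF Cons.prems]) (auto simp: 2 gen_ldeg)
    show ?thesis
      unfolding mon using IH[OF x]
      by (cases "even m"; cases "even p") (simp_all add: 2 d_ext_mult[OF gen_ldeg(2)] sg_def algebra_simps flip: m_def)
  next
    case 3
    have x: "x * gen l \<in> piece ldeg p" by (rule piece_mult'[OF Cons.prems]) (auto simp: 3 gen_ldeg)
    show ?thesis
      unfolding mon using IH[OF x]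
      by (simp add: 3 d_ext_mult[OF gen_ldeg(3)] d_ext_mult[OF w] distrib_left m_def)
  qed
qed

lemma d_cder: "d_ext (cder x 0 1) = cder (d_ext x) 0 1"
  by (rule falg_eqI[of "\<lambda>x. d_ext (cder x 0 1)" "\<lambda>x. cder (d_ext x) 0 1"])
     (auto intro!: klin_intros simp: d_cyc[OF piece_one] klin_zero[OF klin_cyc[OF klin_id]])

text \<open>Multiplying v u by t on the right gives back u t v up to a rotation, so each letter t of
  the word contributes one copy. This is the Euler formula for the cyclic derivative.\<close>

lemma cyc_times_t:
  assumes "x \<in> piece ldeg p"
  shows "cyc w p x * gen t_letter \<simeq>[DT] smul (of_nat (sum_list (map vdeg w))) (mon w * x)"
  using assms
proof (induction w arbitrary: p x)
  case (Cons l w)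
  define m where "m = int (sum_list (map ldeg w))"
  define c where "c = int (ldeg l)"
  define k where "k = sum_list (map vdeg w)"
  have w: "mon w \<in> piece ldeg m" and l: "gen l \<in> piece ldeg c" by (simp_all add: m_def c_def piece_mon)
  have wx: "mon w * x \<in> piece ldeg (m + p)" by (rule piece_mult[OF w Cons.prems])
  have xl: "x * gen l \<in> piece ldeg (p + c)" by (rule piece_mult[OF Cons.prems l])
  have rot: "sg (c * (m + p)) * (mon w * x * gen l) \<simeq>[DT] mon (l # w) * x"
  proof -
    have "gen l * (mon w * x) \<simeq>[DT] sg (c * (m + p)) * ((mon w * x) * gen l)" by (rule commutator_DT[OF l wx])
    then show ?thesis by (simp add: mon_Cons[of l w] mult.assoc D.sym)
  qed
  have "sg (c * (m + p)) * (cyc w (p + c) (x * gen l) * gen t_letter) \<simeq>[DT] sg (c * (m + p)) * smul (of_nat k) (mon w * (x * gen l))"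
    using Cons.IH[OF xl] D.uminus by (auto simp: sg_def k_def)
  also have "\<dots> = smul (of_nat k) (sg (c * (m + p)) * (mon w * x * gen l))"
    by (simp add: smul_mult_right mult.assoc)
  also have "\<dots> \<simeq>[DT] smul (of_nat k) (mon (l # w) * x)" by (rule D.scale[OF rot])
  finally have 1: "sg (c * (m + p)) * (cyc w (p + c) (x * gen l) * gen t_letter) \<simeq>[DT] smul (of_nat k) (mon (l # w) * x)" .
  have 2: "(if l = t_letter then mon w * x else 0) * gen t_letter \<simeq>[DT] smul (of_nat (vdeg l)) (mon (l # w) * x)"
  proof (cases "l = t_letter")
    case True
    then show ?thesis using rot by (simp add: c_def)
  next
    case False
    then have "vdeg l = 0" by (cases l) auto
    then show ?thesis using False by simp
  qed
  show ?case
    using D.add[OF 2 1] by (simp add: distrib_right mult.assoc smul.scale_left_distrib flip: m_def c_def k_def)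
qed simp

lemma cder_times_t:
  assumes "x \<in> bipiece p (int q)"
  shows "cder x 0 1 * gen t_letter \<simeq>[DT] smul (of_nat q) x"
  unfolding eqv_def
proof (rule piece_mem[of x vdeg "int q" "\<lambda>x. cder x 0 1 * gen t_letter - smul (of_nat q) x"])
  fix w :: "('a, unit) letter list" assume "int (sum_list (map vdeg w)) = int q"
  then show "cder (mon w) 0 1 * gen t_letter - smul (of_nat q) (mon w) \<in> DT"
    using cyc_times_t[OF piece_one, of w] by (simp add: eqv_def)
qed (use assms in \<open>auto intro!: klin_intros D.sub simp: bipiece_def\<close>)

lemma bipiece_mult: "f \<in> bipiece a b \<Longrightarrow> g \<in> bipiece a' b' \<Longrightarrow> r = a + a' \<Longrightarrow> s = b + b' \<Longrightarrow> f * g \<in> bipiece r s"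
  by (auto simp: bipiece_def)

lemma bipiece_mon: "mon w \<in> bipiece (int (sum_list (map ldeg w))) (int (sum_list (map vdeg w)))"
  by (simp add: bipiece_def)

lemma bipiece_sg: "f \<in> bipiece a b \<Longrightarrow> sg n * f \<in> bipiece a b"
  by (auto simp: bipiece_def)

lemma cyc_bipiece:
  "x \<in> bipiece a b \<Longrightarrow> cyc w p x \<in> bipiece (a + int (sum_list (map ldeg w))) (b + int (sum_list (map vdeg w)) - 1)"
proof (induction w arbitrary: p x a b)
  case Nil
  show ?case by (simp add: smul.subspace_0)
next
  case (Cons l w)
  define A B where "A = a + int (sum_list (map ldeg (l # w)))" and "B = b + int (sum_list (map vdeg (l # w))) - 1"
  have "(if l = t_letter then mon w * x else 0) \<in> bipiece A B"
    using bipiece_mult[OF bipiece_mon[of w] Cons.prems HOL.refl HOL.refl]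
    by (auto simp: A_def B_def smul.subspace_0 add.commute)
  moreover have "x * gen l \<in> bipiece (a + int (ldeg l)) (b + int (vdeg l))"
    by (rule bipiece_mult[OF Cons.prems bipiece_mon]) simp_all
  from Cons.IH[OF this, of "p + int (ldeg l)"]
  have "cyc w (p + int (ldeg l)) (x * gen l) \<in> bipiece A B" by (simp add: A_def B_def ac_simps)
  ultimately show ?case
    unfolding cyc.simps A_def[symmetric] B_def[symmetric]
    by (intro smul.subspace_add[OF bipiece_submod] bipiece_sg)
qed

lemma bipiece_mem:
  assumes "x \<in> bipiece p q" "klin L" "submod W"
    "\<And>w. int (sum_list (map ldeg w)) = p \<Longrightarrow> int (sum_list (map vdeg w)) = q \<Longrightarrow> L (mon w) \<in> W"
  shows "L x \<in> W"
proof (rule falg_mem[OF assms(2,3)])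
  fix w assume w: "Word w \<in> Poly_Mapping.keys x"
  have "\<forall>w\<in>Poly_Mapping.keys x. int (wdeg ldeg w) = p \<and> int (wdeg vdeg w) = q"
    using assms(1) by (auto simp: bipiece_def piece_def)
  from bspec[OF this w] show "L (mon w) \<in> W" by (intro assms(4)) (simp_all add: wdeg_def)
qed

lemma cder_bipiece:
  assumes "x \<in> bipiece p q"
  shows "cder x 0 1 \<in> bipiece p (q - 1)"
  by (rule bipiece_mem[OF assms klin_cder[OF klin_id] bipiece_submod])
     (use cyc_bipiece[of 1 0 0] in \<open>auto simp: bipiece_def\<close>)

end

section \<open>Contraction of extended forms modulo k[t]\<close>

context split_alg
begin

text \<open>The contraction of the first factor of \<open>\<Omega> t \<Omega> t \<dots> t \<Omega>\<close> that is not reduced to scalars: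
  \<open>hop w f\<close> is its value on \<open>f w\<close>, where the forms to the left of the first \<open>t\<close> are collected in \<open>f\<close>.\<close>

primrec hop :: "('a, unit) letter list \<Rightarrow> ('a, 'k) nc_forms \<Rightarrow> ('a, 'k) ext_forms" where
  "hop [] f = forms_to_ext (s_op f)"
| "hop (l # w) f = (case l of Form x \<Rightarrow> hop w (f * gen x)
     | Var v \<Rightarrow> forms_to_ext (s_op f) * (gen t_letter * mon w) + pi_op f * (gen t_letter * hop w 1))"

lemma klin_hop [klin_intros]: "klin g \<Longrightarrow> klin (\<lambda>x. hop w (g x))"
proof (induction w arbitrary: g)
  case (Cons l w)
  show ?case
  proof (cases l)
    case (Form x)
    have "klin (\<lambda>y. hop w (g y * gen x))"
      by (rule Cons.IH) (rule klin_mult_right[OF Cons.prems])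
    then show ?thesis by (simp add: Form)
  next
    case (Var v)
    show ?thesis unfolding Var hop.simps letter.case
      by (intro klin_intros Cons.prems)
  qed
next
  case Nil
  show ?case unfolding hop.simps by (intro klin_intros Nil)
qed

definition hopL :: "('a, 'k) nc_forms \<Rightarrow> ('a, 'k) ext_forms \<Rightarrow> ('a, 'k) ext_forms" where
  "hopL f g = lin (\<lambda>w. hop (letters w) f) g"

lemma klin_hopL_right [klin_intros]: "klin g \<Longrightarrow> klin (\<lambda>x. hopL f (g x))"
  unfolding hopL_def by (rule klin_lin')

lemma hopL_mon [simp]: "hopL f (mon w) = hop w f"
  by (simp add: hopL_def mon_def)

lemma klin_hopL_left [klin_intros]: "klin g \<Longrightarrow> klin (\<lambda>x. hopL (g x) y)"
  unfolding hopL_def lin_def by (intro klin_intros)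

lemmas hopL_simps = klin_add[OF klin_hopL_right[OF klin_id]] klin_neg[OF klin_hopL_right[OF klin_id]]
  klin_zero[OF klin_hopL_right[OF klin_id]]

lemma hopL_Form: "hopL f (gen (Form l) * g) = hopL (f * gen l) g"
  by (rule falg_eqI[of "\<lambda>g. hopL f (gen (Form l) * g)" "\<lambda>g. hopL (f * gen l) g"])
     (auto intro!: klin_intros simp flip: mon_Cons)

lemma hopL_t: "hopL f (gen t_letter * g) = forms_to_ext (s_op f) * (gen t_letter * g) + pi_op f * (gen t_letter * hopL 1 g)"
  by (rule falg_eqI[of "\<lambda>g. hopL f (gen t_letter * g)"
        "\<lambda>g. forms_to_ext (s_op f) * (gen t_letter * g) + pi_op f * (gen t_letter * hopL 1 g)"])
     (auto intro!: klin_intros simp flip: mon_Cons)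

lemma hop_FI: "f \<in> FI \<Longrightarrow> hop w f \<in> XI"
proof (induction w arbitrary: f)
  case (Cons l w)
  show ?case
  proof (cases l)
    case (Form x)
    then show ?thesis using Cons.IH[OF F.absorb_r[OF Cons.prems]] by simp
  next
    case (Var v)
    have "forms_to_ext (s_op f) * (gen t_letter * mon w) \<in> XI"
      by (intro X.absorb_r forms_to_ext_FI s_FI Cons.prems)
    then show ?thesis by (simp add: Var pi_FI[OF Cons.prems])
  qed
qed (simp add: forms_to_ext_FI s_FI)

lemma hopL_FI: "f \<in> FI \<Longrightarrow> hopL f g \<in> XI"
  unfolding hopL_def by (rule lin_mem[OF X.sub hop_FI])

lemma hopL_forms: "hopL f (forms_to_ext r * g) = hopL (f * r) g"
proof (rule falg_eqI[of "\<lambda>r. hopL f (forms_to_ext r * g)" "\<lambda>r. hopL (f * r) g"])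
  fix z :: "'a form list"
  show "hopL f (forms_to_ext (mon z) * g) = hopL (f * mon z) g"
  proof (induction z arbitrary: f)
    case (Cons l z)
    have "forms_to_ext (mon (l # z) :: ('a, 'k) nc_forms) = gen (Form l) * forms_to_ext (mon z)"
      by (subst mon_Cons) (simp del: forms_to_ext_mon)
    moreover have "f * mon (l # z) = f * gen l * mon z" by (subst mon_Cons) (simp add: mult.assoc)
    ultimately show ?case using Cons[of "f * gen l"] by (simp only: hopL_Form mult.assoc)
  qed simp
qed (auto intro!: klin_intros)

text \<open>Behind a letter t the relation either remains untouched or lies in the argument of the
  recursion. In the factor under treatment it is absorbed into f, where s and \<pi> respect
  it.\<close>

lemma hopL_ideal:
  assumes "r \<in> FI"
  shows "hopL f (mon u * (forms_to_ext r * g)) \<in> XI"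
proof (induction u arbitrary: f)
  case Nil
  show ?case using hopL_FI[OF F.absorb_l[OF assms]] by (simp add: hopL_forms)
next
  case (Cons l u)
  have e: "mon (l # u) * (forms_to_ext r * g) = gen l * (mon u * (forms_to_ext r * g))"
    by (subst mon_Cons) (simp add: mult.assoc)
  show ?case
  proof (cases l)
    case (Form x)
    then show ?thesis unfolding e using Cons by (simp add: hopL_Form)
  next
    case (Var v)
    have "forms_to_ext (s_op f) * (gen t_letter * (mon u * (forms_to_ext r * g))) \<in> XI"
      by (intro X.absorb_l X.absorb_r forms_to_ext_FI assms)
    moreover have "pi_op f * (gen t_letter * hopL 1 (mon u * (forms_to_ext r * g))) \<in> XI"
      by (intro X.absorb_l Cons)
    ultimately show ?thesis unfolding e by (simp add: Var hopL_t X.closed(1))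
  qed
qed

lemma s_one: "s_op 1 = 0" by (simp add: s_op_def s_formula_def)
lemma pi_one: "pi_op 1 = 1" by (simp add: pi_op_def)

text \<open>Powers of t are killed because s 1 = 0, and \<pi> 1 = 1 passes on to the next
  factor.\<close>

lemma hopL_NT: "x \<in> NT \<Longrightarrow> hopL 1 x \<in> NT"
proof (rule NT_mem[OF klin_hopL_right[OF klin_id] N.sub])
  fix x :: "('a, 'k) ext_forms" assume "x \<in> XI"
  then have "hopL 1 x \<in> XI"
  proof (rule XI_mem[OF klin_hopL_right[OF klin_id] X.sub, rotated])
    fix u v and r :: "('a, 'k) nc_forms" assume "r \<in> form_relations sc {} (\<lambda>l. l)"
    then have "r \<in> FI" unfolding forms_ideal_def by (rule ideal_k_base)
    then show "hopL 1 (mon u * forms_to_ext r * mon v) \<in> XI" unfolding mult.assoc by (rule hopL_ideal)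
  qed
  then show "hopL 1 x \<in> NT" by (rule subsetD[OF XI_NT])
next
  fix q
  have "hopL 1 (gen t_letter ^ q) = 0"
  proof (induction q)
    case 0
    show ?case using hopL_mon[of 1 "[]"] by (simp add: s_one fe_simps)
  next
    case (Suc q)
    then show ?case by (simp add: hopL_t s_one pi_one fe_simps)
  qed
  then show "hopL 1 (gen t_letter ^ q) \<in> NT" by (simp add: N.closed(5))
qed

lemma forms_to_ext_eqv: "x \<simeq>[FI] y \<Longrightarrow> forms_to_ext x \<simeq>[XI] forms_to_ext y"
  by (rule X.klin[OF klin_forms_to_ext[OF klin_id] forms_to_ext_FI])

lemma forms_to_ext_pi: "forms_to_ext (pi_op f) = pi_op f"
  unfolding pi_op_def on_normal_klin[OF klin_forms_to_ext[OF klin_id], symmetric]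
  by (rule arg_cong[of _ _ "\<lambda>h. on_normal h f"]) (auto simp: fun_eq_iff fe_simps)

lemma X_N: "x \<simeq>[XI] y \<Longrightarrow> x \<simeq>[NT] y" by (rule eqv_mono[OF XI_NT])

lemma pi_scalar: "pi_op f \<in> span_k {1}"
  unfolding pi_op_def
  by (rule on_normal_mem'[OF span_k_submod])
     (auto intro: smul.subspace_scale[OF span_k_submod span_k_base] smul.subspace_0)

lemma pi_t_NT: "y \<in> NT \<Longrightarrow> pi_op f * (gen t_letter * y) \<in> NT"
proof -
  assume y: "y \<in> NT"
  have "(\<lambda>z. z * (gen t_letter * y)) (pi_op f) \<in> NT"
  proof (rule klin_span[OF _ N.sub _ pi_scalar])
    show "klin (\<lambda>z. z * (gen t_letter * y))" by (intro klin_intros)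
  qed (use NT_t_left[OF y] in simp)
  then show ?thesis .
qed

text \<open>The usual homotopy on a tensor product: the first factor contributes 1 - \<pi>, and on
  its scalar part the recursion contributes the rest. When all factors are scalar, a multiple of a
  power of t is left, which is zero modulo \<open>NT\<close>.\<close>

lemma hop_homotopy:
  assumes "f \<in> piece fdeg n"
  shows "d_ext (hop w f) + hopL (d_form f) (mon w) + sg n * hopL f (d_ext (mon w)) \<simeq>[NT] forms_to_ext f * mon w"
  using assms
proof (induction w arbitrary: f n)
  case Nil
  have "forms_to_ext (s_op (d_form f) + d_form (s_op f)) \<simeq>[XI] forms_to_ext (f - pi_op f)"
    by (rule forms_to_ext_eqv[OF homotopy])
  then have 1: "forms_to_ext (d_form (s_op f)) + forms_to_ext (s_op (d_form f)) \<simeq>[NT] forms_to_ext f - pi_op f"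
    by (intro X_N) (simp add: fe_simps forms_to_ext_pi add.commute)
  have "span_k {1} \<subseteq> NT" by (rule span_k_least) (use t_pow_NT[of 0] N.sub in auto)
  then have "pi_op f \<simeq>[NT] 0" using pi_scalar by (auto simp: eqv_def)
  from N.diff[OF N.refl[of "forms_to_ext f"] this] N.trans[OF 1]
  show ?case using hopL_mon[of "d_form f" "[]"] by (simp add: d_ext_forms hopL_simps)
next
  case (Cons l w)
  have mon: "mon (l # w) = gen l * mon w" by (rule mon_Cons)
  note [simp] = hopL_simps klin_add[OF klin_hopL_left[OF klin_id]] klin_sgI[OF klin_hopL_left[OF klin_id]]
    klin_sgI[OF klin_hopL_right[OF klin_id]] klin_neg[OF klin_hopL_left[OF klin_id]]
    klin_add[OF klin_hop[OF klin_id]] klin_sgI[OF klin_hop[OF klin_id]] klin_neg[OF klin_hop[OF klin_id]]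
  consider a where "l = Form (El a)" | a where "l = Form (Df a)" | "l = t_letter"
    by (cases l) (metis form.exhaust, metis old.unit.exhaust)
  then show ?case
  proof cases
    case (1 a)
    have p: "f * gen (El a) \<in> piece fdeg n" by (rule piece_mult'[OF Cons.prems El_piece]) simp
    show ?thesis
      unfolding mon using Cons.IH[OF p]
      by (simp add: 1 d_ext_mult[OF gen_ldeg(1)] hopL_Form d_mult[OF Cons.prems] mult.assoc distrib_left ac_simps)
  next
    case (2 a)
    have p: "f * gen (Df a) \<in> piece fdeg (n + 1)" by (rule piece_mult'[OF Cons.prems Df1_piece]) simp
    show ?thesis
      unfolding mon using Cons.IH[OF p]
      by (simp add: 2 d_ext_mult[OF gen_ldeg(2)] hopL_Form d_mult[OF Cons.prems] mult.assoc sg_add)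
  next
    case 3
    let ?t = "gen t_letter :: ('a, 'k) ext_forms"
    have sf: "forms_to_ext (s_op f) \<in> piece ldeg (n - 1)"
      using forms_to_ext_bipiece[OF s_piece[OF Cons.prems]] by (simp add: bipiece_def)
    have dpi: "d_ext (pi_op f * (?t * y)) = pi_op f * (?t * d_ext y)" for y
    proof -
      have "(\<lambda>z. d_ext (z * (?t * y)) - z * (?t * d_ext y)) (pi_op f) \<in> {0}"
        by (rule klin_span[OF _ _ _ pi_scalar])
           (auto intro!: klin_intros simp: smul.subspace_single_0 d_ext_mult[OF gen_ldeg(3)])
      then show ?thesis by simp
    qed
    have pid: "pi_op (d_form f) = (0 :: ('a, 'k) ext_forms)"
    proof (cases "n + 1 = 0")
      case True
      then have "f = 0" using piece_neg_deg[OF _ Cons.prems] by simp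
      then show ?thesis by (simp add: klin_zero[OF klin_pi_op[OF klin_id]] op_simps)
    qed (rule pi_pos[OF d_piece[OF Cons.prems]])
    \<comment> \<open>The sign may be dropped, since \<pi> f vanishes unless f has degree 0.\<close>
    have sgpi: "sg n * (pi_op f * y) = pi_op f * y" for y :: "('a, 'k) ext_forms"
      by (cases "n = 0") (simp_all add: pi_pos[OF Cons.prems])
    have hom: "forms_to_ext (d_form (s_op f)) + forms_to_ext (s_op (d_form f)) \<simeq>[XI] forms_to_ext f - pi_op f"
      using forms_to_ext_eqv[OF homotopy[of f]] by (simp add: fe_simps forms_to_ext_pi add.commute)
    have IH: "d_ext (hop w 1) + hopL 1 (d_ext (mon w)) \<simeq>[NT] mon w"
      using Cons.IH[OF piece_one] klin_zero[OF klin_hop[OF klin_id]] by simp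
    have "d_ext (hop (l # w) f) + hopL (d_form f) (mon (l # w)) + sg n * hopL f (d_ext (mon (l # w)))
      = d_ext (forms_to_ext (s_op f) * (?t * mon w)) + pi_op f * (?t * d_ext (hop w 1))
        + forms_to_ext (s_op (d_form f)) * (?t * mon w)
        + sg n * (forms_to_ext (s_op f) * (?t * d_ext (mon w))) + pi_op f * (?t * hopL 1 (d_ext (mon w)))"
      unfolding mon
      by (simp add: 3 d_ext_mult[OF gen_ldeg(3)] hopL_t ext_simps dpi pid distrib_left sgpi)
    also have "d_ext (forms_to_ext (s_op f) * (?t * mon w))
      = forms_to_ext (d_form (s_op f)) * (?t * mon w) + sg (n - 1) * (forms_to_ext (s_op f) * (?t * d_ext (mon w)))"
      by (simp add: d_ext_mult[OF sf] d_ext_mult[OF gen_ldeg(3)] d_ext_forms)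
    also have "\<dots> + pi_op f * (?t * d_ext (hop w 1))
        + forms_to_ext (s_op (d_form f)) * (?t * mon w)
        + sg n * (forms_to_ext (s_op f) * (?t * d_ext (mon w))) + pi_op f * (?t * hopL 1 (d_ext (mon w)))
      = (forms_to_ext (d_form (s_op f)) + forms_to_ext (s_op (d_form f))) * (?t * mon w)
        + pi_op f * (?t * (d_ext (hop w 1) + hopL 1 (d_ext (mon w))))"
      by (cases "even n") (simp_all add: sg_def algebra_simps)
    also have "\<dots> \<simeq>[NT] (forms_to_ext f - pi_op f) * (?t * mon w) + pi_op f * (?t * mon w)"
    proof (rule N.add)
      show "(forms_to_ext (d_form (s_op f)) + forms_to_ext (s_op (d_form f))) * (?t * mon w)
        \<simeq>[NT] (forms_to_ext f - pi_op f) * (?t * mon w)"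
        by (intro X_N X.mult hom X.refl)
      show "pi_op f * (?t * (d_ext (hop w 1) + hopL 1 (d_ext (mon w)))) \<simeq>[NT] pi_op f * (?t * mon w)"
        using pi_t_NT[OF IH[unfolded eqv_def], of f] by (simp add: eqv_def algebra_simps)
    qed
    finally show ?thesis unfolding mon by (simp add: 3 algebra_simps)
  qed
qed

lemma ext_homotopy: "d_ext (hopL 1 y) + hopL 1 (d_ext y) \<simeq>[NT] y"
  unfolding eqv_def
proof (rule falg_mem[of "\<lambda>y. d_ext (hopL 1 y) + hopL 1 (d_ext y) - y"])
  fix w :: "('a, unit) letter list"
  have "hopL 0 (mon w) = 0" by (rule klin_zero[OF klin_hopL_left[OF klin_id]])
  then show "d_ext (hopL 1 (mon w)) + hopL 1 (d_ext (mon w)) - mon w \<in> NT"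
    using hop_homotopy[OF piece_one, of w] by (simp add: eqv_def del: hopL_mon) simp
qed (auto intro!: klin_intros N.sub)

lemma hop_bipiece:
  assumes "f \<in> piece fdeg n"
  shows "hop w f \<in> bipiece (n + int (sum_list (map ldeg w)) - 1) (int (sum_list (map vdeg w)))"
  using assms
proof (induction w arbitrary: f n)
  case Nil
  then show ?case using forms_to_ext_bipiece[OF s_piece] by simp
next
  case (Cons l w)
  show ?case
  proof (cases l)
    case (Form x)
    have "f * gen x \<in> piece fdeg (n + int (fdeg x))" by (rule piece_mult[OF Cons.prems]) (simp add: piece_mon)
    from Cons.IH[OF this] show ?thesis by (simp add: Form add.assoc)
  next
    case (Var v)
    have t: "gen t_letter \<in> bipiece 0 1" by (simp add: bipiece_def gen_ldeg gen_vdeg)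
    have 1: "forms_to_ext (s_op f) * (gen t_letter * mon w) \<in> bipiece (n + int (sum_list (map ldeg (l # w))) - 1) (int (sum_list (map vdeg (l # w))))"
      by (rule bipiece_mult[OF forms_to_ext_bipiece[OF s_piece[OF Cons.prems]] bipiece_mult[OF t bipiece_mon HOL.refl HOL.refl]])
         (simp_all add: Var)
    have 2: "pi_op f * (gen t_letter * hop w 1) \<in> bipiece (n + int (sum_list (map ldeg (l # w))) - 1) (int (sum_list (map vdeg (l # w))))"
    proof (cases "n = 0")
      case True
      have "span_k {1} \<subseteq> (bipiece 0 0 :: ('a, 'k) ext_forms set)"
        by (rule span_k_least[OF _ bipiece_submod]) (simp add: bipiece_def)
      then have pi: "pi_op f \<in> (bipiece 0 0 :: ('a, 'k) ext_forms set)" using pi_scalar by blast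
      show ?thesis
        by (rule bipiece_mult[OF pi bipiece_mult[OF t Cons.IH[OF piece_one] HOL.refl HOL.refl]])
           (simp_all add: Var True)
    next
      case False
      have "pi_op f = (0 :: ('a, 'k) ext_forms)" by (rule pi_pos[OF Cons.prems False])
      then show ?thesis by (simp add: smul.subspace_0)
    qed
    show ?thesis using smul.subspace_add[OF bipiece_submod 1 2] by (simp add: Var)
  qed
qed

lemma hopL_bipiece: "x \<in> bipiece p q \<Longrightarrow> hopL 1 x \<in> bipiece (p - 1) q"
  by (rule bipiece_mem[OF _ klin_hopL_right[OF klin_id] bipiece_submod])
     (use hop_bipiece[OF piece_one] in auto)

end

sublocale cyclic \<subseteq> tsygan_alg sc \<rho> by unfold_locales

context cyclic
begin

text \<open>The cyclic derivative y of x is closed modulo \<open>NT\<close>, hence exact there.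
  Multiplication by t returns to DR_t and sends y to q x, and q is invertible.\<close>

lemma ext_acyclic:
  assumes "x \<in> bipiece p (int q)" "q > 0" "d_ext x \<in> DT"
  shows "\<exists>h \<in> bipiece (p - 1) (int q). x \<simeq>[DT] d_ext h"
proof -
  define y where "y = cder x 0 1"
  define c where "c = \<rho> (1 / of_nat q)"
  have t: "gen t_letter \<in> bipiece 0 1" by (simp add: bipiece_def gen_ldeg gen_vdeg)
  have y: "y \<in> bipiece p (int q - 1)" unfolding y_def by (rule cder_bipiece[OF assms(1)])
  have "d_ext y \<in> NT" unfolding y_def d_cder by (rule cder_DT[OF assms(3)])
  then have "hopL 1 (d_ext y) \<simeq>[NT] 0" using hopL_NT by (simp add: eqv_def)
  from N.diff[OF ext_homotopy this, of y] have "d_ext (hopL 1 y) \<simeq>[NT] y" by simp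
  \<comment> \<open>Powers of t times t are still powers of t, so the zero elements modulo
    \<open>NT\<close> become zero in reduced DR_t.\<close>
  then have "(d_ext (hopL 1 y) - y) * gen t_letter \<in> DT" unfolding eqv_def by (rule NT_t_right)
  then have "d_ext (hopL 1 y) * gen t_letter \<simeq>[DT] y * gen t_letter" by (simp add: eqv_def left_diff_distrib)
  also have "\<dots> \<simeq>[DT] smul (of_nat q) x" unfolding y_def by (rule cder_times_t[OF assms(1)])
  finally have "smul c (d_ext (hopL 1 y) * gen t_letter) \<simeq>[DT] smul c (smul (of_nat q) x)" by (rule D.scale)
  then have e: "smul c (d_ext (hopL 1 y) * gen t_letter) \<simeq>[DT] x"
    unfolding c_def smul_inverse[OF assms(2)] .
  define h where "h = smul c (hopL 1 y * gen t_letter)"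
  have hp: "hopL 1 y \<in> bipiece (p - 1) (int q - 1)" by (rule hopL_bipiece[OF y])
  have "d_ext (hopL 1 y * gen t_letter) = d_ext (hopL 1 y) * gen t_letter"
    using d_ext_mult[of "hopL 1 y" "p - 1" "gen t_letter"] hp by (simp add: bipiece_def)
  then have "d_ext h \<simeq>[DT] x" using e by (simp add: h_def ext_simps)
  moreover have "h \<in> bipiece (p - 1) (int q)"
    unfolding h_def by (intro smul.subspace_scale[OF bipiece_submod] bipiece_mult[OF hp t]) simp_all
  ultimately show ?thesis using D.sym by blast
qed

end

section \<open>Representation schemes\<close>

locale rep_alg = k_alg sc for sc :: "'k::comm_ring_1 \<Rightarrow> 'a::ring_1 \<Rightarrow> 'a" +
  fixes idx :: "'n::finite itself"
begin

abbreviation RI :: "('a, 'n, 'k) rep_ring set" where "RI \<equiv> rep_ideal sc"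

definition eq_relations :: "('a, 'n, 'k) rep_eq_forms set" where
  "eq_relations = form_relations smul RI Form \<union> supercommutators ldeg \<union> {gen (Form (Df c)) * gen (Form (Df c)) | c. True}"

definition eq_ideal :: "('a, 'n, 'k) rep_eq_forms set" where
  "eq_ideal = ideal_k eq_relations"

definition EN :: "('a, 'n, 'k) rep_eq_forms set" where
  "EN = eq_null smul RI"

sublocale R: form_calculus eq_ideal smul RI Form
proof -
  interpret tsideal eq_ideal unfolding eq_ideal_def by (rule tsideal_ideal_k)
  show "form_calculus eq_ideal smul RI Form"
    by unfold_locales
       (auto simp: eq_ideal_def eq_relations_def k_algebra_def smul.module_axioms smul_mult_left smul_mult_right intro: ideal_k_base)
qed

sublocale RR: tsideal RI
  unfolding rep_ideal_def by (rule tsideal_ideal_k)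

sublocale EN: submodule EN by unfold_locales (simp add: EN_def eq_null_def)

lemma eq_ideal_EN: "eq_ideal \<subseteq> EN"
  unfolding EN_def eq_null_def eq_ideal_def eq_relations_def by (intro subsetI span_k_base UnI1)

lemma R_EN: "x \<simeq>[eq_ideal] y \<Longrightarrow> x \<simeq>[EN] y" by (rule eqv_mono[OF eq_ideal_EN])

lemma vars_EN: "mon (map Var vs) \<in> EN"
  unfolding EN_def eq_null_def by (intro span_k_base UnI2 CollectI exI[of _ vs] conjI TrueI HOL.refl)

lemma supercommutators_R: "span_k (supercommutators ldeg) \<subseteq> eq_ideal"
proof (rule span_k_least[OF _ R.sub], rule subsetI)
  fix x :: "('a, 'n, 'k) rep_eq_forms" assume "x \<in> supercommutators ldeg"
  then show "x \<in> eq_ideal" unfolding eq_ideal_def by (intro ideal_k_base) (simp add: eq_relations_def)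
qed

lemma R_commute:
  assumes "f \<in> piece ldeg p" "g \<in> piece ldeg q"
  shows "f * g \<simeq>[eq_ideal] sg (p * q) * (g * f)"
  unfolding eqv_def using supercommutators_R supercommutators_span[OF assms] by blast

lemma el_cong: "x \<simeq>[RI] y \<Longrightarrow> R.el x \<simeq>[eq_ideal] R.el y"
  using R.trans[OF R.sym[OF R.el_diff] R.el_J, of x y] by (simp add: eqv_def)
lemma df_cong: "x \<simeq>[RI] y \<Longrightarrow> R.df x \<simeq>[eq_ideal] R.df y"
  using R.trans[OF R.sym[OF R.df_diff] R.df_J, of x y] by (simp add: eqv_def)

lemma coord_relations:
  "coord (a + b) i j \<simeq>[RI] coord a i j + coord b i j"
  "coord (sc c a) i j \<simeq>[RI] smul c (coord a i j)"
  "coord (a * b) i j \<simeq>[RI] (\<Sum>k\<in>UNIV. coord a i k * coord b k j)"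
  "coord 1 i j \<simeq>[RI] (if i = j then 1 else 0)"
  "f * g \<simeq>[RI] g * f"
  unfolding eqv_def rep_ideal_def by (rule ideal_k_base; blast)+

section \<open>Evaluation of extended forms on matrices\<close>

abbreviation evm :: "('a, 'k) ext_forms \<Rightarrow> ('a, 'n, 'k) rep_eq_forms ^ 'n ^ 'n" where "evm \<equiv> ev"
abbreviation evl :: "('a, unit) letter \<Rightarrow> ('a, 'n, 'k) rep_eq_forms ^ 'n ^ 'n" where "evl \<equiv> ev_letter"
abbreviation evw :: "('a, unit) letter list \<Rightarrow> ('a, 'n, 'k) rep_eq_forms ^ 'n ^ 'n" where "evw \<equiv> ev_word"
abbreviation tre :: "('a, 'k) ext_forms \<Rightarrow> ('a, 'n, 'k) rep_eq_forms" where "tre \<equiv> tr_ev"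
abbreviation vmons :: "('a, 'n, 'k) rep_eq_forms set" where "vmons \<equiv> {mon (map Var vs) | vs. True}"

lemma ev_mon: "evm (mon w) = evw w"
  by (simp add: ev_def mon_def vec_eq_iff)

lemma klin_ev [klin_intros]: "klin g \<Longrightarrow> klin (\<lambda>x. evm (g x) $ i $ j)"
  by (simp add: ev_def klin_lin')

lemmas ev_simps = klin_add[OF klin_ev[OF klin_id]] klin_diff[OF klin_ev[OF klin_id]]
  klin_smul[OF klin_ev[OF klin_id]] klin_zero[OF klin_ev[OF klin_id]] klin_neg[OF klin_ev[OF klin_id]]

lemma ev_word_append: "evw (u @ v) = evw u ** evw v"
  by (induction u) (simp_all add: ev_word_def matrix_mul_lid matrix_mul_assoc[symmetric])

lemma mat_nth: "(A ** B) $ i $ j = (\<Sum>k\<in>UNIV. A $ i $ k * B $ k $ j)"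
  by (simp add: matrix_matrix_mult_def)

lemma ev_mult: "evm (f * g) = evm f ** evm g"
proof -
  have "evm (f * g) $ i $ j = (evm f ** evm g) $ i $ j" for i j
    unfolding mat_nth
  proof (rule falg_eqI[of "\<lambda>f. evm (f * g) $ i $ j" "\<lambda>f. \<Sum>k\<in>UNIV. evm f $ i $ k * evm g $ k $ j"])
    fix u
    show "evm (mon u * g) $ i $ j = (\<Sum>k\<in>UNIV. evm (mon u) $ i $ k * evm g $ k $ j)"
      by (rule falg_eqI[of "\<lambda>g. evm (mon u * g) $ i $ j" "\<lambda>g. \<Sum>k\<in>UNIV. evm (mon u) $ i $ k * evm g $ k $ j"])
         (auto intro!: klin_intros simp: ev_mon ev_word_append mat_nth simp flip: mon_append)
  qed (auto intro!: klin_intros)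
  then show ?thesis by (simp add: vec_eq_iff)
qed

lemma ev_one: "evm 1 = mat 1"
  using ev_mon[of "[]"] by (simp add: ev_word_def)

lemma ev_gen: "evm (gen l) = evl l"
  using ev_mon[of "[l]"] by (simp add: ev_word_def matrix_mul_rid)

lemma ev_letter_simps:
  "evl (Form (El a)) $ i $ j = R.el (coord a i j)" "evl (Form (Df a)) $ i $ j = R.df (coord a i j)"
  "evl t_letter $ i $ j = gen (Var (i, j))"
  by (simp_all add: ev_letter_def)

lemma ev_gen_simps:
  "evm (gen (Form (El a))) $ i $ j = R.el (coord a i j)" "evm (gen (Form (Df a))) $ i $ j = R.df (coord a i j)"
  "evm (gen t_letter) $ i $ j = gen (Var (i, j))"
  by (simp_all add: ev_gen ev_letter_simps)

lemma ev_letter_piece: "evl l $ i $ j \<in> piece ldeg (int (ldeg l))" "evl l $ i $ j \<in> piece vdeg (int (vdeg l))"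
  by (auto simp: ev_letter_def piece_mon split: letter.splits form.splits)

lemma ev_word_piece:
  assumes "\<And>l i j. evl l $ i $ j \<in> piece deg' (int (deg l))"
  shows "evw w $ i $ j \<in> piece deg' (int (sum_list (map deg w)))"
proof (induction w arbitrary: i)
  case Nil
  show ?case by (simp add: ev_word_def mat_def)
next
  case (Cons l w)
  have "evw (l # w) = evl l ** evw w" by (simp add: ev_word_def)
  then show ?case by (auto simp: mat_nth intro!: piece_sum piece_mult'[OF assms Cons])
qed

lemma ev_ldeg: "f \<in> piece ldeg p \<Longrightarrow> evm f $ i $ j \<in> piece ldeg p"
  by (rule piece_mem[OF _ klin_ev[OF klin_id] piece_submod])
     (use ev_word_piece[OF ev_letter_piece(1)] in \<open>auto simp: ev_mon\<close>)

lemma ev_vdeg: "f \<in> piece vdeg p \<Longrightarrow> evm f $ i $ j \<in> piece vdeg p"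
  by (rule piece_mem[OF _ klin_ev[OF klin_id] piece_submod])
     (use ev_word_piece[OF ev_letter_piece(2)] in \<open>auto simp: ev_mon\<close>)

text \<open>The product relation becomes the matrix product relation between the coordinate
  functions, and the Leibniz relation its differential.\<close>

lemma ev_relations:
  assumes "r \<in> form_relations sc {} Form"
  shows "evm r $ i $ j \<in> eq_ideal"
  using assms
proof (cases rule: form_relations_cases)
  case (1 a b)
  have "R.el (coord (a + b) i j) \<simeq>[eq_ideal] R.el (coord a i j) + R.el (coord b i j)"
    by (rule R.trans[OF el_cong[OF coord_relations(1)] R.el_add])
  then show ?thesis by (simp add: 1 ev_simps ev_gen_simps eqv_def)
next
  case (2 c a)
  have "R.el (coord (sc c a) i j) \<simeq>[eq_ideal] smul c (R.el (coord a i j))"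
    by (rule R.trans[OF el_cong[OF coord_relations(2)] R.el_sc])
  then show ?thesis by (simp add: 2 ev_simps ev_gen_simps eqv_def)
next
  case (3 a b)
  have "R.el (coord (a * b) i j) \<simeq>[eq_ideal] R.el (\<Sum>k\<in>UNIV. coord a i k * coord b k j)"
    by (rule el_cong[OF coord_relations(3)])
  also have "\<dots> \<simeq>[eq_ideal] (\<Sum>k\<in>UNIV. R.el (coord a i k * coord b k j))" by (rule R.el_sum)
  also have "\<dots> \<simeq>[eq_ideal] (\<Sum>k\<in>UNIV. R.el (coord a i k) * R.el (coord b k j))" by (intro R.sum R.el_mult)
  finally show ?thesis by (simp add: 3 ev_simps ev_gen_simps ev_mult mat_nth eqv_def)
next
  case 4
  have "R.el (coord 1 i j) \<simeq>[eq_ideal] R.el (if i = j then 1 else 0)"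
    by (rule el_cong[OF coord_relations(4)])
  also have "\<dots> \<simeq>[eq_ideal] (if i = j then 1 else 0)"
    using R.el_one R.el_0 by simp
  finally show ?thesis by (simp add: 4 ev_simps ev_gen_simps ev_one mat_def eqv_def)
next
  case (6 a b)
  have "R.df (coord (a + b) i j) \<simeq>[eq_ideal] R.df (coord a i j) + R.df (coord b i j)"
    by (rule R.trans[OF df_cong[OF coord_relations(1)] R.df_add])
  then show ?thesis by (simp add: 6 ev_simps ev_gen_simps eqv_def)
next
  case (7 c a)
  have "R.df (coord (sc c a) i j) \<simeq>[eq_ideal] smul c (R.df (coord a i j))"
    by (rule R.trans[OF df_cong[OF coord_relations(2)] R.df_sc])
  then show ?thesis by (simp add: 7 ev_simps ev_gen_simps eqv_def)
next
  case (8 c)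
  have "coord (sc c 1) i j \<simeq>[RI] smul c (if i = j then 1 else 0)"
    by (rule RR.trans[OF coord_relations(2) RR.scale[OF coord_relations(4)]])
  then have "R.df (coord (sc c 1) i j) \<simeq>[eq_ideal] R.df (smul c (if i = j then 1 else 0))"
    by (rule df_cong)
  also have "\<dots> \<simeq>[eq_ideal] 0" using R.df_scalar R.df_0 by simp
  finally show ?thesis by (simp add: 8 ev_gen_simps eqv_def)
next
  case (10 a b)
  have "R.df (coord (a * b) i j) \<simeq>[eq_ideal] R.df (\<Sum>k\<in>UNIV. coord a i k * coord b k j)"
    by (rule df_cong[OF coord_relations(3)])
  also have "\<dots> \<simeq>[eq_ideal] (\<Sum>k\<in>UNIV. R.df (coord a i k * coord b k j))" by (rule R.df_sum)
  also have "\<dots> \<simeq>[eq_ideal] (\<Sum>k\<in>UNIV. R.df (coord a i k) * R.el (coord b k j) + R.el (coord a i k) * R.df (coord b k j))"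
    by (intro R.sum R.df_mult)
  finally show ?thesis by (simp add: 10 ev_simps ev_gen_simps ev_mult mat_nth eqv_def sum.distrib)
qed auto

lemma ev_XI: "x \<in> XI \<Longrightarrow> evm x $ i $ j \<in> eq_ideal"
  unfolding ext_ideal_def
proof (rule ideal_k_mem[OF klin_ev[OF klin_id] R.sub])
  fix u v and r :: "('a, 'k) ext_forms" assume r: "r \<in> form_relations sc {} Form"
  show "evm (mon u * r * mon v) $ i $ j \<in> eq_ideal"
    unfolding ev_mult mat_nth
    by (rule R.closed(6), rule R.absorb_r, rule R.closed(6), rule R.absorb_l, rule ev_relations[OF r])
qed

lemma tr_ev_sum: "tre f = (\<Sum>i\<in>UNIV. evm f $ i $ i)"
  by (simp add: tr_ev_def trace_def)

lemma klin_tr_ev [klin_intros]: "klin g \<Longrightarrow> klin (\<lambda>x. tre (g x) :: ('a, 'n, 'k) rep_eq_forms)"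
  unfolding tr_ev_sum by (intro klin_intros)

lemma tr_ev_bipiece: "f \<in> bipiece p q \<Longrightarrow> (tre f :: ('a, 'n, 'k) rep_eq_forms) \<in> bipiece p q"
  unfolding tr_ev_sum bipiece_def using ev_ldeg ev_vdeg by (auto intro!: piece_sum)

lemma ev_t_pow: "evm (gen t_letter ^ q) $ i $ j \<in> span_k vmons"
proof (induction q arbitrary: i)
  case 0
  have "1 \<in> span_k vmons" by (rule span_k_base) (auto intro!: exI[of _ "[]"])
  then show ?case by (simp add: ev_one mat_def smul.subspace_0)
next
  case (Suc q)
  have *: "gen (Var v) * x \<in> span_k vmons" if "x \<in> span_k vmons" for v x
  proof (rule klin_span[OF _ span_k_submod _ that, of "\<lambda>x. gen (Var v) * x"])
    fix s assume "s \<in> vmons"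
    then obtain vs where "s = mon (map Var vs)" by auto
    then have "gen (Var v) * s = mon (map Var (v # vs))" by (simp flip: mon_Cons)
    then show "gen (Var v) * s \<in> span_k vmons" by (intro span_k_base) blast
  qed (intro klin_intros)
  show ?case
    unfolding power_Suc ev_mult mat_nth ev_gen_simps
    by (intro smul.subspace_sum[OF span_k_submod] * Suc)
qed

text \<open>The entries supercommute modulo \<open>eq_ideal\<close>, so exchanging the two summation
  indices shows that the trace kills supercommutators. Powers of t go to polynomials on the Lie
  algebra, which are zero in the reduced complex.\<close>

lemma tr_ev_DT: "x \<in> DT \<Longrightarrow> tre x \<in> EN"
proof (rule DT_mem[OF klin_tr_ev[OF klin_id] EN.sub])
  fix x :: "('a, 'k) ext_forms" assume "x \<in> XI"
  then show "tre x \<in> EN" unfolding tr_ev_sum by (intro EN.closed(6) subsetD[OF eq_ideal_EN] ev_XI)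
next
  fix x :: "('a, 'k) ext_forms" assume x: "x \<in> supercommutators ldeg"
  show "tre x \<in> EN"
  proof (rule supercommutators_mem[OF klin_tr_ev[OF klin_id] EN.sub _ x])
    fix u v :: "('a, unit) letter list"
    define a b where "a = int (sum_list (map ldeg u))" and "b = int (sum_list (map ldeg v))"
    have u: "evm (mon u) $ i $ j \<in> piece ldeg a" and v: "evm (mon v) $ i $ j \<in> piece ldeg b" for i j
      unfolding a_def b_def by (rule ev_ldeg[OF piece_mon'])+
    have "(\<Sum>i\<in>UNIV. \<Sum>j\<in>UNIV. evm (mon u) $ i $ j * evm (mon v) $ j $ i) \<simeq>[eq_ideal]
      (\<Sum>i\<in>UNIV. \<Sum>j\<in>UNIV. sg (a * b) * (evm (mon v) $ j $ i * evm (mon u) $ i $ j))"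
      by (intro R.sum R_commute u v)
    also have "\<dots> = (\<Sum>j\<in>UNIV. \<Sum>i\<in>UNIV. sg (a * b) * (evm (mon v) $ j $ i * evm (mon u) $ i $ j))"
      by (rule sum.swap)
    finally have "tre (mon u * mon v) \<simeq>[eq_ideal] sg (a * b) * tre (mon v * mon u)"
      by (simp add: tr_ev_sum ev_mult mat_nth sum_distrib_left)
    then show "tre (mon u * mon v - sg (int (sum_list (map ldeg u)) * int (sum_list (map ldeg v))) * (mon v * mon u)) \<in> EN"
      using R_EN unfolding a_def[symmetric] b_def[symmetric]
      by (simp add: klin_diff[OF klin_tr_ev[OF klin_id]] klin_sgI[OF klin_tr_ev[OF klin_id]] eqv_def)
  qed
next
  fix q
  have "span_k vmons \<subseteq> EN" by (rule span_k_least[OF _ EN.sub]) (use vars_EN in blast)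
  then show "tre (gen t_letter ^ q) \<in> EN"
    unfolding tr_ev_sum using ev_t_pow by (intro EN.closed(6)) blast
qed

lemma d_ext_ev: "d_ext (evm f $ i $ j) = evm (d_ext f) $ i $ j"
proof (rule falg_eqI[of "\<lambda>f. d_ext (evm f $ i $ j)" "\<lambda>f. evm (d_ext f) $ i $ j"])
  fix w :: "('a, unit) letter list"
  show "d_ext (evm (mon w) $ i $ j) = evm (d_ext (mon w)) $ i $ j"
  proof (induction w arbitrary: i)
    case Nil
    show ?case by (simp add: ev_one mat_def ev_simps ext_simps)
  next
    case (Cons l w)
    have l: "gen l \<in> piece ldeg (int (ldeg l))" by (simp add: piece_mon)
    have dl: "d_ext (evl l $ i $ k) = evm (d_ext (gen l)) $ i $ k" for i k
    proof (cases l)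
      case (Form x)
      then show ?thesis by (cases x) (simp_all add: ev_letter_simps ev_gen_simps ev_simps)
    next
      case (Var v)
      then show ?thesis by (simp add: ev_letter_simps ev_simps)
    qed
    have "d_ext (evm (mon (l # w)) $ i $ j) = (\<Sum>k\<in>UNIV. d_ext (evl l $ i $ k * evm (mon w) $ k $ j))"
      by (subst mon_Cons) (simp add: ev_mult mat_nth ev_gen ext_simps)
    also have "\<dots> = (\<Sum>k\<in>UNIV. evm (d_ext (gen l)) $ i $ k * evm (mon w) $ k $ j
        + sg (int (ldeg l)) * (evl l $ i $ k * evm (d_ext (mon w)) $ k $ j))"
      by (simp add: d_ext_mult[OF ev_letter_piece(1)] dl Cons)
    also have "\<dots> = evm (d_ext (gen l) * mon w + sg (int (ldeg l)) * (gen l * d_ext (mon w))) $ i $ j"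
      unfolding klin_add[OF klin_ev[OF klin_id]] klin_sgI[OF klin_ev[OF klin_id]]
      unfolding ev_mult mat_nth by (simp add: ev_gen sum.distrib sum_distrib_left)
    also have "\<dots> = evm (d_ext (mon (l # w))) $ i $ j"
      by (subst mon_Cons) (simp add: d_ext_mult[OF l])
    finally show ?case .
  qed
qed (auto intro!: klin_intros)

lemma d_ext_tr_ev: "d_ext (tre f) = (tre (d_ext f) :: ('a, 'n, 'k) rep_eq_forms)"
  by (simp add: tr_ev_sum ext_simps d_ext_ev)

section \<open>Contraction and Lie derivative of matrix entries and traces\<close>

abbreviation ig :: "('a, 'n, 'k) rep_eq_forms \<Rightarrow> ('a, 'n, 'k) rep_eq_forms" where "ig \<equiv> i_g gl_act"

lemma klin_ig [klin_intros]: "klin g \<Longrightarrow> klin (\<lambda>x. ig (g x))"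
  unfolding i_g_def by (rule klin_derivation')

lemma ig_mult: "f \<in> piece ldeg p \<Longrightarrow> ig (f * g) = ig f * g + sg p * (f * ig g)"
  unfolding i_g_def using derivation_mult[of f ldeg p 1] by simp

lemma gl_act_coord: "gl_act x (coord a i j) = (\<Sum>k\<in>UNIV. smul (x (k, j)) (coord a i k) - smul (x (i, k)) (coord a k j))"
  by (simp add: gl_act_def coord_def)

lemma sum_basis: "(\<Sum>v\<in>UNIV. smul (basis_vec v w) (f v)) = f (w :: 'n \<times> 'n)"
proof -
  have "(\<Sum>v\<in>UNIV. smul (basis_vec v w) (f v)) = (\<Sum>v\<in>UNIV. if w = v then f v else 0)"
    by (intro sum.cong) (auto simp: basis_vec_def)
  then show ?thesis by simp
qed

text \<open>The action on the coordinate matrix is [\<rho>(a), x], and the matrix of variables is x,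
  the value of t. So contracting the differential of the coordinate matrix gives the value of
  i_t(da) = [a, t].\<close>

lemma ig_df: "ig (R.df (coord a i j)) \<simeq>[eq_ideal] evm (i_t (gen (Form (Df a)))) $ i $ j"
proof -
  have "R.el (gl_act x (coord a i j)) \<simeq>[eq_ideal] (\<Sum>k\<in>UNIV. smul (x (k, j)) (R.el (coord a i k)) - smul (x (i, k)) (R.el (coord a k j)))" for x
    unfolding gl_act_coord
    by (rule R.trans[OF R.el_sum]) (intro R.sum R.trans[OF R.el_diff] R.diff R.el_sc)
  then have "ig (R.df (coord a i j)) \<simeq>[eq_ideal] (\<Sum>v\<in>UNIV. gen (Var v) *
      (\<Sum>k\<in>UNIV. smul (basis_vec v (k, j)) (R.el (coord a i k)) - smul (basis_vec v (i, k)) (R.el (coord a k j))))"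
    by (simp add: i_g_def ig_letter_def) (intro R.sum R.mult R.refl)
  also have "\<dots> = (\<Sum>k\<in>UNIV. (\<Sum>v\<in>UNIV. smul (basis_vec v (k, j)) (gen (Var v) * R.el (coord a i k)))
      - (\<Sum>v\<in>UNIV. smul (basis_vec v (i, k)) (gen (Var v) * R.el (coord a k j))))"
    unfolding sum_distrib_left sum_subtractf[symmetric]
    by (subst sum.swap) (simp add: right_diff_distrib smul_mult_right)
  also have "\<dots> = (\<Sum>k\<in>UNIV. gen (Var (k, j)) * R.el (coord a i k) - gen (Var (i, k)) * R.el (coord a k j))"
    by (simp add: sum_basis)
  also have "\<dots> \<simeq>[eq_ideal] (\<Sum>k\<in>UNIV. R.el (coord a i k) * gen (Var (k, j)) - gen (Var (i, k)) * R.el (coord a k j))"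
    by (intro R.sum R.diff R.refl) (use R_commute[OF gen_ldeg(3) gen_ldeg(1)] in simp)
  also have "\<dots> = evm (i_t (gen (Form (Df a)))) $ i $ j"
    by (simp add: ev_simps ev_mult mat_nth ev_gen_simps sum_subtractf)
  finally show ?thesis .
qed

lemma ig_ev: "ig (evm f $ i $ j) \<simeq>[eq_ideal] evm (i_t f) $ i $ j"
  unfolding eqv_def
proof (rule falg_mem[of "\<lambda>f. ig (evm f $ i $ j) - evm (i_t f) $ i $ j"])
  fix w :: "('a, unit) letter list"
  have "ig (evm (mon w) $ i $ j) \<simeq>[eq_ideal] evm (i_t (mon w)) $ i $ j"
  proof (induction w arbitrary: i)
    case Nil
    have "ig 1 = 0" by (simp add: i_g_def)
    then show ?case by (simp add: ev_one mat_def ev_simps klin_zero[OF klin_ig[OF klin_id]])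
  next
    case (Cons l w)
    have l: "gen l \<in> piece ldeg (int (ldeg l))" by (simp add: piece_mon)
    have dl: "ig (evl l $ i $ k) \<simeq>[eq_ideal] evm (i_t (gen l)) $ i $ k" for i k
    proof (cases l)
      case (Form x)
      then show ?thesis
      proof (cases x)
        case (El a)
        then show ?thesis by (simp add: Form ev_letter_simps ev_simps) (simp add: i_g_def ig_letter_def)
      next
        case (Df a)
        then show ?thesis using ig_df by (simp add: Form ev_letter_simps del: i_t_gen)
      qed
    next
      case (Var v)
      then show ?thesis by (simp add: ev_letter_simps ev_simps) (simp add: i_g_def ig_letter_def)
    qed
    have "ig (evm (mon (l # w)) $ i $ j) = (\<Sum>k\<in>UNIV. ig (evl l $ i $ k * evm (mon w) $ k $ j))"
      by (subst mon_Cons) (simp add: ev_mult mat_nth ev_gen klin_sum[OF klin_ig[OF klin_id]])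
    also have "\<dots> \<simeq>[eq_ideal] (\<Sum>k\<in>UNIV. evm (i_t (gen l)) $ i $ k * evm (mon w) $ k $ j
        + sg (int (ldeg l)) * (evl l $ i $ k * evm (i_t (mon w)) $ k $ j))"
      unfolding ig_mult[OF ev_letter_piece(1)] by (intro R.sum R.add R.mult R.refl dl Cons)
    also have "\<dots> = evm (i_t (gen l) * mon w + sg (int (ldeg l)) * (gen l * i_t (mon w))) $ i $ j"
      unfolding klin_add[OF klin_ev[OF klin_id]] klin_sgI[OF klin_ev[OF klin_id]]
      unfolding ev_mult mat_nth by (simp add: ev_gen sum.distrib sum_distrib_left)
    also have "\<dots> = evm (i_t (mon (l # w))) $ i $ j"
      by (subst mon_Cons) (simp add: i_t_mult[OF l])
    finally show ?case .
  qed
  then show "ig (evm (mon w) $ i $ j) - evm (i_t (mon w)) $ i $ j \<in> eq_ideal" by (simp add: eqv_def)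
qed (auto intro!: klin_intros R.sub)

lemma ig_tr_ev: "ig (tre f) \<simeq>[eq_ideal] tre (i_t f)"
  unfolding tr_ev_sum klin_sum[OF klin_ig[OF klin_id]] by (intro R.sum ig_ev)

abbreviation lie :: "('n \<times> 'n \<Rightarrow> 'k) \<Rightarrow> ('a, 'n, 'k) rep_eq_forms \<Rightarrow> ('a, 'n, 'k) rep_eq_forms" where
  "lie \<xi> \<equiv> lie_action gl_act gl_bracket \<xi>"

lemma klin_lie [klin_intros]: "klin g \<Longrightarrow> klin (\<lambda>x. lie \<xi> (g x))"
  unfolding lie_action_def by (rule klin_derivation')

lemma lie_mult: "lie \<xi> (f * g) = lie \<xi> f * g + f * lie \<xi> g"
proof (rule falg_eqI[of "\<lambda>f. lie \<xi> (f * g)" "\<lambda>f. lie \<xi> f * g + f * lie \<xi> g"])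
  fix w
  show "lie \<xi> (mon w * g) = lie \<xi> (mon w) * g + mon w * lie \<xi> g"
    unfolding lie_action_def using derivation_mult[OF piece_mon', of 0] by simp
qed (auto intro!: klin_intros)

definition scalar_matrix :: "('n \<times> 'n \<Rightarrow> 'k) \<Rightarrow> ('a, 'n, 'k) rep_eq_forms ^ 'n ^ 'n" where
  "scalar_matrix \<xi> = (\<chi> i j. smul (\<xi> (i, j)) 1)"

lemma scalar_matrix_mult:
  "(M ** scalar_matrix \<xi>) $ i $ j = (\<Sum>k\<in>UNIV. smul (\<xi> (k, j)) (M $ i $ k))"
  "(scalar_matrix \<xi> ** M) $ i $ j = (\<Sum>k\<in>UNIV. smul (\<xi> (i, k)) (M $ k $ j))"
  by (simp_all add: mat_nth scalar_matrix_def smul_mult_left smul_mult_right)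

lemma lie_gen: "lie \<xi> (gen l) = lie_letter gl_act gl_bracket \<xi> l"
  by (simp add: lie_action_def)

text \<open>All three kinds of letter transform by the same commutator with \<xi>. For the variables
  this is the coadjoint action: y goes to -[\<xi>, y] = [y, \<xi>].\<close>

lemma lie_ev_letter:
  "lie \<xi> (evl l $ i $ j) \<simeq>[eq_ideal] (evl l ** scalar_matrix \<xi>) $ i $ j - (scalar_matrix \<xi> ** evl l) $ i $ j"
proof -
  have e: "F (gl_act \<xi> (coord a i j)) \<simeq>[eq_ideal] (\<Sum>k\<in>UNIV. smul (\<xi> (k, j)) (F (coord a i k))) - (\<Sum>k\<in>UNIV. smul (\<xi> (i, k)) (F (coord a k j)))"
    if F: "\<And>x y. F (x - y) \<simeq>[eq_ideal] F x - F y" "\<And>c x. F (smul c x) \<simeq>[eq_ideal] smul c (F x)"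
      "\<And>g. F (sum g (UNIV :: 'n set)) \<simeq>[eq_ideal] (\<Sum>k\<in>UNIV. F (g k))" for F :: "('a, 'n, 'k) rep_ring \<Rightarrow> ('a, 'n, 'k) rep_eq_forms" and a
    unfolding gl_act_coord sum_subtractf[symmetric]
    by (rule R.trans[OF F(3)]) (intro R.sum R.trans[OF F(1)] R.diff F(2))
  show ?thesis
  proof (cases l)
    case (Form x)
    then show ?thesis
    proof (cases x)
      case (El a)
      show ?thesis
        using e[of "\<lambda>x. R.el x" a, OF R.el_diff R.el_sc R.el_sum]
        by (simp add: Form El ev_letter_simps scalar_matrix_mult lie_gen lie_letter_def)
    next
      case (Df a)
      show ?thesis
        using e[of "\<lambda>x. R.df x" a, OF R.df_diff R.df_sc R.df_sum]
        by (simp add: Form Df ev_letter_simps scalar_matrix_mult lie_gen lie_letter_def)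
    qed
  next
    case (Var v)
    have br: "gl_bracket \<xi> (basis_vec w) (i, j)
        = (\<Sum>k\<in>UNIV. \<xi> (i, k) * basis_vec w (k, j) - basis_vec w (i, k) * \<xi> (k, j))" for w
      by (simp add: gl_bracket_def)
    have "(\<Sum>w\<in>UNIV. smul (gl_bracket \<xi> (basis_vec w) (i, j)) (gen (Var w)))
      = (\<Sum>k\<in>UNIV. (\<Sum>w\<in>UNIV. smul (basis_vec w (k, j)) (smul (\<xi> (i, k)) (gen (Var w))))
          - (\<Sum>w\<in>UNIV. smul (basis_vec w (i, k)) (smul (\<xi> (k, j)) (gen (Var w) :: ('a, 'n, 'k) rep_eq_forms))))"
      unfolding br smul.scale_sum_left sum_subtractf[symmetric]
      by (subst sum.swap) (simp add: smul.scale_left_diff_distrib mult.commute)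
    also have "\<dots> = (\<Sum>k\<in>UNIV. smul (\<xi> (i, k)) (gen (Var (k, j))) - smul (\<xi> (k, j)) (gen (Var (i, k))))"
      unfolding sum_basis ..
    finally have e: "(\<Sum>w\<in>UNIV. smul (gl_bracket \<xi> (basis_vec w) (i, j)) (gen (Var w)))
      = (\<Sum>k\<in>UNIV. smul (\<xi> (i, k)) (gen (Var (k, j))) - smul (\<xi> (k, j)) (gen (Var (i, k)) :: ('a, 'n, 'k) rep_eq_forms))" .
    show ?thesis
      by (simp add: Var ev_letter_simps scalar_matrix_mult lie_gen lie_letter_def e sum_subtractf)
  qed
qed

lemma lie_ev: "lie \<xi> (evm f $ i $ j) \<simeq>[eq_ideal] (evm f ** scalar_matrix \<xi>) $ i $ j - (scalar_matrix \<xi> ** evm f) $ i $ j"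
  unfolding eqv_def scalar_matrix_mult
proof (rule falg_mem[of "\<lambda>f. lie \<xi> (evm f $ i $ j) - ((\<Sum>k\<in>UNIV. smul (\<xi> (k, j)) (evm f $ i $ k)) - (\<Sum>k\<in>UNIV. smul (\<xi> (i, k)) (evm f $ k $ j)))"])
  fix w :: "('a, unit) letter list"
  let ?X = "scalar_matrix \<xi>"
  have "lie \<xi> (evw w $ i $ j) \<simeq>[eq_ideal] (evw w ** ?X) $ i $ j - (?X ** evw w) $ i $ j"
  proof (induction w arbitrary: i)
    case Nil
    have "lie \<xi> 1 = 0" by (simp add: lie_action_def)
    then show ?case
      by (simp add: ev_word_def matrix_mul_lid matrix_mul_rid) (simp add: mat_def klin_zero[OF klin_lie[OF klin_id]])
  next
    case (Cons l w)
    have w: "evw (l # w) = evl l ** evw w" by (simp add: ev_word_def)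
    have "lie \<xi> (evw (l # w) $ i $ j) = (\<Sum>k\<in>UNIV. lie \<xi> (evl l $ i $ k) * evw w $ k $ j + evl l $ i $ k * lie \<xi> (evw w $ k $ j))"
      unfolding w mat_nth klin_sum[OF klin_lie[OF klin_id]] lie_mult ..
    also have "\<dots> \<simeq>[eq_ideal] (\<Sum>k\<in>UNIV. ((evl l ** ?X) $ i $ k - (?X ** evl l) $ i $ k) * evw w $ k $ j
        + evl l $ i $ k * ((evw w ** ?X) $ k $ j - (?X ** evw w) $ k $ j))"
      by (intro R.sum R.add R.mult R.refl lie_ev_letter Cons)
    also have "\<dots> = ((evl l ** ?X) ** evw w) $ i $ j - ((?X ** evl l) ** evw w) $ i $ j
        + ((evl l ** (evw w ** ?X)) $ i $ j - (evl l ** (?X ** evw w)) $ i $ j)"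
      unfolding mat_nth[of "evl l ** ?X"] mat_nth[of "?X ** evl l"] mat_nth[of "evl l" "evw w ** ?X"]
        mat_nth[of "evl l" "?X ** evw w"]
      by (simp add: left_diff_distrib right_diff_distrib sum.distrib sum_subtractf)
    also have "\<dots> = (evw (l # w) ** ?X) $ i $ j - (?X ** evw (l # w)) $ i $ j"
      unfolding w by (simp add: matrix_mul_assoc)
    finally show ?case .
  qed
  then show "lie \<xi> (evm (mon w) $ i $ j) - ((\<Sum>k\<in>UNIV. smul (\<xi> (k, j)) (evm (mon w) $ i $ k)) - (\<Sum>k\<in>UNIV. smul (\<xi> (i, k)) (evm (mon w) $ k $ j))) \<in> eq_ideal"
    by (simp add: eqv_def ev_mon scalar_matrix_mult)
qed (auto intro!: klin_intros R.sub)

text \<open>The Lie derivative is the trace of a commutator with a matrix of scalars, and such a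
  trace vanishes.\<close>

lemma lie_tr_ev: "lie \<xi> (tre f) \<in> eq_ideal"
proof -
  have "lie \<xi> (tre f) \<simeq>[eq_ideal] (\<Sum>i\<in>UNIV. (evm f ** scalar_matrix \<xi>) $ i $ i - (scalar_matrix \<xi> ** evm f) $ i $ i)"
    unfolding tr_ev_sum klin_sum[OF klin_lie[OF klin_id]] by (intro R.sum lie_ev)
  also have "\<dots> = 0"
    unfolding scalar_matrix_mult sum_subtractf by (subst sum.swap) simp
  finally show ?thesis by (simp add: eqv_def)
qed

lemma gl_act_mult: "gl_act x (f * g) = gl_act x f * g + f * gl_act x g"
proof (rule falg_eqI[of "\<lambda>f. gl_act x (f * g)" "\<lambda>f. gl_act x f * g + f * gl_act x g"])
  fix w
  show "gl_act x (mon w * g) = gl_act x (mon w) * g + mon w * gl_act x g"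
    unfolding gl_act_def using derivation_mult[OF piece_mon', of 0] by simp
qed (auto intro!: klin_intros simp: gl_act_def)

lemma klin_gl_act [klin_intros]: "klin g \<Longrightarrow> klin (\<lambda>y. gl_act x (g y))"
  unfolding gl_act_def by (rule klin_derivation')

lemmas gl_act_simps = klin_add[OF klin_gl_act[OF klin_id]] klin_diff[OF klin_gl_act[OF klin_id]]
  klin_smul[OF klin_gl_act[OF klin_id]] klin_zero[OF klin_gl_act[OF klin_id]] klin_sum[OF klin_gl_act[OF klin_id]]

lemma gl_act_one [simp]: "gl_act x 1 = 0"
  by (simp add: gl_act_def)

definition comm_xi :: "('n \<times> 'n \<Rightarrow> 'k) \<Rightarrow> ('n \<Rightarrow> 'n \<Rightarrow> ('a, 'n, 'k) rep_ring) \<Rightarrow> 'n \<Rightarrow> 'n \<Rightarrow> ('a, 'n, 'k) rep_ring" where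
  "comm_xi x M i j = (\<Sum>k\<in>UNIV. smul (x (k, j)) (M i k) - smul (x (i, k)) (M k j))"

lemma gl_act_coord': "gl_act x (coord a i j) = comm_xi x (coord a) i j"
  by (simp add: gl_act_coord comm_xi_def)

lemma comm_xi_RI: "(\<And>i j. M i j \<simeq>[RI] M' i j) \<Longrightarrow> comm_xi x M i j \<simeq>[RI] comm_xi x M' i j"
  unfolding comm_xi_def by (intro RR.sum RR.diff RR.scale)

text \<open>The commutator with x is a derivation of the matrix algebra that kills the identity
  matrix, so it respects the relations for products and for the unit.\<close>

lemma gl_act_RI:
  assumes "f \<in> RI"
  shows "gl_act x f \<in> RI"
proof -
  let ?S = "{f * g - g * f | f g. True} \<union>
     {coord (a + b) i j - (coord a i j + coord b i j) | a b i j. True} \<union>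
     {coord (sc c a) i j - smul c (coord a i j) | c a i j. True} \<union>
     {coord (a * b) i j - (\<Sum>k\<in>UNIV. coord a i k * coord b k j) | a b i j. True} \<union>
     {coord 1 i j - (if i = j then 1 else 0) | i j. True} :: ('a, 'n, 'k) rep_ring set"
  have RI: "RI = ideal_k ?S" by (simp add: rep_ideal_def)
  have act: "gl_act x s \<in> RI" if "s \<in> ?S" for s
  proof -
    from that consider (1) f g where "s = f * g - g * f"
      | (2) a b i j where "s = coord (a + b) i j - (coord a i j + coord b i j)"
      | (3) c a i j where "s = coord (sc c a) i j - smul c (coord a i j)"
      | (4) a b i j where "s = coord (a * b) i j - (\<Sum>k\<in>UNIV. coord a i k * coord b k j)"
      | (5) i j where "s = coord 1 i j - (if i = j then 1 else 0)"
      by blast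
    then show ?thesis
    proof cases
      case (1 f g)
      have "gl_act x s = (gl_act x f * g - g * gl_act x f) + (f * gl_act x g - gl_act x g * f)"
        by (simp add: 1 gl_act_simps gl_act_mult)
      then show ?thesis using coord_relations(5) RR.closed(1) by (simp add: eqv_def)
    next
      case (2 a b i j)
      have "comm_xi x (coord (a + b)) i j \<simeq>[RI] comm_xi x (\<lambda>i j. coord a i j + coord b i j) i j"
        by (rule comm_xi_RI[OF coord_relations(1)])
      also have "\<dots> = comm_xi x (coord a) i j + comm_xi x (coord b) i j"
        by (simp add: comm_xi_def smul.scale_right_distrib sum.distrib sum_subtractf)
      finally show ?thesis by (simp add: 2 gl_act_simps gl_act_coord' eqv_def)
    next
      case (3 c a i j)
      have "comm_xi x (coord (sc c a)) i j \<simeq>[RI] comm_xi x (\<lambda>i j. smul c (coord a i j)) i j"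
        by (rule comm_xi_RI[OF coord_relations(2)])
      also have "\<dots> = smul c (comm_xi x (coord a) i j)"
        by (simp add: comm_xi_def smul.scale_sum_right smul.scale_right_diff_distrib mult.commute)
      finally show ?thesis by (simp add: 3 gl_act_simps gl_act_coord' eqv_def)
    next
      case (4 a b i j)
      let ?A = "coord a" and ?B = "coord b :: 'n \<Rightarrow> 'n \<Rightarrow> ('a, 'n, 'k) rep_ring"
      have "comm_xi x (coord (a * b)) i j \<simeq>[RI] comm_xi x (\<lambda>i j. \<Sum>k\<in>UNIV. ?A i k * ?B k j) i j"
        by (rule comm_xi_RI[OF coord_relations(3)])
      also have "\<dots> = (\<Sum>k\<in>UNIV. comm_xi x ?A i k * ?B k j + ?A i k * comm_xi x ?B k j)"
      proof -
        have 1: "(\<Sum>k\<in>UNIV. \<Sum>m\<in>UNIV. smul (x (m, j)) (?A i k * ?B k m)) = (\<Sum>m\<in>UNIV. \<Sum>k\<in>UNIV. smul (x (m, j)) (?A i k * ?B k m))"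
          by (rule sum.swap)
        have 2: "(\<Sum>k\<in>UNIV. \<Sum>m\<in>UNIV. smul (x (i, m)) (?A m k * ?B k j)) = (\<Sum>m\<in>UNIV. \<Sum>k\<in>UNIV. smul (x (i, m)) (?A m k * ?B k j))"
          by (rule sum.swap)
        have 3: "(\<Sum>k\<in>UNIV. \<Sum>m\<in>UNIV. smul (x (m, k)) (?A i m * ?B k j)) = (\<Sum>m\<in>UNIV. \<Sum>k\<in>UNIV. smul (x (m, k)) (?A i m * ?B k j))"
          by (rule sum.swap)
        have "(\<Sum>k\<in>UNIV. comm_xi x ?A i k * ?B k j + ?A i k * comm_xi x ?B k j)
          = ((\<Sum>k\<in>UNIV. \<Sum>m\<in>UNIV. smul (x (m, k)) (?A i m * ?B k j)) - (\<Sum>k\<in>UNIV. \<Sum>m\<in>UNIV. smul (x (i, m)) (?A m k * ?B k j)))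
          + ((\<Sum>k\<in>UNIV. \<Sum>m\<in>UNIV. smul (x (m, j)) (?A i k * ?B k m)) - (\<Sum>k\<in>UNIV. \<Sum>m\<in>UNIV. smul (x (k, m)) (?A i k * ?B m j)))"
          by (simp add: comm_xi_def sum_distrib_left sum_distrib_right sum.distrib sum_subtractf
              left_diff_distrib right_diff_distrib smul_mult_left smul_mult_right)
        also have "\<dots> = comm_xi x (\<lambda>i j. \<Sum>k\<in>UNIV. ?A i k * ?B k j) i j"
          unfolding 1 2 3 by (simp add: comm_xi_def smul.scale_sum_right sum_subtractf)
        finally show ?thesis ..
      qed
      finally show ?thesis by (simp add: 4 gl_act_simps gl_act_coord' gl_act_mult eqv_def)
    next
      case (5 i j)
      have "comm_xi x (coord 1) i j \<simeq>[RI] comm_xi x (\<lambda>i j. if i = j then 1 else 0) i j"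
        by (rule comm_xi_RI[OF coord_relations(4)])
      also have "\<dots> = (\<Sum>k\<in>UNIV. if i = k then smul (x (k, j)) 1 else 0) - (\<Sum>k\<in>UNIV. if k = j then smul (x (i, k)) 1 else 0)"
        unfolding comm_xi_def sum_subtractf by (intro arg_cong2[of _ _ _ _ "(-)"] sum.cong) auto
      also have "\<dots> = 0" by simp
      finally have "comm_xi x (coord 1) i j \<in> RI" by (simp add: eqv_def)
      moreover have "gl_act x (if i = j then 1 else 0 :: ('a, 'n, 'k) rep_ring) = 0" by (simp add: gl_act_simps)
      then have "gl_act x s = comm_xi x (coord 1) i j"
        unfolding 5 gl_act_simps gl_act_coord' by (simp only: diff_zero)
      ultimately show ?thesis by (simp only:)
    qed
  qed
  show ?thesis
    unfolding RI gl_act_def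
  proof (rule derivation_ideal[OF _ _ assms[unfolded RI]])
    fix r assume r: "r \<in> ?S"
    show "derivation 0 (\<lambda>_. 0) (\<lambda>(a, i, j). \<Sum>k\<in>UNIV. smul (x (k, j)) (coord a i k) - smul (x (i, k)) (coord a k j)) r
        \<in> ideal_k ?S"
      using act[OF r] unfolding RI gl_act_def .
    show "\<exists>p. r \<in> piece (\<lambda>_. 0) p"
      by (rule exI[of _ 0]) (simp add: piece_def wdeg_def)
  qed
qed

lemma lie_letter_ldeg: "lie_letter gl_act gl_bracket x l \<in> piece ldeg (int (ldeg l) + 0)"
  by (auto simp: lie_letter_def piece_mon intro!: piece_neg piece_sum piece_smul split: letter.splits form.splits)

lemma lie_gen_simps:
  "lie x (R.el f) = R.el (gl_act x f)" "lie x (R.df f) = R.df (gl_act x f)"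
  by (simp_all add: lie_gen lie_letter_def)

lemmas lie_simps = klin_add[OF klin_lie[OF klin_id]] klin_diff[OF klin_lie[OF klin_id]]
  klin_smul[OF klin_lie[OF klin_id]] klin_zero[OF klin_lie[OF klin_id]]

lemma lie_one: "lie x 1 = 0" by (simp add: lie_action_def)

lemma lie_relations:
  assumes "r \<in> form_relations smul RI Form"
  shows "lie x r \<in> eq_ideal"
  using assms
proof (cases rule: form_relations_cases)
  case (1 f g)
  then show ?thesis using R.el_add[of "gl_act x f" "gl_act x g"] by (simp add: lie_simps lie_gen_simps gl_act_simps eqv_def)
next
  case (2 c f)
  then show ?thesis using R.el_sc[of c "gl_act x f"] by (simp add: lie_simps lie_gen_simps gl_act_simps eqv_def)
next
  case (3 f g)
  have "R.el (gl_act x f * g + f * gl_act x g) \<simeq>[eq_ideal] R.el (gl_act x f) * R.el g + R.el f * R.el (gl_act x g)"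
    by (rule R.trans[OF R.el_add R.add[OF R.el_mult R.el_mult]])
  then show ?thesis by (simp add: 3 lie_simps lie_gen_simps lie_mult gl_act_mult eqv_def)
next
  case 4
  then show ?thesis using R.el_0 by (simp add: lie_simps lie_gen_simps lie_one eqv_def)
next
  case (5 f)
  then show ?thesis using R.el_J[OF gl_act_RI[OF 5(1), of x]] by (simp add: lie_gen_simps eqv_def)
next
  case (6 f g)
  then show ?thesis using R.df_add[of "gl_act x f" "gl_act x g"] by (simp add: lie_simps lie_gen_simps gl_act_simps eqv_def)
next
  case (7 c f)
  then show ?thesis using R.df_sc[of c "gl_act x f"] by (simp add: lie_simps lie_gen_simps gl_act_simps eqv_def)
next
  case (8 c)
  then show ?thesis using R.df_0 by (simp add: lie_gen_simps gl_act_simps eqv_def)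
next
  case (9 f)
  then show ?thesis using R.df_J[OF gl_act_RI[OF 9(1), of x]] by (simp add: lie_gen_simps eqv_def)
next
  case (10 f g)
  have "R.df (gl_act x f * g + f * gl_act x g) \<simeq>[eq_ideal]
    (R.df (gl_act x f) * R.el g + R.el (gl_act x f) * R.df g) + (R.df f * R.el (gl_act x g) + R.el f * R.df (gl_act x g))"
    by (rule R.trans[OF R.df_add R.add[OF R.df_mult R.df_mult]])
  then show ?thesis by (simp add: 10 lie_simps lie_gen_simps lie_mult gl_act_mult eqv_def algebra_simps)
qed

text \<open>Invariance is a condition on representatives. This stability lets a correction term by
  an element of the ideal stay among the invariant chains.\<close>

lemma lie_eq_ideal:
  assumes "f \<in> eq_ideal"
  shows "lie x f \<in> eq_ideal"
  unfolding eq_ideal_def lie_action_def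
proof (rule derivation_ideal[OF _ _ assms[unfolded eq_ideal_def]])
  fix r assume r: "r \<in> eq_relations"
  then consider "r \<in> form_relations smul RI Form" | "r \<in> supercommutators ldeg" | c where "r = R.df c * R.df c"
    unfolding eq_relations_def by blast
  then show "derivation 0 ldeg (lie_letter gl_act gl_bracket x) r \<in> ideal_k eq_relations"
  proof cases
    case 1
    then show ?thesis using lie_relations by (simp add: lie_action_def eq_ideal_def)
  next
    case 2
    show ?thesis
      unfolding eq_ideal_def[symmetric]
      by (rule subsetD[OF supercommutators_R derivation_supercommutators[OF lie_letter_ldeg]]) (use 2 in simp_all)
  next
    \<comment> \<open>The derivative of the square of dc is a supercommutator of two odd
      elements.\<close>
    case (3 c)
    have "lie x r = R.df (gl_act x c) * R.df c - sg (1 * 1) * (R.df c * R.df (gl_act x c))"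
      by (simp add: 3 lie_mult lie_gen_simps)
    also have "\<dots> \<in> eq_ideal" using R_commute[OF gen_ldeg(2) gen_ldeg(2)] by (simp add: eqv_def)
    finally show ?thesis by (simp add: lie_action_def eq_ideal_def)
  qed
  from r consider "r \<in> form_relations smul RI Form" | "r \<in> supercommutators ldeg" | c where "r = R.df c * R.df c"
    unfolding eq_relations_def by blast
  then show "\<exists>p. r \<in> piece ldeg p"
  proof cases
    case 1
    then show ?thesis by (rule form_relations_piece[of _ _ _ _ _ 1]) auto
  next
    case 2
    then obtain f g p q where "r = f * g - (-1) ^ (p * q) * (g * f)" "f \<in> piece ldeg (int p)" "g \<in> piece ldeg (int q)"
      by (auto simp: supercommutators_def)
    then have "r \<in> piece ldeg (int p + int q)"
      using piece_mult'[of f ldeg "int p" g "int q" "int p + int q"] piece_mult'[of g ldeg "int q" f "int p" "int p + int q"]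
      by (auto simp: power_sg intro!: piece_diff piece_sg)
    then show ?thesis by blast
  next
    case (3 c)
    then have "r \<in> piece ldeg 2" by (auto intro!: piece_mult'[OF gen_ldeg(2) gen_ldeg(2)])
    then show ?thesis by blast
  qed
qed

lemma ig_letter_bipiece: "ig_letter gl_act l \<in> piece ldeg (int (ldeg l) + (- 1))" "ig_letter gl_act l \<in> piece vdeg (int (vdeg l) + 1)"
  by (auto simp: ig_letter_def intro!: piece_sum piece_mult'[OF gen_ldeg(3) gen_ldeg(1)] piece_mult'[OF gen_vdeg(3) gen_vdeg(1)]
      split: letter.splits form.splits)

lemma ig_bipiece: "f \<in> bipiece p q \<Longrightarrow> ig f \<in> bipiece (p - 1) (q + 1)"
  unfolding bipiece_def i_g_def
  using derivation_piece[OF ig_letter_bipiece(1), of f p] derivation_piece[OF ig_letter_bipiece(2), of f q] by auto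

section \<open>The chain map to the equivariant Deligne complex\<close>

lemma internal_chains_iff: "x \<in> internal_chains N l \<longleftrightarrow>
    (\<forall>r. Poly_Mapping.lookup x r \<in> bipiece (l - 2 * int r) (N - l + int r))"
proof -
  have "(\<exists>p q. p + 2 * int r = l \<and> p + q + int r = N \<and> Poly_Mapping.lookup x r \<in> bipiece p q)
     \<longleftrightarrow> Poly_Mapping.lookup x r \<in> bipiece (l - 2 * int r) (N - l + int r)" for r
  proof
    assume "\<exists>p q. p + 2 * int r = l \<and> p + q + int r = N \<and> Poly_Mapping.lookup x r \<in> bipiece p q"
    then obtain p q where "p + 2 * int r = l" "p + q + int r = N" and b: "Poly_Mapping.lookup x r \<in> bipiece p q" by blast
    then have "p = l - 2 * int r" "q = N - l + int r" by simp_all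
    with b show "Poly_Mapping.lookup x r \<in> bipiece (l - 2 * int r) (N - l + int r)" by simp
  next
    assume "Poly_Mapping.lookup x r \<in> bipiece (l - 2 * int r) (N - l + int r)"
    then show "\<exists>p q. p + 2 * int r = l \<and> p + q + int r = N \<and> Poly_Mapping.lookup x r \<in> bipiece p q"
      by (intro exI[of _ "l - 2 * int r"] exI[of _ "N - l + int r"]) simp
  qed
  then show ?thesis by (simp add: internal_chains_def)
qed

lemma subspace_internal_chains: "subspace_R (internal_chains N l)"
  by (rule scale_R.subspaceI)
     (auto simp: internal_chains_iff lookup_add smul.subspace_0 smul.subspace_add smul.subspace_scale)

abbreviation "DR \<equiv> deligne_rep sc :: int \<Rightarrow> int \<Rightarrow> ('a, 'n, 'k) rep_eq_forms tensor_R subquotient"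

definition del_chains :: "int \<Rightarrow> int \<Rightarrow> ('a, 'n, 'k) rep_eq_forms tensor_R set" where
  "del_chains N l = {x \<in> internal_chains N l. \<forall>r \<xi>. lie \<xi> (Poly_Mapping.lookup x r) \<in> EN}"

lemma deligne_eq: "deligne_rep sc l m = homology (del_chains (l - m)) (null_R EN) (mixed_diff ig d_ext) l"
proof -
  have "del_chains (l - m) = (\<lambda>l'. {x \<in> internal_chains (l - m) l'. \<forall>r \<xi>. lie \<xi> (Poly_Mapping.lookup x r) \<in> EN})"
    by (rule ext) (rule del_chains_def)
  then show ?thesis by (simp only: deligne_rep_def deligne_def EN_def)
qed

lemma subspace_del_chains: "subspace_R (del_chains N l)"
proof -
  have "del_chains N l = internal_chains N l \<inter> {x. \<forall>r \<xi>. lie \<xi> (Poly_Mapping.lookup x r) \<in> EN}"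
    by (auto simp: del_chains_def)
  moreover have "subspace_R {x. \<forall>r \<xi>. lie \<xi> (Poly_Mapping.lookup x r) \<in> EN}"
    by (rule scale_R.subspaceI) (auto simp: lookup_add lie_simps EN.closed)
  ultimately show ?thesis using scale_R.subspace_inter[OF subspace_internal_chains] by simp
qed

lemma EHC_eq: "EHC sc l m = homology (internal_chains (l - m)) (null_R DT) (mixed_diff i_t d_ext) l"
  by (simp add: EHC_def)

lemma subspace_EHC: "subspace_R (fst (EHC sc l m))" "subspace_R (snd (EHC sc l m))"
  unfolding EHC_eq
  by (intro subspace_homology subspace_internal_chains subspace_null_R D.sub mixed_diff_linear klin_i_t klin_d_ext klin_id)+

lemma subspace_deligne: "subspace_R (fst (deligne_rep sc l m :: ('a, 'n, 'k) rep_eq_forms tensor_R subquotient))"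
    "subspace_R (snd (deligne_rep sc l m :: ('a, 'n, 'k) rep_eq_forms tensor_R subquotient))"
  unfolding deligne_eq
  by (intro subspace_homology subspace_del_chains subspace_null_R EN.sub mixed_diff_linear klin_ig klin_d_ext klin_id)+

lemma lookup_map_tre: "Poly_Mapping.lookup (Poly_Mapping.map tre x) r = tre (Poly_Mapping.lookup x r)"
  by (rule lookup_map0) (rule klin_zero[OF klin_tr_ev[OF klin_id]])

lemma map_tre_chains: "x \<in> internal_chains N l \<Longrightarrow> Poly_Mapping.map tre x \<in> del_chains N l"
  unfolding del_chains_def internal_chains_iff mem_Collect_eq lookup_map_tre
  using tr_ev_bipiece subsetD[OF eq_ideal_EN lie_tr_ev] by blast

text \<open>The trace intertwines i_t and i_g only modulo \<open>eq_ideal\<close>, so a boundary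
  goes to a boundary plus an error term. The error has to be a zero element that is also an
  invariant chain of the right degrees.\<close>

lemma EHC_deligne_map:
  "subquotient_map scale_R scale_R (EHC sc l m) (deligne_rep sc l m) (Poly_Mapping.map tre)"
proof (unfold_locales; (rule subspace_EHC subspace_deligne)?)
  fix x y
  show "Poly_Mapping.map tre (x + y) = Poly_Mapping.map tre x + Poly_Mapping.map tre y"
    by (rule poly_mapping_eqI) (simp add: lookup_map_tre lookup_add klin_add[OF klin_tr_ev[OF klin_id]])
next
  fix c x
  show "Poly_Mapping.map tre (scale_R c x) = scale_R c (Poly_Mapping.map tre x)"
    by (rule poly_mapping_eqI) (simp add: lookup_map_tre klin_smul[OF klin_tr_ev[OF klin_id]])
next
  have D: "Poly_Mapping.lookup (mixed_diff ig d_ext (Poly_Mapping.map tre x)) r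
    = ig (tre (Poly_Mapping.lookup x r)) - tre (d_ext (Poly_Mapping.lookup x (Suc r)))" for x r
    by (simp add: lookup_mixed_diff'[OF klin_ig[OF klin_id] klin_d_ext[OF klin_id]] lookup_map_tre d_ext_tr_ev)
  have D': "Poly_Mapping.lookup (Poly_Mapping.map tre (mixed_diff i_t d_ext x)) r
    = tre (i_t (Poly_Mapping.lookup x r)) - tre (d_ext (Poly_Mapping.lookup x (Suc r)))" for x r
    by (simp add: lookup_mixed_diff'[OF klin_i_t[OF klin_id] klin_d_ext[OF klin_id]] lookup_map_tre klin_diff[OF klin_tr_ev[OF klin_id]])
  have E: "Poly_Mapping.lookup (mixed_diff ig d_ext (Poly_Mapping.map tre x)) r
    \<simeq>[eq_ideal] Poly_Mapping.lookup (Poly_Mapping.map tre (mixed_diff i_t d_ext x)) r" for x r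
    unfolding D D' by (intro R.diff R.refl ig_tr_ev)
  {
    fix x assume "x \<in> fst (EHC sc l m)"
    then have x: "x \<in> internal_chains (l - m) l" "mixed_diff i_t d_ext x \<in> null_R DT"
      by (simp_all add: EHC_eq homology_def)
    have "Poly_Mapping.lookup (mixed_diff ig d_ext (Poly_Mapping.map tre x)) r \<in> EN" for r
    proof -
      have "Poly_Mapping.lookup (Poly_Mapping.map tre (mixed_diff i_t d_ext x)) r \<in> EN"
        using x(2) by (simp add: lookup_map_tre null_R_def tr_ev_DT)
      then show ?thesis using EN.mem_cong[OF R_EN[OF E]] by blast
    qed
    then show "Poly_Mapping.map tre x \<in> fst (deligne_rep sc l m)"
      using map_tre_chains[OF x(1)] by (simp add: deligne_eq homology_def null_R_def)
  }
  {
    fix x assume "x \<in> snd (EHC sc l m)"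
    then obtain y w where x: "x = mixed_diff i_t d_ext y + w" and y: "y \<in> internal_chains (l - m) (l + 1)"
      and w: "w \<in> null_R DT" "w \<in> internal_chains (l - m) l"
      by (auto simp: EHC_eq homology_def)
    let ?f = "Poly_Mapping.map tre" and ?D = "mixed_diff ig d_ext"
    \<comment> \<open>Modulo \<open>eq_ideal\<close> this error is the trace of a zero chain, hence
      invariant by \<open>lie_tr_ev\<close> and \<open>lie_eq_ideal\<close>.\<close>
    define v where "v = ?f x - ?D (?f y)"
    have fx: "Poly_Mapping.lookup (?f x) r = Poly_Mapping.lookup (?f (mixed_diff i_t d_ext y)) r + tre (Poly_Mapping.lookup w r)" for r
      by (simp add: x lookup_map_tre lookup_add klin_add[OF klin_tr_ev[OF klin_id]])
    have v: "Poly_Mapping.lookup v r \<simeq>[eq_ideal] tre (Poly_Mapping.lookup w r)" for r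
      using R.diff[OF R.refl[of "Poly_Mapping.lookup (?f x) r"] E[of y r]]
      by (simp add: v_def lookup_minus fx)
    have yb: "Poly_Mapping.lookup y r \<in> bipiece (l + 1 - 2 * int r) (l - m - (l + 1) + int r)" for r
      using y by (simp add: internal_chains_iff)
    have "v \<in> null_R EN"
      unfolding null_R_def using EN.mem_cong[OF R_EN[OF v]] w(1) tr_ev_DT by (auto simp: null_R_def)
    moreover have "v \<in> internal_chains (l - m) l"
    proof -
      have t: "Poly_Mapping.lookup (?D (?f y)) r \<in> bipiece (l - 2 * int r) (l - m - l + int r)" for r
        unfolding D
      proof (rule smul.subspace_diff[OF bipiece_submod])
        show "ig (tre (Poly_Mapping.lookup y r)) \<in> bipiece (l - 2 * int r) (l - m - l + int r)"
          using ig_bipiece[OF tr_ev_bipiece[OF yb[of r]]] by (simp add: algebra_simps)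
        show "tre (d_ext (Poly_Mapping.lookup y (Suc r))) \<in> bipiece (l - 2 * int r) (l - m - l + int r)"
          using tr_ev_bipiece[OF d_ext_bipiece[OF yb[of "Suc r"]]] by (simp add: algebra_simps)
      qed
      have t': "Poly_Mapping.lookup (mixed_diff i_t d_ext y) r \<in> bipiece (l - 2 * int r) (l - m - l + int r)" for r
        unfolding lookup_mixed_diff'[OF klin_i_t[OF klin_id] klin_d_ext[OF klin_id]]
        using i_t_bipiece[OF yb[of r]] d_ext_bipiece[OF yb[of "Suc r"]]
        by (intro smul.subspace_diff[OF bipiece_submod]) (simp_all add: algebra_simps)
      then have "x \<in> internal_chains (l - m) l"
        unfolding x by (intro scale_R.subspace_add[OF subspace_internal_chains] w(2)) (simp add: internal_chains_iff)
      then have "?f x \<in> internal_chains (l - m) l" using map_tre_chains by (auto simp: del_chains_def)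
      moreover have "?D (?f y) \<in> internal_chains (l - m) l" using t by (simp add: internal_chains_iff)
      ultimately show ?thesis unfolding v_def by (rule scale_R.subspace_diff[OF subspace_internal_chains])
    qed
    moreover have "lie \<xi> (Poly_Mapping.lookup v r) \<in> EN" for r \<xi>
    proof -
      have "lie \<xi> (Poly_Mapping.lookup v r) \<simeq>[eq_ideal] lie \<xi> (tre (Poly_Mapping.lookup w r))"
        by (rule R.klin[OF klin_lie[OF klin_id] lie_eq_ideal v])
      then show ?thesis using R.mem_cong lie_tr_ev eq_ideal_EN by blast
    qed
    ultimately have "v \<in> null_R EN \<inter> del_chains (l - m) l" by (simp add: del_chains_def)
    moreover have "?f x = ?D (?f y) + v" by (simp add: v_def)
    ultimately show "?f x \<in> snd (deligne_rep sc l m)"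
      unfolding deligne_eq homology_def snd_conv using map_tre_chains[OF y] by blast
  }
qed

end

section \<open>The Tsygan map on cyclic homology\<close>

lemma proj_ldeg_eq: "proj_ldeg p = proj_deg ldeg p"
  by (simp add: proj_ldeg_def proj_deg_def fun_eq_iff)

lemma lookup_internal_proj: "Poly_Mapping.lookup (internal_proj k y) r =
    (\<Sum>q\<in>{q. int q + int r \<le> k}. proj_ldeg (k - int q - int r) (y r q))"
proof -
  have "{q. int q + int r \<le> k} = {}" if "r > nat k" for r using that by auto
  then have "{r. (\<Sum>q\<in>{q. int q + int r \<le> k}. proj_ldeg (k - int q - int r) (y r q)) \<noteq> 0} \<subseteq> {..nat k}"
    by (metis (mono_tags, lifting) atMost_iff mem_Collect_eq not_le subsetI sum.empty)
  then have "finite {r. (\<Sum>q\<in>{q. int q + int r \<le> k}. proj_ldeg (k - int q - int r) (y r q)) \<noteq> 0}"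
    by (rule finite_subset) simp
  then show ?thesis by (simp add: internal_proj_def)
qed

context tsygan_alg
begin

text \<open>At u^-r the relevant degree in t is r - m, which is negative for small r if m is
  positive. Setting E to zero there treats all m uniformly.\<close>

definition Ez :: "('a, 'k) nc_forms \<Rightarrow> int \<Rightarrow> ('a, 'k) ext_forms" where
  "Ez f j = (if j < 0 then 0 else E f (nat j))"

lemma klin_Ez: "klin (\<lambda>f. Ez f j)"
  by (cases "j < 0") (simp_all add: Ez_def klin_tsygan[OF klin_id] klin_const0)

lemma Ez_bipiece: "f \<in> piece fdeg p \<Longrightarrow> Ez f j \<in> bipiece p j"
  using tsygan_bipiece[where q = "nat j"] by (auto simp: Ez_def smul.subspace_0)

lemma Ez_cong: "x \<simeq>[ON] y \<Longrightarrow> Ez x j \<simeq>[DT] Ez y j"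
  by (simp add: Ez_def E_cong)

text \<open>The case j = -1 says that E b f has no component of degree 0 in t.\<close>

lemma Ez_b:
  assumes "f \<in> piece fdeg p"
  shows "i_t (Ez f j) \<simeq>[DT] Ez (b_op f) (j + 1)"
proof -
  consider "j \<ge> 0" | "j = - 1" | "j < - 1" by linarith
  then show ?thesis
  proof cases
    case 1
    then have "nat (j + 1) = Suc (nat j)" by simp
    then show ?thesis using 1 D.sym[OF E_b(1)[OF assms]] by (simp add: Ez_def)
  next
    case 2
    then show ?thesis using D.sym[OF E_b(2)[OF assms]] by (simp add: Ez_def ext_simps)
  qed (simp add: Ez_def ext_simps)
qed

lemma Ez_B: "f \<in> piece fdeg p \<Longrightarrow> d_ext (Ez f j) \<simeq>[DT] Ez (B_op f) j"
  using D.sym[OF E_B] by (simp add: Ez_def ext_simps)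

text \<open>The coefficient of u^-r has form degree l - 2r, so internal degree l - m selects q = (l
  - m) - (l - 2r) - r = r - m.\<close>

lemma internal_proj_E:
  assumes "Poly_Mapping.lookup x r \<in> piece fdeg (l - 2 * int r)"
  shows "Poly_Mapping.lookup (internal_proj (l - m) (tsygan_R \<rho> x)) r = Ez (Poly_Mapping.lookup x r) (int r - m)"
proof -
  define z where "z = Poly_Mapping.lookup x r"
  define p where "p = l - 2 * int r"
  have z: "z \<in> piece fdeg p" using assms by (simp add: z_def p_def)
  let ?S = "{q. int q + int r \<le> l - m}"
  have fin: "finite ?S" by (rule finite_subset[of _ "{..nat (l - m)}"]) auto
  have "Poly_Mapping.lookup (internal_proj (l - m) (tsygan_R \<rho> x)) r
    = (\<Sum>q\<in>?S. proj_ldeg (l - m - int q - int r) (E z q))"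
    by (simp add: lookup_internal_proj tsygan_R_def z_def)
  also have "\<dots> = (\<Sum>q\<in>?S. if int q = int r - m then E z q else 0)"
  proof (rule sum.cong[OF refl])
    fix q
    have "E z q \<in> piece ldeg p" using tsygan_bipiece[OF z] by (simp add: bipiece_def)
    then show "proj_ldeg (l - m - int q - int r) (E z q) = (if int q = int r - m then E z q else 0)"
      unfolding proj_ldeg_eq by (auto simp: proj_deg_same p_def)
  qed
  also have "\<dots> = Ez z (int r - m)"
  proof (cases "p < 0 \<or> int r - m < 0")
    case True
    then have "z = 0 \<or> int r - m < 0" using piece_neg_deg[OF _ z] by auto
    moreover have "E (0 :: ('a, 'k) nc_forms) q = 0" for q by (rule klin_zero[OF klin_tsygan[OF klin_id]])
    ultimately show ?thesis by (auto simp: Ez_def intro!: sum.neutral)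
  next
    case False
    then have "(\<Sum>q\<in>?S. if int q = int r - m then E z q else 0) = (\<Sum>q\<in>?S. if q = nat (int r - m) then E z q else 0)"
      by (intro sum.cong) auto
    also have "\<dots> = E z (nat (int r - m))" using fin False by (simp add: p_def)
    finally show ?thesis using False by (simp add: Ez_def)
  qed
  finally show ?thesis by (simp add: z_def)
qed

end

section \<open>The maps in homology and the explicit formula\<close>

locale cyclic_rep = cyclic sc pr \<rho> + rep_alg sc idx
  for sc :: "'k::comm_ring_1 \<Rightarrow> 'a::ring_1 \<Rightarrow> 'a" and pr \<rho> and idx :: "'n::finite itself"
begin

lemma lookup_DEHC: "Poly_Mapping.lookup (mixed_diff i_t d_ext x) r = i_t (Poly_Mapping.lookup x r) - d_ext (Poly_Mapping.lookup x (Suc r))"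
  by (rule lookup_mixed_diff'[OF klin_i_t[OF klin_id] klin_d_ext[OF klin_id]])

lemma EHC_fst: "x \<in> fst (EHC sc l m) \<longleftrightarrow>
    (\<forall>r. Poly_Mapping.lookup x r \<in> bipiece (l - 2 * int r) (int r - m)) \<and>
    (\<forall>r. i_t (Poly_Mapping.lookup x r) \<simeq>[DT] d_ext (Poly_Mapping.lookup x (Suc r)))"
  by (simp add: EHC_eq homology_def internal_chains_iff null_R_def lookup_DEHC eqv_def)

lemma EHC_sndI:
  assumes x: "\<And>r. Poly_Mapping.lookup x r \<in> bipiece (l - 2 * int r) (int r - m)"
    and y: "\<And>r. y r \<in> bipiece (l + 1 - 2 * int r) (int r - m - 1)"
    and xy: "\<And>r. Poly_Mapping.lookup x r \<simeq>[DT] i_t (y r) - d_ext (y (Suc r))"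
  shows "x \<in> snd (EHC sc l m)"
proof -
  define Y where "Y = Poly_Mapping.Abs_poly_mapping y"
  have Y: "Poly_Mapping.lookup Y = y"
    unfolding Y_def by (rule finite_support_pieces[of _ ldeg "l + 1"]) (use y in \<open>simp add: bipiece_def\<close>)
  let ?D = "mixed_diff i_t d_ext"
  have Dp: "i_t (y r) - d_ext (y (Suc r)) \<in> bipiece (l - 2 * int r) (int r - m)" for r
    using i_t_bipiece[OF y[of r]] d_ext_bipiece[OF y[of "Suc r"]]
    by (intro smul.subspace_diff[OF bipiece_submod]) (simp_all add: algebra_simps)
  have "x = ?D Y + (x - ?D Y)" by simp
  moreover have "Y \<in> internal_chains (l - m) (l + 1)"
    using y by (simp add: internal_chains_iff Y algebra_simps)
  moreover have "x - ?D Y \<in> null_R DT \<inter> internal_chains (l - m) l"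
    using xy smul.subspace_diff[OF bipiece_submod x Dp]
    by (simp add: null_R_def internal_chains_iff lookup_minus lookup_DEHC Y eqv_def)
  ultimately show ?thesis unfolding EHC_eq homology_def snd_conv by blast
qed

lemma HC_EHC_map:
  "subquotient_map scale_R scale_R (HC sc l) (EHC sc l m) (\<lambda>x. internal_proj (l - m) (tsygan_R \<rho> x))"
proof (unfold_locales; (rule HC_subspace subspace_EHC)?)
  let ?P = "\<lambda>x. internal_proj (l - m) (tsygan_R \<rho> x)"
  have lin: "klin (\<lambda>z. \<Sum>q\<in>{q. int q + int r \<le> l - m}. proj_ldeg (l - m - int q - int r) (E z q))" for r
    unfolding proj_ldeg_eq by (intro klin_intros)
  have P: "Poly_Mapping.lookup (?P x) r
      = (\<lambda>z. \<Sum>q\<in>{q. int q + int r \<le> l - m}. proj_ldeg (l - m - int q - int r) (E z q)) (Poly_Mapping.lookup x r)" for x r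
    by (simp add: lookup_internal_proj tsygan_R_def)
  fix x y c
  show "?P (x + y) = ?P x + ?P y"
    by (rule poly_mapping_eqI) (unfold P lookup_add, rule klin_add[OF lin])
  show "?P (scale_R c x) = scale_R c (?P x)"
    by (rule poly_mapping_eqI) (unfold P lookup_scale_R, rule klin_smul[OF lin])
next
  fix x assume "x \<in> fst (HC sc l)"
  then have x: "\<And>r. Poly_Mapping.lookup x r \<in> piece fdeg (l - 2 * int r)"
    and c: "\<And>r. b_op (Poly_Mapping.lookup x r) \<simeq>[ON] B_op (Poly_Mapping.lookup x (Suc r))"
    by (simp_all add: HC_fst cycle_def)
  have "i_t (Ez (Poly_Mapping.lookup x r) (int r - m)) \<simeq>[DT] d_ext (Ez (Poly_Mapping.lookup x (Suc r)) (int (Suc r) - m))" for r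
  proof -
    have "i_t (Ez (Poly_Mapping.lookup x r) (int r - m)) \<simeq>[DT] Ez (b_op (Poly_Mapping.lookup x r)) (int r - m + 1)"
      by (rule Ez_b[OF x])
    also have "\<dots> \<simeq>[DT] Ez (B_op (Poly_Mapping.lookup x (Suc r))) (int r - m + 1)"
      by (rule Ez_cong[OF c])
    also have "\<dots> \<simeq>[DT] d_ext (Ez (Poly_Mapping.lookup x (Suc r)) (int r - m + 1))"
      by (rule D.sym[OF Ez_B[OF x]])
    also have "int r - m + 1 = int (Suc r) - m" by simp
    finally show ?thesis .
  qed
  then show "internal_proj (l - m) (tsygan_R \<rho> x) \<in> fst (EHC sc l m)"
    using Ez_bipiece[OF x] by (simp add: EHC_fst internal_proj_E[OF x])
next
  fix x assume "x \<in> snd (HC sc l)"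
  then obtain y where x: "\<And>r. Poly_Mapping.lookup x r \<in> piece fdeg (l - 2 * int r)"
    and y: "\<And>r. y r \<in> piece fdeg (l + 1 - 2 * int r)"
    and xy: "\<And>r. Poly_Mapping.lookup x r \<simeq>[ON] b_op (y r) - B_op (y (Suc r))"
    unfolding HC_snd by blast
  show "internal_proj (l - m) (tsygan_R \<rho> x) \<in> snd (EHC sc l m)"
  \<comment> \<open>In homological degree l + 1 the same internal degree l - m forces degree r - m -
    1 in t at u^-r.\<close>
  proof (rule EHC_sndI[where y = "\<lambda>r. Ez (y r) (int r - m - 1)"]; (unfold internal_proj_E[OF x])?)
    fix r
    show "Ez (Poly_Mapping.lookup x r) (int r - m) \<in> bipiece (l - 2 * int r) (int r - m)"
      by (rule Ez_bipiece[OF x])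
    show "Ez (y r) (int r - m - 1) \<in> bipiece (l + 1 - 2 * int r) (int r - m - 1)"
      by (rule Ez_bipiece[OF y])
    have "Ez (Poly_Mapping.lookup x r) (int r - m) \<simeq>[DT] Ez (b_op (y r) - B_op (y (Suc r))) (int r - m)"
      by (rule Ez_cong[OF xy])
    also have "\<dots> = Ez (b_op (y r)) (int r - m) - Ez (B_op (y (Suc r))) (int r - m)"
      by (rule klin_diff[OF klin_Ez])
    also have "\<dots> \<simeq>[DT] i_t (Ez (y r) (int r - m - 1)) - d_ext (Ez (y (Suc r)) (int r - m))"
      using D.diff[OF D.sym[OF Ez_b[OF y, of r "int r - m - 1"]] D.sym[OF Ez_B[OF y, of "Suc r" "int r - m"]]] by simp
    finally show "Ez (Poly_Mapping.lookup x r) (int r - m) \<simeq>[DT] i_t (Ez (y r) (int r - m - 1)) - d_ext (Ez (y (Suc r)) (int (Suc r) - m - 1))"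
      by simp
  qed
qed

text \<open>In degree 0 every T contributes 1, so the form itself remains, divided by n!. This is
  the origin of the factor 1/l! in the formula.\<close>

lemma E_forms:
  assumes "f \<in> piece fdeg (int n)"
  shows "E f 0 \<simeq>[XI] smul (\<rho> (1 / fact n)) (forms_to_ext f)"
proof -
  let ?L = "\<lambda>f. fps_nth (hf f) 0 - forms_to_ext f"
  have fold: "fps_nth (foldr (\<lambda>l F. C (gen (Form l)) * (T * F)) ls 1) 0 = (mon (map Form ls) :: ('a, 'k) ext_forms)" for ls
    by (induction ls) (simp_all add: T_def flip: mon_Cons)
  have "?L f \<in> XI"
  proof (rule std_form_mem[OF assms, of ?L])
    show "klin ?L" by (intro klin_intros)
    show "?L x \<in> XI" if "x \<in> FI" for x
      by (rule smul.subspace_diff[OF X.sub hf_FI[OF that] forms_to_ext_FI[OF that]])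
    fix a0 as
    have "fps_nth (hf (std_form a0 as)) 0 \<simeq>[XI] fps_nth (hser a0 as * T) 0"
      using hf_std by (simp only: feq_def)
    also have "fps_nth (hser a0 as * T) 0 = (forms_to_ext (std_form a0 as) :: ('a, 'k) ext_forms)"
      unfolding hser_foldr fold std_form_def forms_to_ext_mon ..
    finally show "?L (std_form a0 as) \<in> XI" by (simp add: eqv_def)
  qed (rule X.sub)
  then have "fps_nth (hf f) 0 \<simeq>[XI] forms_to_ext f" by (simp add: eqv_def)
  from X.scale[OF this] show ?thesis using tsygan_hf[OF assms, of \<rho> 0] by simp
qed

lemma bipiece_drt_plus:
  assumes "x \<in> bipiece p q" "q > 0"
  shows "x \<in> drt_plus"
  unfolding drt_plus_def
proof (intro CollectI ballI)
  fix w assume "w \<in> Poly_Mapping.keys x"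
  moreover have "\<forall>w\<in>Poly_Mapping.keys x. int (wdeg vdeg w) = q"
    using assms(1) unfolding bipiece_def piece_def by simp
  ultimately show "0 < wdeg vdeg w" using assms(2) by fastforce
qed

text \<open>A step carries the pair of y_r and y_(r+1) with e_r - g_r = i_t y_r - d y_(r+1).
  Applying i_t to this relation shows both that i_t g_r is in the domain of \<sigma> and that the
  next difference, corrected by i_t y_(r+1), is closed of positive degree in t. Acyclicity then
  provides y_(r+2).\<close>

lemma section_recursion:
  assumes \<sigma>: "homogeneous_section sc \<sigma>" and f: "f \<in> piece fdeg (int l)"
    and e: "\<And>r. e r \<in> bipiece (int l - 2 * int r) (int r)"
    and ed: "\<And>r. i_t (e r) \<simeq>[DT] d_ext (e (Suc r))"
    and h: "h \<in> bipiece (int l - 1) 0" and e0: "e 0 - forms_to_ext f \<simeq>[DT] d_ext h"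
  shows "\<exists>y. \<forall>r. y r \<in> bipiece (int l + 1 - 2 * int r) (int r - 1) \<and>
    ((\<sigma> \<circ> i_t) ^^ r) (forms_to_ext f) \<in> bipiece (int l - 2 * int r) (int r) \<and>
    e r - ((\<sigma> \<circ> i_t) ^^ r) (forms_to_ext f) \<simeq>[DT] i_t (y r) - d_ext (y (Suc r))"
proof -
  define g where "g r = ((\<sigma> \<circ> i_t) ^^ r) (forms_to_ext f)" for r
  have g0: "g 0 = forms_to_ext f" and gS: "g (Suc r) = \<sigma> (i_t (g r))" for r by (simp_all add: g_def)
  define P where "P r z \<longleftrightarrow> fst z \<in> bipiece (int l + 1 - 2 * int r) (int r - 1) \<and> snd z \<in> bipiece (int l - 1 - 2 * int r) (int r)
    \<and> g r \<in> bipiece (int l - 2 * int r) (int r) \<and> e r - g r \<simeq>[DT] i_t (fst z) - d_ext (snd z)" for r z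
  have "\<exists>z. \<forall>r. P r (z r) \<and> fst (z (Suc r)) = snd (z r)"
  proof (rule dependent_nat_choice)
    \<comment> \<open>The component y_0 would have degree -1 in t, so it is 0; the hypothesis on e_0
      gives y_1 = -h.\<close>
    show "\<exists>z. P 0 z"
      using h e0 forms_to_ext_bipiece[OF f]
      by (intro exI[of _ "(0, - h)"]) (auto simp: P_def g0 ext_simps intro: smul.subspace_0 smul.subspace_neg)
  next
    fix z r assume "P r z"
    then have y: "snd z \<in> bipiece (int l - 1 - 2 * int r) (int r)"
      and g: "g r \<in> bipiece (int l - 2 * int r) (int r)"
      and eg: "e r - g r \<simeq>[DT] i_t (fst z) - d_ext (snd z)" by (simp_all add: P_def)
    let ?y = "snd z"
    have eS: "e (Suc r) \<in> bipiece (int l - 2 - 2 * int r) (int (Suc r))"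
      using e[of "Suc r"] by (simp add: algebra_simps)
    have iy: "i_t ?y \<in> bipiece (int l - 2 - 2 * int r) (int (Suc r))"
      using i_t_bipiece[OF y] by (simp add: algebra_simps)
    have ig: "i_t (g r) \<in> bipiece (int l - 1 - 2 * int r) (int (Suc r))"
      using i_t_bipiece[OF g] by (simp add: algebra_simps)
    \<comment> \<open>A second primitive of i_t g_r under d, next to g_(r+1) = \<sigma>(i_t g_r).
      Comparing them is what makes the difference closed.\<close>
    define k where "k = e (Suc r) - i_t ?y"
    have k: "k \<in> bipiece (int l - 2 - 2 * int r) (int (Suc r))"
      unfolding k_def by (rule smul.subspace_diff[OF bipiece_submod eS iy])
    have "i_t (e r - (e r - g r)) \<simeq>[DT] i_t (e r - (i_t (fst z) - d_ext ?y))"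
      by (rule i_t_cong[OF D.diff[OF D.refl eg]])
    also have "\<dots> = i_t (e r) + i_t (d_ext ?y)" by (simp add: ext_simps)
    also have "\<dots> \<simeq>[DT] d_ext (e (Suc r)) + (- d_ext (i_t ?y))"
    proof (rule D.add[OF ed])
      show "i_t (d_ext ?y) \<simeq>[DT] - d_ext (i_t ?y)"
        using d_i_t_DT[of ?y] by (simp add: eqv_def add.commute)
    qed
    also have "\<dots> = d_ext k" by (simp add: k_def ext_simps)
    finally have igk: "i_t (g r) \<simeq>[DT] d_ext k" by simp
    have d: "i_t (g r) \<in> d_drt_plus sc"
      unfolding d_drt_plus_def
      by (intro CollectI conjI bexI[of _ k] bipiece_drt_plus[OF ig] bipiece_drt_plus[OF k])
         (use igk in \<open>simp_all add: eqv_def\<close>)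
    have s: "d_ext (g (Suc r)) \<simeq>[DT] i_t (g r)"
      and gb: "g (Suc r) \<in> bipiece (int l - 2 - 2 * int r) (int (Suc r))"
    proof -
      from \<sigma> d have "d_ext (\<sigma> (i_t (g r))) - i_t (g r) \<in> DT"
        unfolding homogeneous_section_def by (elim conjE) (drule (1) bspec, elim conjE)
      then show "d_ext (g (Suc r)) \<simeq>[DT] i_t (g r)" by (simp only: gS eqv_def)
      from \<sigma> have "\<forall>p q. \<forall>y\<in>d_drt_plus sc \<inter> bipiece p q. \<sigma> y \<in> bipiece (p - 1) q"
        unfolding homogeneous_section_def by (elim conjE)
      from bspec[OF this[THEN spec, THEN spec] IntI[OF d ig]]
      show "g (Suc r) \<in> bipiece (int l - 2 - 2 * int r) (int (Suc r))"
        unfolding gS by (simp add: algebra_simps)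
    qed
    have kg: "k - g (Suc r) \<in> bipiece (int l - 2 - 2 * int r) (int (Suc r))"
      by (rule smul.subspace_diff[OF bipiece_submod k gb])
    have "d_ext (k - g (Suc r)) \<simeq>[DT] d_ext k - d_ext k"
      using D.diff[OF D.refl D.trans[OF s igk], of "d_ext k"] by (simp add: ext_simps)
    then have "d_ext (k - g (Suc r)) \<in> DT" by (simp add: eqv_def)
    from ext_acyclic[OF kg _ this] obtain h where h: "h \<in> bipiece (int l - 2 - 2 * int r - 1) (int (Suc r))"
      and kh: "k - g (Suc r) \<simeq>[DT] d_ext h" by auto
    have "e (Suc r) - g (Suc r) = i_t ?y + (k - g (Suc r))" by (simp add: k_def)
    also have "\<dots> \<simeq>[DT] i_t ?y + d_ext h" by (rule D.add[OF D.refl kh])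
    finally have "P (Suc r) (?y, - h)"
      using y gb smul.subspace_neg[OF bipiece_submod h]
      by (simp add: P_def ext_simps algebra_simps)
    then show "\<exists>z'. P (Suc r) z' \<and> fst z' = snd z" by (intro exI[of _ "(?y, - h)"]) simp
  qed
  then obtain z where z: "\<And>r. P r (z r)" "\<And>r. fst (z (Suc r)) = snd (z r)" by blast
  have "fst (z r) \<in> bipiece (int l + 1 - 2 * int r) (int r - 1) \<and> g r \<in> bipiece (int l - 2 * int r) (int r) \<and>
    e r - g r \<simeq>[DT] i_t (fst (z r)) - d_ext (fst (z (Suc r)))" for r
    using z(1)[of r] by (simp add: P_def z(2))
  then show ?thesis unfolding g_def by (intro exI[of _ "\<lambda>r. fst (z r)"]) blast
qed

text \<open>Multiplication by l! turns the image of the cycle into a sequence whose first term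
  agrees with f up to an exact form, so \<open>section_recursion\<close> applies; the witnesses are
  divided by l! afterwards.\<close>

lemma tsygan_kernel_lift:
  assumes \<sigma>: "homogeneous_section sc \<sigma>" and f: "f \<in> piece fdeg (int l)"
    and x: "cycle (int l) (Poly_Mapping.lookup x)" "Poly_Mapping.lookup x 0 - f \<in> bd_null (int l)"
  shows "internal_proj (int l) (tsygan_R \<rho> x) - (\<Sum>j = 0..l div 2. Poly_Mapping.single j
      (smul (\<rho> (1 / fact l)) (((\<sigma> \<circ> i_t) ^^ j) (forms_to_ext f)))) \<in> snd (EHC sc (int l) 0)"
proof -
  define X where "X = Poly_Mapping.lookup x"
  define c where "c = \<rho> (1 / fact l)"
  have cc: "smul (of_nat (fact l)) (smul c y) = y" "smul c (smul (of_nat (fact l)) y) = y" for y :: "('a, 'k) ext_forms"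
    using rho_inverse[of "fact l"] by (simp_all add: c_def mult.commute)
  have X: "X r \<in> piece fdeg (int l - 2 * int r)" and cyc: "b_op (X r) \<simeq>[ON] B_op (X (Suc r))" for r
    using x(1) by (simp_all add: cycle_def X_def)
  define a where "a r = E (X r) r" for r
  have Px: "Poly_Mapping.lookup (internal_proj (int l) (tsygan_R \<rho> x)) r = a r" for r
    using internal_proj_E[of x r "int l" 0] X[of r] by (simp add: X_def a_def Ez_def)
  have ab: "a r \<in> bipiece (int l - 2 * int r) (int r)" for r
    unfolding a_def by (rule tsygan_bipiece[OF X])
  have ad: "i_t (a r) \<simeq>[DT] d_ext (a (Suc r))" for r
    unfolding a_def
    by (rule D.trans[OF D.sym[OF E_b(1)[OF X]] D.trans[OF E_cong[OF cyc] E_B[OF X]]])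
  from x(2) obtain u v where u: "u \<in> piece fdeg (int l + 1)" and v: "v \<in> piece fdeg (int l - 1)"
    and uv: "X 0 - f \<simeq>[ON] b_op u + d_form v" unfolding X_def by (rule bd_nullE)
  define e where "e r = smul (of_nat (fact l)) (a r)" for r
  have ae: "a r = smul c (e r)" for r by (simp only: e_def cc)
  \<comment> \<open>In degree 0 in t, E kills b u and turns dv into an exact form, so a lift of f up
    to \<open>bd_null\<close> is enough.\<close>
  have "e 0 - forms_to_ext f \<simeq>[DT] d_ext (forms_to_ext v)"
  proof -
    have dv: "d_form v \<in> piece fdeg (int l)" using d_piece[OF v] by simp
    have "E (X 0 - f) 0 \<simeq>[DT] E (b_op u + d_form v) 0" by (rule E_cong[OF uv])
    also have "\<dots> = E (b_op u) 0 + E (d_form v) 0" by (rule klin_add[OF klin_tsygan[OF klin_id]])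
    also have "\<dots> \<simeq>[DT] 0 + smul c (forms_to_ext (d_form v))"
      unfolding c_def by (intro D.add E_b(2)[OF u] X_D[OF E_forms[OF dv]])
    finally have 1: "E (X 0 - f) 0 \<simeq>[DT] smul c (d_ext (forms_to_ext v))" by (simp add: d_ext_forms)
    have "E (X 0 - f) 0 = a 0 - E f 0" unfolding a_def by (rule klin_diff[OF klin_tsygan[OF klin_id]])
    also have "\<dots> \<simeq>[DT] a 0 - smul c (forms_to_ext f)"
      unfolding c_def by (intro D.diff D.refl X_D[OF E_forms[OF f]])
    finally have "a 0 - smul c (forms_to_ext f) \<simeq>[DT] smul c (d_ext (forms_to_ext v))"
      using 1 D.sym D.trans by blast
    from D.scale[OF this, of "of_nat (fact l)"] show ?thesis
      by (simp only: smul.scale_right_diff_distrib cc flip: e_def)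
  qed
  moreover have "e r \<in> bipiece (int l - 2 * int r) (int r)" for r
    unfolding e_def by (rule smul.subspace_scale[OF bipiece_submod ab])
  moreover have "i_t (e r) \<simeq>[DT] d_ext (e (Suc r))" for r
    using D.scale[OF ad] by (simp add: e_def ext_simps)
  ultimately obtain y where y: "\<And>r. y r \<in> bipiece (int l + 1 - 2 * int r) (int r - 1)"
    and g: "\<And>r. ((\<sigma> \<circ> i_t) ^^ r) (forms_to_ext f) \<in> bipiece (int l - 2 * int r) (int r)"
    and eg: "\<And>r. e r - ((\<sigma> \<circ> i_t) ^^ r) (forms_to_ext f) \<simeq>[DT] i_t (y r) - d_ext (y (Suc r))"
    using section_recursion[OF \<sigma> f, of e "forms_to_ext v"] forms_to_ext_bipiece[OF v] by blast
  define G where "G r = ((\<sigma> \<circ> i_t) ^^ r) (forms_to_ext f)" for r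
  have sum: "Poly_Mapping.lookup (\<Sum>j = 0..l div 2. Poly_Mapping.single j (smul c (G j))) r = smul c (G r)" for r
  proof -
    have "Poly_Mapping.lookup (\<Sum>j = 0..l div 2. Poly_Mapping.single j (smul c (G j))) r
      = (if r \<le> l div 2 then smul c (G r) else 0)"
      by (simp add: lookup_sum lookup_single when_def)
    \<comment> \<open>For r above l/2 the form degree l - 2r is negative, so the finite sum up to l
      div 2 is the whole sequence.\<close>
    moreover have "G r = 0" if "\<not> r \<le> l div 2"
      using bipiece_neg[OF g[of r]] that by (simp add: G_def)
    ultimately show ?thesis by simp
  qed
  have eq: "Poly_Mapping.lookup (internal_proj (int l) (tsygan_R \<rho> x) - (\<Sum>j = 0..l div 2. Poly_Mapping.single j (smul c (G j)))) r
    = smul c (e r - G r)" for r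
    unfolding lookup_minus Px sum ae smul.scale_right_diff_distrib ..
  have "internal_proj (int l) (tsygan_R \<rho> x) - (\<Sum>j = 0..l div 2. Poly_Mapping.single j (smul c (G j))) \<in> snd (EHC sc (int l) 0)"
  proof (rule EHC_sndI[where y = "\<lambda>r. smul c (y r)"]; (unfold eq)?)
    fix r
    show "smul c (e r - G r) \<in> bipiece (int l - 2 * int r) (int r - 0)"
      using smul.subspace_diff[OF bipiece_submod ab smul.subspace_scale[OF bipiece_submod g]]
      by (simp add: smul.scale_right_diff_distrib G_def flip: ae)
    show "smul c (y r) \<in> bipiece (int l + 1 - 2 * int r) (int r - 0 - 1)"
      using smul.subspace_scale[OF bipiece_submod y] by simp
    show "smul c (e r - G r) \<simeq>[DT] i_t (smul c (y r)) - d_ext (smul c (y (Suc r)))"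
      using D.scale[OF eg] by (simp add: G_def ext_simps smul.scale_right_diff_distrib)
  qed
  then show ?thesis by (simp only: G_def c_def)
qed

text \<open>By injectivity of the map to the kernel of i, any cycle that lifts f represents its
  preimage. On such a cycle the claim is the trace of \<open>tsygan_kernel_lift\<close>.\<close>

lemma Psi'_formula:
  assumes \<sigma>: "homogeneous_section sc \<sigma>" and f: "f \<in> fst (ker_i sc (int l))"
  shows "Psi' \<rho> sc (int l) (coset (ker_i sc (int l)) f) =
    coset (deligne_rep sc (int l) 0) (\<Sum>j = 0..l div 2. Poly_Mapping.single j
      (smul (\<rho> (1 / fact l)) (tre (((\<sigma> \<circ> i_t) ^^ j) (forms_to_ext f)))))"
proof -
  interpret M: subquotient_map scale_R smul "HC sc (int l)" "ker_i sc (int l)" "\<lambda>x. Poly_Mapping.lookup x 0"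
    by (rule HC_map)
  interpret H: subquotient_map scale_R scale_R "HC sc (int l)" "EHC sc (int l) 0" "\<lambda>x. internal_proj (int l - 0) (tsygan_R \<rho> x)"
    by (rule HC_EHC_map)
  interpret N: subquotient_map scale_R scale_R "EHC sc (int l) 0" "DR (int l) 0" "Poly_Mapping.map tre"
    by (rule EHC_deligne_map)
  have fp: "f \<in> piece fdeg (int l)" using f by (simp add: ker_i_def)
  from kernel_lift[OF f] obtain X where X: "cycle (int l) X" "X 0 - f \<in> bd_null (int l)" by blast
  define x where "x = Poly_Mapping.Abs_poly_mapping X"
  have x: "Poly_Mapping.lookup x = X"
    unfolding x_def by (rule finite_support_pieces[of _ fdeg "int l"]) (use X(1) in \<open>simp add: cycle_def\<close>)
  have "X 0 \<in> piece fdeg (int l)" using spec[OF conjunct1[OF X(1)[unfolded cycle_def]], of 0] by simp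
  then have "X 0 - f \<in> snd (ker_i sc (int l))" using fp X(2) by (simp add: ker_i_snd piece_diff)
  then have "HC_to_ker_i sc (int l) (coset (HC sc (int l)) x) = coset (ker_i sc (int l)) f"
    unfolding HC_to_ker_i_def M.induced_coset x by (simp add: coset_eq_iff[OF smul.module_axioms M.sndN])
  moreover have "coset (HC sc (int l)) x \<in> elements (HC sc (int l))"
    using X(1) by (auto simp: elements_def HC_fst x)
  ultimately have inv: "inv_into (elements (HC sc (int l))) (HC_to_ker_i sc (int l)) (coset (ker_i sc (int l)) f) = coset (HC sc (int l)) x"
    using inv_into_f_f[OF bij_betw_imp_inj_on[OF HC_bij]] by metis
  let ?g = "\<lambda>j. smul (\<rho> (1 / fact l)) (((\<sigma> \<circ> i_t) ^^ j) (forms_to_ext f))"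
  have "Poly_Mapping.map tre (internal_proj (int l) (tsygan_R \<rho> x) - (\<Sum>j = 0..l div 2. Poly_Mapping.single j (?g j)))
      \<in> snd (DR (int l) 0)"
    by (rule N.snd_map, rule tsygan_kernel_lift[OF \<sigma> fp]) (use X in \<open>simp_all add: x\<close>)
  also have "Poly_Mapping.map tre (internal_proj (int l) (tsygan_R \<rho> x) - (\<Sum>j = 0..l div 2. Poly_Mapping.single j (?g j)))
    = Poly_Mapping.map tre (internal_proj (int l) (tsygan_R \<rho> x)) - (\<Sum>j = 0..l div 2. Poly_Mapping.single j (smul (\<rho> (1 / fact l)) (tre (((\<sigma> \<circ> i_t) ^^ j) (forms_to_ext f)))))"
  proof (rule poly_mapping_eqI)
    fix r
    have tre0: "tre 0 = 0" by (rule klin_zero[OF klin_tr_ev[OF klin_id]])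
    have "tre (\<Sum>j = 0..l div 2. Poly_Mapping.lookup (Poly_Mapping.single j (?g j)) r)
      = (\<Sum>j = 0..l div 2. tre (Poly_Mapping.lookup (Poly_Mapping.single j (?g j)) r))"
      by (rule klin_sum[OF klin_tr_ev[OF klin_id]])
    also have "\<dots> = (\<Sum>j = 0..l div 2. Poly_Mapping.lookup (Poly_Mapping.single j (tre (?g j))) r)"
      by (intro sum.cong refl) (simp add: lookup_single when_def tre0)
    finally show "Poly_Mapping.lookup (Poly_Mapping.map tre (internal_proj (int l) (tsygan_R \<rho> x) - (\<Sum>j = 0..l div 2. Poly_Mapping.single j (?g j)))) r
      = Poly_Mapping.lookup (Poly_Mapping.map tre (internal_proj (int l) (tsygan_R \<rho> x)) - (\<Sum>j = 0..l div 2. Poly_Mapping.single j (smul (\<rho> (1 / fact l)) (tre (((\<sigma> \<circ> i_t) ^^ j) (forms_to_ext f)))))) r"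
      unfolding lookup_map_tre lookup_minus lookup_sum klin_diff[OF klin_tr_ev[OF klin_id]]
      by (simp only: klin_smul[OF klin_tr_ev[OF klin_id]])
  qed
  finally have "coset (DR (int l) 0) (Poly_Mapping.map tre (internal_proj (int l) (tsygan_R \<rho> x)))
    = coset (DR (int l) 0) (\<Sum>j = 0..l div 2. Poly_Mapping.single j (smul (\<rho> (1 / fact l)) (tre (((\<sigma> \<circ> i_t) ^^ j) (forms_to_ext f)))))"
    by (simp only: coset_eq_iff[OF scale_R.module_axioms N.sndN])
  then show ?thesis
    unfolding Psi'_def Psi_def comp_apply inv HC_to_EHC_def EHC_to_deligne_def H.induced_coset N.induced_coset
    by simp
qed

end

theorem theorem8p3p2:
  fixes \<rho> :: "rat \<Rightarrow> 'k::comm_ring_1"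
    and sc :: "'k \<Rightarrow> 'a::ring_1 \<Rightarrow> 'a"
  assumes "rat_algebra \<rho>" and "k_algebra sc" and "k_split_injection sc"
  shows
    "(\<forall>l m :: int.
        k_linear scale_R scale_R (HC sc l) (EHC sc l m) (HC_to_EHC \<rho> sc l m) \<and>
        k_linear scale_R scale_R (EHC sc l m)
          (deligne_rep sc l m :: ('a, 'n::finite, 'k) rep_eq_forms tensor_R subquotient)
          (EHC_to_deligne sc l m) \<and>
        k_linear scale_R scale_R (HC sc l)
          (deligne_rep sc l m :: ('a, 'n, 'k) rep_eq_forms tensor_R subquotient)
          (Psi \<rho> sc l m)) \<and>
     (\<forall>l :: nat.
        k_linear scale_R smul (HC sc l) (ker_i sc l) (HC_to_ker_i sc l) \<and>
        bij_betw (HC_to_ker_i sc l) (elements (HC sc l)) (elements (ker_i sc l)) \<and>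
        (\<forall>\<sigma>. homogeneous_section sc \<sigma> \<longrightarrow>
          (\<forall>f\<in>fst (ker_i sc l).
             Psi' \<rho> sc l (coset (ker_i sc l) f) =
             coset (deligne_rep sc l 0 :: ('a, 'n, 'k) rep_eq_forms tensor_R subquotient)
               (\<Sum>j = 0..l div 2. Poly_Mapping.single j
                  (smul (\<rho> (1 / fact l)) (tr_ev (((\<sigma> \<circ> i_t) ^^ j) (forms_to_ext f))))))))"
proof -
  obtain pr where pr: "module_hom sc (*) pr" "\<And>c. pr (sc c 1) = c"
    using assms(3) unfolding k_split_injection_def by blast
  have "k_alg sc" using assms(2) by (rule k_alg.intro)
  then interpret cyclic_rep sc pr \<rho> "TYPE('n)"
    using assms(1) pr
    by (intro cyclic_rep.intro cyclic.intro rep_alg.intro split_alg.intro split_alg_axioms.intro rat_alg.intro)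
  have 1: "k_linear scale_R scale_R (HC sc l) (EHC sc l m) (HC_to_EHC \<rho> sc l m)" for l m
    unfolding HC_to_EHC_def by (rule subquotient_map.k_linear_induced[OF HC_EHC_map])
  have 2: "k_linear scale_R scale_R (EHC sc l m) (DR l m) (EHC_to_deligne sc l m)" for l m
    unfolding EHC_to_deligne_def by (rule subquotient_map.k_linear_induced[OF EHC_deligne_map])
  have 3: "k_linear scale_R scale_R (HC sc l) (DR l m) (Psi \<rho> sc l m)" for l m
    unfolding Psi_def by (rule k_linear_comp[OF 1 2])
  have 4: "k_linear scale_R smul (HC sc (int l)) (ker_i sc (int l)) (HC_to_ker_i sc (int l))" for l
    unfolding HC_to_ker_i_def by (rule subquotient_map.k_linear_induced[OF HC_map])
  show ?thesis
    by (intro conjI allI impI ballI 1 2 3 4 HC_bij Psi'_formula)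
qed

end
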